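(* Let $V$ be a unital commutative ring and $\mathfrak{m}$ an idempotent ideal of $V$ such that $\tilde{\mathfrak{m}}=\mathfrak{m}\otimes_V\mathfrak{m}$ is a flat $V$-module. Let $A$ be an almost $V$-algebra and $j: I \to A$ a Smith ideal such that $I$ is an almost finitely generated $A$-module. Then, for any almost $A$-module $M$, the almost nilpotent approximation $\Lambda_j(M)$ is almost complete.
   Context: A $V$-module $M$ is almost zero if $\mathfrak{m}M=0$; $\mathrm{AMod}_V$ is the localization of the category of $V$-modules by the Serre subcategory of almost zero modules, with its induced tensor product. A homomorphism $f$ of $V$-modules is an almost isomorphism if $\tilde{\mathfrak{m}}\otimes_V f$ is an isomorphism; this holds exactly when $f$ is an isomorphism in $\mathrm{AMod}_V$. An almost $V$-algebra is a commutative monoid object of $\mathrm{AMod}_V$, and an almost $A$-module is a module over $A$ in $\mathrm{AMod}_V$; $\mathrm{AMod}_A$ is the category of these. An $A$-module $N$ is almost finitely generated (in the sense of Gabber–Ramero) if for every finitely generated ideal $\mathfrak{m}_0\subset\mathfrak{m}$ there is a finitely generated submodule $N_0\subset N$ with $\mathfrak{m}_0N\subset N_0$. A Smith ideal $j:I\to A$ is a commutative monoid object in the category of arrows of $\mathrm{AMod}_V$ with respect to the pushout product $f\Box g:(X_0\otimes Y_1)\amalg_{X_0\otimes Y_0}(X_1\otimes Y_0)\to X_1\otimes Y_1$ (for $f:X_0\to X_1$, $g:Y_0\to Y_1$). $I^m$ is the image of the multiplication $I^{\otimes m}\to I$, and $I^mM$ is the image of $I^m\otimes_A M\to M$. The almost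 nilpotent approximation $\Lambda_j(M)$ of an almost $A$-module $M$ is the inverse limit over $n\ge0$ of the arrows $\mathcal{P}^n(j\otimes_A M): IM/I^{n+1}M\to M/I^{n+1}M$. Completeness. For an arrow $X=(X_0\to X_1)$ of almost $A$-modules with a compatible map $I\otimes_A X_1\to X_0$, put $\mathcal{P}^n_j(X)=(X_0/I^{n+1}X_1\to X_1/I^{n+1}X_1)$, where $I^{n+1}X_1$ is the image of $I^{n+1}\otimes_A X_1$ in $X_0$, respectively in $X_1$ (for $X=(IM\to M)$ this is the arrow above). $X$ is almost complete if the canonical morphism $X\to\varprojlim_n\mathcal{P}^n_j(X)$ becomes an isomorphism in the arrow category of $\mathrm{AMod}_A$ (an almost isomorphism in each term) after applying $\mathcal{P}^m_j$, for every $m\ge0$. *)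

theory Defs
  imports "HOL-Algebra.Module" "HOL-Algebra.AbelCoset" "HOL-Algebra.Ideal_Product"
begin

section \<open>Modules: submodules, quotients, sums, tensor products\<close>

definition span_mod :: "'v ring \<Rightarrow> ('v, 'a) module \<Rightarrow> 'a set \<Rightarrow> 'a set" where
  "span_mod V X S = \<Inter>{N. submodule N V X \<and> S \<subseteq> N}"

definition mod_hom :: "'v ring \<Rightarrow> ('v, 'a) module \<Rightarrow> ('v, 'b) module \<Rightarrow> ('a \<Rightarrow> 'b) set" where
  "mod_hom V X Y = {h \<in> carrier X \<rightarrow> carrier Y.
     (\<forall>x \<in> carrier X. \<forall>y \<in> carrier X. h (x \<oplus>\<^bsub>X\<^esub> y) = h x \<oplus>\<^bsub>Y\<^esub> h y) \<and>
     (\<forall>v \<in> carrier V. \<forall>x \<in> carrier X. h (v \<odot>\<^bsub>X\<^esub> x) = v \<odot>\<^bsub>Y\<^esub> h x)}"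

text \<open>The record type of modules inherits the ring fields \<open>mult\<close> and \<open>one\<close>; they play no role
  for modules and are left undefined.\<close>

definition sub_mod :: "('v, 'a) module \<Rightarrow> 'a set \<Rightarrow> ('v, 'a) module" where
  "sub_mod X N = X\<lparr>carrier := N\<rparr>"

definition quot_mod :: "('v, 'a) module \<Rightarrow> 'a set \<Rightarrow> ('v, 'a set) module" where
  "quot_mod X N = \<lparr>carrier = a_rcosets\<^bsub>X\<^esub> N, mult = undefined, one = undefined,
     zero = N, add = set_add X, smult = (\<lambda>v C. \<Union>x\<in>C. N +>\<^bsub>X\<^esub> (v \<odot>\<^bsub>X\<^esub> x))\<rparr>"

definition sum_mod :: "('v, 'a) module \<Rightarrow> ('v, 'b) module \<Rightarrow> ('v, 'a \<times> 'b) module" where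
  "sum_mod X Y = \<lparr>carrier = carrier X \<times> carrier Y, mult = undefined, one = undefined,
     zero = (\<zero>\<^bsub>X\<^esub>, \<zero>\<^bsub>Y\<^esub>),
     add = (\<lambda>(x, y) (x', y'). (x \<oplus>\<^bsub>X\<^esub> x', y \<oplus>\<^bsub>Y\<^esub> y')),
     smult = (\<lambda>v (x, y). (v \<odot>\<^bsub>X\<^esub> x, v \<odot>\<^bsub>Y\<^esub> y))\<rparr>"

definition seq_mod :: "(nat \<Rightarrow> ('v, 'a) module) \<Rightarrow> ('v, nat \<Rightarrow> 'a) module" where
  "seq_mod T = \<lparr>carrier = {x. \<forall>n. x n \<in> carrier (T n)}, mult = undefined, one = undefined,
     zero = (\<lambda>n. \<zero>\<^bsub>T n\<^esub>), add = (\<lambda>x y n. x n \<oplus>\<^bsub>T n\<^esub> y n), smult = (\<lambda>v x n. v \<odot>\<^bsub>T n\<^esub> x n)\<rparr>"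

definition zero_mod :: "('v, unit) module" where
  "zero_mod = \<lparr>carrier = {()}, mult = undefined, one = undefined,
     zero = (), add = (\<lambda>_ _. ()), smult = (\<lambda>_ _. ())\<rparr>"

definition self_mod :: "'v ring \<Rightarrow> ('v, 'v) module" where
  "self_mod V = \<lparr>carrier = carrier V, mult = undefined, one = undefined,
     zero = \<zero>\<^bsub>V\<^esub>, add = add V, smult = mult V\<rparr>"

text \<open>The free module on a set of symbols: finitely supported \<open>V\<close>-valued functions.\<close>

definition free_mod :: "'v ring \<Rightarrow> 'b set \<Rightarrow> ('v, 'b \<Rightarrow> 'v) module" where
  "free_mod V B = \<lparr>carrier = {f. (\<forall>b. f b \<in> carrier V) \<and> (\<forall>b. b \<notin> B \<longrightarrow> f b = \<zero>\<^bsub>V\<^esub>) \<and>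
       finite {b. f b \<noteq> \<zero>\<^bsub>V\<^esub>}},
     mult = undefined, one = undefined, zero = (\<lambda>_. \<zero>\<^bsub>V\<^esub>),
     add = (\<lambda>f g b. f b \<oplus>\<^bsub>V\<^esub> g b), smult = (\<lambda>v f b. v \<otimes>\<^bsub>V\<^esub> f b)\<rparr>"

definition free_gen :: "'v ring \<Rightarrow> 'b \<Rightarrow> 'b \<Rightarrow> 'v" where
  "free_gen V b = (\<lambda>c. if c = b then \<one>\<^bsub>V\<^esub> else \<zero>\<^bsub>V\<^esub>)"

type_synonym ('v, 'a, 'b) tens = "('a \<times> 'b \<Rightarrow> 'v) set"

definition tens_rels ::
  "'v ring \<Rightarrow> ('v, 'a) module \<Rightarrow> ('v, 'b) module \<Rightarrow> ('a \<times> 'b \<Rightarrow> 'v) set" where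
  "tens_rels V X Y = (let F = free_mod V (carrier X \<times> carrier Y); d = (\<lambda>x y. free_gen V (x, y)) in
     {d (x \<oplus>\<^bsub>X\<^esub> x') y \<ominus>\<^bsub>F\<^esub> (d x y \<oplus>\<^bsub>F\<^esub> d x' y) | x x' y.
        x \<in> carrier X \<and> x' \<in> carrier X \<and> y \<in> carrier Y} \<union>
     {d x (y \<oplus>\<^bsub>Y\<^esub> y') \<ominus>\<^bsub>F\<^esub> (d x y \<oplus>\<^bsub>F\<^esub> d x y') | x y y'.
        x \<in> carrier X \<and> y \<in> carrier Y \<and> y' \<in> carrier Y} \<union>
     {d (v \<odot>\<^bsub>X\<^esub> x) y \<ominus>\<^bsub>F\<^esub> v \<odot>\<^bsub>F\<^esub> d x y | v x y.
        v \<in> carrier V \<and> x \<in> carrier X \<and> y \<in> carrier Y} \<union>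
     {d x (v \<odot>\<^bsub>Y\<^esub> y) \<ominus>\<^bsub>F\<^esub> v \<odot>\<^bsub>F\<^esub> d x y | v x y.
        v \<in> carrier V \<and> x \<in> carrier X \<and> y \<in> carrier Y})"

definition tens_ker ::
  "'v ring \<Rightarrow> ('v, 'a) module \<Rightarrow> ('v, 'b) module \<Rightarrow> ('a \<times> 'b \<Rightarrow> 'v) set" where
  "tens_ker V X Y = span_mod V (free_mod V (carrier X \<times> carrier Y)) (tens_rels V X Y)"

definition tens ::
  "'v ring \<Rightarrow> ('v, 'a) module \<Rightarrow> ('v, 'b) module \<Rightarrow> ('v, ('v, 'a, 'b) tens) module" where
  "tens V X Y = quot_mod (free_mod V (carrier X \<times> carrier Y)) (tens_ker V X Y)"

definition pure_tens ::
  "'v ring \<Rightarrow> ('v, 'a) module \<Rightarrow> ('v, 'b) module \<Rightarrow> 'a \<Rightarrow> 'b \<Rightarrow> ('v, 'a, 'b) tens" where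
  "pure_tens V X Y x y =
     tens_ker V X Y +>\<^bsub>free_mod V (carrier X \<times> carrier Y)\<^esub> free_gen V (x, y)"

text \<open>The \<open>n\<close>-fold tensor power, with the list \<open>[x\<^sub>1, \<dots>, x\<^sub>n]\<close> as the symbol of
  \<open>x\<^sub>1 \<otimes> \<dots> \<otimes> x\<^sub>n\<close>. (Iterating the binary tensor product would need a type depending on \<open>n\<close>.)\<close>

definition tpow_free :: "'v ring \<Rightarrow> ('v, 'a) module \<Rightarrow> nat \<Rightarrow> ('v, 'a list \<Rightarrow> 'v) module" where
  "tpow_free V X n = free_mod V {xs. length xs = n \<and> set xs \<subseteq> carrier X}"

definition tpow_rels :: "'v ring \<Rightarrow> ('v, 'a) module \<Rightarrow> nat \<Rightarrow> ('a list \<Rightarrow> 'v) set" where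
  "tpow_rels V X n = (let F = tpow_free V X n in
     {free_gen V (xs[i := x \<oplus>\<^bsub>X\<^esub> y]) \<ominus>\<^bsub>F\<^esub> (free_gen V (xs[i := x]) \<oplus>\<^bsub>F\<^esub> free_gen V (xs[i := y]))
        | xs i x y. length xs = n \<and> set xs \<subseteq> carrier X \<and> i < n \<and> x \<in> carrier X \<and> y \<in> carrier X} \<union>
     {free_gen V (xs[i := v \<odot>\<^bsub>X\<^esub> x]) \<ominus>\<^bsub>F\<^esub> v \<odot>\<^bsub>F\<^esub> free_gen V (xs[i := x])
        | xs i v x. length xs = n \<and> set xs \<subseteq> carrier X \<and> i < n \<and> v \<in> carrier V \<and> x \<in> carrier X})"

definition tpow_ker :: "'v ring \<Rightarrow> ('v, 'a) module \<Rightarrow> nat \<Rightarrow> ('a list \<Rightarrow> 'v) set" where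
  "tpow_ker V X n = span_mod V (tpow_free V X n) (tpow_rels V X n)"

definition tpow :: "'v ring \<Rightarrow> ('v, 'a) module \<Rightarrow> nat \<Rightarrow> ('v, ('a list \<Rightarrow> 'v) set) module" where
  "tpow V X n = quot_mod (tpow_free V X n) (tpow_ker V X n)"

definition pure_tpow ::
  "'v ring \<Rightarrow> ('v, 'a) module \<Rightarrow> nat \<Rightarrow> 'a list \<Rightarrow> ('a list \<Rightarrow> 'v) set" where
  "pure_tpow V X n xs = tpow_ker V X n +>\<^bsub>tpow_free V X n\<^esub> free_gen V xs"

text \<open>\<open>T\<close> is flat if \<open>T \<otimes> f\<close> is injective for every injective linear map \<open>f : N \<rightarrow> N'\<close>; the map
  \<open>h\<close> below is \<open>T \<otimes> f\<close>. A formula cannot quantify over the types carrying \<open>N\<close> and \<open>N'\<close>. The type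
  chosen here carries the cosets of submodules of \<open>V\<^sup>(\<^sup>\<nat>\<^sup>)\<close>, hence isomorphic copies of all countably
  generated modules; as these include \<open>V\<close> and its finitely generated ideals, nothing is lost.\<close>

definition flat_mod :: "'v ring \<Rightarrow> ('v, 'a) module \<Rightarrow> bool" where
  "flat_mod V T \<longleftrightarrow> (\<forall>(N :: ('v, (nat \<Rightarrow> 'v) set) module) (N' :: ('v, (nat \<Rightarrow> 'v) set) module) f.
     module V N \<and> module V N' \<and> f \<in> mod_hom V N N' \<and> inj_on f (carrier N) \<longrightarrow>
     (\<exists>h \<in> mod_hom V (tens V T N) (tens V T N').
        (\<forall>t \<in> carrier T. \<forall>x \<in> carrier N. h (pure_tens V T N t x) = pure_tens V T N' t (f x)) \<and>
        inj_on h (carrier (tens V T N))))"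


section \<open>The category of almost modules\<close>

text \<open>Objects of \<open>AMod\<^sub>V\<close> are \<open>V\<close>-modules. Morphisms \<open>X \<rightarrow> Y\<close> of the localization by the Serre
  subcategory of almost zero modules are the elements of \<open>colim Hom\<^sub>V(X', Y/Y')\<close>, over the submodules
  \<open>X' \<subseteq> X\<close>, \<open>Y' \<subseteq> Y\<close> with \<open>X/X'\<close> and \<open>Y'\<close> almost zero. As \<open>\<mm>\<close> is idempotent there is a smallest
  \<open>X'\<close>, namely \<open>\<mm>X\<close>, and a largest \<open>Y'\<close>, namely the \<open>\<mm>\<close>-torsion \<open>Y[\<mm>]\<close>, so that the colimit is
  \<open>Hom\<^sub>V(\<mm>X, Y/Y[\<mm>])\<close>. A linear map \<open>f : \<mm>X \<rightarrow> Y/Y[\<mm>]\<close> is represented by the submodule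
  \<open>{(x, y). x \<in> \<mm>X, y \<in> f(x)}\<close> of \<open>X \<oplus> Y\<close>; composition in the localization is then composition of
  relations.\<close>

record ('v, 'a, 'b) amor =
  asrc :: "('v, 'a) module"
  atgt :: "('v, 'b) module"
  agraph :: "('a \<times> 'b) set"

text \<open>An almost \<open>V\<close>-algebra, and an almost module over an almost algebra with underlying object of
  type \<open>'a\<close>.\<close>

record ('v, 'a) aalg =
  alg_obj :: "('v, 'a) module"
  alg_mult :: "('v, ('v, 'a, 'a) tens, 'a) amor"
  alg_unit :: "('v, 'v, 'a) amor"

record ('v, 'a, 'x) amodule =
  obj :: "('v, 'x) module"
  act :: "('v, ('v, 'a, 'x) tens, 'x) amor"

text \<open>A morphism in the category of arrows, i.e. a square.\<close>

record ('v, 'a, 'b, 'c, 'd) asq =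
  sq_src :: "('v, 'a, 'b) amor"
  sq_tgt :: "('v, 'c, 'd) amor"
  sq0 :: "('v, 'a, 'c) amor"
  sq1 :: "('v, 'b, 'd) amor"

type_synonym ('v, 'a, 'b, 'c, 'd) boxt = "(('v, 'a, 'd) tens \<times> ('v, 'b, 'c) tens) set"

record ('v, 'i, 'a) smith =
  s_arrow :: "('v, 'i, 'a) amor"
  s_mult :: "('v, ('v, 'i, 'a, 'i, 'a) boxt, ('v, 'a, 'a) tens, 'i, 'a) asq"
  s_unit :: "('v, unit, 'v, 'i, 'a) asq"

text \<open>An arrow \<open>X\<^sub>0 \<rightarrow> X\<^sub>1\<close> of almost \<open>A\<close>-modules together with a map \<open>I \<otimes>\<^sub>A X\<^sub>1 \<rightarrow> X\<^sub>0\<close>.\<close>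

record ('v, 'a, 'i, 'x, 'y) jarrow =
  jtop :: "('v, 'a, 'x) amodule"
  jbot :: "('v, 'a, 'y) amodule"
  jmap :: "('v, 'x, 'y) amor"
  jcmp :: "('v, ('v, 'i, 'y) tens set, 'x) amor"

locale almost_setup = V?: cring V for V :: "'v ring" (structure) +
  fixes \<mm> :: "'v set"
  assumes ideal_mm: "ideal \<mm> V"
    and idempotent_mm: "ideal_prod V \<mm> \<mm> = \<mm>"
    and flat_mm: "flat_mod V (tens V (sub_mod (self_mod V) \<mm>) (sub_mod (self_mod V) \<mm>))"
begin

abbreviation tens_V (infixl \<open>\<otimes>\<^sub>m\<close> 70) where "X \<otimes>\<^sub>m Y \<equiv> tens V X Y"

definition mpart :: "('v, 'x) module \<Rightarrow> 'x set" where
  "mpart X = span_mod V X {e \<odot>\<^bsub>X\<^esub> x | e x. e \<in> \<mm> \<and> x \<in> carrier X}"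

definition mtors :: "('v, 'x) module \<Rightarrow> 'x set" where
  "mtors X = {x \<in> carrier X. \<forall>e \<in> \<mm>. e \<odot>\<^bsub>X\<^esub> x = \<zero>\<^bsub>X\<^esub>}"

text \<open>Two submodules define the same subobject in \<open>AMod\<^sub>V\<close> iff they have the same saturation;
  subobjects are represented by saturated submodules, so that their inclusion is set inclusion.\<close>

definition msat :: "('v, 'x) module \<Rightarrow> 'x set \<Rightarrow> 'x set" where
  "msat X N = {x \<in> carrier X. \<forall>e \<in> \<mm>. e \<odot>\<^bsub>X\<^esub> x \<in> N}"

definition is_amor :: "('v, 'x) module \<Rightarrow> ('v, 'y) module \<Rightarrow> ('v, 'x, 'y) amor \<Rightarrow> bool" where
  "is_amor X Y f \<longleftrightarrow> module V X \<and> module V Y \<and> asrc f = X \<and> atgt f = Y \<and>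
     submodule (agraph f) V (sum_mod X Y) \<and>
     Domain (agraph f) = mpart X \<and> agraph f `` {\<zero>\<^bsub>X\<^esub>} = mtors Y"

text \<open>The morphism determined by a set \<open>S \<subseteq> X \<times> Y\<close> of pairs ``\<open>x \<mapsto> y\<close>''. It is only used when these
  assignments extend to a well-defined morphism in \<open>AMod\<^sub>V\<close>.\<close>

definition gen_amor ::
  "('v, 'x) module \<Rightarrow> ('v, 'y) module \<Rightarrow> ('x \<times> 'y) set \<Rightarrow> ('v, 'x, 'y) amor" where
  "gen_amor X Y S = \<lparr>asrc = X, atgt = Y,
     agraph = span_mod V (sum_mod X Y) (S \<union> {\<zero>\<^bsub>X\<^esub>} \<times> mtors Y) \<inter> mpart X \<times> carrier Y\<rparr>"

definition aid :: "('v, 'x) module \<Rightarrow> ('v, 'x, 'x) amor" where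
  "aid X = gen_amor X X (Id_on (carrier X))"

text \<open>Composition in diagrammatic order.\<close>

definition acomp ::
  "('v, 'x, 'y) amor \<Rightarrow> ('v, 'y, 'z) amor \<Rightarrow> ('v, 'x, 'z) amor" (infixl \<open>\<Zsemi>\<close> 60) where
  "f \<Zsemi> g = \<lparr>asrc = asrc f, atgt = atgt g, agraph = agraph f O agraph g\<rparr>"

definition adiff :: "('v, 'x, 'y) amor \<Rightarrow> ('v, 'x, 'y) amor \<Rightarrow> ('v, 'x, 'y) amor" where
  "adiff f g = \<lparr>asrc = asrc f, atgt = atgt f,
     agraph = {(x, y \<ominus>\<^bsub>atgt f\<^esub> z) | x y z. (x, y) \<in> agraph f \<and> (x, z) \<in> agraph g}\<rparr>"

definition aimage :: "('v, 'x, 'y) amor \<Rightarrow> 'y set" where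
  "aimage f = msat (atgt f) (Range (agraph f))"

definition aincl :: "('v, 'x) module \<Rightarrow> 'x set \<Rightarrow> ('v, 'x, 'x) amor" where
  "aincl X N = gen_amor (sub_mod X N) X (Id_on N)"

definition aproj :: "('v, 'x) module \<Rightarrow> 'x set \<Rightarrow> ('v, 'x, 'x set) amor" where
  "aproj X N = gen_amor X (quot_mod X N) {(x, N +>\<^bsub>X\<^esub> x) | x. x \<in> carrier X}"

text \<open>The factorization of \<open>f\<close> through an epimorphism \<open>q\<close> out of the source of \<open>f\<close>, and through a
  monomorphism \<open>i\<close> into the target of \<open>f\<close>.\<close>

definition adescend :: "('v, 'x, 'y) amor \<Rightarrow> ('v, 'x, 'z) amor \<Rightarrow> ('v, 'y, 'z) amor" where
  "adescend q f = gen_amor (atgt q) (atgt f) ((agraph q)\<inverse> O agraph f)"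

definition alift :: "('v, 'z, 'y) amor \<Rightarrow> ('v, 'x, 'y) amor \<Rightarrow> ('v, 'x, 'z) amor" where
  "alift i f = gen_amor (asrc f) (asrc i) (agraph f O (agraph i)\<inverse>)"

subsection \<open>The symmetric monoidal structure\<close>

definition amap_tens ::
  "('v, 'x, 'y) amor \<Rightarrow> ('v, 'x1, 'y1) amor \<Rightarrow> ('v, ('v, 'x, 'x1) tens, ('v, 'y, 'y1) tens) amor"
  (infixl \<open>\<otimes>\<^sub>a\<close> 70) where
  "f \<otimes>\<^sub>a g = gen_amor (asrc f \<otimes>\<^sub>m asrc g) (atgt f \<otimes>\<^sub>m atgt g)
     {(pure_tens V (asrc f) (asrc g) x x', pure_tens V (atgt f) (atgt g) y y') | x y x' y'.
        (x, y) \<in> agraph f \<and> (x', y') \<in> agraph g}"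

definition aassoc :: "('v, 'x) module \<Rightarrow> ('v, 'y) module \<Rightarrow> ('v, 'z) module \<Rightarrow>
    ('v, ('v, ('v, 'x, 'y) tens, 'z) tens, ('v, 'x, ('v, 'y, 'z) tens) tens) amor" where
  "aassoc X Y Z = gen_amor ((X \<otimes>\<^sub>m Y) \<otimes>\<^sub>m Z) (X \<otimes>\<^sub>m (Y \<otimes>\<^sub>m Z))
     {(pure_tens V (X \<otimes>\<^sub>m Y) Z (pure_tens V X Y x y) z,
       pure_tens V X (Y \<otimes>\<^sub>m Z) x (pure_tens V Y Z y z)) | x y z.
        x \<in> carrier X \<and> y \<in> carrier Y \<and> z \<in> carrier Z}"

definition aswap :: "('v, 'x) module \<Rightarrow> ('v, 'y) module \<Rightarrow>
    ('v, ('v, 'x, 'y) tens, ('v, 'y, 'x) tens) amor" where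
  "aswap X Y = gen_amor (X \<otimes>\<^sub>m Y) (Y \<otimes>\<^sub>m X)
     {(pure_tens V X Y x y, pure_tens V Y X y x) | x y. x \<in> carrier X \<and> y \<in> carrier Y}"

definition alunit :: "('v, 'x) module \<Rightarrow> ('v, ('v, 'v, 'x) tens, 'x) amor" where
  "alunit X = gen_amor (self_mod V \<otimes>\<^sub>m X) X
     {(pure_tens V (self_mod V) X v x, v \<odot>\<^bsub>X\<^esub> x) | v x. v \<in> carrier V \<and> x \<in> carrier X}"

subsection \<open>Almost algebras and their almost modules\<close>

definition almost_algebra :: "('v, 'a) aalg \<Rightarrow> bool" where
  "almost_algebra A \<longleftrightarrow> (let X = alg_obj A; \<mu> = alg_mult A; \<eta> = alg_unit A in
     is_amor (X \<otimes>\<^sub>m X) X \<mu> \<and> is_amor (self_mod V) X \<eta> \<and>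
     (\<mu> \<otimes>\<^sub>a aid X) \<Zsemi> \<mu> = aassoc X X X \<Zsemi> (aid X \<otimes>\<^sub>a \<mu>) \<Zsemi> \<mu> \<and>
     (\<eta> \<otimes>\<^sub>a aid X) \<Zsemi> \<mu> = alunit X \<and>
     aswap X X \<Zsemi> \<mu> = \<mu>)"

definition almost_module :: "('v, 'a) aalg \<Rightarrow> ('v, 'a, 'x) amodule \<Rightarrow> bool" where
  "almost_module A M \<longleftrightarrow> (let R = alg_obj A; \<mu> = alg_mult A; \<eta> = alg_unit A; X = obj M; \<alpha> = act M in
     is_amor (R \<otimes>\<^sub>m X) X \<alpha> \<and>
     (\<mu> \<otimes>\<^sub>a aid X) \<Zsemi> \<alpha> = aassoc R R X \<Zsemi> (aid R \<otimes>\<^sub>a \<alpha>) \<Zsemi> \<alpha> \<and>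
     (\<eta> \<otimes>\<^sub>a aid X) \<Zsemi> \<alpha> = alunit X)"

definition alinear :: "('v, 'a) aalg \<Rightarrow> ('v, 'a, 'x) amodule \<Rightarrow> ('v, 'a, 'y) amodule \<Rightarrow>
    ('v, 'x, 'y) amor \<Rightarrow> bool" where
  "alinear A M N f \<longleftrightarrow> is_amor (obj M) (obj N) f \<and> act M \<Zsemi> f = (aid (alg_obj A) \<otimes>\<^sub>a f) \<Zsemi> act N"

definition self_amodule :: "('v, 'a) aalg \<Rightarrow> ('v, 'a, 'a) amodule" where
  "self_amodule A = \<lparr>obj = alg_obj A, act = alg_mult A\<rparr>"

definition sub_amodule ::
  "('v, 'a) aalg \<Rightarrow> ('v, 'a, 'x) amodule \<Rightarrow> 'x set \<Rightarrow> ('v, 'a, 'x) amodule" where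
  "sub_amodule A M N = (let i = aincl (obj M) N in
     \<lparr>obj = sub_mod (obj M) N, act = alift i ((aid (alg_obj A) \<otimes>\<^sub>a i) \<Zsemi> act M)\<rparr>)"

definition quot_amodule ::
  "('v, 'a) aalg \<Rightarrow> ('v, 'a, 'x) amodule \<Rightarrow> 'x set \<Rightarrow> ('v, 'a, 'x set) amodule" where
  "quot_amodule A M N = (let q = aproj (obj M) N in
     \<lparr>obj = quot_mod (obj M) N, act = adescend (aid (alg_obj A) \<otimes>\<^sub>a q) (act M \<Zsemi> q)\<rparr>)"

text \<open>The image of the morphism \<open>A\<^sup>k \<rightarrow> N\<close> given by \<open>A\<close>-linear morphisms \<open>\<phi>\<^sub>1, \<dots>, \<phi>\<^sub>k : A \<rightarrow> N\<close> is the
  saturation of the sum of the images of the \<open>\<phi>\<^sub>i\<close>.\<close>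

definition fin_gen_sub :: "('v, 'a) aalg \<Rightarrow> ('v, 'a, 'x) amodule \<Rightarrow> 'x set \<Rightarrow> bool" where
  "fin_gen_sub A N N\<^sub>0 \<longleftrightarrow> (\<exists>\<Phi>. finite \<Phi> \<and> (\<forall>\<phi> \<in> \<Phi>. alinear A (self_amodule A) N \<phi>) \<and>
     N\<^sub>0 = msat (obj N) (span_mod V (obj N) (\<Union>\<phi> \<in> \<Phi>. Range (agraph \<phi>))))"

definition almost_fin_gen :: "('v, 'a) aalg \<Rightarrow> ('v, 'a, 'x) amodule \<Rightarrow> bool" where
  "almost_fin_gen A N \<longleftrightarrow> (\<forall>F. finite F \<and> F \<subseteq> carrier V \<and> genideal V F \<subseteq> \<mm> \<longrightarrow>
     (\<exists>N\<^sub>0. fin_gen_sub A N N\<^sub>0 \<and>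
        span_mod V (obj N) {e \<odot>\<^bsub>obj N\<^esub> x | e x. e \<in> genideal V F \<and> x \<in> carrier (obj N)} \<subseteq> N\<^sub>0))"

text \<open>\<open>P \<otimes>\<^sub>A M\<close> is the coequalizer of \<open>(P \<otimes> A) \<otimes> M \<rightrightarrows> P \<otimes> M\<close>.\<close>

definition tensA_ker :: "('v, 'a) aalg \<Rightarrow> ('v, 'a, 'x) amodule \<Rightarrow> ('v, 'a, 'y) amodule \<Rightarrow>
    ('v, 'x, 'y) tens set" where
  "tensA_ker A P M = (let R = alg_obj A in aimage (adiff
     ((aswap (obj P) R \<Zsemi> act P) \<otimes>\<^sub>a aid (obj M))
     (aassoc (obj P) R (obj M) \<Zsemi> (aid (obj P) \<otimes>\<^sub>a act M))))"

definition tensA_proj :: "('v, 'a) aalg \<Rightarrow> ('v, 'a, 'x) amodule \<Rightarrow> ('v, 'a, 'y) amodule \<Rightarrow>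
    ('v, ('v, 'x, 'y) tens, ('v, 'x, 'y) tens set) amor" where
  "tensA_proj A P M = aproj (obj P \<otimes>\<^sub>m obj M) (tensA_ker A P M)"

definition tensA_map :: "('v, 'a) aalg \<Rightarrow>
    ('v, 'a, 'x) amodule \<Rightarrow> ('v, 'a, 'x1) amodule \<Rightarrow> ('v, 'x, 'x1) amor \<Rightarrow>
    ('v, 'a, 'y) amodule \<Rightarrow> ('v, 'a, 'y1) amodule \<Rightarrow> ('v, 'y, 'y1) amor \<Rightarrow>
    ('v, ('v, 'x, 'y) tens set, ('v, 'x1, 'y1) tens set) amor" where
  "tensA_map A P P' f M M' g = adescend (tensA_proj A P M) ((f \<otimes>\<^sub>a g) \<Zsemi> tensA_proj A P' M')"

subsection \<open>The arrow category with the pushout product\<close>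

definition is_asq :: "('v, 'a, 'b) amor \<Rightarrow> ('v, 'c, 'd) amor \<Rightarrow> ('v, 'a, 'b, 'c, 'd) asq \<Rightarrow> bool" where
  "is_asq f g s \<longleftrightarrow> sq_src s = f \<and> sq_tgt s = g \<and>
     is_amor (asrc f) (asrc g) (sq0 s) \<and> is_amor (atgt f) (atgt g) (sq1 s) \<and>
     sq0 s \<Zsemi> g = f \<Zsemi> sq1 s"

definition sq_id :: "('v, 'a, 'b) amor \<Rightarrow> ('v, 'a, 'b, 'a, 'b) asq" where
  "sq_id f = \<lparr>sq_src = f, sq_tgt = f, sq0 = aid (asrc f), sq1 = aid (atgt f)\<rparr>"

definition sq_comp :: "('v, 'a, 'b, 'c, 'd) asq \<Rightarrow> ('v, 'c, 'd, 'e, 'f) asq \<Rightarrow>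
    ('v, 'a, 'b, 'e, 'f) asq" (infixl \<open>\<Zsemi>\<^sub>s\<close> 60) where
  "s \<Zsemi>\<^sub>s t = \<lparr>sq_src = sq_src s, sq_tgt = sq_tgt t, sq0 = sq0 s \<Zsemi> sq0 t, sq1 = sq1 s \<Zsemi> sq1 t\<rparr>"

text \<open>The source of \<open>f \<box> g\<close> for \<open>f : X\<^sub>0 \<rightarrow> X\<^sub>1\<close>, \<open>g : Y\<^sub>0 \<rightarrow> Y\<^sub>1\<close>: the pushout
  \<open>(X\<^sub>0 \<otimes> Y\<^sub>1) \<amalg> (X\<^sub>1 \<otimes> Y\<^sub>0)\<close> under \<open>X\<^sub>0 \<otimes> Y\<^sub>0\<close>, i.e. the cokernel of
  \<open>(X\<^sub>0 \<otimes> g, - f \<otimes> Y\<^sub>0) : X\<^sub>0 \<otimes> Y\<^sub>0 \<rightarrow> (X\<^sub>0 \<otimes> Y\<^sub>1) \<oplus> (X\<^sub>1 \<otimes> Y\<^sub>0)\<close>.\<close>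

definition box_sum :: "('v, 'a, 'b) amor \<Rightarrow> ('v, 'c, 'd) amor \<Rightarrow>
    ('v, ('v, 'a, 'd) tens \<times> ('v, 'b, 'c) tens) module" where
  "box_sum f g = sum_mod (asrc f \<otimes>\<^sub>m atgt g) (atgt f \<otimes>\<^sub>m asrc g)"

definition box_ker :: "('v, 'a, 'b) amor \<Rightarrow> ('v, 'c, 'd) amor \<Rightarrow>
    (('v, 'a, 'd) tens \<times> ('v, 'b, 'c) tens) set" where
  "box_ker f g = aimage \<lparr>asrc = asrc f \<otimes>\<^sub>m asrc g, atgt = box_sum f g,
     agraph = {(c, (p, \<ominus>\<^bsub>atgt f \<otimes>\<^sub>m asrc g\<^esub> q)) | c p q.
       (c, p) \<in> agraph (aid (asrc f) \<otimes>\<^sub>a g) \<and> (c, q) \<in> agraph (f \<otimes>\<^sub>a aid (asrc g))}\<rparr>"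

definition box_obj :: "('v, 'a, 'b) amor \<Rightarrow> ('v, 'c, 'd) amor \<Rightarrow>
    ('v, ('v, 'a, 'b, 'c, 'd) boxt) module" where
  "box_obj f g = quot_mod (box_sum f g) (box_ker f g)"

definition box_inl :: "('v, 'a, 'b) amor \<Rightarrow> ('v, 'c, 'd) amor \<Rightarrow>
    ('v, 'a, 'd) tens \<Rightarrow> ('v, 'a, 'b, 'c, 'd) boxt" where
  "box_inl f g p = box_ker f g +>\<^bsub>box_sum f g\<^esub> (p, \<zero>\<^bsub>atgt f \<otimes>\<^sub>m asrc g\<^esub>)"

definition box_inr :: "('v, 'a, 'b) amor \<Rightarrow> ('v, 'c, 'd) amor \<Rightarrow>
    ('v, 'b, 'c) tens \<Rightarrow> ('v, 'a, 'b, 'c, 'd) boxt" where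
  "box_inr f g q = box_ker f g +>\<^bsub>box_sum f g\<^esub> (\<zero>\<^bsub>asrc f \<otimes>\<^sub>m atgt g\<^esub>, q)"

definition box :: "('v, 'a, 'b) amor \<Rightarrow> ('v, 'c, 'd) amor \<Rightarrow>
    ('v, ('v, 'a, 'b, 'c, 'd) boxt, ('v, 'b, 'd) tens) amor" (infixl \<open>\<box>\<close> 70) where
  "f \<box> g = gen_amor (box_obj f g) (atgt f \<otimes>\<^sub>m atgt g)
     ({(box_inl f g p, z) | p z. (p, z) \<in> agraph (f \<otimes>\<^sub>a aid (atgt g))} \<union>
      {(box_inr f g q, z) | q z. (q, z) \<in> agraph (aid (atgt f) \<otimes>\<^sub>a g)})"

definition box_map where
  "box_map s t = (let f = sq_src s; f' = sq_tgt s; g = sq_src t; g' = sq_tgt t in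
     \<lparr>sq_src = f \<box> g, sq_tgt = f' \<box> g',
      sq0 = gen_amor (box_obj f g) (box_obj f' g')
        ({(box_inl f g p, box_inl f' g' p') | p p'. (p, p') \<in> agraph (sq0 s \<otimes>\<^sub>a sq1 t)} \<union>
         {(box_inr f g q, box_inr f' g' q') | q q'. (q, q') \<in> agraph (sq1 s \<otimes>\<^sub>a sq0 t)}),
      sq1 = sq1 s \<otimes>\<^sub>a sq1 t\<rparr>)"

text \<open>The associator \<open>(f \<box> g) \<box> h \<rightarrow> f \<box> (g \<box> h)\<close>: the source of either side is the sum of the
  images of \<open>X\<^sub>0 \<otimes> Y\<^sub>1 \<otimes> Z\<^sub>1\<close>, \<open>X\<^sub>1 \<otimes> Y\<^sub>0 \<otimes> Z\<^sub>1\<close> and \<open>X\<^sub>1 \<otimes> Y\<^sub>1 \<otimes> Z\<^sub>0\<close>.\<close>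

definition box_assoc where
  "box_assoc f g h =
     \<lparr>sq_src = (f \<box> g) \<box> h, sq_tgt = f \<box> (g \<box> h),
      sq0 = gen_amor (box_obj (f \<box> g) h) (box_obj f (g \<box> h))
       ({(box_inl (f \<box> g) h (pure_tens V (box_obj f g) (atgt h)
            (box_inl f g (pure_tens V (asrc f) (atgt g) x y)) z),
          box_inl f (g \<box> h) (pure_tens V (asrc f) (atgt g \<otimes>\<^sub>m atgt h)
            x (pure_tens V (atgt g) (atgt h) y z))) | x y z.
          x \<in> carrier (asrc f) \<and> y \<in> carrier (atgt g) \<and> z \<in> carrier (atgt h)} \<union>
        {(box_inl (f \<box> g) h (pure_tens V (box_obj f g) (atgt h)
            (box_inr f g (pure_tens V (atgt f) (asrc g) x y)) z),
          box_inr f (g \<box> h) (pure_tens V (atgt f) (box_obj g h)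
            x (box_inl g h (pure_tens V (asrc g) (atgt h) y z)))) | x y z.
          x \<in> carrier (atgt f) \<and> y \<in> carrier (asrc g) \<and> z \<in> carrier (atgt h)} \<union>
        {(box_inr (f \<box> g) h (pure_tens V (atgt f \<otimes>\<^sub>m atgt g) (asrc h)
            (pure_tens V (atgt f) (atgt g) x y) z),
          box_inr f (g \<box> h) (pure_tens V (atgt f) (box_obj g h)
            x (box_inr g h (pure_tens V (atgt g) (asrc h) y z)))) | x y z.
          x \<in> carrier (atgt f) \<and> y \<in> carrier (atgt g) \<and> z \<in> carrier (asrc h)}),
      sq1 = aassoc (atgt f) (atgt g) (atgt h)\<rparr>"

definition box_swap where
  "box_swap f g =
     \<lparr>sq_src = f \<box> g, sq_tgt = g \<box> f,
      sq0 = gen_amor (box_obj f g) (box_obj g f)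
       ({(box_inl f g (pure_tens V (asrc f) (atgt g) x y),
          box_inr g f (pure_tens V (atgt g) (asrc f) y x)) | x y.
          x \<in> carrier (asrc f) \<and> y \<in> carrier (atgt g)} \<union>
        {(box_inr f g (pure_tens V (atgt f) (asrc g) x y),
          box_inl g f (pure_tens V (asrc g) (atgt f) y x)) | x y.
          x \<in> carrier (atgt f) \<and> y \<in> carrier (asrc g)}),
      sq1 = aswap (atgt f) (atgt g)\<rparr>"

text \<open>The unit of the pushout product is \<open>0 \<rightarrow> V\<close>; its unitor vanishes on the summand \<open>0 \<otimes> X\<^sub>1\<close>.\<close>

definition box_unit :: "('v, unit, 'v) amor" where
  "box_unit = gen_amor zero_mod (self_mod V) {}"

definition box_lunit where
  "box_lunit f =
     \<lparr>sq_src = box_unit \<box> f, sq_tgt = f,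
      sq0 = gen_amor (box_obj box_unit f) (asrc f)
        {(box_inr box_unit f (pure_tens V (self_mod V) (asrc f) v x), v \<odot>\<^bsub>asrc f\<^esub> x) | v x.
           v \<in> carrier V \<and> x \<in> carrier (asrc f)},
      sq1 = alunit (atgt f)\<rparr>"

subsection \<open>Smith ideals\<close>

definition smith_monoid :: "('v, 'i, 'a) smith \<Rightarrow> bool" where
  "smith_monoid J \<longleftrightarrow> (let j = s_arrow J; \<mu> = s_mult J; \<eta> = s_unit J in
     is_amor (asrc j) (atgt j) j \<and> is_asq (j \<box> j) j \<mu> \<and> is_asq box_unit j \<eta> \<and>
     box_map \<mu> (sq_id j) \<Zsemi>\<^sub>s \<mu> = box_assoc j j j \<Zsemi>\<^sub>s box_map (sq_id j) \<mu> \<Zsemi>\<^sub>s \<mu> \<and>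
     box_map \<eta> (sq_id j) \<Zsemi>\<^sub>s \<mu> = box_lunit j \<and>
     box_swap j j \<Zsemi>\<^sub>s \<mu> = \<mu>)"

text \<open>Evaluation at the target of arrows is a strict monoidal functor, so a Smith ideal induces an
  algebra structure on the target of \<open>j\<close>; for \<open>j : I \<rightarrow> A\<close> this has to be the given one.\<close>

definition smith_ideal :: "('v, 'a) aalg \<Rightarrow> ('v, 'i, 'a) smith \<Rightarrow> bool" where
  "smith_ideal A J \<longleftrightarrow> smith_monoid J \<and> atgt (s_arrow J) = alg_obj A \<and>
     sq1 (s_mult J) = alg_mult A \<and> sq1 (s_unit J) = alg_unit A"

text \<open>\<open>I\<close> as an almost \<open>A\<close>-module, through \<open>A \<otimes> I \<rightarrow> (I \<otimes> A) \<amalg> (A \<otimes> I) \<rightarrow> I\<close>.\<close>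

definition smith_module :: "('v, 'i, 'a) smith \<Rightarrow> ('v, 'a, 'i) amodule" where
  "smith_module J = (let j = s_arrow J; T = atgt j \<otimes>\<^sub>m asrc j in
     \<lparr>obj = asrc j,
      act = gen_amor T (box_obj j j) {(q, box_inr j j q) | q. q \<in> carrier T} \<Zsemi> sq0 (s_mult J)\<rparr>)"

text \<open>The binary multiplication \<open>I \<otimes> I \<rightarrow> A \<otimes> I \<rightarrow> I\<close>, and its iterate \<open>I\<^sup>\<otimes>\<^sup>m \<rightarrow> I\<close> for \<open>m \<ge> 1\<close>; a product
  of elements of \<open>\<mm>I\<close> is determined up to torsion.\<close>

definition smith_bin :: "('v, 'i, 'a) smith \<Rightarrow> ('v, ('v, 'i, 'i) tens, 'i) amor" where
  "smith_bin J = (s_arrow J \<otimes>\<^sub>a aid (asrc (s_arrow J))) \<Zsemi> act (smith_module J)"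

fun smith_prods :: "('v, 'i, 'a) smith \<Rightarrow> 'i list \<Rightarrow> 'i set" where
  "smith_prods J [] = {}"
| "smith_prods J [x] = agraph (aid (asrc (s_arrow J))) `` {x}"
| "smith_prods J (x # y # zs) = agraph (smith_bin J) ``
     {pure_tens V (asrc (s_arrow J)) (asrc (s_arrow J)) x z | z.
        (x \<in> mpart (asrc (s_arrow J))) \<and> z \<in> smith_prods J (y # zs)}"

definition smith_mult :: "('v, 'i, 'a) smith \<Rightarrow> nat \<Rightarrow> ('v, ('i list \<Rightarrow> 'v) set, 'i) amor" where
  "smith_mult J m = (let X = asrc (s_arrow J) in gen_amor (tpow V X m) X
     {(pure_tpow V X m xs, y) | xs y. length xs = m \<and> set xs \<subseteq> carrier X \<and> y \<in> smith_prods J xs})"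

text \<open>\<open>I\<^sup>m\<close>, for \<open>m \<ge> 1\<close>.\<close>

definition smith_pow :: "('v, 'i, 'a) smith \<Rightarrow> nat \<Rightarrow> 'i set" where
  "smith_pow J m = aimage (smith_mult J m)"

definition pow_module :: "('v, 'a) aalg \<Rightarrow> ('v, 'i, 'a) smith \<Rightarrow> nat \<Rightarrow> ('v, 'a, 'i) amodule" where
  "pow_module A J m = sub_amodule A (smith_module J) (smith_pow J m)"

text \<open>\<open>I \<otimes>\<^sub>A M \<rightarrow> A \<otimes>\<^sub>A M = M\<close>, and \<open>I\<^sup>m \<otimes>\<^sub>A M \<rightarrow> I \<otimes>\<^sub>A M\<close>.\<close>

definition jact :: "('v, 'a) aalg \<Rightarrow> ('v, 'i, 'a) smith \<Rightarrow> ('v, 'a, 'x) amodule \<Rightarrow>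
    ('v, ('v, 'i, 'x) tens set, 'x) amor" where
  "jact A J M = adescend (tensA_proj A (smith_module J) M) ((s_arrow J \<otimes>\<^sub>a aid (obj M)) \<Zsemi> act M)"

definition pow_tens :: "('v, 'a) aalg \<Rightarrow> ('v, 'i, 'a) smith \<Rightarrow> nat \<Rightarrow> ('v, 'a, 'x) amodule \<Rightarrow>
    ('v, ('v, 'i, 'x) tens set, ('v, 'i, 'x) tens set) amor" where
  "pow_tens A J m M = tensA_map A
     (pow_module A J m) (smith_module J) (aincl (asrc (s_arrow J)) (smith_pow J m)) M M (aid (obj M))"

definition pow_mult_mod :: "('v, 'a) aalg \<Rightarrow> ('v, 'i, 'a) smith \<Rightarrow> nat \<Rightarrow> ('v, 'a, 'x) amodule \<Rightarrow>
    'x set" where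
  "pow_mult_mod A J m M = aimage (pow_tens A J m M \<Zsemi> jact A J M)"

subsection \<open>The approximations \<open>\<P>\<^sup>n\<^sub>j\<close>\<close>

text \<open>For \<open>X = (X\<^sub>0 \<rightarrow> X\<^sub>1)\<close>, the images of \<open>I\<^sup>n\<^sup>+\<^sup>1 \<otimes>\<^sub>A X\<^sub>1\<close> in \<open>X\<^sub>0\<close> and in \<open>X\<^sub>1\<close>.\<close>

definition jker0 :: "('v, 'a) aalg \<Rightarrow> ('v, 'i, 'a) smith \<Rightarrow> nat \<Rightarrow>
    ('v, 'a, 'i, 'x, 'y) jarrow \<Rightarrow> 'x set" where
  "jker0 A J n X = aimage (pow_tens A J (Suc n) (jbot X) \<Zsemi> jcmp X)"

definition jker1 :: "('v, 'a) aalg \<Rightarrow> ('v, 'i, 'a) smith \<Rightarrow> nat \<Rightarrow>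
    ('v, 'a, 'i, 'x, 'y) jarrow \<Rightarrow> 'y set" where
  "jker1 A J n X = pow_mult_mod A J (Suc n) (jbot X)"

definition jproj0 :: "('v, 'a) aalg \<Rightarrow> ('v, 'i, 'a) smith \<Rightarrow> nat \<Rightarrow>
    ('v, 'a, 'i, 'x, 'y) jarrow \<Rightarrow> ('v, 'x, 'x set) amor" where
  "jproj0 A J n X = aproj (obj (jtop X)) (jker0 A J n X)"

definition jproj1 :: "('v, 'a) aalg \<Rightarrow> ('v, 'i, 'a) smith \<Rightarrow> nat \<Rightarrow>
    ('v, 'a, 'i, 'x, 'y) jarrow \<Rightarrow> ('v, 'y, 'y set) amor" where
  "jproj1 A J n X = aproj (obj (jbot X)) (jker1 A J n X)"

definition jP :: "('v, 'a) aalg \<Rightarrow> ('v, 'i, 'a) smith \<Rightarrow> nat \<Rightarrow>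
    ('v, 'a, 'i, 'x, 'y) jarrow \<Rightarrow> ('v, 'a, 'i, 'x set, 'y set) jarrow" where
  "jP A J n X = (let I = smith_module J; X1' = quot_amodule A (jbot X) (jker1 A J n X) in
     \<lparr>jtop = quot_amodule A (jtop X) (jker0 A J n X),
      jbot = X1',
      jmap = adescend (jproj0 A J n X) (jmap X \<Zsemi> jproj1 A J n X),
      jcmp = adescend (tensA_map A I I (aid (obj I)) (jbot X) X1' (jproj1 A J n X))
        (jcmp X \<Zsemi> jproj0 A J n X)\<rparr>)"

text \<open>\<open>\<P>\<^sup>n\<^sub>j\<close> on a morphism \<open>X \<rightarrow> Y\<close> of arrows.\<close>

definition jP_map :: "('v, 'a) aalg \<Rightarrow> ('v, 'i, 'a) smith \<Rightarrow> nat \<Rightarrow>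
    ('v, 'a, 'i, 'x, 'y) jarrow \<Rightarrow> ('v, 'a, 'i, 'x1, 'y1) jarrow \<Rightarrow>
    ('v, 'x, 'y, 'x1, 'y1) asq \<Rightarrow> ('v, 'x set, 'y set, 'x1 set, 'y1 set) asq" where
  "jP_map A J n X Y s =
     \<lparr>sq_src = jmap (jP A J n X), sq_tgt = jmap (jP A J n Y),
      sq0 = adescend (jproj0 A J n X) (sq0 s \<Zsemi> jproj0 A J n Y),
      sq1 = adescend (jproj1 A J n X) (sq1 s \<Zsemi> jproj1 A J n Y)\<rparr>"

subsection \<open>Inverse limits\<close>

text \<open>The limit of a tower \<open>\<dots> \<rightarrow> T\<^sub>2 \<rightarrow> T\<^sub>1 \<rightarrow> T\<^sub>0\<close> in \<open>AMod\<^sub>V\<close>, with transition morphisms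
  \<open>t n : T\<^sub>n\<^sub>+\<^sub>1 \<rightarrow> T\<^sub>n\<close>. The elements of the limit lie in \<open>\<mm>T\<^sub>n\<^sub>+\<^sub>1\<close> (the domain of \<open>t n\<close>) and are
  compatible up to torsion, neither of which matters up to isomorphism in \<open>AMod\<^sub>V\<close>.\<close>

definition alim :: "(nat \<Rightarrow> ('v, 'x) module) \<Rightarrow> (nat \<Rightarrow> ('v, 'x, 'x) amor) \<Rightarrow>
    ('v, nat \<Rightarrow> 'x) module" where
  "alim T t = sub_mod (seq_mod T) {x \<in> carrier (seq_mod T). \<forall>n. (x (Suc n), x n) \<in> agraph (t n)}"

definition alim_proj :: "(nat \<Rightarrow> ('v, 'x) module) \<Rightarrow> (nat \<Rightarrow> ('v, 'x, 'x) amor) \<Rightarrow> nat \<Rightarrow>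
    ('v, nat \<Rightarrow> 'x, 'x) amor" where
  "alim_proj T t n = gen_amor (alim T t) (T n) {(x, x n) | x. x \<in> carrier (alim T t)}"

text \<open>The morphism into the limit given by a compatible family \<open>f n : W \<rightarrow> T\<^sub>n\<close>.\<close>

definition alim_lift :: "(nat \<Rightarrow> ('v, 'x) module) \<Rightarrow> (nat \<Rightarrow> ('v, 'x, 'x) amor) \<Rightarrow>
    ('v, 'w) module \<Rightarrow> (nat \<Rightarrow> ('v, 'w, 'x) amor) \<Rightarrow> ('v, 'w, nat \<Rightarrow> 'x) amor" where
  "alim_lift T t W f = \<lparr>asrc = W, atgt = alim T t,
     agraph = {(w, x). x \<in> carrier (alim T t) \<and> (\<forall>n. (w, x n) \<in> agraph (f n))}\<rparr>"

definition alim_module :: "('v, 'a) aalg \<Rightarrow> (nat \<Rightarrow> ('v, 'a, 'x) amodule) \<Rightarrow>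
    (nat \<Rightarrow> ('v, 'x, 'x) amor) \<Rightarrow> ('v, 'a, nat \<Rightarrow> 'x) amodule" where
  "alim_module A T t = (let L = alim (obj \<circ> T) t; R = alg_obj A in
     \<lparr>obj = L, act = alim_lift (obj \<circ> T) t (R \<otimes>\<^sub>m L)
        (\<lambda>n. (aid R \<otimes>\<^sub>a alim_proj (obj \<circ> T) t n) \<Zsemi> act (T n))\<rparr>)"

text \<open>\<open>lim\<^sub>n \<P>\<^sup>n\<^sub>j(X)\<close>; the transition morphisms are induced by the identity of \<open>X\<close>.\<close>

definition jtrans0 :: "('v, 'a) aalg \<Rightarrow> ('v, 'i, 'a) smith \<Rightarrow> ('v, 'a, 'i, 'x, 'y) jarrow \<Rightarrow> nat \<Rightarrow>
    ('v, 'x set, 'x set) amor" where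
  "jtrans0 A J X n = adescend (jproj0 A J (Suc n) X) (jproj0 A J n X)"

definition jtrans1 :: "('v, 'a) aalg \<Rightarrow> ('v, 'i, 'a) smith \<Rightarrow> ('v, 'a, 'i, 'x, 'y) jarrow \<Rightarrow> nat \<Rightarrow>
    ('v, 'y set, 'y set) amor" where
  "jtrans1 A J X n = adescend (jproj1 A J (Suc n) X) (jproj1 A J n X)"

definition jcompletion :: "('v, 'a) aalg \<Rightarrow> ('v, 'i, 'a) smith \<Rightarrow>
    ('v, 'a, 'i, 'x, 'y) jarrow \<Rightarrow> ('v, 'a, 'i, nat \<Rightarrow> 'x set, nat \<Rightarrow> 'y set) jarrow" where
  "jcompletion A J X = (let I = smith_module J;
       P = (\<lambda>n. jP A J n X); t0 = jtrans0 A J X; t1 = jtrans1 A J X;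
       T0 = (\<lambda>n. jtop (P n)); T1 = (\<lambda>n. jbot (P n));
       L0 = alim_module A T0 t0; L1 = alim_module A T1 t1 in
     \<lparr>jtop = L0,
      jbot = L1,
      jmap = alim_lift (obj \<circ> T1) t1 (obj L0) (\<lambda>n. alim_proj (obj \<circ> T0) t0 n \<Zsemi> jmap (P n)),
      jcmp = alim_lift (obj \<circ> T0) t0 (atgt (tensA_proj A I L1))
        (\<lambda>n. tensA_map A I I (aid (obj I)) L1 (T1 n) (alim_proj (obj \<circ> T1) t1 n) \<Zsemi> jcmp (P n))\<rparr>)"

definition jcanonical :: "('v, 'a) aalg \<Rightarrow> ('v, 'i, 'a) smith \<Rightarrow> ('v, 'a, 'i, 'x, 'y) jarrow \<Rightarrow>
    ('v, 'x, 'y, nat \<Rightarrow> 'x set, nat \<Rightarrow> 'y set) asq" where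
  "jcanonical A J X =
     \<lparr>sq_src = jmap X, sq_tgt = jmap (jcompletion A J X),
      sq0 = alim_lift (\<lambda>n. obj (jtop (jP A J n X))) (jtrans0 A J X) (obj (jtop X))
        (\<lambda>n. jproj0 A J n X),
      sq1 = alim_lift (\<lambda>n. obj (jbot (jP A J n X))) (jtrans1 A J X) (obj (jbot X))
        (\<lambda>n. jproj1 A J n X)\<rparr>"

subsection \<open>Almost completeness and the almost nilpotent approximation\<close>

definition is_asq_A :: "('v, 'a) aalg \<Rightarrow> ('v, 'a, 'i, 'x, 'y) jarrow \<Rightarrow>
    ('v, 'a, 'i, 'x1, 'y1) jarrow \<Rightarrow> ('v, 'x, 'y, 'x1, 'y1) asq \<Rightarrow> bool" where
  "is_asq_A A X Y s \<longleftrightarrow> is_asq (jmap X) (jmap Y) s \<and>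
     alinear A (jtop X) (jtop Y) (sq0 s) \<and> alinear A (jbot X) (jbot Y) (sq1 s)"

definition is_iso_A :: "('v, 'a) aalg \<Rightarrow> ('v, 'a, 'i, 'x, 'y) jarrow \<Rightarrow>
    ('v, 'a, 'i, 'x1, 'y1) jarrow \<Rightarrow> ('v, 'x, 'y, 'x1, 'y1) asq \<Rightarrow> bool" where
  "is_iso_A A X Y s \<longleftrightarrow> is_asq_A A X Y s \<and>
     (\<exists>s'. is_asq_A A Y X s' \<and> s \<Zsemi>\<^sub>s s' = sq_id (jmap X) \<and> s' \<Zsemi>\<^sub>s s = sq_id (jmap Y))"

definition almost_complete :: "('v, 'a) aalg \<Rightarrow> ('v, 'i, 'a) smith \<Rightarrow>
    ('v, 'a, 'i, 'x, 'y) jarrow \<Rightarrow> bool" where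
  "almost_complete A J X \<longleftrightarrow> (let Y = jcompletion A J X in
     \<forall>m. is_iso_A A (jP A J m X) (jP A J m Y) (jP_map A J m X Y (jcanonical A J X)))"

text \<open>The arrow \<open>IM \<rightarrow> M\<close> with the corestriction \<open>I \<otimes>\<^sub>A M \<rightarrow> IM\<close> of \<open>I \<otimes>\<^sub>A M \<rightarrow> M\<close>.\<close>

definition module_arrow :: "('v, 'a) aalg \<Rightarrow> ('v, 'i, 'a) smith \<Rightarrow> ('v, 'a, 'x) amodule \<Rightarrow>
    ('v, 'a, 'i, 'x, 'x) jarrow" where
  "module_arrow A J M = (let N = aimage (jact A J M); i = aincl (obj M) N in
     \<lparr>jtop = sub_amodule A M N, jbot = M, jmap = i, jcmp = alift i (jact A J M)\<rparr>)"

definition nilpotent_approx :: "('v, 'a) aalg \<Rightarrow> ('v, 'i, 'a) smith \<Rightarrow> ('v, 'a, 'x) amodule \<Rightarrow>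
    ('v, 'a, 'i, nat \<Rightarrow> 'x set, nat \<Rightarrow> 'x set) jarrow" where
  "nilpotent_approx A J M = jcompletion A J (module_arrow A J M)"

end

end

theory Submission
  imports Defs
begin

text \<open>
  A morphism of almost modules is the same thing as a linear map between certain modules. The core
  of \<open>X\<close>, which is \<open>\<mm>X\<close> modulo its \<open>\<mm>\<close>-torsion, is a fully faithful functor on \<open>AMod\<^sub>V\<close> (\<open>amor_eqI\<close>,
  \<open>amor_of_hom\<close>), so one can compute with elements of cores. A morphism is an isomorphism iff it is
  bijective on cores (\<open>amor_inverse\<close> for the harder direction), and \<open>X \<otimes> Y\<close> represents bilinear maps of
  cores (\<open>tens_core_universal\<close>). Algebras, modules and the Smith ideal thus turn into bilinear
  operations on elements. The commutativity of the Smith ideal and the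
  pushout relation yield \<open>j(i) i' = j(i') i\<close> (\<open>jc_comm\<close>), and hence
  \<open>I\<^sup>k\<^sup>+\<^sup>1 X\<^sub>1 = I \<cdot> I\<^sup>k X\<^sub>1\<close> in \<open>X\<^sub>0\<close> for an arrow \<open>X\<^sub>0 \<rightarrow> X\<^sub>1\<close> with a pairing \<open>\<beta> : I \<times> X\<^sub>1 \<rightarrow> X\<^sub>0\<close>
  (\<open>gpow_Fpow\<close>).

  Let \<open>\<Lambda> = (\<Lambda>\<^sub>0 \<rightarrow> \<Lambda>\<^sub>1)\<close> be the limit of the approximations of \<open>X = (X\<^sub>0 \<rightarrow> X\<^sub>1)\<close>. The bottom of each construction is
  the top of the same construction for the identity of \<open>X\<^sub>1\<close>, so that it suffices to study tops. The
  theorem comes down to the following: the kernel of \<open>\<Lambda>\<^sub>0 \<rightarrow> X\<^sub>0/I\<^sup>n\<^sup>+\<^sup>1 X\<^sub>1\<close> is \<open>I\<^sup>n\<^sup>+\<^sup>1 \<Lambda>\<^sub>1\<close> up to saturation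
  (\<open>kernel_completion\<close>, \<open>kernel_completion_iff\<close>). Then the approximations of \<open>\<Lambda>\<close> are subobjects of those of
  \<open>X\<close>, and a comparison of compatible sequences shows that \<open>\<Lambda>\<close> maps isomorphically to its own
  completion (\<open>jcanonical_bij\<close>); an isomorphism of arrows stays one after each approximation (\<open>jP_map_iso\<close>).

  The kernel is found as in the classical proof that the completion along a finitely generated ideal
  is complete. Let \<open>u\<close> be in the kernel and approximate it by \<open>x\<^sub>k \<in> X\<^sub>0\<close>, with \<open>x\<^sub>k = 0\<close> for \<open>k \<le> n\<close> and
  \<open>x\<^sub>k\<^sub>+\<^sub>1 - x\<^sub>k \<in> I\<^sup>k\<^sup>+\<^sup>1 X\<^sub>1\<close>. If \<open>I\<close> is generated by finitely many \<open>g\<close>, these differences are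
  \<open>\<Sum>\<^sub>g \<beta>(g, y\<^sub>g\<^sub>,\<^sub>k)\<close> with \<open>y\<^sub>g\<^sub>,\<^sub>k \<in> I\<^sup>k X\<^sub>1\<close>, so \<open>u = \<Sum>\<^sub>g \<beta>(g, Y\<^sub>g)\<close> with \<open>Y\<^sub>g = \<Sum>\<^sub>k y\<^sub>g\<^sub>,\<^sub>k \<in> \<Lambda>\<^sub>1\<close> (\<open>series_limit\<close>). As \<open>Y\<^sub>g\<close> vanishes in
  \<open>X\<^sub>1/I\<^sup>n X\<^sub>1\<close>, it lies in \<open>I\<^sup>n \<Lambda>\<^sub>1\<close> by induction on \<open>n\<close>, and \<open>u\<close> lies in \<open>I\<^sup>n\<^sup>+\<^sup>1 \<Lambda>\<^sub>1\<close>.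

  Here \<open>I\<close> is only almost finitely generated: for given scalars in \<open>\<mm>\<close>, the corresponding multiples of
  \<open>I\<close> lie in a submodule with finitely many generators, which depend on the scalars
  (\<open>almost_generators\<close>). Memberships and limits also hold only up to scalars. The argument survives
  because finitely many scalars, chosen once and for all terms of the series, suffice, and because
  products of any fixed number of elements span \<open>\<mm>\<close>.
\<close>

section \<open>Modules, linear maps, quotients and spans\<close>

text \<open>Quotient modules and cores have operations defined by representatives; the module axioms then come
  from the module of representatives.\<close>

lemma module_by_surjection:
  assumes X: "module V X"
    and car: "carrier Q = \<pi> ` carrier X"
    and add: "\<And>x y. x \<in> carrier X \<Longrightarrow> y \<in> carrier X \<Longrightarrow> \<pi> x \<oplus>\<^bsub>Q\<^esub> \<pi> y = \<pi> (x \<oplus>\<^bsub>X\<^esub> y)"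
    and zero: "\<zero>\<^bsub>Q\<^esub> = \<pi> \<zero>\<^bsub>X\<^esub>"
    and smult: "\<And>v x. v \<in> carrier V \<Longrightarrow> x \<in> carrier X \<Longrightarrow> v \<odot>\<^bsub>Q\<^esub> \<pi> x = \<pi> (v \<odot>\<^bsub>X\<^esub> x)"
  shows "module V Q"
proof -
  interpret X: module V X by fact
  show ?thesis
  proof (rule moduleI)
    show "cring V" by (rule X.R.is_cring)
    show "abelian_group Q"
    proof (rule abelian_groupI)
      fix q assume "q \<in> carrier Q"
      then obtain x where x: "x \<in> carrier X" "q = \<pi> x" using car by auto
      show "\<exists>p\<in>carrier Q. p \<oplus>\<^bsub>Q\<^esub> q = \<zero>\<^bsub>Q\<^esub>"
        using x by (intro bexI[of _ "\<pi> (\<ominus>\<^bsub>X\<^esub> x)"]) (auto simp: car add zero X.M.l_neg)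
    next
      fix p q r assume "p \<in> carrier Q" "q \<in> carrier Q" "r \<in> carrier Q"
      then show "p \<oplus>\<^bsub>Q\<^esub> q \<oplus>\<^bsub>Q\<^esub> r = p \<oplus>\<^bsub>Q\<^esub> (q \<oplus>\<^bsub>Q\<^esub> r)"
        by (auto simp: car add X.M.a_assoc)
    next
      fix p q assume "p \<in> carrier Q" "q \<in> carrier Q"
      then show "p \<oplus>\<^bsub>Q\<^esub> q = q \<oplus>\<^bsub>Q\<^esub> p"
        unfolding car by (elim imageE) (simp only: add X.M.a_comm)
    qed (auto simp: car add zero)
  qed (auto simp: car add smult X.smult_l_distr X.smult_r_distr X.smult_assoc1)
qed

text \<open>Closure under negation is omitted: it follows from closure under multiplication by \<open>-1\<close>.\<close>

lemma submodule_iff: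
  assumes "module V X"
  shows "submodule N V X \<longleftrightarrow> N \<subseteq> carrier X \<and> \<zero>\<^bsub>X\<^esub> \<in> N \<and> (\<forall>x\<in>N. \<forall>y\<in>N. x \<oplus>\<^bsub>X\<^esub> y \<in> N) \<and>
    (\<forall>v\<in>carrier V. \<forall>x\<in>N. v \<odot>\<^bsub>X\<^esub> x \<in> N)" (is "?l = ?r")
proof -
  interpret X: module V X by fact
  show ?thesis
  proof
    assume ?l
    then show ?r
      using X.submoduleE[OF \<open>?l\<close>] subgroup.one_closed[OF submodule.axioms(1)[OF \<open>?l\<close>]] by auto
  next
    assume r: ?r
    show ?l
    proof (rule X.submoduleI)
      fix a assume a: "a \<in> N"
      then have "(\<ominus>\<^bsub>V\<^esub> \<one>\<^bsub>V\<^esub>) \<odot>\<^bsub>X\<^esub> a \<in> N" "a \<in> carrier X" using r by auto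
      then show "\<ominus>\<^bsub>X\<^esub> a \<in> N" using X.smult_l_minus[of "\<one>\<^bsub>V\<^esub>" a] by simp
    qed (use r in auto)
  qed
qed

lemma submoduleD:
  assumes "module V X" "submodule N V X"
  shows "x \<in> N \<Longrightarrow> x \<in> carrier X" "\<zero>\<^bsub>X\<^esub> \<in> N"
    "x \<in> N \<Longrightarrow> y \<in> N \<Longrightarrow> x \<oplus>\<^bsub>X\<^esub> y \<in> N" "v \<in> carrier V \<Longrightarrow> x \<in> N \<Longrightarrow> v \<odot>\<^bsub>X\<^esub> x \<in> N"
  using assms(2) unfolding submodule_iff[OF assms(1)] by auto

lemma submodule_minus:
  assumes "module V X" "submodule N V X" "x \<in> N" "y \<in> N"
  shows "x \<ominus>\<^bsub>X\<^esub> y \<in> N"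
  using module.submoduleE(3,5)[OF assms(1,2)] assms(3,4) by (auto simp: a_minus_def)

lemma submodule_carrier: "module V X \<Longrightarrow> submodule (carrier X) V X"
  by (rule module.carrier_is_submodule)

lemma submodule_zero:
  assumes "module V X" shows "submodule {\<zero>\<^bsub>X\<^esub>} V X"
proof -
  interpret X: module V X by fact
  show ?thesis unfolding submodule_iff[OF assms] by auto
qed

lemma span_mod_submodule:
  assumes X: "module V X" and "S \<subseteq> carrier X"
  shows "submodule (span_mod V X S) V X"
proof -
  have mem: "x \<in> span_mod V X S \<longleftrightarrow> (\<forall>N. submodule N V X \<and> S \<subseteq> N \<longrightarrow> x \<in> N)" for x
    by (auto simp: span_mod_def)
  have "span_mod V X S \<subseteq> carrier X" using submodule_carrier[OF X] assms(2) mem by blast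
  moreover have "\<zero>\<^bsub>X\<^esub> \<in> span_mod V X S" unfolding mem by (auto simp: submodule_iff[OF X])
  moreover have "x \<oplus>\<^bsub>X\<^esub> y \<in> span_mod V X S" if "x \<in> span_mod V X S" "y \<in> span_mod V X S" for x y
    using that unfolding mem by (meson submodule_iff[OF X])
  moreover have "v \<odot>\<^bsub>X\<^esub> x \<in> span_mod V X S" if "v \<in> carrier V" "x \<in> span_mod V X S" for v x
    using that unfolding mem by (meson submodule_iff[OF X])
  ultimately show ?thesis unfolding submodule_iff[OF X] by blast
qed

lemma span_mod_superset: "S \<subseteq> span_mod V X S"
  unfolding span_mod_def by auto

lemma span_mod_base: "x \<in> S \<Longrightarrow> x \<in> span_mod V X S"
  by (rule subsetD[OF span_mod_superset])

lemma span_mod_least: "submodule N V X \<Longrightarrow> S \<subseteq> N \<Longrightarrow> span_mod V X S \<subseteq> N"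
  unfolding span_mod_def by auto

lemma span_mod_mono: "S \<subseteq> S' \<Longrightarrow> span_mod V X S \<subseteq> span_mod V X S'"
  unfolding span_mod_def by auto

lemma span_mod_induct [consumes 3, case_names base zero add smult]:
  assumes X: "module V X" and S: "S \<subseteq> carrier X" and u: "u \<in> span_mod V X S"
    and base: "\<And>x. x \<in> S \<Longrightarrow> P x" and zero: "P \<zero>\<^bsub>X\<^esub>"
    and add: "\<And>x y. x \<in> carrier X \<Longrightarrow> y \<in> carrier X \<Longrightarrow> P x \<Longrightarrow> P y \<Longrightarrow> P (x \<oplus>\<^bsub>X\<^esub> y)"
    and smult: "\<And>v x. v \<in> carrier V \<Longrightarrow> x \<in> carrier X \<Longrightarrow> P x \<Longrightarrow> P (v \<odot>\<^bsub>X\<^esub> x)"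
  shows "P u"
proof -
  interpret X: module V X by fact
  have "submodule {x \<in> carrier X. P x} V X"
    unfolding submodule_iff[OF X] using zero add smult by auto
  from span_mod_least[OF this, of S] S base u show ?thesis by auto
qed

lemma sub_mod_simps [simp]:
  "carrier (sub_mod X N) = N" "\<zero>\<^bsub>sub_mod X N\<^esub> = \<zero>\<^bsub>X\<^esub>"
  "x \<oplus>\<^bsub>sub_mod X N\<^esub> y = x \<oplus>\<^bsub>X\<^esub> y" "v \<odot>\<^bsub>sub_mod X N\<^esub> x = v \<odot>\<^bsub>X\<^esub> x"
  by (auto simp: sub_mod_def)

lemma module_sub_mod: "module V X \<Longrightarrow> submodule N V X \<Longrightarrow> module V (sub_mod X N)"
  unfolding sub_mod_def by (rule submodule.submodule_is_module)

lemma sum_mod_simps [simp]: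
  "carrier (sum_mod X Y) = carrier X \<times> carrier Y" "\<zero>\<^bsub>sum_mod X Y\<^esub> = (\<zero>\<^bsub>X\<^esub>, \<zero>\<^bsub>Y\<^esub>)"
  "(x, y) \<oplus>\<^bsub>sum_mod X Y\<^esub> (x', y') = (x \<oplus>\<^bsub>X\<^esub> x', y \<oplus>\<^bsub>Y\<^esub> y')"
  "v \<odot>\<^bsub>sum_mod X Y\<^esub> (x, y) = (v \<odot>\<^bsub>X\<^esub> x, v \<odot>\<^bsub>Y\<^esub> y)"
  by (auto simp: sum_mod_def)

lemma module_sum_mod:
  assumes "module V X" "module V Y" shows "module V (sum_mod X Y)"
proof -
  interpret X: module V X by fact
  interpret Y: module V Y by fact
  show ?thesis
  proof (rule moduleI)
    show "cring V" by (rule X.R.is_cring)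
    show "abelian_group (sum_mod X Y)"
    proof (rule abelian_groupI)
      fix q assume "q \<in> carrier (sum_mod X Y)"
      then show "\<exists>p\<in>carrier (sum_mod X Y). p \<oplus>\<^bsub>sum_mod X Y\<^esub> q = \<zero>\<^bsub>sum_mod X Y\<^esub>"
        by (cases q, intro bexI[of _ "(\<ominus>\<^bsub>X\<^esub> fst q, \<ominus>\<^bsub>Y\<^esub> snd q)"]) (auto simp: X.M.l_neg Y.M.l_neg)
    qed (auto simp: X.M.a_ac Y.M.a_ac)
  qed (auto simp: X.smult_l_distr X.smult_r_distr X.smult_assoc1
      Y.smult_l_distr Y.smult_r_distr Y.smult_assoc1)
qed

lemma seq_mod_simps [simp]:
  "carrier (seq_mod T) = {x. \<forall>n. x n \<in> carrier (T n)}" "\<zero>\<^bsub>seq_mod T\<^esub> = (\<lambda>n. \<zero>\<^bsub>T n\<^esub>)"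
  "x \<oplus>\<^bsub>seq_mod T\<^esub> y = (\<lambda>n. x n \<oplus>\<^bsub>T n\<^esub> y n)" "v \<odot>\<^bsub>seq_mod T\<^esub> x = (\<lambda>n. v \<odot>\<^bsub>T n\<^esub> x n)"
  by (auto simp: seq_mod_def)

lemma module_seq_mod:
  assumes "\<And>n. module V (T n)" shows "module V (seq_mod T)"
proof -
  interpret T: module V "T n" for n by fact
  show ?thesis
  proof (rule moduleI)
    show "cring V" by (rule T.R.is_cring)
    show "abelian_group (seq_mod T)"
    proof (rule abelian_groupI)
      fix q assume "q \<in> carrier (seq_mod T)"
      then show "\<exists>p\<in>carrier (seq_mod T). p \<oplus>\<^bsub>seq_mod T\<^esub> q = \<zero>\<^bsub>seq_mod T\<^esub>"
        by (intro bexI[of _ "\<lambda>n. \<ominus>\<^bsub>T n\<^esub> q n"]) (auto simp: T.M.l_neg)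
    qed (auto simp: T.M.a_ac)
  qed (auto simp: T.smult_l_distr T.smult_r_distr T.smult_assoc1)
qed

lemma self_mod_simps [simp]:
  "carrier (self_mod V) = carrier V" "\<zero>\<^bsub>self_mod V\<^esub> = \<zero>\<^bsub>V\<^esub>"
  "x \<oplus>\<^bsub>self_mod V\<^esub> y = x \<oplus>\<^bsub>V\<^esub> y" "v \<odot>\<^bsub>self_mod V\<^esub> x = v \<otimes>\<^bsub>V\<^esub> x"
  by (auto simp: self_mod_def)

lemma module_self_mod:
  assumes "cring V" shows "module V (self_mod V)"
proof -
  interpret V: cring V by fact
  show ?thesis
  proof (rule moduleI)
    show "abelian_group (self_mod V)"
    proof (rule abelian_groupI)
      fix q assume "q \<in> carrier (self_mod V)"
      then show "\<exists>p\<in>carrier (self_mod V). p \<oplus>\<^bsub>self_mod V\<^esub> q = \<zero>\<^bsub>self_mod V\<^esub>"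
        by (intro bexI[of _ "\<ominus>\<^bsub>V\<^esub> q"]) (auto simp: V.l_neg)
    qed (auto simp: V.a_ac)
  qed (auto simp: V.l_distr V.r_distr V.m_assoc assms)
qed

subsection \<open>Linear maps\<close>

lemma mod_homI:
  assumes "\<And>x. x \<in> carrier X \<Longrightarrow> h x \<in> carrier Y"
    and "\<And>x y. x \<in> carrier X \<Longrightarrow> y \<in> carrier X \<Longrightarrow> h (x \<oplus>\<^bsub>X\<^esub> y) = h x \<oplus>\<^bsub>Y\<^esub> h y"
    and "\<And>v x. v \<in> carrier V \<Longrightarrow> x \<in> carrier X \<Longrightarrow> h (v \<odot>\<^bsub>X\<^esub> x) = v \<odot>\<^bsub>Y\<^esub> h x"
  shows "h \<in> mod_hom V X Y"
  using assms unfolding mod_hom_def by auto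

lemma mod_hom_closed: "h \<in> mod_hom V X Y \<Longrightarrow> x \<in> carrier X \<Longrightarrow> h x \<in> carrier Y"
  and mod_hom_add: "h \<in> mod_hom V X Y \<Longrightarrow> x \<in> carrier X \<Longrightarrow> y \<in> carrier X \<Longrightarrow>
    h (x \<oplus>\<^bsub>X\<^esub> y) = h x \<oplus>\<^bsub>Y\<^esub> h y"
  and mod_hom_smult: "h \<in> mod_hom V X Y \<Longrightarrow> v \<in> carrier V \<Longrightarrow> x \<in> carrier X \<Longrightarrow>
    h (v \<odot>\<^bsub>X\<^esub> x) = v \<odot>\<^bsub>Y\<^esub> h x"
  unfolding mod_hom_def by auto

lemma mod_hom_zero:
  assumes h: "h \<in> mod_hom V X Y" and X: "module V X" and Y: "module V Y"
  shows "h \<zero>\<^bsub>X\<^esub> = \<zero>\<^bsub>Y\<^esub>"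
proof -
  interpret X: module V X by fact
  interpret Y: module V Y by fact
  have "h (\<zero>\<^bsub>V\<^esub> \<odot>\<^bsub>X\<^esub> \<zero>\<^bsub>X\<^esub>) = \<zero>\<^bsub>V\<^esub> \<odot>\<^bsub>Y\<^esub> h \<zero>\<^bsub>X\<^esub>"
    by (rule mod_hom_smult[OF h]) auto
  then show ?thesis using mod_hom_closed[OF h, of "\<zero>\<^bsub>X\<^esub>"] by simp
qed

lemma mod_hom_minus:
  assumes h: "h \<in> mod_hom V X Y" and X: "module V X" and Y: "module V Y"
    and x: "x \<in> carrier X" "y \<in> carrier X"
  shows "h (x \<ominus>\<^bsub>X\<^esub> y) = h x \<ominus>\<^bsub>Y\<^esub> h y"
proof -
  interpret X: module V X by fact
  interpret Y: module V Y by fact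
  have "h (\<ominus>\<^bsub>X\<^esub> y) = \<ominus>\<^bsub>Y\<^esub> h y"
    using mod_hom_smult[OF h, of "\<ominus>\<^bsub>V\<^esub> \<one>\<^bsub>V\<^esub>" y] x mod_hom_closed[OF h, of y]
    by (simp add: X.smult_l_minus Y.smult_l_minus)
  then show ?thesis using x mod_hom_add[OF h, of x "\<ominus>\<^bsub>X\<^esub> y"] by (simp add: a_minus_def)
qed

lemma mod_hom_comp:
  "g \<in> mod_hom V X Y \<Longrightarrow> h \<in> mod_hom V Y Z \<Longrightarrow> (\<lambda>x. h (g x)) \<in> mod_hom V X Z"
  unfolding mod_hom_def by (auto simp: Pi_iff)

lemma submodule_preimage:
  assumes h: "h \<in> mod_hom V X Y" and X: "module V X" and Y: "module V Y" and N: "submodule N V Y"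
  shows "submodule {x \<in> carrier X. h x \<in> N} V X"
proof -
  interpret X: module V X by fact
  show ?thesis
    using N mod_hom_zero[OF h X Y] mod_hom_add[OF h] mod_hom_smult[OF h]
    unfolding submodule_iff[OF X] submodule_iff[OF Y] by auto
qed

lemma submodule_image:
  assumes h: "h \<in> mod_hom V X Y" and X: "module V X" and Y: "module V Y" and N: "submodule N V X"
  shows "submodule (h ` N) V Y"
proof -
  have N': "N \<subseteq> carrier X" "\<zero>\<^bsub>X\<^esub> \<in> N" "\<And>x y. x \<in> N \<Longrightarrow> y \<in> N \<Longrightarrow> x \<oplus>\<^bsub>X\<^esub> y \<in> N"
    "\<And>v x. v \<in> carrier V \<Longrightarrow> x \<in> N \<Longrightarrow> v \<odot>\<^bsub>X\<^esub> x \<in> N" using N unfolding submodule_iff[OF X] by auto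
  show ?thesis unfolding submodule_iff[OF Y]
  proof (intro conjI ballI)
    show "h ` N \<subseteq> carrier Y" using N' mod_hom_closed[OF h] by auto
    show "\<zero>\<^bsub>Y\<^esub> \<in> h ` N" using N' mod_hom_zero[OF h X Y] by (metis imageI)
  next
    fix x y assume "x \<in> h ` N" "y \<in> h ` N"
    then obtain a b where "a \<in> N" "b \<in> N" "x = h a" "y = h b" by auto
    then show "x \<oplus>\<^bsub>Y\<^esub> y \<in> h ` N"
      using N' mod_hom_add[OF h, of a b] by (metis imageI subsetD)
  next
    fix v x assume "v \<in> carrier V" "x \<in> h ` N"
    then obtain a where "a \<in> N" "x = h a" by auto
    then show "v \<odot>\<^bsub>Y\<^esub> x \<in> h ` N"
      using N' mod_hom_smult[OF h, of v a] \<open>v \<in> carrier V\<close> by (metis imageI subsetD)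
  qed
qed

lemma mod_hom_span:
  assumes h: "h \<in> mod_hom V X Y" and X: "module V X" and Y: "module V Y"
    and S: "S \<subseteq> carrier X" and N: "submodule N V Y" and SN: "\<And>x. x \<in> S \<Longrightarrow> h x \<in> N"
    and u: "u \<in> span_mod V X S"
  shows "h u \<in> N"
  using span_mod_least[OF submodule_preimage[OF h X Y N], of S] S SN u by auto

lemma mod_hom_eq_span:
  assumes h: "h \<in> mod_hom V X Y" "h' \<in> mod_hom V X Y" and X: "module V X" and Y: "module V Y"
    and S: "S \<subseteq> carrier X" and eq: "\<And>x. x \<in> S \<Longrightarrow> h x = h' x" and u: "u \<in> span_mod V X S"
  shows "h u = h' u"
  using X S u
proof (induct rule: span_mod_induct)
  case zero then show ?case using mod_hom_zero[OF _ X Y] h by metis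
qed (auto simp: eq mod_hom_add[OF h(1)] mod_hom_add[OF h(2)] mod_hom_smult[OF h(1)] mod_hom_smult[OF h(2)])

lemma hom_factor:
  assumes A: "module V A" and B: "module V B" and C: "module V C"
    and q: "q \<in> mod_hom V A B" and f: "f \<in> mod_hom V A C"
    and surj: "q ` carrier A = carrier B"
    and ker: "\<And>u. u \<in> carrier A \<Longrightarrow> q u = \<zero>\<^bsub>B\<^esub> \<Longrightarrow> f u = \<zero>\<^bsub>C\<^esub>"
  obtains k where "k \<in> mod_hom V B C" "\<And>u. u \<in> carrier A \<Longrightarrow> k (q u) = f u"
proof -
  interpret A: module V A by fact
  interpret B: module V B by fact
  interpret C: module V C by fact
  have eq: "f u = f w" if u: "u \<in> carrier A" "w \<in> carrier A" and e: "q u = q w" for u w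
  proof -
    have "q (u \<ominus>\<^bsub>A\<^esub> w) = \<zero>\<^bsub>B\<^esub>"
      using mod_hom_minus[OF q A B u] e mod_hom_closed[OF q] u by (simp add: B.M.r_neg a_minus_def)
    then have "f u \<ominus>\<^bsub>C\<^esub> f w = \<zero>\<^bsub>C\<^esub>" using ker[of "u \<ominus>\<^bsub>A\<^esub> w"] mod_hom_minus[OF f A C u] u by simp
    then show ?thesis by (metis C.M.minus_equality C.M.minus_minus C.M.add.inv_closed a_minus_def mod_hom_closed[OF f] u)
  qed
  define k where "k b = f (SOME u. u \<in> carrier A \<and> q u = b)" for b
  have k: "k (q u) = f u" if u: "u \<in> carrier A" for u
  proof -
    have "(SOME w. w \<in> carrier A \<and> q w = q u) \<in> carrier A \<and> q (SOME w. w \<in> carrier A \<and> q w = q u) = q u"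
      by (rule someI[of _ u]) (use u in auto)
    then show ?thesis unfolding k_def by (intro eq) (use u in auto)
  qed
  have "k \<in> mod_hom V B C"
  proof (rule mod_homI)
    fix b assume "b \<in> carrier B"
    then obtain u where "u \<in> carrier A" "b = q u" using surj by auto
    then show "k b \<in> carrier C" using k mod_hom_closed[OF f] by simp
  next
    fix b b' assume "b \<in> carrier B" "b' \<in> carrier B"
    then obtain u u' where u: "u \<in> carrier A" "b = q u" "u' \<in> carrier A" "b' = q u'" using surj by blast
    have "k (b \<oplus>\<^bsub>B\<^esub> b') = k (q (u \<oplus>\<^bsub>A\<^esub> u'))" using u mod_hom_add[OF q] by simp
    then show "k (b \<oplus>\<^bsub>B\<^esub> b') = k b \<oplus>\<^bsub>C\<^esub> k b'" using u k mod_hom_add[OF f] by simp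
  next
    fix v b assume v: "v \<in> carrier V" and "b \<in> carrier B"
    then obtain u where u: "u \<in> carrier A" "b = q u" using surj by auto
    have "k (v \<odot>\<^bsub>B\<^esub> b) = k (q (v \<odot>\<^bsub>A\<^esub> u))" using u v mod_hom_smult[OF q] by simp
    then show "k (v \<odot>\<^bsub>B\<^esub> b) = v \<odot>\<^bsub>C\<^esub> k b" using u v k mod_hom_smult[OF f] by simp
  qed
  then show ?thesis using that k by blast
qed

lemma hom_lift:
  assumes A: "module V A" and B: "module V B" and C: "module V C"
    and i: "i \<in> mod_hom V B C" and f: "f \<in> mod_hom V A C"
    and inj: "inj_on i (carrier B)" and im: "\<And>u. u \<in> carrier A \<Longrightarrow> f u \<in> i ` carrier B"
  obtains k where "k \<in> mod_hom V A B" "\<And>u. u \<in> carrier A \<Longrightarrow> i (k u) = f u"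
proof -
  interpret A: module V A by fact
  interpret B: module V B by fact
  have "\<exists>k. \<forall>u \<in> carrier A. k u \<in> carrier B \<and> i (k u) = f u"
    using im by (intro bchoice) fastforce
  then obtain k where k: "\<And>u. u \<in> carrier A \<Longrightarrow> k u \<in> carrier B" "\<And>u. u \<in> carrier A \<Longrightarrow> i (k u) = f u" by blast
  have "k \<in> mod_hom V A B"
  proof (rule mod_homI)
    fix u w assume u: "u \<in> carrier A" "w \<in> carrier A"
    show "k (u \<oplus>\<^bsub>A\<^esub> w) = k u \<oplus>\<^bsub>B\<^esub> k w"
      by (rule inj_onD[OF inj]) (use u k mod_hom_add[OF f] mod_hom_add[OF i] in auto)
  next
    fix v u assume u: "v \<in> carrier V" "u \<in> carrier A"
    show "k (v \<odot>\<^bsub>A\<^esub> u) = v \<odot>\<^bsub>B\<^esub> k u"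
      by (rule inj_onD[OF inj]) (use u k mod_hom_smult[OF f] mod_hom_smult[OF i] in auto)
  qed (rule k)
  then show ?thesis using that k by blast
qed

lemma hom_inj_on:
  assumes A: "module V A" and B: "module V B" and h: "h \<in> mod_hom V A B"
    and ker: "\<And>u. u \<in> carrier A \<Longrightarrow> h u = \<zero>\<^bsub>B\<^esub> \<Longrightarrow> u = \<zero>\<^bsub>A\<^esub>"
  shows "inj_on h (carrier A)"
proof (rule inj_onI)
  interpret A: module V A by fact
  interpret B: module V B by fact
  fix u w assume u: "u \<in> carrier A" "w \<in> carrier A" "h u = h w"
  have "h (u \<ominus>\<^bsub>A\<^esub> w) = \<zero>\<^bsub>B\<^esub>"
    using mod_hom_minus[OF h A B u(1,2)] u mod_hom_closed[OF h] by (simp add: B.M.r_neg a_minus_def)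
  then have "u \<ominus>\<^bsub>A\<^esub> w = \<zero>\<^bsub>A\<^esub>" using ker u by simp
  then show "u = w" by (metis A.M.minus_equality A.M.minus_minus A.M.add.inv_closed a_minus_def u(1,2))
qed

lemma (in module) minus_eq_zero_iff:
  "x \<in> carrier M \<Longrightarrow> y \<in> carrier M \<Longrightarrow> x \<ominus>\<^bsub>M\<^esub> y = \<zero>\<^bsub>M\<^esub> \<longleftrightarrow> x = y"
  by (metis M.minus_equality M.minus_minus M.add.inv_closed M.r_neg M.a_comm a_minus_def)

lemma (in module) smult_minus:
  "v \<in> carrier R \<Longrightarrow> x \<in> carrier M \<Longrightarrow> y \<in> carrier M \<Longrightarrow> v \<odot>\<^bsub>M\<^esub> (x \<ominus>\<^bsub>M\<^esub> y) = v \<odot>\<^bsub>M\<^esub> x \<ominus>\<^bsub>M\<^esub> v \<odot>\<^bsub>M\<^esub> y"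
  by (simp add: a_minus_def smult_r_distr smult_r_minus)

subsection \<open>Quotients\<close>

locale quotient = module V X for V :: "'v ring" and X :: "('v, 'x) module" +
  fixes N assumes N: "submodule N V X"
begin

lemma abelian_subgroup_N: "abelian_subgroup N X"
  using submodule.axioms(1)[OF N] by (intro abelian_subgroupI3 additive_subgroup.intro) (auto simp: M.abelian_group_axioms)

interpretation S: abelian_subgroup N X by (rule abelian_subgroup_N)

lemma coset_eq_iff:
  assumes "x \<in> carrier X" "y \<in> carrier X"
  shows "N +>\<^bsub>X\<^esub> x = N +>\<^bsub>X\<^esub> y \<longleftrightarrow> x \<ominus>\<^bsub>X\<^esub> y \<in> N"
proof -
  have "x \<in> N +>\<^bsub>X\<^esub> y \<longleftrightarrow> x \<oplus>\<^bsub>X\<^esub> \<ominus>\<^bsub>X\<^esub> y \<in> N"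
    by (rule S.a_rcos_module) (use assms in auto)
  moreover have "N +>\<^bsub>X\<^esub> x = N +>\<^bsub>X\<^esub> y \<longleftrightarrow> x \<in> N +>\<^bsub>X\<^esub> y"
    using S.a_repr_independence'[of x y] S.a_rcos_self[of x] assms by auto
  ultimately show ?thesis by (simp add: a_minus_def)
qed

lemma carrier_quot: "carrier (quot_mod X N) = (\<lambda>x. N +>\<^bsub>X\<^esub> x) ` carrier X"
  by (auto simp: quot_mod_def A_RCOSETS_def')

lemma coset_closed: "x \<in> carrier X \<Longrightarrow> N +>\<^bsub>X\<^esub> x \<in> carrier (quot_mod X N)"
  by (auto simp: carrier_quot)

lemma coset_add: "x \<in> carrier X \<Longrightarrow> y \<in> carrier X \<Longrightarrow>
    (N +>\<^bsub>X\<^esub> x) \<oplus>\<^bsub>quot_mod X N\<^esub> (N +>\<^bsub>X\<^esub> y) = N +>\<^bsub>X\<^esub> (x \<oplus>\<^bsub>X\<^esub> y)"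
  by (simp add: quot_mod_def S.a_rcos_sum)

lemma coset_smult:
  assumes "v \<in> carrier V" "x \<in> carrier X"
  shows "v \<odot>\<^bsub>quot_mod X N\<^esub> (N +>\<^bsub>X\<^esub> x) = N +>\<^bsub>X\<^esub> (v \<odot>\<^bsub>X\<^esub> x)"
proof -
  have "N +>\<^bsub>X\<^esub> (v \<odot>\<^bsub>X\<^esub> y) = N +>\<^bsub>X\<^esub> (v \<odot>\<^bsub>X\<^esub> x)" if y: "y \<in> N +>\<^bsub>X\<^esub> x" for y
  proof -
    have yc: "y \<in> carrier X" using y S.a_elemrcos_carrier assms by blast
    have "N +>\<^bsub>X\<^esub> y = N +>\<^bsub>X\<^esub> x" using S.a_repr_independence'[OF y assms(2)] by simp
    then have "y \<ominus>\<^bsub>X\<^esub> x \<in> N" using coset_eq_iff[OF yc assms(2)] by simp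
    then have "v \<odot>\<^bsub>X\<^esub> (y \<ominus>\<^bsub>X\<^esub> x) \<in> N" using N assms(1) unfolding submodule_iff[OF module_axioms] by auto
    then show ?thesis using coset_eq_iff[of "v \<odot>\<^bsub>X\<^esub> y" "v \<odot>\<^bsub>X\<^esub> x"] assms yc by (simp add: smult_minus)
  qed
  moreover have "N +>\<^bsub>X\<^esub> x \<noteq> {}" using S.a_rcos_self assms by auto
  ultimately show ?thesis by (auto simp: quot_mod_def)
qed

lemma coset_zero: "N +>\<^bsub>X\<^esub> \<zero>\<^bsub>X\<^esub> = \<zero>\<^bsub>quot_mod X N\<^esub>"
  using S.a_rcos_const[OF S.zero_closed] by (simp add: quot_mod_def)

lemma coset_eq_zero_iff: "x \<in> carrier X \<Longrightarrow> N +>\<^bsub>X\<^esub> x = \<zero>\<^bsub>quot_mod X N\<^esub> \<longleftrightarrow> x \<in> N"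
  using coset_eq_iff[of x "\<zero>\<^bsub>X\<^esub>"] M.minus_equality[of "\<zero>\<^bsub>X\<^esub>" "\<zero>\<^bsub>X\<^esub>"]
  by (simp add: coset_zero a_minus_def)

lemma module_quot: "module V (quot_mod X N)"
  by (rule module_by_surjection[OF module_axioms, of _ "\<lambda>x. N +>\<^bsub>X\<^esub> x"])
     (simp_all add: carrier_quot coset_add coset_smult coset_zero)

lemma coset_hom: "(\<lambda>x. N +>\<^bsub>X\<^esub> x) \<in> mod_hom V X (quot_mod X N)"
  by (rule mod_homI) (simp_all add: coset_closed coset_add coset_smult)

lemma quotient_universal:
  assumes h: "h \<in> mod_hom V X Z" and Z: "module V Z" and ker: "\<And>n. n \<in> N \<Longrightarrow> h n = \<zero>\<^bsub>Z\<^esub>"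
  obtains k where "k \<in> mod_hom V (quot_mod X N) Z" "\<And>x. x \<in> carrier X \<Longrightarrow> k (N +>\<^bsub>X\<^esub> x) = h x"
proof -
  interpret Z: module V Z by fact
  define k where "k C = h (SOME x. x \<in> carrier X \<and> C = N +>\<^bsub>X\<^esub> x)" for C
  have k: "k (N +>\<^bsub>X\<^esub> x) = h x" if x: "x \<in> carrier X" for x
  proof -
    define y where "y = (SOME y. y \<in> carrier X \<and> N +>\<^bsub>X\<^esub> x = N +>\<^bsub>X\<^esub> y)"
    have "y \<in> carrier X \<and> N +>\<^bsub>X\<^esub> x = N +>\<^bsub>X\<^esub> y" unfolding y_def by (rule someI[of _ x]) (use x in auto)
    then have y: "y \<in> carrier X" "x \<ominus>\<^bsub>X\<^esub> y \<in> N" using coset_eq_iff x by auto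
    then have "h x \<ominus>\<^bsub>Z\<^esub> h y = \<zero>\<^bsub>Z\<^esub>" using ker mod_hom_minus[OF h module_axioms Z x y(1)] by metis
    then have "h x = h y" using Z.minus_eq_zero_iff mod_hom_closed[OF h] x y by metis
    then show ?thesis by (simp add: k_def y_def)
  qed
  have "k \<in> mod_hom V (quot_mod X N) Z"
    by (rule mod_homI) (auto simp: carrier_quot k coset_add coset_smult mod_hom_closed[OF h]
        mod_hom_add[OF h] mod_hom_smult[OF h])
  then show ?thesis using k that by blast
qed

end

lemma quotientI: "module V X \<Longrightarrow> submodule N V X \<Longrightarrow> quotient V X N"
  by (simp add: quotient_def quotient_axioms_def)

subsection \<open>Free modules and tensor products\<close>

lemma free_mod_simps [simp]:
  "\<zero>\<^bsub>free_mod V B\<^esub> = (\<lambda>_. \<zero>\<^bsub>V\<^esub>)" "f \<oplus>\<^bsub>free_mod V B\<^esub> g = (\<lambda>b. f b \<oplus>\<^bsub>V\<^esub> g b)"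
  "v \<odot>\<^bsub>free_mod V B\<^esub> f = (\<lambda>b. v \<otimes>\<^bsub>V\<^esub> f b)"
  by (auto simp: free_mod_def)

lemma free_mod_carrier: "f \<in> carrier (free_mod V B) \<longleftrightarrow>
  (\<forall>b. f b \<in> carrier V) \<and> (\<forall>b. b \<notin> B \<longrightarrow> f b = \<zero>\<^bsub>V\<^esub>) \<and> finite {b. f b \<noteq> \<zero>\<^bsub>V\<^esub>}"
  by (simp add: free_mod_def)

lemma module_free_mod:
  assumes "cring V" shows "module V (free_mod V B)"
proof -
  interpret V: cring V by fact
  have fin: "finite {b. f b \<oplus>\<^bsub>V\<^esub> g b \<noteq> \<zero>\<^bsub>V\<^esub>}" if "finite {b. f b \<noteq> \<zero>\<^bsub>V\<^esub>}" "finite {b. g b \<noteq> \<zero>\<^bsub>V\<^esub>}" for f g :: "_ \<Rightarrow> 'a"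
    by (rule finite_subset[OF _ finite_UnI[OF that]]) auto
  have fin': "finite {b. v \<otimes>\<^bsub>V\<^esub> f b \<noteq> \<zero>\<^bsub>V\<^esub>}" if "finite {b. f b \<noteq> \<zero>\<^bsub>V\<^esub>}" "v \<in> carrier V" for f :: "_ \<Rightarrow> 'a" and v
    by (rule finite_subset[OF _ that(1)]) (use that(2) in auto)
  show ?thesis
  proof (rule moduleI)
    show "abelian_group (free_mod V B)"
    proof (rule abelian_groupI)
      fix q assume "q \<in> carrier (free_mod V B)"
      moreover then have "finite {b. \<ominus>\<^bsub>V\<^esub> q b \<noteq> \<zero>\<^bsub>V\<^esub>}"
        by (auto simp: free_mod_carrier elim!: finite_subset[rotated])
      ultimately show "\<exists>p\<in>carrier (free_mod V B). p \<oplus>\<^bsub>free_mod V B\<^esub> q = \<zero>\<^bsub>free_mod V B\<^esub>"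
        by (intro bexI[of _ "\<lambda>n. \<ominus>\<^bsub>V\<^esub> q n"]) (auto simp: V.l_neg free_mod_carrier)
    qed (auto simp: V.a_ac fin free_mod_carrier)
  qed (auto simp: V.l_distr V.r_distr V.m_assoc assms free_mod_carrier fin')
qed

lemma free_gen_closed: "cring V \<Longrightarrow> b \<in> B \<Longrightarrow> free_gen V b \<in> carrier (free_mod V B)"
  by (auto simp: free_gen_def free_mod_carrier cring.cring_simprules(6) cring.cring_simprules(2))

lemma free_mod_span:
  assumes V: "cring V" and f: "f \<in> carrier (free_mod V B)"
  shows "f \<in> span_mod V (free_mod V B) (free_gen V ` B)"
proof -
  interpret V: cring V by fact
  note F = module_free_mod[OF V, of B]
  interpret F: module V "free_mod V B" by (rule F)
  have S: "free_gen V ` B \<subseteq> carrier (free_mod V B)" using free_gen_closed[OF V] by auto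
  note sp = span_mod_submodule[OF F S, unfolded submodule_iff[OF F]]
  have "\<forall>f \<in> carrier (free_mod V B). {b. f b \<noteq> \<zero>\<^bsub>V\<^esub>} \<subseteq> A \<longrightarrow> f \<in> span_mod V (free_mod V B) (free_gen V ` B)"
    if "finite A" "A \<subseteq> B" for A
    using that
  proof (induct A)
    case empty
    have "\<zero>\<^bsub>free_mod V B\<^esub> \<in> span_mod V (free_mod V B) (free_gen V ` B)" using sp by blast
    moreover have "f = \<zero>\<^bsub>free_mod V B\<^esub>" if "{b. f b \<noteq> \<zero>\<^bsub>V\<^esub>} \<subseteq> {}" for f :: "'b \<Rightarrow> 'a" using that by auto
    ultimately show ?case by metis
  next
    case (insert a A)
    show ?case
    proof (intro ballI impI)
      fix f assume f: "f \<in> carrier (free_mod V B)" and supp: "{b. f b \<noteq> \<zero>\<^bsub>V\<^esub>} \<subseteq> insert a A"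
      define g where "g = f(a := \<zero>\<^bsub>V\<^esub>)"
      have "finite {b. g b \<noteq> \<zero>\<^bsub>V\<^esub>}" using f by (auto simp: free_mod_carrier g_def elim!: finite_subset[rotated])
      then have "g \<in> carrier (free_mod V B)" "{b. g b \<noteq> \<zero>\<^bsub>V\<^esub>} \<subseteq> A" using f supp insert(2)
        by (auto simp: free_mod_carrier g_def)
      then have "g \<in> span_mod V (free_mod V B) (free_gen V ` B)" using insert by auto
      moreover have "f a \<odot>\<^bsub>free_mod V B\<^esub> free_gen V a \<in> span_mod V (free_mod V B) (free_gen V ` B)"
        using sp f insert(4) span_mod_superset[of "free_gen V ` B" V "free_mod V B"] by (auto simp: free_mod_carrier)
      moreover have "f = g \<oplus>\<^bsub>free_mod V B\<^esub> f a \<odot>\<^bsub>free_mod V B\<^esub> free_gen V a"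
        using f by (auto simp: free_mod_carrier g_def free_gen_def)
      ultimately show "f \<in> span_mod V (free_mod V B) (free_gen V ` B)" using sp by metis
    qed
  qed
  moreover have "finite {b. f b \<noteq> \<zero>\<^bsub>V\<^esub>}" "{b. f b \<noteq> \<zero>\<^bsub>V\<^esub>} \<subseteq> B"
    using f unfolding free_mod_carrier by auto
  ultimately show ?thesis using f by blast
qed

lemma free_mod_universal:
  assumes V: "cring V" and Z: "module V Z" and g: "\<And>b. b \<in> B \<Longrightarrow> g b \<in> carrier Z"
  obtains h where "h \<in> mod_hom V (free_mod V B) Z" "\<And>b. b \<in> B \<Longrightarrow> h (free_gen V b) = g b"
proof -
  interpret V: cring V by fact
  interpret Z: module V Z by fact
  define h where "h f = (\<Oplus>\<^bsub>Z\<^esub>b\<in>{b. f b \<noteq> \<zero>\<^bsub>V\<^esub>}. f b \<odot>\<^bsub>Z\<^esub> g b)" for f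
  have h: "h f = (\<Oplus>\<^bsub>Z\<^esub>b\<in>A. f b \<odot>\<^bsub>Z\<^esub> g b)"
    if "f \<in> carrier (free_mod V B)" "finite A" "A \<subseteq> B" "{b. f b \<noteq> \<zero>\<^bsub>V\<^esub>} \<subseteq> A" for f A
    unfolding h_def
    by (rule Z.M.add.finprod_mono_neutral_cong_left) (use that g in \<open>auto simp: free_mod_carrier subset_eq\<close>)
  note F = module_free_mod[OF V, of B]
  interpret F: module V "free_mod V B" by (rule F)
  have supp: "finite {b. f b \<noteq> \<zero>\<^bsub>V\<^esub>}" "{b. f b \<noteq> \<zero>\<^bsub>V\<^esub>} \<subseteq> B" if "f \<in> carrier (free_mod V B)" for f
    using that by (auto simp: free_mod_carrier)
  have fc: "f b \<in> carrier V" if "f \<in> carrier (free_mod V B)" for f b using that by (auto simp: free_mod_carrier)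
  have "h \<in> mod_hom V (free_mod V B) Z"
  proof (rule mod_homI)
    fix f assume f: "f \<in> carrier (free_mod V B)"
    show "h f \<in> carrier Z" unfolding h_def using f g supp(2)[OF f] by (intro Z.M.finsum_closed) (auto simp: fc[OF f] subset_eq)
  next
    fix f f' assume f: "f \<in> carrier (free_mod V B)" "f' \<in> carrier (free_mod V B)"
    let ?A = "{b. f b \<noteq> \<zero>\<^bsub>V\<^esub>} \<union> {b. f' b \<noteq> \<zero>\<^bsub>V\<^esub>}"
    have A: "finite ?A" "?A \<subseteq> B" using supp f by blast+
    have "h (f \<oplus>\<^bsub>free_mod V B\<^esub> f') = (\<Oplus>\<^bsub>Z\<^esub>b\<in>?A. (f \<oplus>\<^bsub>free_mod V B\<^esub> f') b \<odot>\<^bsub>Z\<^esub> g b)"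
      by (rule h[OF F.M.a_closed[OF f] A]) auto
    also have "\<dots> = (\<Oplus>\<^bsub>Z\<^esub>b\<in>?A. f b \<odot>\<^bsub>Z\<^esub> g b \<oplus>\<^bsub>Z\<^esub> f' b \<odot>\<^bsub>Z\<^esub> g b)"
      by (rule Z.M.finsum_cong') (use A g f in \<open>auto simp: fc Z.smult_l_distr subset_eq\<close>)
    also have "\<dots> = (\<Oplus>\<^bsub>Z\<^esub>b\<in>?A. f b \<odot>\<^bsub>Z\<^esub> g b) \<oplus>\<^bsub>Z\<^esub> (\<Oplus>\<^bsub>Z\<^esub>b\<in>?A. f' b \<odot>\<^bsub>Z\<^esub> g b)"
      by (rule Z.M.finsum_addf) (use A g f in \<open>auto simp: fc subset_eq\<close>)
    also have "(\<Oplus>\<^bsub>Z\<^esub>b\<in>?A. f b \<odot>\<^bsub>Z\<^esub> g b) = h f" by (rule h[OF _ A, symmetric]) (use f in auto)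
    also have "(\<Oplus>\<^bsub>Z\<^esub>b\<in>?A. f' b \<odot>\<^bsub>Z\<^esub> g b) = h f'" by (rule h[OF _ A, symmetric]) (use f in auto)
    finally show "h (f \<oplus>\<^bsub>free_mod V B\<^esub> f') = h f \<oplus>\<^bsub>Z\<^esub> h f'" .
  next
    fix v f assume v: "v \<in> carrier V" and f: "f \<in> carrier (free_mod V B)"
    let ?A = "{b. f b \<noteq> \<zero>\<^bsub>V\<^esub>}"
    have A: "finite ?A" "?A \<subseteq> B" using supp f by blast+
    have "h (v \<odot>\<^bsub>free_mod V B\<^esub> f) = (\<Oplus>\<^bsub>Z\<^esub>b\<in>?A. (v \<odot>\<^bsub>free_mod V B\<^esub> f) b \<odot>\<^bsub>Z\<^esub> g b)"
      by (rule h[OF F.smult_closed[OF v f] A]) (use v in auto)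
    also have "\<dots> = (\<Oplus>\<^bsub>Z\<^esub>b\<in>?A. v \<odot>\<^bsub>Z\<^esub> (f b \<odot>\<^bsub>Z\<^esub> g b))"
      by (rule Z.M.finsum_cong') (use A g f v in \<open>auto simp: fc Z.smult_assoc1 subset_eq\<close>)
    also have "\<dots> = v \<odot>\<^bsub>Z\<^esub> h f" unfolding h_def
      by (rule Z.finsum_smult_ldistr[symmetric]) (use A g f v in \<open>auto simp: fc subset_eq\<close>)
    finally show "h (v \<odot>\<^bsub>free_mod V B\<^esub> f) = v \<odot>\<^bsub>Z\<^esub> h f" .
  qed
  moreover have "h (free_gen V b) = g b" if b: "b \<in> B" for b
  proof -
    have "h (free_gen V b) = (\<Oplus>\<^bsub>Z\<^esub>c\<in>{b}. free_gen V b c \<odot>\<^bsub>Z\<^esub> g c)"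
      by (rule h) (use b free_gen_closed[OF V b] in \<open>auto simp: free_gen_def\<close>)
    also have "\<dots> = g b" using b g by (simp add: Z.M.finsum_insert free_gen_def)
    finally show ?thesis .
  qed
  ultimately show ?thesis using that by blast
qed

definition bilin :: "'v ring \<Rightarrow> ('v, 'x) module \<Rightarrow> ('v, 'y) module \<Rightarrow> ('v, 'z) module \<Rightarrow> ('x \<Rightarrow> 'y \<Rightarrow> 'z) \<Rightarrow> bool" where
  "bilin V X Y Z b \<longleftrightarrow> (\<forall>x\<in>carrier X. b x \<in> mod_hom V Y Z) \<and> (\<forall>y\<in>carrier Y. (\<lambda>x. b x y) \<in> mod_hom V X Z)"

lemma bilinD:
  assumes "bilin V X Y Z b"
  shows "x \<in> carrier X \<Longrightarrow> y \<in> carrier Y \<Longrightarrow> b x y \<in> carrier Z"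
    and "x \<in> carrier X \<Longrightarrow> x' \<in> carrier X \<Longrightarrow> y \<in> carrier Y \<Longrightarrow> b (x \<oplus>\<^bsub>X\<^esub> x') y = b x y \<oplus>\<^bsub>Z\<^esub> b x' y"
    and "x \<in> carrier X \<Longrightarrow> y \<in> carrier Y \<Longrightarrow> y' \<in> carrier Y \<Longrightarrow> b x (y \<oplus>\<^bsub>Y\<^esub> y') = b x y \<oplus>\<^bsub>Z\<^esub> b x y'"
    and "v \<in> carrier V \<Longrightarrow> x \<in> carrier X \<Longrightarrow> y \<in> carrier Y \<Longrightarrow> b (v \<odot>\<^bsub>X\<^esub> x) y = v \<odot>\<^bsub>Z\<^esub> b x y"
    and "v \<in> carrier V \<Longrightarrow> x \<in> carrier X \<Longrightarrow> y \<in> carrier Y \<Longrightarrow> b x (v \<odot>\<^bsub>Y\<^esub> y) = v \<odot>\<^bsub>Z\<^esub> b x y"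
  using assms unfolding bilin_def mod_hom_def by auto

lemma bilinI:
  assumes "\<And>x y. x \<in> carrier X \<Longrightarrow> y \<in> carrier Y \<Longrightarrow> b x y \<in> carrier Z"
    and "\<And>x x' y. x \<in> carrier X \<Longrightarrow> x' \<in> carrier X \<Longrightarrow> y \<in> carrier Y \<Longrightarrow> b (x \<oplus>\<^bsub>X\<^esub> x') y = b x y \<oplus>\<^bsub>Z\<^esub> b x' y"
    and "\<And>x y y'. x \<in> carrier X \<Longrightarrow> y \<in> carrier Y \<Longrightarrow> y' \<in> carrier Y \<Longrightarrow> b x (y \<oplus>\<^bsub>Y\<^esub> y') = b x y \<oplus>\<^bsub>Z\<^esub> b x y'"
    and "\<And>v x y. v \<in> carrier V \<Longrightarrow> x \<in> carrier X \<Longrightarrow> y \<in> carrier Y \<Longrightarrow> b (v \<odot>\<^bsub>X\<^esub> x) y = v \<odot>\<^bsub>Z\<^esub> b x y"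
    and "\<And>v x y. v \<in> carrier V \<Longrightarrow> x \<in> carrier X \<Longrightarrow> y \<in> carrier Y \<Longrightarrow> b x (v \<odot>\<^bsub>Y\<^esub> y) = v \<odot>\<^bsub>Z\<^esub> b x y"
  shows "bilin V X Y Z b"
  using assms unfolding bilin_def mod_hom_def by auto

lemma bilin_comp:
  assumes "bilin V X Y Z b" "f \<in> mod_hom V X' X" "g \<in> mod_hom V Y' Y" "h \<in> mod_hom V Z Z'"
  shows "bilin V X' Y' Z' (\<lambda>x y. h (b (f x) (g y)))"
  using assms unfolding bilin_def mod_hom_def by (auto simp: Pi_iff)

locale tensor_product = X: module V X + Y: module V Y
  for V :: "'v ring" and X :: "('v, 'x) module" and Y :: "('v, 'y) module"
begin

abbreviation "TF \<equiv> free_mod V (carrier X \<times> carrier Y)"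
abbreviation pt (infix \<open>\<otimes>\<^sub>t\<close> 70) where "x \<otimes>\<^sub>t y \<equiv> pure_tens V X Y x y"

lemma V_cring: "cring V" by (rule X.R.is_cring)

sublocale F: module V TF by (rule module_free_mod[OF V_cring])

lemma gen_closed: "x \<in> carrier X \<Longrightarrow> y \<in> carrier Y \<Longrightarrow> free_gen V (x, y) \<in> carrier TF"
  by (rule free_gen_closed[OF V_cring]) auto

lemma tens_rels_closed: "tens_rels V X Y \<subseteq> carrier TF"
  unfolding tens_rels_def Let_def
  by (intro Un_least) (auto simp del: free_mod_simps intro!: F.M.minus_closed F.M.a_closed F.smult_closed gen_closed)

lemma tens_ker_submodule: "submodule (tens_ker V X Y) V TF"
  unfolding tens_ker_def by (rule span_mod_submodule[OF F.module_axioms tens_rels_closed])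

sublocale Q: quotient V TF "tens_ker V X Y"
  by (rule quotientI[OF F.module_axioms tens_ker_submodule])

lemma module_tens: "module V (tens V X Y)"
  unfolding tens_def by (rule Q.module_quot)

lemma pt_closed: "x \<in> carrier X \<Longrightarrow> y \<in> carrier Y \<Longrightarrow> x \<otimes>\<^sub>t y \<in> carrier (tens V X Y)"
  unfolding tens_def pure_tens_def by (rule Q.coset_closed[OF gen_closed])

lemma pt_bilin: "bilin V X Y (tens V X Y) (pure_tens V X Y)"
proof -
  have eqI: "tens_ker V X Y +>\<^bsub>TF\<^esub> a = tens_ker V X Y +>\<^bsub>TF\<^esub> b"
    if "a \<ominus>\<^bsub>TF\<^esub> b \<in> tens_rels V X Y" "a \<in> carrier TF" "b \<in> carrier TF" for a b
    unfolding Q.coset_eq_iff[OF that(2,3)] using that(1) unfolding tens_ker_def by (rule span_mod_base)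
  show ?thesis
  proof (rule bilinI)
    fix x x' y assume c: "x \<in> carrier X" "x' \<in> carrier X" "y \<in> carrier Y"
    show "(x \<oplus>\<^bsub>X\<^esub> x') \<otimes>\<^sub>t y = x \<otimes>\<^sub>t y \<oplus>\<^bsub>tens V X Y\<^esub> x' \<otimes>\<^sub>t y"
      unfolding tens_def pure_tens_def Q.coset_add[OF gen_closed[OF c(1,3)] gen_closed[OF c(2,3)]]
    proof (rule eqI)
      show "free_gen V (x \<oplus>\<^bsub>X\<^esub> x', y) \<ominus>\<^bsub>TF\<^esub> (free_gen V (x, y) \<oplus>\<^bsub>TF\<^esub> free_gen V (x', y)) \<in> tens_rels V X Y"
        unfolding tens_rels_def Let_def using c by blast
    qed (use c in \<open>auto simp del: free_mod_simps intro!: gen_closed\<close>)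
  next
    fix x y y' assume c: "x \<in> carrier X" "y \<in> carrier Y" "y' \<in> carrier Y"
    show "x \<otimes>\<^sub>t (y \<oplus>\<^bsub>Y\<^esub> y') = x \<otimes>\<^sub>t y \<oplus>\<^bsub>tens V X Y\<^esub> x \<otimes>\<^sub>t y'"
      unfolding tens_def pure_tens_def Q.coset_add[OF gen_closed[OF c(1,2)] gen_closed[OF c(1,3)]]
    proof (rule eqI)
      show "free_gen V (x, y \<oplus>\<^bsub>Y\<^esub> y') \<ominus>\<^bsub>TF\<^esub> (free_gen V (x, y) \<oplus>\<^bsub>TF\<^esub> free_gen V (x, y')) \<in> tens_rels V X Y"
        unfolding tens_rels_def Let_def using c by blast
    qed (use c in \<open>auto simp del: free_mod_simps intro!: gen_closed\<close>)
  next
    fix v x y assume c: "v \<in> carrier V" "x \<in> carrier X" "y \<in> carrier Y"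
    show "(v \<odot>\<^bsub>X\<^esub> x) \<otimes>\<^sub>t y = v \<odot>\<^bsub>tens V X Y\<^esub> (x \<otimes>\<^sub>t y)"
      unfolding tens_def pure_tens_def Q.coset_smult[OF c(1) gen_closed[OF c(2,3)]]
    proof (rule eqI)
      show "free_gen V (v \<odot>\<^bsub>X\<^esub> x, y) \<ominus>\<^bsub>TF\<^esub> (v \<odot>\<^bsub>TF\<^esub> free_gen V (x, y)) \<in> tens_rels V X Y"
        unfolding tens_rels_def Let_def using c by blast
    qed (use c in \<open>auto simp del: free_mod_simps intro!: gen_closed\<close>)
    show "x \<otimes>\<^sub>t (v \<odot>\<^bsub>Y\<^esub> y) = v \<odot>\<^bsub>tens V X Y\<^esub> (x \<otimes>\<^sub>t y)"
      unfolding tens_def pure_tens_def Q.coset_smult[OF c(1) gen_closed[OF c(2,3)]]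
    proof (rule eqI)
      show "free_gen V (x, v \<odot>\<^bsub>Y\<^esub> y) \<ominus>\<^bsub>TF\<^esub> (v \<odot>\<^bsub>TF\<^esub> free_gen V (x, y)) \<in> tens_rels V X Y"
        unfolding tens_rels_def Let_def using c by blast
    qed (use c in \<open>auto simp del: free_mod_simps intro!: gen_closed\<close>)
  qed (rule pt_closed)
qed

lemma tens_span:
  assumes t: "t \<in> carrier (tens V X Y)"
  shows "t \<in> span_mod V (tens V X Y) {x \<otimes>\<^sub>t y | x y. x \<in> carrier X \<and> y \<in> carrier Y}"
proof -
  obtain f where f: "f \<in> carrier TF" "t = tens_ker V X Y +>\<^bsub>TF\<^esub> f"
    using t unfolding tens_def Q.carrier_quot by auto
  show ?thesis unfolding f(2)
  proof (rule mod_hom_span[OF Q.coset_hom[folded tens_def] F.module_axioms module_tens])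
    show "f \<in> span_mod V TF (free_gen V ` (carrier X \<times> carrier Y))" by (rule free_mod_span[OF V_cring f(1)])
    show "submodule (span_mod V (tens V X Y) {x \<otimes>\<^sub>t y |x y. x \<in> carrier X \<and> y \<in> carrier Y}) V (tens V X Y)"
      by (rule span_mod_submodule[OF module_tens]) (auto intro: pt_closed)
  qed (auto intro!: gen_closed span_mod_base simp: pure_tens_def)
qed

lemma tens_universal:
  assumes b: "bilin V X Y Z b" and Z: "module V Z"
  obtains h where "h \<in> mod_hom V (tens V X Y) Z"
    "\<And>x y. x \<in> carrier X \<Longrightarrow> y \<in> carrier Y \<Longrightarrow> h (x \<otimes>\<^sub>t y) = b x y"
proof -
  interpret Z: module V Z by fact
  obtain h where h: "h \<in> mod_hom V TF Z" "\<And>p. p \<in> carrier X \<times> carrier Y \<Longrightarrow> h (free_gen V p) = (case p of (x, y) \<Rightarrow> b x y)"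
    by (rule free_mod_universal[OF V_cring Z, of "carrier X \<times> carrier Y" "\<lambda>(x, y). b x y"])
       (auto intro: bilinD(1)[OF b])
  note hm = mod_hom_minus[OF h(1) F.module_axioms Z]
  have h2: "h (free_gen V (x, y)) = b x y" if "x \<in> carrier X" "y \<in> carrier Y" for x y using h(2) that by auto
  have ker: "h r = \<zero>\<^bsub>Z\<^esub>" if "r \<in> tens_rels V X Y" for r
  proof -
    note simps = hm mod_hom_add[OF h(1)] mod_hom_smult[OF h(1)] h2 bilinD[OF b] Z.minus_eq_zero_iff
      gen_closed F.M.a_closed F.smult_closed
    from that show ?thesis unfolding tens_rels_def Let_def
      by (elim UnE CollectE exE conjE) (simp_all del: free_mod_simps add: simps)
  qed
  have "h n = \<zero>\<^bsub>Z\<^esub>" if "n \<in> tens_ker V X Y" for n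
    using mod_hom_span[OF h(1) F.module_axioms Z tens_rels_closed submodule_zero[OF Z]] ker that
    unfolding tens_ker_def by auto
  then obtain k where "k \<in> mod_hom V (quot_mod TF (tens_ker V X Y)) Z" "\<And>x. x \<in> carrier TF \<Longrightarrow> k (tens_ker V X Y +>\<^bsub>TF\<^esub> x) = h x"
    using Q.quotient_universal[OF h(1) Z] by blast
  then show ?thesis using that[of k] gen_closed h2 unfolding tens_def pure_tens_def by auto
qed

end

lemma tensor_productI: "module V X \<Longrightarrow> module V Y \<Longrightarrow> tensor_product V X Y"
  by (simp add: tensor_product_def)

section \<open>The core of a module\<close>

context almost_setup
begin

lemma mm_carrier: "e \<in> \<mm> \<Longrightarrow> e \<in> carrier V"
  using ideal.Icarr[OF ideal_mm] .

lemma mm_mult: "v \<in> carrier V \<Longrightarrow> e \<in> \<mm> \<Longrightarrow> v \<otimes> e \<in> \<mm>"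
  using ideal.I_l_closed[OF ideal_mm] .

lemma mm_induct [consumes 1, case_names mult add]:
  assumes e: "e \<in> \<mm>"
    and mult: "\<And>a b. a \<in> \<mm> \<Longrightarrow> b \<in> \<mm> \<Longrightarrow> P (a \<otimes> b)"
    and add: "\<And>a b. a \<in> \<mm> \<Longrightarrow> b \<in> \<mm> \<Longrightarrow> P a \<Longrightarrow> P b \<Longrightarrow> P (a \<oplus> b)"
  shows "P e"
proof -
  have "e \<in> ideal_prod V \<mm> \<mm>" using e idempotent_mm by simp
  then show ?thesis
  proof (induct rule: ideal_prod.induct)
    case (sum a b)
    then show ?case using add idempotent_mm by blast
  qed (rule mult)
qed

text \<open>As \<open>\<mm>\<close> is spanned by products of two of its elements, a scalar from \<open>\<mm>\<close> may always be split off.\<close>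

lemma mm_double:
  assumes X: "module V X" and N: "submodule N V X" and x: "x \<in> carrier X" and e: "e \<in> \<mm>"
    and d: "\<And>a b. a \<in> \<mm> \<Longrightarrow> b \<in> \<mm> \<Longrightarrow> a \<odot>\<^bsub>X\<^esub> (b \<odot>\<^bsub>X\<^esub> x) \<in> N"
  shows "e \<odot>\<^bsub>X\<^esub> x \<in> N"
  using e
proof (induct rule: mm_induct)
  case (mult a b)
  then show ?case using d x module.smult_assoc1[OF X] mm_carrier by metis
next
  case (add a b)
  then show ?case using submoduleD(3)[OF X N add(3,4)] x
    by (simp add: module.smult_l_distr[OF X] mm_carrier)
qed

lemma mm_cancel:
  assumes X: "module V X" and x: "x \<in> carrier X" "y \<in> carrier X" and e: "e \<in> \<mm>"
    and d: "\<And>a b. a \<in> \<mm> \<Longrightarrow> b \<in> \<mm> \<Longrightarrow> a \<odot>\<^bsub>X\<^esub> (b \<odot>\<^bsub>X\<^esub> x) = a \<odot>\<^bsub>X\<^esub> (b \<odot>\<^bsub>X\<^esub> y)"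
  shows "e \<odot>\<^bsub>X\<^esub> x = e \<odot>\<^bsub>X\<^esub> y"
proof -
  interpret X: module V X by fact
  have "e \<odot>\<^bsub>X\<^esub> (x \<ominus>\<^bsub>X\<^esub> y) \<in> {\<zero>\<^bsub>X\<^esub>}"
    by (rule mm_double[OF X submodule_zero[OF X] _ e])
       (use x d in \<open>auto simp: X.smult_minus mm_carrier X.minus_eq_zero_iff\<close>)
  then show ?thesis using x e by (simp add: X.smult_minus mm_carrier X.minus_eq_zero_iff)
qed

lemma mpart_gens: "module V X \<Longrightarrow> {e \<odot>\<^bsub>X\<^esub> x |e x. e \<in> \<mm> \<and> x \<in> carrier X} \<subseteq> carrier X"
  using module.smult_closed mm_carrier by fastforce

lemma mpart_submodule: "module V X \<Longrightarrow> submodule (mpart X) V X"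
  unfolding mpart_def by (rule span_mod_submodule[OF _ mpart_gens])

lemma mpart_carrier: "module V X \<Longrightarrow> x \<in> mpart X \<Longrightarrow> x \<in> carrier X"
  by (rule submoduleD(1)[OF _ mpart_submodule])

lemma mpart_add: "module V X \<Longrightarrow> x \<in> mpart X \<Longrightarrow> y \<in> mpart X \<Longrightarrow> x \<oplus>\<^bsub>X\<^esub> y \<in> mpart X"
  and mpart_zero: "module V X \<Longrightarrow> \<zero>\<^bsub>X\<^esub> \<in> mpart X"
  and mpart_smult: "module V X \<Longrightarrow> v \<in> carrier V \<Longrightarrow> x \<in> mpart X \<Longrightarrow> v \<odot>\<^bsub>X\<^esub> x \<in> mpart X"
  by (rule submoduleD(3)[OF _ mpart_submodule] submoduleD(2)[OF _ mpart_submodule]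
      submoduleD(4)[OF _ mpart_submodule]; assumption)+

lemma mpart_base: "e \<in> \<mm> \<Longrightarrow> x \<in> carrier X \<Longrightarrow> e \<odot>\<^bsub>X\<^esub> x \<in> mpart X"
  unfolding mpart_def by (rule span_mod_base) blast

text \<open>As \<open>\<mm>\<close> is idempotent, \<open>\<mm>X = \<mm>(\<mm>X)\<close>: in the products \<open>e x\<close> that span \<open>\<mm>X\<close> the factor \<open>x\<close> may again be
  taken in \<open>\<mm>X\<close>.\<close>

lemma mpart_induct [consumes 2, case_names smult add]:
  assumes X: "module V X" and x: "x \<in> mpart X"
    and smult: "\<And>e x. e \<in> \<mm> \<Longrightarrow> x \<in> mpart X \<Longrightarrow> P (e \<odot>\<^bsub>X\<^esub> x)"
    and add: "\<And>x y. x \<in> mpart X \<Longrightarrow> y \<in> mpart X \<Longrightarrow> P x \<Longrightarrow> P y \<Longrightarrow> P (x \<oplus>\<^bsub>X\<^esub> y)"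
  shows "P x"
proof -
  interpret X: module V X by fact
  have *: "P (e \<odot>\<^bsub>X\<^esub> x)" if "e \<in> \<mm>" "x \<in> carrier X" for e x
    using that(1)
  proof (induct rule: mm_induct)
    case (mult a b)
    then show ?case using smult[of a "b \<odot>\<^bsub>X\<^esub> x"] that mpart_base[of b x X] by (simp add: X.smult_assoc1 mm_carrier)
  next
    case (add a b)
    then show ?case
      using assms(4)[OF mpart_base[OF add(1) that(2)] mpart_base[OF add(2) that(2)]] that
      by (simp add: X.smult_l_distr mm_carrier)
  qed
  have ze: "\<zero> \<in> \<mm>" using additive_subgroup.zero_closed[OF ideal.axioms(1)[OF ideal_mm]] .
  have "x \<in> mpart X \<and> (\<forall>v\<in>carrier V. P (v \<odot>\<^bsub>X\<^esub> x))"
    using X mpart_gens[OF X] x[unfolded mpart_def]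
  proof (induct rule: span_mod_induct)
    case (base x)
    then obtain e z where "x = e \<odot>\<^bsub>X\<^esub> z" "e \<in> \<mm>" "z \<in> carrier X" by auto
    moreover have "P (v \<odot>\<^bsub>X\<^esub> (e \<odot>\<^bsub>X\<^esub> z))" if "v \<in> carrier V" for v
      using *[of "v \<otimes> e" z] that calculation mm_mult[of v e] by (simp add: X.smult_assoc1 mm_carrier)
    ultimately show ?case using mpart_base by auto
  next
    case zero
    then show ?case using *[OF ze, of "\<zero>\<^bsub>X\<^esub>"] mpart_zero[OF X] by simp
  next
    case (add x y)
    then show ?case using assms(4) mpart_add[OF X] mpart_smult[OF X] by (simp add: X.smult_r_distr)
  next
    case (smult v x)
    then have "P (w \<odot>\<^bsub>X\<^esub> (v \<odot>\<^bsub>X\<^esub> x))" if "w \<in> carrier V" for w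
      using that by (simp add: X.smult_assoc1[symmetric])
    then show ?case using smult mpart_smult[OF X] by blast
  qed
  then show ?thesis using mpart_carrier[OF X, of x] by (metis one_closed X.smult_one)
qed

text \<open>\<open>cl X x\<close> is the class of \<open>x \<in> \<mm>X\<close> modulo \<open>\<mm>\<close>-torsion. The core of \<open>X\<close> is a module almost isomorphic
  to \<open>X\<close> on which nothing is lost in \<open>AMod\<^sub>V\<close>: it has no \<open>\<mm>\<close>-torsion and is \<open>\<mm>\<close> times itself.\<close>

definition cl :: "('v, 'x) module \<Rightarrow> 'x \<Rightarrow> 'x set" where
  "cl X x = {y \<in> mpart X. \<forall>e\<in>\<mm>. e \<odot>\<^bsub>X\<^esub> y = e \<odot>\<^bsub>X\<^esub> x}"

definition core :: "('v, 'x) module \<Rightarrow> ('v, 'x set) module" where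
  "core X = \<lparr>carrier = cl X ` mpart X, mult = undefined, one = undefined, zero = cl X \<zero>\<^bsub>X\<^esub>,
     add = (\<lambda>C D. \<Union>x\<in>C. \<Union>y\<in>D. cl X (x \<oplus>\<^bsub>X\<^esub> y)), smult = (\<lambda>v C. \<Union>x\<in>C. cl X (v \<odot>\<^bsub>X\<^esub> x))\<rparr>"

lemma cl_eqI: "(\<And>e. e \<in> \<mm> \<Longrightarrow> e \<odot>\<^bsub>X\<^esub> x = e \<odot>\<^bsub>X\<^esub> y) \<Longrightarrow> cl X x = cl X y"
  by (auto simp: cl_def)

lemma cl_self: "x \<in> mpart X \<Longrightarrow> x \<in> cl X x"
  by (auto simp: cl_def)

lemma cl_eq_iff:
  assumes "x \<in> mpart X"
  shows "cl X x = cl X y \<longleftrightarrow> (\<forall>e\<in>\<mm>. e \<odot>\<^bsub>X\<^esub> x = e \<odot>\<^bsub>X\<^esub> y)"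
proof
  assume "cl X x = cl X y"
  then have "x \<in> cl X y" using cl_self[OF assms] by simp
  then show "\<forall>e\<in>\<mm>. e \<odot>\<^bsub>X\<^esub> x = e \<odot>\<^bsub>X\<^esub> y" by (simp add: cl_def)
next
  assume "\<forall>e\<in>\<mm>. e \<odot>\<^bsub>X\<^esub> x = e \<odot>\<^bsub>X\<^esub> y"
  then show "cl X x = cl X y" by (intro cl_eqI) simp
qed

abbreviation "elts X \<equiv> carrier (core X)"

lemma core_carrier: "elts X = cl X ` mpart X" and core_zero: "\<zero>\<^bsub>core X\<^esub> = cl X \<zero>\<^bsub>X\<^esub>"
  by (simp_all add: core_def)

lemma cl_closed: "x \<in> mpart X \<Longrightarrow> cl X x \<in> elts X"
  by (simp add: core_carrier)

lemma core_cases: assumes "u \<in> elts X" obtains x where "x \<in> mpart X" "u = cl X x"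
  using assms by (auto simp: core_carrier)

lemma cl_add:
  assumes X: "module V X" and x: "x \<in> mpart X" "y \<in> mpart X"
  shows "cl X x \<oplus>\<^bsub>core X\<^esub> cl X y = cl X (x \<oplus>\<^bsub>X\<^esub> y)"
proof -
  interpret X: module V X by fact
  have "cl X (a \<oplus>\<^bsub>X\<^esub> b) = cl X (x \<oplus>\<^bsub>X\<^esub> y)" if "a \<in> cl X x" "b \<in> cl X y" for a b
    using that x by (intro cl_eqI) (auto simp: cl_def X.smult_r_distr mm_carrier mpart_carrier[OF X])
  moreover have "cl X x \<noteq> {}" "cl X y \<noteq> {}" using cl_self[OF x(1)] cl_self[OF x(2)] by auto
  ultimately show ?thesis by (simp add: core_def cong: SUP_cong)
qed

lemma cl_smult:
  assumes X: "module V X" and v: "v \<in> carrier V" and x: "x \<in> mpart X"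
  shows "v \<odot>\<^bsub>core X\<^esub> cl X x = cl X (v \<odot>\<^bsub>X\<^esub> x)"
proof -
  interpret X: module V X by fact
  have "cl X (v \<odot>\<^bsub>X\<^esub> a) = cl X (v \<odot>\<^bsub>X\<^esub> x)" if "a \<in> cl X x" for a
  proof (rule cl_eqI)
    fix e assume e: "e \<in> \<mm>"
    have a: "a \<in> carrier X" "x \<in> carrier X" using that x by (auto simp: cl_def mpart_carrier[OF X])
    have "e \<odot>\<^bsub>X\<^esub> (v \<odot>\<^bsub>X\<^esub> a) = v \<odot>\<^bsub>X\<^esub> (e \<odot>\<^bsub>X\<^esub> a)"
      using a v e by (simp add: X.smult_assoc1[symmetric] mm_carrier m_comm)
    also have "\<dots> = v \<odot>\<^bsub>X\<^esub> (e \<odot>\<^bsub>X\<^esub> x)" using that e by (simp add: cl_def)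
    also have "\<dots> = e \<odot>\<^bsub>X\<^esub> (v \<odot>\<^bsub>X\<^esub> x)"
      using a v e by (simp add: X.smult_assoc1[symmetric] mm_carrier m_comm)
    finally show "e \<odot>\<^bsub>X\<^esub> (v \<odot>\<^bsub>X\<^esub> a) = e \<odot>\<^bsub>X\<^esub> (v \<odot>\<^bsub>X\<^esub> x)" .
  qed
  moreover have "cl X x \<noteq> {}" using cl_self[OF x] by auto
  ultimately show ?thesis by (simp add: core_def cong: SUP_cong)
qed

lemma module_core: assumes X: "module V X" shows "module V (core X)"
proof (rule module_by_surjection[OF module_sub_mod[OF X mpart_submodule[OF X]], where \<pi> = "cl X"])
qed (auto simp: core_carrier core_zero cl_add[OF X] cl_smult[OF X])

text \<open>The core has no \<open>\<mm>\<close>-torsion, and it is spanned by the products with elements of \<open>\<mm>\<close>.\<close>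

lemma core_eqI:
  assumes X: "module V X" and u: "u \<in> elts X" "w \<in> elts X"
    and eq: "\<And>e. e \<in> \<mm> \<Longrightarrow> e \<odot>\<^bsub>core X\<^esub> u = e \<odot>\<^bsub>core X\<^esub> w"
  shows "u = w"
proof -
  obtain x where x: "x \<in> mpart X" "u = cl X x" using u(1) by (rule core_cases)
  obtain y where y: "y \<in> mpart X" "w = cl X y" using u(2) by (rule core_cases)
  have *: "a \<odot>\<^bsub>X\<^esub> (e \<odot>\<^bsub>X\<^esub> x) = a \<odot>\<^bsub>X\<^esub> (e \<odot>\<^bsub>X\<^esub> y)" if "a \<in> \<mm>" "e \<in> \<mm>" for a e
  proof -
    have "cl X (e \<odot>\<^bsub>X\<^esub> x) = cl X (e \<odot>\<^bsub>X\<^esub> y)"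
      using eq[OF that(2)] x y cl_smult[OF X mm_carrier[OF that(2)]] by simp
    then show ?thesis using cl_eq_iff[of "e \<odot>\<^bsub>X\<^esub> x" X] mpart_smult[OF X mm_carrier[OF that(2)] x(1)] that by blast
  qed
  show ?thesis unfolding x y
    by (rule cl_eqI, rule mm_cancel[OF X _ _ _ *]) (use x y mpart_carrier[OF X] in auto)
qed

lemma core_induct [consumes 2, case_names smult add]:
  assumes X: "module V X" and u: "u \<in> elts X"
    and smult: "\<And>e u. e \<in> \<mm> \<Longrightarrow> u \<in> elts X \<Longrightarrow> P (e \<odot>\<^bsub>core X\<^esub> u)"
    and add: "\<And>u w. u \<in> elts X \<Longrightarrow> w \<in> elts X \<Longrightarrow> P u \<Longrightarrow> P w \<Longrightarrow> P (u \<oplus>\<^bsub>core X\<^esub> w)"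
  shows "P u"
proof -
  obtain x where x: "x \<in> mpart X" "u = cl X x" using u by (rule core_cases)
  have "P (cl X x)" using X x(1)
  proof (induct rule: mpart_induct)
    case (smult e x)
    then show ?case using assms(3)[of e "cl X x"] by (simp add: cl_smult[OF X] mm_carrier cl_closed)
  next
    case (add x y)
    then show ?case using assms(4)[of "cl X x" "cl X y"] by (simp add: cl_add[OF X] cl_closed)
  qed
  then show ?thesis using x by simp
qed

lemma core_divisible:
  assumes X: "module V X" and N: "submodule N V (core X)" and u: "u \<in> elts X"
    and *: "\<And>e u. e \<in> \<mm> \<Longrightarrow> u \<in> elts X \<Longrightarrow> e \<odot>\<^bsub>core X\<^esub> u \<in> N"
  shows "u \<in> N"
  using X u
proof (induct rule: core_induct)
  case (add u w)
  then show ?case using N unfolding submodule_iff[OF module_core[OF X]] by blast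
qed (rule *)

section \<open>Morphisms of almost modules as linear maps of cores\<close>

lemma amorD:
  assumes f: "is_amor X Y f"
  shows "module V X" "module V Y" "asrc f = X" "atgt f = Y"
    and "(x, y) \<in> agraph f \<Longrightarrow> x \<in> mpart X" and "(x, y) \<in> agraph f \<Longrightarrow> y \<in> carrier Y"
    and "(x, y) \<in> agraph f \<Longrightarrow> (x', y') \<in> agraph f \<Longrightarrow> (x \<oplus>\<^bsub>X\<^esub> x', y \<oplus>\<^bsub>Y\<^esub> y') \<in> agraph f"
    and "v \<in> carrier V \<Longrightarrow> (x, y) \<in> agraph f \<Longrightarrow> (v \<odot>\<^bsub>X\<^esub> x, v \<odot>\<^bsub>Y\<^esub> y) \<in> agraph f"
proof -
  have X: "module V X" "module V Y" and S: "submodule (agraph f) V (sum_mod X Y)"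
    and D: "Domain (agraph f) = mpart X" and a: "asrc f = X" "atgt f = Y"
    using f by (auto simp: is_amor_def)
  note S' = S[unfolded submodule_iff[OF module_sum_mod[OF X]]]
  show "module V X" "module V Y" "asrc f = X" "atgt f = Y" by fact+
  show "(x, y) \<in> agraph f \<Longrightarrow> x \<in> mpart X" using D by auto
  show "(x, y) \<in> agraph f \<Longrightarrow> y \<in> carrier Y" using S' by auto
  show "(x, y) \<in> agraph f \<Longrightarrow> (x', y') \<in> agraph f \<Longrightarrow> (x \<oplus>\<^bsub>X\<^esub> x', y \<oplus>\<^bsub>Y\<^esub> y') \<in> agraph f"
    using S' by (metis sum_mod_simps(3))
  show "v \<in> carrier V \<Longrightarrow> (x, y) \<in> agraph f \<Longrightarrow> (v \<odot>\<^bsub>X\<^esub> x, v \<odot>\<^bsub>Y\<^esub> y) \<in> agraph f"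
    using S' by (metis sum_mod_simps(4))
qed

text \<open>A value at \<open>e x\<close> is \<open>e\<close> times a value at \<open>x\<close>, hence can be taken in \<open>\<mm>Y\<close>, where it has a class.\<close>

lemma amor_total:
  assumes f: "is_amor X Y f" and x: "x \<in> mpart X"
  shows "\<exists>y\<in>mpart Y. (x, y) \<in> agraph f"
  using amorD(1)[OF f] x
proof (induct rule: mpart_induct)
  case (smult e x)
  then obtain y where "(x, y) \<in> agraph f" using f by (auto simp: is_amor_def)
  then have "(e \<odot>\<^bsub>X\<^esub> x, e \<odot>\<^bsub>Y\<^esub> y) \<in> agraph f" "e \<odot>\<^bsub>Y\<^esub> y \<in> mpart Y"
    using amorD(8)[OF f mm_carrier[OF smult(1)]] mpart_base[OF smult(1) amorD(6)[OF f]] by auto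
  then show ?case by auto
next
  case (add x y)
  then show ?case using amorD(7)[OF f] mpart_add[OF amorD(2)[OF f]] by blast
qed

lemma amor_unique:
  assumes f: "is_amor X Y f" and xy: "(x, y) \<in> agraph f" "(x, y') \<in> agraph f" and e: "e \<in> \<mm>"
  shows "e \<odot>\<^bsub>Y\<^esub> y = e \<odot>\<^bsub>Y\<^esub> y'"
proof -
  interpret X: module V X using amorD(1)[OF f] .
  interpret Y: module V Y using amorD(2)[OF f] .
  have c: "x \<in> carrier X" "y \<in> carrier Y" "y' \<in> carrier Y"
    using amorD(5,6)[OF f] xy mpart_carrier[OF X.module_axioms] by auto
  have "((\<ominus> \<one>) \<odot>\<^bsub>X\<^esub> x, (\<ominus> \<one>) \<odot>\<^bsub>Y\<^esub> y') \<in> agraph f" using amorD(8)[OF f _ xy(2)] by simp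
  then have "(\<ominus>\<^bsub>X\<^esub> x, \<ominus>\<^bsub>Y\<^esub> y') \<in> agraph f" using c by (simp add: X.smult_l_minus Y.smult_l_minus)
  from amorD(7)[OF f xy(1) this] have "(\<zero>\<^bsub>X\<^esub>, y \<ominus>\<^bsub>Y\<^esub> y') \<in> agraph f" using c by (simp add: X.M.r_neg a_minus_def)
  then have "y \<ominus>\<^bsub>Y\<^esub> y' \<in> mtors Y" using f by (auto simp: is_amor_def)
  then show ?thesis using c e by (simp add: mtors_def Y.smult_minus mm_carrier Y.minus_eq_zero_iff)
qed

lemma amor_saturated:
  assumes f: "is_amor X Y f" and xy: "(x, y) \<in> agraph f" and y': "y' \<in> carrier Y"
    and eq: "\<And>e. e \<in> \<mm> \<Longrightarrow> e \<odot>\<^bsub>Y\<^esub> y = e \<odot>\<^bsub>Y\<^esub> y'"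
  shows "(x, y') \<in> agraph f"
proof -
  interpret X: module V X using amorD(1)[OF f] .
  interpret Y: module V Y using amorD(2)[OF f] .
  have c: "x \<in> carrier X" "y \<in> carrier Y"
    using amorD(5,6)[OF f] xy mpart_carrier[OF X.module_axioms] by auto
  have "y' \<ominus>\<^bsub>Y\<^esub> y \<in> mtors Y"
    using c y' eq by (auto simp: mtors_def Y.smult_minus mm_carrier Y.minus_eq_zero_iff)
  then have "(\<zero>\<^bsub>X\<^esub>, y' \<ominus>\<^bsub>Y\<^esub> y) \<in> agraph f" using f by (auto simp: is_amor_def)
  from amorD(7)[OF f xy this] show ?thesis
    using c y' by (simp add: a_minus_def Y.M.a_lcomm[of y] Y.M.r_neg)
qed

lemma is_amorI:
  assumes X: "module V X" "module V Y" and f: "asrc f = X" "atgt f = Y"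
    and dom: "\<And>x y. (x, y) \<in> agraph f \<Longrightarrow> x \<in> mpart X \<and> y \<in> carrier Y"
    and add: "\<And>x y x' y'. (x, y) \<in> agraph f \<Longrightarrow> (x', y') \<in> agraph f \<Longrightarrow> (x \<oplus>\<^bsub>X\<^esub> x', y \<oplus>\<^bsub>Y\<^esub> y') \<in> agraph f"
    and smult: "\<And>v x y. v \<in> carrier V \<Longrightarrow> (x, y) \<in> agraph f \<Longrightarrow> (v \<odot>\<^bsub>X\<^esub> x, v \<odot>\<^bsub>Y\<^esub> y) \<in> agraph f"
    and total: "\<And>x. x \<in> mpart X \<Longrightarrow> \<exists>y. (x, y) \<in> agraph f"
    and zero: "\<And>y. y \<in> carrier Y \<Longrightarrow> (\<zero>\<^bsub>X\<^esub>, y) \<in> agraph f \<longleftrightarrow> (\<forall>e\<in>\<mm>. e \<odot>\<^bsub>Y\<^esub> y = \<zero>\<^bsub>Y\<^esub>)"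
  shows "is_amor X Y f"
proof -
  interpret Y: module V Y by fact
  have z: "(\<zero>\<^bsub>X\<^esub>, \<zero>\<^bsub>Y\<^esub>) \<in> agraph f" using zero[of "\<zero>\<^bsub>Y\<^esub>"] by (simp add: mm_carrier)
  have "submodule (agraph f) V (sum_mod X Y)"
    unfolding submodule_iff[OF module_sum_mod[OF X]]
    using dom add smult z mpart_carrier[OF X(1)] by auto
  moreover have "Domain (agraph f) = mpart X" using dom total by (blast intro: DomainI)
  moreover have "agraph f `` {\<zero>\<^bsub>X\<^esub>} = mtors Y" using zero dom by (auto simp: mtors_def)
  ultimately show ?thesis using X f by (simp add: is_amor_def)
qed

text \<open>The core is a functor on \<open>AMod\<^sub>V\<close>, and \<open>ev f\<close> is its value at the morphism \<open>f\<close>.\<close>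

definition ev :: "('v, 'x, 'y) amor \<Rightarrow> 'x set \<Rightarrow> 'y set" where
  "ev f C = {y \<in> mpart (atgt f). \<exists>x\<in>C. (x, y) \<in> agraph f}"

lemma ev_cl:
  assumes f: "is_amor X Y f" and xy: "(x, y) \<in> agraph f" "y \<in> mpart Y"
  shows "ev f (cl X x) = cl Y y"
proof -
  note X = amorD(1)[OF f] and Y = amorD(2)[OF f]
  have "y' \<in> cl Y y" if x': "x' \<in> cl X x" and y': "(x', y') \<in> agraph f" "y' \<in> mpart Y" for x' y'
  proof -
    have "e \<odot>\<^bsub>Y\<^esub> y' = e \<odot>\<^bsub>Y\<^esub> y" if e: "e \<in> \<mm>" for e
    proof (rule mm_cancel[OF Y _ _ e])
      fix a b assume ab: "a \<in> \<mm>" "b \<in> \<mm>"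
      have "b \<odot>\<^bsub>X\<^esub> x' = b \<odot>\<^bsub>X\<^esub> x" using x' ab by (simp add: cl_def)
      then show "a \<odot>\<^bsub>Y\<^esub> (b \<odot>\<^bsub>Y\<^esub> y') = a \<odot>\<^bsub>Y\<^esub> (b \<odot>\<^bsub>Y\<^esub> y)"
        using amor_unique[OF f _ _ ab(1)] amorD(8)[OF f mm_carrier[OF ab(2)]] xy y' by metis
    qed (use y' xy mpart_carrier[OF Y] in auto)
    then show ?thesis using y' by (simp add: cl_def)
  qed
  moreover have "(x, y') \<in> agraph f" if "y' \<in> cl Y y" for y'
    by (rule amor_saturated[OF f xy(1)]) (use that mpart_carrier[OF Y] in \<open>auto simp: cl_def\<close>)
  moreover have "x \<in> cl X x" using amorD(5)[OF f xy(1)] by (rule cl_self)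
  ultimately show ?thesis using amorD(4)[OF f] by (auto simp: ev_def cl_def)
qed

lemma ev_ex:
  assumes f: "is_amor X Y f" and x: "x \<in> mpart X"
  obtains y where "(x, y) \<in> agraph f" "y \<in> mpart Y" "ev f (cl X x) = cl Y y"
  using amor_total[OF f x] ev_cl[OF f] by blast

lemma ev_hom:
  assumes f: "is_amor X Y f" shows "ev f \<in> mod_hom V (core X) (core Y)"
proof -
  note X = amorD(1)[OF f] and Y = amorD(2)[OF f]
  show ?thesis
  proof (rule mod_homI)
    fix u assume "u \<in> elts X"
    then obtain x where x: "x \<in> mpart X" "u = cl X x" by (rule core_cases)
    from ev_ex[OF f x(1)] show "ev f u \<in> elts Y" using x by (metis cl_closed)
  next
    fix u w assume "u \<in> elts X" "w \<in> elts X"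
    then obtain x y where x: "x \<in> mpart X" "u = cl X x" "y \<in> mpart X" "w = cl X y" by (meson core_cases)
    obtain a where a: "(x, a) \<in> agraph f" "a \<in> mpart Y" "ev f (cl X x) = cl Y a" using ev_ex[OF f x(1)] .
    obtain b where b: "(y, b) \<in> agraph f" "b \<in> mpart Y" "ev f (cl X y) = cl Y b" using ev_ex[OF f x(3)] .
    show "ev f (u \<oplus>\<^bsub>core X\<^esub> w) = ev f u \<oplus>\<^bsub>core Y\<^esub> ev f w"
      using ev_cl[OF f amorD(7)[OF f a(1) b(1)] mpart_add[OF Y a(2) b(2)]] x a b
      by (simp add: cl_add[OF X] cl_add[OF Y])
  next
    fix v u assume v: "v \<in> carrier V" and "u \<in> elts X"
    then obtain x where x: "x \<in> mpart X" "u = cl X x" by (meson core_cases)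
    obtain a where a: "(x, a) \<in> agraph f" "a \<in> mpart Y" "ev f (cl X x) = cl Y a" using ev_ex[OF f x(1)] .
    show "ev f (v \<odot>\<^bsub>core X\<^esub> u) = v \<odot>\<^bsub>core Y\<^esub> ev f u"
      using ev_cl[OF f amorD(8)[OF f v a(1)] mpart_smult[OF Y v a(2)]] x a v
      by (simp add: cl_smult[OF X] cl_smult[OF Y])
  qed
qed

lemma ev_closed: "is_amor X Y f \<Longrightarrow> u \<in> elts X \<Longrightarrow> ev f u \<in> elts Y"
  by (rule mod_hom_closed[OF ev_hom])

text \<open>A value \<open>y\<close> of \<open>f\<close> need not lie in \<open>\<mm>Y\<close>, but its multiples \<open>e y\<close> do, and they determine \<open>y\<close> up to torsion.
  Hence \<open>f\<close> is recovered from \<open>ev f\<close>, and the functor is faithful.\<close>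

lemma agraph_iff:
  assumes f: "is_amor X Y f"
  shows "(x, y) \<in> agraph f \<longleftrightarrow> x \<in> mpart X \<and> y \<in> carrier Y \<and>
    (\<forall>e\<in>\<mm>. cl Y (e \<odot>\<^bsub>Y\<^esub> y) = e \<odot>\<^bsub>core Y\<^esub> ev f (cl X x))" (is "_ \<longleftrightarrow> ?r")
proof -
  note X = amorD(1)[OF f] and Y = amorD(2)[OF f]
  show ?thesis
  proof
    assume xy: "(x, y) \<in> agraph f"
    have "cl Y (e \<odot>\<^bsub>Y\<^esub> y) = e \<odot>\<^bsub>core Y\<^esub> ev f (cl X x)" if e: "e \<in> \<mm>" for e
    proof -
      have "ev f (cl X (e \<odot>\<^bsub>X\<^esub> x)) = cl Y (e \<odot>\<^bsub>Y\<^esub> y)"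
        using amorD(8)[OF f mm_carrier[OF e] xy] amorD(6)[OF f xy] mpart_base[OF e] by (intro ev_cl[OF f])
      then show ?thesis
        using mod_hom_smult[OF ev_hom[OF f] mm_carrier[OF e], of "cl X x"] amorD(5)[OF f xy]
        by (simp add: cl_smult[OF X] mm_carrier e cl_closed)
    qed
    then show ?r using amorD(5,6)[OF f xy] by auto
  next
    assume r: ?r
    then obtain z where z: "(x, z) \<in> agraph f" "z \<in> mpart Y" "ev f (cl X x) = cl Y z" using ev_ex[OF f] by blast
    show "(x, y) \<in> agraph f"
    proof (rule amor_saturated[OF f z(1)])
      fix e assume e: "e \<in> \<mm>"
      show "e \<odot>\<^bsub>Y\<^esub> z = e \<odot>\<^bsub>Y\<^esub> y"
      proof (rule mm_cancel[OF Y _ _ e])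
        fix a b assume ab: "a \<in> \<mm>" "b \<in> \<mm>"
        have "cl Y (b \<odot>\<^bsub>Y\<^esub> y) = cl Y (b \<odot>\<^bsub>Y\<^esub> z)"
          using r ab z cl_smult[OF Y mm_carrier[OF ab(2)] z(2)] by simp
        then show "a \<odot>\<^bsub>Y\<^esub> (b \<odot>\<^bsub>Y\<^esub> z) = a \<odot>\<^bsub>Y\<^esub> (b \<odot>\<^bsub>Y\<^esub> y)"
          using cl_eq_iff[of "b \<odot>\<^bsub>Y\<^esub> y" Y] r mpart_base[OF ab(2)] ab by metis
      qed (use r z mpart_carrier[OF Y] in auto)
    qed (use r in auto)
  qed
qed

lemma amor_eqI:
  assumes f: "is_amor X Y f" and g: "is_amor X Y g" and eq: "\<And>u. u \<in> elts X \<Longrightarrow> ev f u = ev g u"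
  shows "f = g"
proof -
  have "agraph f = agraph g"
    by (auto simp: agraph_iff[OF f] agraph_iff[OF g] eq cl_closed)
  then show ?thesis using amorD(3,4)[OF f] amorD(3,4)[OF g] by simp
qed

text \<open>The functor is also full; the graph belonging to a linear map of cores is dictated by \<open>agraph_iff\<close>.\<close>

definition amor_of_hom :: "('v, 'x) module \<Rightarrow> ('v, 'y) module \<Rightarrow> ('x set \<Rightarrow> 'y set) \<Rightarrow> ('v, 'x, 'y) amor" where
  "amor_of_hom X Y h = \<lparr>asrc = X, atgt = Y, agraph = {(x, y). x \<in> mpart X \<and> y \<in> carrier Y \<and>
     (\<forall>e\<in>\<mm>. cl Y (e \<odot>\<^bsub>Y\<^esub> y) = e \<odot>\<^bsub>core Y\<^esub> h (cl X x))}\<rparr>"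

lemma cl_base_add:
  assumes Y: "module V Y" and e: "e \<in> \<mm>" and y: "y \<in> carrier Y" "y' \<in> carrier Y"
  shows "cl Y (e \<odot>\<^bsub>Y\<^esub> (y \<oplus>\<^bsub>Y\<^esub> y')) = cl Y (e \<odot>\<^bsub>Y\<^esub> y) \<oplus>\<^bsub>core Y\<^esub> cl Y (e \<odot>\<^bsub>Y\<^esub> y')"
  using assms by (simp add: cl_add mpart_base module.smult_r_distr mm_carrier)

lemma cl_base_smult:
  assumes Y: "module V Y" and e: "e \<in> \<mm>" and v: "v \<in> carrier V" and y: "y \<in> carrier Y"
  shows "cl Y (e \<odot>\<^bsub>Y\<^esub> (v \<odot>\<^bsub>Y\<^esub> y)) = v \<odot>\<^bsub>core Y\<^esub> cl Y (e \<odot>\<^bsub>Y\<^esub> y)"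
proof -
  interpret Y: module V Y by fact
  show ?thesis using assms
    by (simp add: cl_smult mpart_base Y.smult_assoc1[symmetric] mm_carrier m_comm)
qed

lemma amor_of_hom:
  assumes X: "module V X" and Y: "module V Y" and h: "h \<in> mod_hom V (core X) (core Y)"
  shows is_amor_of_hom: "is_amor X Y (amor_of_hom X Y h)"
    and ev_amor_of_hom: "u \<in> elts X \<Longrightarrow> ev (amor_of_hom X Y h) u = h u"
proof -
  interpret X: module V X by fact
  interpret Y: module V Y by fact
  interpret CX: module V "core X" by (rule module_core[OF X])
  interpret CY: module V "core Y" by (rule module_core[OF Y])
  have ex: "(x, y) \<in> agraph (amor_of_hom X Y h)" if "x \<in> mpart X" "y \<in> mpart Y" "h (cl X x) = cl Y y" for x y
    using that by (auto simp: amor_of_hom_def mpart_carrier[OF Y] cl_smult[OF Y] mm_carrier)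
  have hc: "h (cl X x) \<in> elts Y" if "x \<in> mpart X" for x using mod_hom_closed[OF h cl_closed[OF that]] .
  show am: "is_amor X Y (amor_of_hom X Y h)"
  proof (rule is_amorI[OF X Y])
    fix x y x' y' assume "(x, y) \<in> agraph (amor_of_hom X Y h)" "(x', y') \<in> agraph (amor_of_hom X Y h)"
    then show "(x \<oplus>\<^bsub>X\<^esub> x', y \<oplus>\<^bsub>Y\<^esub> y') \<in> agraph (amor_of_hom X Y h)"
      using mod_hom_add[OF h]
      by (simp add: amor_of_hom_def mpart_add[OF X] cl_base_add[OF Y] cl_add[OF X, symmetric] cl_closed hc
          CY.smult_r_distr mm_carrier)
  next
    fix v x y assume v: "v \<in> carrier V" and "(x, y) \<in> agraph (amor_of_hom X Y h)"
    then show "(v \<odot>\<^bsub>X\<^esub> x, v \<odot>\<^bsub>Y\<^esub> y) \<in> agraph (amor_of_hom X Y h)"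
      using mod_hom_smult[OF h v]
      by (simp add: amor_of_hom_def mpart_smult[OF X] cl_base_smult[OF Y] cl_smult[OF X, symmetric] cl_closed hc
          CY.smult_assoc1[symmetric] mm_carrier m_comm)
  next
    fix x assume x: "x \<in> mpart X"
    then obtain y where "y \<in> mpart Y" "h (cl X x) = cl Y y" using core_cases[OF hc] by metis
    then show "\<exists>y. (x, y) \<in> agraph (amor_of_hom X Y h)" using ex[OF x] by blast
  next
    fix y assume y: "y \<in> carrier Y"
    have h0: "h (cl X \<zero>\<^bsub>X\<^esub>) = \<zero>\<^bsub>core Y\<^esub>"
      using mod_hom_zero[OF h CX.module_axioms CY.module_axioms] by (simp add: core_zero)
    have "(\<zero>\<^bsub>X\<^esub>, y) \<in> agraph (amor_of_hom X Y h) \<longleftrightarrow> (\<forall>e\<in>\<mm>. cl Y (e \<odot>\<^bsub>Y\<^esub> y) = cl Y \<zero>\<^bsub>Y\<^esub>)"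
      using y mpart_zero[OF X] by (simp add: amor_of_hom_def h0 mm_carrier) (simp add: core_zero)
    also have "\<dots> \<longleftrightarrow> (\<forall>e\<in>\<mm>. \<forall>a\<in>\<mm>. a \<odot>\<^bsub>Y\<^esub> (e \<odot>\<^bsub>Y\<^esub> y) = a \<odot>\<^bsub>Y\<^esub> (e \<odot>\<^bsub>Y\<^esub> \<zero>\<^bsub>Y\<^esub>))"
      using y by (simp add: cl_eq_iff mpart_base mm_carrier)
    also have "\<dots> \<longleftrightarrow> (\<forall>e\<in>\<mm>. e \<odot>\<^bsub>Y\<^esub> y = e \<odot>\<^bsub>Y\<^esub> \<zero>\<^bsub>Y\<^esub>)"
      using mm_cancel[OF Y y Y.M.zero_closed] by auto
    finally show "(\<zero>\<^bsub>X\<^esub>, y) \<in> agraph (amor_of_hom X Y h) \<longleftrightarrow> (\<forall>e\<in>\<mm>. e \<odot>\<^bsub>Y\<^esub> y = \<zero>\<^bsub>Y\<^esub>)"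
      by (simp add: mm_carrier)
  qed (auto simp: amor_of_hom_def)
  assume "u \<in> elts X"
  then obtain x where x: "x \<in> mpart X" "u = cl X x" by (rule core_cases)
  obtain y where "y \<in> mpart Y" "h (cl X x) = cl Y y" using core_cases[OF hc[OF x(1)]] by metis
  then show "ev (amor_of_hom X Y h) u = h u" using ev_cl[OF am ex[OF x(1)]] x by simp
qed

lemma acomp:
  assumes f: "is_amor X Y f" and g: "is_amor Y Z g"
  shows is_amor_acomp: "is_amor X Z (f \<Zsemi> g)"
    and ev_acomp: "u \<in> elts X \<Longrightarrow> ev (f \<Zsemi> g) u = ev g (ev f u)"
proof -
  note X = amorD(1)[OF f] and Y = amorD(2)[OF f] and Z = amorD(2)[OF g]
  interpret X: module V X by fact
  interpret Y: module V Y by fact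
  have tot: "\<exists>y z. (x, y) \<in> agraph f \<and> (y, z) \<in> agraph g \<and> y \<in> mpart Y \<and> z \<in> mpart Z" if "x \<in> mpart X" for x
    using amor_total[OF f that] amor_total[OF g] by blast
  show am: "is_amor X Z (f \<Zsemi> g)"
  proof (rule is_amorI[OF X Z])
    fix z assume z: "z \<in> carrier Z"
    show "(\<zero>\<^bsub>X\<^esub>, z) \<in> agraph (f \<Zsemi> g) \<longleftrightarrow> (\<forall>e\<in>\<mm>. e \<odot>\<^bsub>Z\<^esub> z = \<zero>\<^bsub>Z\<^esub>)"
    proof
      assume "(\<zero>\<^bsub>X\<^esub>, z) \<in> agraph (f \<Zsemi> g)"
      then obtain y where y: "(\<zero>\<^bsub>X\<^esub>, y) \<in> agraph f" "(y, z) \<in> agraph g" by (auto simp: acomp_def)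
      show "\<forall>e\<in>\<mm>. e \<odot>\<^bsub>Z\<^esub> z = \<zero>\<^bsub>Z\<^esub>"
      proof
        interpret Z: module V Z by fact
        fix e assume e: "e \<in> \<mm>"
        have "e \<odot>\<^bsub>Z\<^esub> z = e \<odot>\<^bsub>Z\<^esub> \<zero>\<^bsub>Z\<^esub>"
        proof (rule mm_cancel[OF Z z _ e])
          fix a b assume ab: "a \<in> \<mm>" "b \<in> \<mm>"
          have "b \<odot>\<^bsub>Y\<^esub> y = \<zero>\<^bsub>Y\<^esub>" using f y ab by (auto simp: is_amor_def mtors_def)
          then have "(\<zero>\<^bsub>Y\<^esub>, b \<odot>\<^bsub>Z\<^esub> z) \<in> agraph g" using amorD(8)[OF g mm_carrier[OF ab(2)] y(2)] by simp
          then have "b \<odot>\<^bsub>Z\<^esub> z \<in> mtors Z" using g by (auto simp: is_amor_def)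
          then show "a \<odot>\<^bsub>Z\<^esub> (b \<odot>\<^bsub>Z\<^esub> z) = a \<odot>\<^bsub>Z\<^esub> (b \<odot>\<^bsub>Z\<^esub> \<zero>\<^bsub>Z\<^esub>)" using ab by (auto simp: mtors_def mm_carrier)
        qed simp
        then show "e \<odot>\<^bsub>Z\<^esub> z = \<zero>\<^bsub>Z\<^esub>" using e by (simp add: mm_carrier)
      qed
    next
      assume "\<forall>e\<in>\<mm>. e \<odot>\<^bsub>Z\<^esub> z = \<zero>\<^bsub>Z\<^esub>"
      then have "(\<zero>\<^bsub>Y\<^esub>, z) \<in> agraph g" using g z by (auto simp: is_amor_def mtors_def)
      moreover have "(\<zero>\<^bsub>X\<^esub>, \<zero>\<^bsub>Y\<^esub>) \<in> agraph f"
        using submoduleD(2)[OF module_sum_mod[OF X Y], of "agraph f"] f by (simp add: is_amor_def)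
      ultimately show "(\<zero>\<^bsub>X\<^esub>, z) \<in> agraph (f \<Zsemi> g)" by (auto simp: acomp_def)
    qed
  next
    show "\<And>x. x \<in> mpart X \<Longrightarrow> \<exists>y. (x, y) \<in> agraph (f \<Zsemi> g)" using tot by (fastforce simp: acomp_def)
  next
    fix x z x' z' assume "(x, z) \<in> agraph (f \<Zsemi> g)" "(x', z') \<in> agraph (f \<Zsemi> g)"
    then obtain y y' where "(x, y) \<in> agraph f" "(y, z) \<in> agraph g" "(x', y') \<in> agraph f" "(y', z') \<in> agraph g"
      by (auto simp: acomp_def)
    then show "(x \<oplus>\<^bsub>X\<^esub> x', z \<oplus>\<^bsub>Z\<^esub> z') \<in> agraph (f \<Zsemi> g)"
      using amorD(7)[OF f] amorD(7)[OF g] by (simp add: acomp_def) blast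
  next
    fix v x z assume v: "v \<in> carrier V" and "(x, z) \<in> agraph (f \<Zsemi> g)"
    then obtain y where "(x, y) \<in> agraph f" "(y, z) \<in> agraph g" by (auto simp: acomp_def)
    then show "(v \<odot>\<^bsub>X\<^esub> x, v \<odot>\<^bsub>Z\<^esub> z) \<in> agraph (f \<Zsemi> g)"
      using amorD(8)[OF f v] amorD(8)[OF g v] by (simp add: acomp_def) blast
  next
    fix x z assume "(x, z) \<in> agraph (f \<Zsemi> g)"
    then show "x \<in> mpart X \<and> z \<in> carrier Z" using amorD(5)[OF f] amorD(6)[OF g] by (auto simp: acomp_def)
  next
    show "asrc (f \<Zsemi> g) = X" "atgt (f \<Zsemi> g) = Z" using amorD(3)[OF f] amorD(4)[OF g] by (simp_all add: acomp_def)
  qed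
  assume "u \<in> elts X"
  then obtain x where x: "x \<in> mpart X" "u = cl X x" by (rule core_cases)
  then obtain y z where yz: "(x, y) \<in> agraph f" "(y, z) \<in> agraph g" "y \<in> mpart Y" "z \<in> mpart Z" using tot by blast
  then have "(x, z) \<in> agraph (f \<Zsemi> g)" by (auto simp: acomp_def)
  then show "ev (f \<Zsemi> g) u = ev g (ev f u)"
    using ev_cl[OF am _ yz(4)] ev_cl[OF f yz(1,3)] ev_cl[OF g yz(2,4)] x by simp
qed

text \<open>A family of assignments determines a morphism as soon as it is compatible with a linear map
  of cores and is defined on generators.\<close>

lemma gen_amor:
  assumes X: "module V X" and Y: "module V Y" and h: "h \<in> mod_hom V (core X) (core Y)"
    and S: "S \<subseteq> carrier X \<times> carrier Y"
    and compat: "\<And>x y e. (x, y) \<in> S \<Longrightarrow> e \<in> \<mm> \<Longrightarrow> cl Y (e \<odot>\<^bsub>Y\<^esub> y) = h (cl X (e \<odot>\<^bsub>X\<^esub> x))"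
    and dom: "mpart X \<subseteq> span_mod V X (Domain S)"
  shows is_amor_gen_amor: "is_amor X Y (gen_amor X Y S)"
    and ev_gen_amor: "u \<in> elts X \<Longrightarrow> ev (gen_amor X Y S) u = h u"
proof -
  interpret X: module V X by fact
  interpret Y: module V Y by fact
  interpret CX: module V "core X" by (rule module_core[OF X])
  interpret CY: module V "core Y" by (rule module_core[OF Y])
  note XY = module_sum_mod[OF X Y]
  \<comment> \<open>the largest relation compatible with \<open>h\<close>; it contains the generators and hence their span\<close>
  define H where "H = {(x, y). x \<in> carrier X \<and> y \<in> carrier Y \<and> (\<forall>e\<in>\<mm>. cl Y (e \<odot>\<^bsub>Y\<^esub> y) = h (cl X (e \<odot>\<^bsub>X\<^esub> x)))}"
  let ?S = "S \<union> {\<zero>\<^bsub>X\<^esub>} \<times> mtors Y"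
  let ?T = "span_mod V (sum_mod X Y) ?S"
  have h0: "h (cl X \<zero>\<^bsub>X\<^esub>) = cl Y \<zero>\<^bsub>Y\<^esub>"
    using mod_hom_zero[OF h CX.module_axioms CY.module_axioms] by (simp add: core_zero)
  have Hsub: "submodule H V (sum_mod X Y)"
    unfolding submodule_iff[OF XY]
  proof (intro conjI ballI)
    show "H \<subseteq> carrier (sum_mod X Y)" by (auto simp: H_def)
    show "\<zero>\<^bsub>sum_mod X Y\<^esub> \<in> H" by (auto simp: H_def mm_carrier h0)
  next
    fix p q assume "p \<in> H" "q \<in> H"
    then show "p \<oplus>\<^bsub>sum_mod X Y\<^esub> q \<in> H"
      using mod_hom_add[OF h] by (auto simp: H_def cl_base_add[OF X] cl_base_add[OF Y] cl_closed mpart_base)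
  next
    fix v p assume "v \<in> carrier V" "p \<in> H"
    then show "v \<odot>\<^bsub>sum_mod X Y\<^esub> p \<in> H"
      using mod_hom_smult[OF h] by (auto simp: H_def cl_base_smult[OF X] cl_base_smult[OF Y] cl_closed mpart_base)
  qed
  have SH: "?S \<subseteq> H" using S compat by (auto simp: H_def mtors_def mm_carrier h0)
  have TH: "?T \<subseteq> H" by (rule span_mod_least[OF Hsub SH])
  have Sc: "?S \<subseteq> carrier (sum_mod X Y)" using S by (auto simp: mtors_def)
  have Ts: "submodule ?T V (sum_mod X Y)" by (rule span_mod_submodule[OF XY Sc])
  note Ts' = Ts[unfolded submodule_iff[OF XY]]
  have fst_hom: "fst \<in> mod_hom V (sum_mod X Y) X" by (rule mod_homI) auto
  have snd_hom: "snd \<in> mod_hom V (sum_mod X Y) Y" by (rule mod_homI) auto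
  have total: "\<exists>y. (x, y) \<in> ?T" if "x \<in> mpart X" for x
  proof -
    have "submodule (fst ` ?T) V X" by (rule submodule_image[OF fst_hom XY X Ts])
    moreover have "Domain S \<subseteq> fst ` ?T"
    proof
      fix x assume "x \<in> Domain S"
      then obtain y where "(x, y) \<in> ?T" using span_mod_base[of _ ?S] by blast
      then show "x \<in> fst ` ?T" by (metis fst_conv imageI)
    qed
    ultimately have "x \<in> fst ` ?T" using span_mod_least dom that by blast
    then show ?thesis by auto
  qed
  have sameH: "(x, y) \<in> H \<longleftrightarrow> (x, y) \<in> agraph (amor_of_hom X Y h)" if "x \<in> mpart X" for x y
  proof -
    have "h (cl X (e \<odot>\<^bsub>X\<^esub> x)) = e \<odot>\<^bsub>core Y\<^esub> h (cl X x)" if "e \<in> \<mm>" for e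
      using mod_hom_smult[OF h mm_carrier[OF that] cl_closed[OF \<open>x \<in> mpart X\<close>]] \<open>x \<in> mpart X\<close> that
      by (simp add: cl_smult[OF X] mm_carrier)
    then show ?thesis using that mpart_carrier[OF X] by (auto simp: H_def amor_of_hom_def)
  qed
  have "?T \<inter> mpart X \<times> carrier Y = agraph (amor_of_hom X Y h)"
  proof (rule subset_antisym; rule subsetI)
    fix p assume "p \<in> ?T \<inter> mpart X \<times> carrier Y"
    then show "p \<in> agraph (amor_of_hom X Y h)" using TH sameH by auto
  next
    fix p assume p: "p \<in> agraph (amor_of_hom X Y h)"
    obtain x y where xy: "p = (x, y)" by (cases p)
    note am = is_amor_of_hom[OF X Y h]
    have c: "x \<in> mpart X" "y \<in> carrier Y" "x \<in> carrier X" using amorD(5,6)[OF am] p xy mpart_carrier[OF X] by auto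
    obtain z where z: "(x, z) \<in> ?T" using total c by blast
    then have z': "(x, z) \<in> agraph (amor_of_hom X Y h)" "z \<in> carrier Y" using TH sameH c Ts' by auto
    then have "y \<ominus>\<^bsub>Y\<^esub> z \<in> mtors Y"
      using amor_unique[OF am, of x y z] p xy c by (auto simp: mtors_def Y.smult_minus mm_carrier Y.minus_eq_zero_iff)
    then have "(\<zero>\<^bsub>X\<^esub>, y \<ominus>\<^bsub>Y\<^esub> z) \<in> ?T" by (intro span_mod_base) auto
    then have "(x, z) \<oplus>\<^bsub>sum_mod X Y\<^esub> (\<zero>\<^bsub>X\<^esub>, y \<ominus>\<^bsub>Y\<^esub> z) \<in> ?T" using z Ts' by blast
    then show "p \<in> ?T \<inter> mpart X \<times> carrier Y" using c z' xy by (simp add: a_minus_def Y.M.a_lcomm[of z] Y.M.r_neg)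
  qed
  then have eq: "gen_amor X Y S = amor_of_hom X Y h" by (simp add: gen_amor_def amor_of_hom_def)
  show "is_amor X Y (gen_amor X Y S)" unfolding eq by (rule is_amor_of_hom[OF X Y h])
  show "u \<in> elts X \<Longrightarrow> ev (gen_amor X Y S) u = h u" unfolding eq by (rule ev_amor_of_hom[OF X Y h])
qed

subsection \<open>Morphisms induced by linear maps\<close>

lemma hom_mpart:
  assumes X: "module V X" and Y: "module V Y" and g: "g \<in> mod_hom V X Y" and x: "x \<in> mpart X"
  shows "g x \<in> mpart Y"
proof (rule mod_hom_span[OF g X Y mpart_gens[OF X] mpart_submodule[OF Y] _ x[unfolded mpart_def]])
  fix x assume "x \<in> {e \<odot>\<^bsub>X\<^esub> x |e x. e \<in> \<mm> \<and> x \<in> carrier X}"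
  then obtain e z where "x = e \<odot>\<^bsub>X\<^esub> z" "e \<in> \<mm>" "z \<in> carrier X" by auto
  then show "g x \<in> mpart Y"
    using mpart_base[of e "g z" Y] by (simp add: mod_hom_smult[OF g] mm_carrier mod_hom_closed[OF g])
qed

lemma core_map:
  assumes X: "module V X" and Y: "module V Y" and g: "g \<in> mod_hom V X Y"
  obtains h where "h \<in> mod_hom V (core X) (core Y)" "\<And>x. x \<in> mpart X \<Longrightarrow> h (cl X x) = cl Y (g x)"
proof -
  have A: "module V (sub_mod X (mpart X))" by (rule module_sub_mod[OF X mpart_submodule[OF X]])
  have q: "cl X \<in> mod_hom V (sub_mod X (mpart X)) (core X)"
    by (rule mod_homI) (auto simp: cl_closed cl_add[OF X] cl_smult[OF X])
  have f: "(\<lambda>x. cl Y (g x)) \<in> mod_hom V (sub_mod X (mpart X)) (core Y)"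
    by (rule mod_homI) (auto simp: cl_closed hom_mpart[OF X Y g] cl_add[OF Y] cl_smult[OF Y]
        mod_hom_add[OF g] mod_hom_smult[OF g] mpart_carrier[OF X])
  show ?thesis
  proof (rule hom_factor[OF A module_core[OF X] module_core[OF Y] q f])
    show "cl X ` carrier (sub_mod X (mpart X)) = elts X" by (simp add: core_carrier)
  next
    fix x assume x: "x \<in> carrier (sub_mod X (mpart X))" and z: "cl X x = \<zero>\<^bsub>core X\<^esub>"
    have "e \<odot>\<^bsub>Y\<^esub> g x = e \<odot>\<^bsub>Y\<^esub> g \<zero>\<^bsub>X\<^esub>" if e: "e \<in> \<mm>" for e
    proof -
      have x': "x \<in> mpart X" "cl X x = cl X \<zero>\<^bsub>X\<^esub>" using x z by (simp_all add: core_zero)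
      have "e \<odot>\<^bsub>X\<^esub> x = e \<odot>\<^bsub>X\<^esub> \<zero>\<^bsub>X\<^esub>" using cl_eq_iff[OF x'(1)] x'(2) e by blast
      then show ?thesis
        using mod_hom_smult[OF g mm_carrier[OF e] mpart_carrier[OF X x'(1)]]
          mod_hom_smult[OF g mm_carrier[OF e] mpart_carrier[OF X mpart_zero[OF X]]] by simp
    qed
    then show "cl Y (g x) = \<zero>\<^bsub>core Y\<^esub>"
      unfolding core_zero by (intro cl_eqI) (simp add: mod_hom_zero[OF g X Y])
  qed (use that in auto)
qed

lemma gen_amor_linear:
  assumes X: "module V X" and Y: "module V Y" and g: "g \<in> mod_hom V X Y"
    and S: "\<And>x y. (x, y) \<in> S \<Longrightarrow> x \<in> carrier X \<and> y = g x" and dom: "mpart X \<subseteq> span_mod V X (Domain S)"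
  shows is_amor_gen_amor_linear: "is_amor X Y (gen_amor X Y S)"
    and ev_gen_amor_linear: "x \<in> mpart X \<Longrightarrow> ev (gen_amor X Y S) (cl X x) = cl Y (g x)"
proof -
  obtain h where h: "h \<in> mod_hom V (core X) (core Y)" "\<And>x. x \<in> mpart X \<Longrightarrow> h (cl X x) = cl Y (g x)"
    by (rule core_map[OF X Y g], rule that)
  have S': "S \<subseteq> carrier X \<times> carrier Y" using S mod_hom_closed[OF g] by auto
  have c: "cl Y (e \<odot>\<^bsub>Y\<^esub> y) = h (cl X (e \<odot>\<^bsub>X\<^esub> x))" if "(x, y) \<in> S" "e \<in> \<mm>" for x y e
    using S[OF that(1)] that(2) h(2)[OF mpart_base] mod_hom_smult[OF g] mm_carrier by simp
  show "is_amor X Y (gen_amor X Y S)" by (rule is_amor_gen_amor[OF X Y h(1) S' c dom])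
  show "x \<in> mpart X \<Longrightarrow> ev (gen_amor X Y S) (cl X x) = cl Y (g x)"
    by (simp add: ev_gen_amor[OF X Y h(1) S' c dom] h(2) cl_closed)
qed

lemma span_carrier: "module V X \<Longrightarrow> mpart X \<subseteq> span_mod V X (carrier X)"
  by (rule subset_trans[OF _ span_mod_superset]) (auto simp: mpart_carrier)

lemma aid:
  assumes X: "module V X"
  shows is_amor_aid: "is_amor X X (aid X)" and ev_aid: "u \<in> elts X \<Longrightarrow> ev (aid X) u = u"
proof -
  have g: "id \<in> mod_hom V X X" by (rule mod_homI) auto
  have d: "mpart X \<subseteq> span_mod V X (Domain (Id_on (carrier X)))" using span_carrier[OF X] by (simp add: Domain_Id_on)
  have S: "x \<in> carrier X \<and> y = id x" if "(x, y) \<in> Id_on (carrier X)" for x y using that by auto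
  show "is_amor X X (aid X)" unfolding aid_def by (rule is_amor_gen_amor_linear[OF X X g S d])
  assume "u \<in> elts X"
  then obtain x where "x \<in> mpart X" "u = cl X x" by (rule core_cases)
  then show "ev (aid X) u = u" unfolding aid_def using ev_gen_amor_linear[OF X X g S d] by simp
qed

text \<open>By fullness the inverse of the map of cores comes from a morphism, which is an inverse by faithfulness.\<close>

lemma amor_inverse:
  assumes f: "is_amor X Y f" and bij: "bij_betw (ev f) (elts X) (elts Y)"
  obtains g where "is_amor Y X g" "f \<Zsemi> g = aid X" "g \<Zsemi> f = aid Y"
proof -
  note X = amorD(1)[OF f] and Y = amorD(2)[OF f]
  note CX = module_core[OF X] and CY = module_core[OF Y]
  have inj: "inj_on (ev f) (elts X)" and im: "ev f ` elts X = elts Y"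
    using bij by (auto simp: bij_betw_def)
  have idh: "(\<lambda>u. u) \<in> mod_hom V (core Y) (core Y)" by (rule mod_homI) auto
  obtain k where k: "k \<in> mod_hom V (core Y) (core X)" "\<And>u. u \<in> elts Y \<Longrightarrow> ev f (k u) = u"
    using hom_lift[OF CY CX CY ev_hom[OF f] idh inj] im by blast
  let ?g = "amor_of_hom Y X k"
  note g = is_amor_of_hom[OF Y X k(1)] and evg = ev_amor_of_hom[OF Y X k(1)]
  have kf: "k (ev f u) = u" if "u \<in> elts X" for u
    using inj_onD[OF inj, of "k (ev f u)" u] k(2)[OF ev_closed[OF f that]] mod_hom_closed[OF k(1) ev_closed[OF f that]] that by simp
  have "f \<Zsemi> ?g = aid X"
    by (rule amor_eqI[OF is_amor_acomp[OF f g] is_amor_aid[OF X]])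
       (simp add: ev_acomp[OF f g] ev_aid[OF X] evg ev_closed[OF f] kf)
  moreover have "?g \<Zsemi> f = aid Y"
    by (rule amor_eqI[OF is_amor_acomp[OF g f] is_amor_aid[OF Y]])
       (simp add: ev_acomp[OF g f] ev_aid[OF Y] evg k(2))
  ultimately show ?thesis using that g by blast
qed

subsection \<open>Subobjects and quotients\<close>

text \<open>The submodule of the core of \<open>X\<close> that belongs to the subobject \<open>Q\<close>: the image of the core of \<open>Q\<close>.\<close>

definition csub :: "('v, 'x) module \<Rightarrow> 'x set \<Rightarrow> 'x set set" where
  "csub X Q = cl X ` mpart (sub_mod X Q)"

lemma mpart_sub_mod: "submodule N V X \<Longrightarrow> module V X \<Longrightarrow> x \<in> mpart (sub_mod X N) \<Longrightarrow> x \<in> mpart X \<and> x \<in> N"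
  using hom_mpart[OF module_sub_mod, of X N X "\<lambda>x. x"] mpart_carrier[OF module_sub_mod, of X N x]
    submoduleD(1)[of V X N] by (auto simp: mod_hom_def)

lemma csub_submodule:
  assumes X: "module V X" and N: "submodule N V X"
  shows "submodule (csub X N) V (core X)"
proof -
  note SN = module_sub_mod[OF X N]
  have A: "module V (sub_mod (sub_mod X N) (mpart (sub_mod X N)))" by (rule module_sub_mod[OF SN mpart_submodule[OF SN]])
  have "cl X \<in> mod_hom V (sub_mod (sub_mod X N) (mpart (sub_mod X N))) (core X)"
    using mpart_sub_mod[OF N X] by (intro mod_homI) (auto simp: cl_closed cl_add[OF X] cl_smult[OF X])
  from submodule_image[OF this A module_core[OF X] submodule_carrier[OF A]]
  show ?thesis by (simp add: csub_def)
qed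

lemma csubI: "submodule N V X \<Longrightarrow> module V X \<Longrightarrow> e \<in> \<mm> \<Longrightarrow> y \<in> N \<Longrightarrow> cl X (e \<odot>\<^bsub>X\<^esub> y) \<in> csub X N"
  unfolding csub_def using mpart_base[of e y "sub_mod X N"] by simp

lemma csub_induct [consumes 3, case_names base add]:
  assumes X: "module V X" and N: "submodule N V X" and u: "u \<in> csub X N"
    and base: "\<And>e y. e \<in> \<mm> \<Longrightarrow> y \<in> N \<Longrightarrow> P (cl X (e \<odot>\<^bsub>X\<^esub> y))"
    and add: "\<And>u w. u \<in> csub X N \<Longrightarrow> w \<in> csub X N \<Longrightarrow> P u \<Longrightarrow> P w \<Longrightarrow> P (u \<oplus>\<^bsub>core X\<^esub> w)"
  shows "P u"
proof -
  note SN = module_sub_mod[OF X N]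
  obtain x where x: "x \<in> mpart (sub_mod X N)" "u = cl X x" using u by (auto simp: csub_def)
  have "P (cl X x)" using SN x(1)
  proof (induct rule: mpart_induct)
    case (smult e x)
    then show ?case using base[of e x] mpart_sub_mod[OF N X] by simp
  next
    case (add x y)
    then show ?case using assms(5)[of "cl X x" "cl X y"] cl_add[OF X, of x y] mpart_sub_mod[OF N X]
      by (simp add: csub_def)
  qed
  then show ?thesis using x by simp
qed

lemma msat_submodule:
  assumes X: "module V X" and N: "submodule N V X" shows "submodule (msat X N) V X"
proof -
  interpret X: module V X by fact
  note N' = submoduleD[OF X N]
  have sm: "e \<odot>\<^bsub>X\<^esub> (v \<odot>\<^bsub>X\<^esub> x) \<in> N" if "v \<in> carrier V" "e \<in> \<mm>" "x \<in> carrier X" "\<forall>e\<in>\<mm>. e \<odot>\<^bsub>X\<^esub> x \<in> N" for e v x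
    using that N'(4)[OF that(1), of "e \<odot>\<^bsub>X\<^esub> x"] by (simp add: X.smult_assoc1[symmetric] mm_carrier m_comm)
  show ?thesis unfolding submodule_iff[OF X] msat_def
    using N'(2,3) sm by (auto simp: mm_carrier X.smult_r_distr)
qed

lemma msat_superset: "module V X \<Longrightarrow> submodule N V X \<Longrightarrow> N \<subseteq> msat X N"
  using submoduleD(1,4)[of V X N] mm_carrier unfolding msat_def by blast

lemma msat_mono: "N \<subseteq> N' \<Longrightarrow> msat X N \<subseteq> msat X N'"
  unfolding msat_def by auto

lemma msat_eqD: "x \<in> carrier X \<Longrightarrow> module V X \<Longrightarrow> submodule N V X \<Longrightarrow> (\<And>e. e \<in> \<mm> \<Longrightarrow> e \<odot>\<^bsub>X\<^esub> x \<in> msat X N) \<Longrightarrow> x \<in> msat X N"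
  using mm_double[of X N x] unfolding msat_def by blast

text \<open>If \<open>a y\<close> and \<open>b y\<close> lie in \<open>N\<close> for \<open>a\<close>, \<open>b\<close> in \<open>\<mm>\<close>, then \<open>a b y\<close> lies in \<open>\<mm>N\<close>, and such products \<open>a b\<close> span \<open>\<mm>\<close>.\<close>

lemma csub_msat:
  assumes X: "module V X" and N: "submodule N V X" shows "csub X (msat X N) = csub X N"
proof (rule subset_antisym; rule subsetI)
  note S = msat_submodule[OF X N]
  fix u assume "u \<in> csub X (msat X N)"
  with X S show "u \<in> csub X N"
  proof (induct rule: csub_induct)
    case (base e y)
    have y: "y \<in> carrier X" using base by (auto simp: msat_def)
    have "submodule {x \<in> carrier X. x \<in> mpart (sub_mod X N)} V X"
      using mpart_submodule[OF module_sub_mod[OF X N]] mpart_sub_mod[OF N X] submoduleD(1)[OF X N]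
      unfolding submodule_iff[OF X] submodule_iff[OF module_sub_mod[OF X N]] by auto
    from mm_double[OF X this y base(1)] have "e \<odot>\<^bsub>X\<^esub> y \<in> mpart (sub_mod X N)"
      using base mpart_base[of _ _ "sub_mod X N"] submoduleD(1)[OF X N] submoduleD(4)[OF X N mm_carrier] by (auto simp: msat_def)
    then show ?case by (simp add: csub_def)
  next
    case (add u w)
    then show ?case using submoduleD(3)[OF module_core[OF X] csub_submodule[OF X N]] by blast
  qed
next
  fix u assume "u \<in> csub X N"
  with X N show "u \<in> csub X (msat X N)"
  proof (induct rule: csub_induct)
    case (base e y)
    then show ?case using csubI[OF msat_submodule[OF X N] X] msat_superset[OF X N] by blast
  next
    case (add u w)
    then show ?case using submoduleD(3)[OF module_core[OF X] csub_submodule[OF X msat_submodule[OF X N]]] by blast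
  qed
qed

lemma aincl:
  assumes X: "module V X" and N: "submodule N V X"
  shows is_amor_aincl: "is_amor (sub_mod X N) X (aincl X N)"
    and ev_aincl: "x \<in> mpart (sub_mod X N) \<Longrightarrow> ev (aincl X N) (cl (sub_mod X N) x) = cl X x"
    and ev_aincl_inj: "inj_on (ev (aincl X N)) (elts (sub_mod X N))"
    and ev_aincl_image: "ev (aincl X N) ` elts (sub_mod X N) = csub X N"
proof -
  note SN = module_sub_mod[OF X N]
  have g: "(\<lambda>x. x) \<in> mod_hom V (sub_mod X N) X" by (rule mod_homI) (use submoduleD(1)[OF X N] in auto)
  have d: "mpart (sub_mod X N) \<subseteq> span_mod V (sub_mod X N) (Domain (Id_on N))"
    using span_carrier[OF SN] by (simp add: Domain_Id_on)
  have S: "x \<in> carrier (sub_mod X N) \<and> y = x" if "(x, y) \<in> Id_on N" for x y using that by auto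
  show am: "is_amor (sub_mod X N) X (aincl X N)"
    unfolding aincl_def by (rule is_amor_gen_amor_linear[OF SN X g S d])
  show e: "ev (aincl X N) (cl (sub_mod X N) x) = cl X x" if "x \<in> mpart (sub_mod X N)" for x
    unfolding aincl_def using ev_gen_amor_linear[OF SN X g S d that] .
  show "inj_on (ev (aincl X N)) (elts (sub_mod X N))"
  proof (rule inj_onI)
    fix u w assume "u \<in> elts (sub_mod X N)" "w \<in> elts (sub_mod X N)" and eq: "ev (aincl X N) u = ev (aincl X N) w"
    then obtain x y where x: "x \<in> mpart (sub_mod X N)" "u = cl (sub_mod X N) x" "y \<in> mpart (sub_mod X N)" "w = cl (sub_mod X N) y"
      by (meson core_cases)
    then have "cl X x = cl X y" using eq e by simp
    then have "\<forall>e\<in>\<mm>. e \<odot>\<^bsub>X\<^esub> x = e \<odot>\<^bsub>X\<^esub> y" using cl_eq_iff mpart_sub_mod[OF N X x(1)] by metis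
    then show "u = w" unfolding x by (intro cl_eqI) simp
  qed
  show "ev (aincl X N) ` elts (sub_mod X N) = csub X N"
    unfolding core_carrier csub_def image_image using e by simp
qed

lemma aproj:
  assumes X: "module V X" and N: "submodule N V X"
  shows module_quot_mod: "module V (quot_mod X N)"
    and is_amor_aproj: "is_amor X (quot_mod X N) (aproj X N)"
    and ev_aproj: "x \<in> mpart X \<Longrightarrow> ev (aproj X N) (cl X x) = cl (quot_mod X N) (N +>\<^bsub>X\<^esub> x)"
    and ev_aproj_surj: "ev (aproj X N) ` elts X = elts (quot_mod X N)"
proof -
  interpret Q: quotient V X N by (rule quotientI[OF X N])
  note Y = Q.module_quot
  show "module V (quot_mod X N)" by fact
  let ?S = "{(x, N +>\<^bsub>X\<^esub> x) |x. x \<in> carrier X}"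
  have "Domain ?S = carrier X" by auto
  then have d: "mpart X \<subseteq> span_mod V X (Domain ?S)" using span_carrier[OF X] by simp
  have S: "x \<in> carrier X \<and> y = N +>\<^bsub>X\<^esub> x" if "(x, y) \<in> ?S" for x y using that by auto
  show am: "is_amor X (quot_mod X N) (aproj X N)"
    unfolding aproj_def by (rule is_amor_gen_amor_linear[OF X Y Q.coset_hom S d])
  show e: "ev (aproj X N) (cl X x) = cl (quot_mod X N) (N +>\<^bsub>X\<^esub> x)" if "x \<in> mpart X" for x
    unfolding aproj_def using ev_gen_amor_linear[OF X Y Q.coset_hom S d that] .
  show "ev (aproj X N) ` elts X = elts (quot_mod X N)"
  proof (rule subset_antisym; rule subsetI)
    fix w assume "w \<in> elts (quot_mod X N)"
    then show "w \<in> ev (aproj X N) ` elts X"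
    proof (rule core_divisible[OF Y, rotated])
      show "submodule (ev (aproj X N) ` elts X) V (core (quot_mod X N))"
        by (rule submodule_image[OF ev_hom[OF am] module_core[OF X] module_core[OF Y] submodule_carrier[OF module_core[OF X]]])
    next
      fix a w assume a: "a \<in> \<mm>" and "w \<in> elts (quot_mod X N)"
      then obtain y where y: "y \<in> mpart (quot_mod X N)" "w = cl (quot_mod X N) y" by (meson core_cases)
      then obtain x where x: "x \<in> carrier X" "y = N +>\<^bsub>X\<^esub> x"
        using mpart_carrier[OF Y y(1)] by (auto simp: Q.carrier_quot)
      have "ev (aproj X N) (cl X (a \<odot>\<^bsub>X\<^esub> x)) = a \<odot>\<^bsub>core (quot_mod X N)\<^esub> w"
        using e[OF mpart_base[OF a x(1)]] y x a by (simp add: Q.coset_smult[symmetric] mm_carrier cl_smult[OF Y])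
      then show "a \<odot>\<^bsub>core (quot_mod X N)\<^esub> w \<in> ev (aproj X N) ` elts X"
        using cl_closed[OF mpart_base[OF a x(1)]] by (metis imageI)
    qed
  qed (use ev_closed[OF am] in auto)
qed

lemma csub_mem_iff:
  assumes X: "module V X" and N: "submodule N V X" and x: "x \<in> mpart X"
  shows "(\<forall>e\<in>\<mm>. e \<odot>\<^bsub>core X\<^esub> cl X x \<in> csub X N) \<longleftrightarrow> x \<in> msat X N"
proof
  interpret X: module V X by fact
  assume l: "\<forall>e\<in>\<mm>. e \<odot>\<^bsub>core X\<^esub> cl X x \<in> csub X N"
  have xc: "x \<in> carrier X" using mpart_carrier[OF X x] .
  show "x \<in> msat X N" unfolding msat_def
  proof (intro CollectI conjI ballI xc)
    fix e assume e: "e \<in> \<mm>"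
    show "e \<odot>\<^bsub>X\<^esub> x \<in> N"
    proof (rule mm_double[OF X N xc e])
      fix a b assume ab: "a \<in> \<mm>" "b \<in> \<mm>"
      have "cl X (b \<odot>\<^bsub>X\<^esub> x) \<in> csub X N" using l ab x cl_smult[OF X mm_carrier[OF ab(2)] x] by auto
      then obtain y where y: "y \<in> mpart (sub_mod X N)" "cl X (b \<odot>\<^bsub>X\<^esub> x) = cl X y" by (auto simp: csub_def)
      then have "a \<odot>\<^bsub>X\<^esub> (b \<odot>\<^bsub>X\<^esub> x) = a \<odot>\<^bsub>X\<^esub> y"
        using cl_eq_iff[OF mpart_smult[OF X mm_carrier[OF ab(2)] x]] ab by blast
      then show "a \<odot>\<^bsub>X\<^esub> (b \<odot>\<^bsub>X\<^esub> x) \<in> N"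
        using submoduleD(4)[OF X N mm_carrier[OF ab(1)]] mpart_sub_mod[OF N X y(1)] by simp
    qed
  qed
next
  assume r: "x \<in> msat X N"
  show "\<forall>e\<in>\<mm>. e \<odot>\<^bsub>core X\<^esub> cl X x \<in> csub X N"
  proof
    fix e assume e: "e \<in> \<mm>"
    then have "cl X (e \<odot>\<^bsub>X\<^esub> x) \<in> csub X (msat X N)" using csubI[OF msat_submodule[OF X N] X e r] by simp
    then show "e \<odot>\<^bsub>core X\<^esub> cl X x \<in> csub X N" using e x by (simp add: csub_msat[OF X N] cl_smult[OF X] mm_carrier)
  qed
qed

text \<open>The core of a quotient is the quotient of the cores by the saturation of the submodule, whence the
  scalars on the right.\<close>

lemma ev_aproj_zero_iff:
  assumes X: "module V X" and N: "submodule N V X" and u: "u \<in> elts X"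
  shows "ev (aproj X (msat X N)) u = \<zero>\<^bsub>core (quot_mod X (msat X N))\<^esub> \<longleftrightarrow> (\<forall>e\<in>\<mm>. e \<odot>\<^bsub>core X\<^esub> u \<in> csub X N)"
proof -
  note S = msat_submodule[OF X N]
  interpret Q: quotient V X "msat X N" by (rule quotientI[OF X S])
  note Y = Q.module_quot
  interpret Y: module V "quot_mod X (msat X N)" by (rule Y)
  obtain x where x: "x \<in> mpart X" "u = cl X x" using u by (rule core_cases)
  note xc = mpart_carrier[OF X x(1)]
  have xm: "msat X N +>\<^bsub>X\<^esub> x \<in> mpart (quot_mod X (msat X N))" by (rule hom_mpart[OF X Y Q.coset_hom x(1)])
  have "ev (aproj X (msat X N)) u = \<zero>\<^bsub>core (quot_mod X (msat X N))\<^esub> \<longleftrightarrow>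
    (\<forall>e\<in>\<mm>. e \<odot>\<^bsub>quot_mod X (msat X N)\<^esub> (msat X N +>\<^bsub>X\<^esub> x) = \<zero>\<^bsub>quot_mod X (msat X N)\<^esub>)"
    unfolding x(2) ev_aproj[OF X S x(1)] core_zero cl_eq_iff[OF xm] by (simp add: mm_carrier)
  also have "\<dots> \<longleftrightarrow> (\<forall>e\<in>\<mm>. e \<odot>\<^bsub>X\<^esub> x \<in> msat X N)"
    using xc by (simp add: Q.coset_smult mm_carrier Q.coset_eq_zero_iff)
  also have "\<dots> \<longleftrightarrow> x \<in> msat X N"
    using msat_eqD[OF xc X N] submoduleD(4)[OF X S mm_carrier] by blast
  finally show ?thesis using csub_mem_iff[OF X N x(1)] x(2) by simp
qed

lemma Range_submodule:
  assumes X: "module V X" and Y: "module V Y" and G: "submodule G V (sum_mod X Y)"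
  shows "submodule (Range G) V Y"
proof -
  have "snd \<in> mod_hom V (sum_mod X Y) Y" by (rule mod_homI) auto
  from submodule_image[OF this module_sum_mod[OF X Y] Y G] show ?thesis by (simp add: Range_snd)
qed

lemma amor_Range: "is_amor X Y f \<Longrightarrow> submodule (Range (agraph f)) V Y"
  by (rule Range_submodule) (auto simp: is_amor_def)

lemma aimage_submodule: "is_amor X Y f \<Longrightarrow> submodule (aimage f) V Y"
  unfolding aimage_def using msat_submodule[OF amorD(2) amor_Range] amorD(4) by metis

text \<open>The range of the graph of \<open>f\<close> may contain elements outside \<open>\<mm>Y\<close> and torsion; neither is seen by cores.\<close>

lemma csub_Range:
  assumes f: "is_amor X Y f"
  shows "csub Y (Range (agraph f)) = ev f ` elts X"
proof (rule subset_antisym; rule subsetI)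
  note X = amorD(1)[OF f] and Y = amorD(2)[OF f]
  have sub: "submodule (ev f ` elts X) V (core Y)"
    by (rule submodule_image[OF ev_hom[OF f] module_core[OF X] module_core[OF Y] submodule_carrier[OF module_core[OF X]]])
  fix u assume "u \<in> csub Y (Range (agraph f))"
  with Y amor_Range[OF f] show "u \<in> ev f ` elts X"
  proof (induct rule: csub_induct)
    case (base e y)
    then obtain x where xy: "(x, y) \<in> agraph f" by auto
    then have "ev f (cl X (e \<odot>\<^bsub>X\<^esub> x)) = cl Y (e \<odot>\<^bsub>Y\<^esub> y)"
      using ev_cl[OF f amorD(8)[OF f mm_carrier[OF base(1)] xy]] mpart_base[OF base(1) amorD(6)[OF f xy]] by simp
    then show ?case
      using cl_closed[OF mpart_smult[OF X mm_carrier[OF base(1)] amorD(5)[OF f xy]]] by (metis imageI)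
  next
    case (add u w)
    then show ?case using submoduleD(3)[OF module_core[OF Y] sub] by blast
  qed
next
  note X = amorD(1)[OF f] and Y = amorD(2)[OF f]
  fix w assume "w \<in> ev f ` elts X"
  then obtain u where u: "u \<in> elts X" "w = ev f u" by auto
  have "u \<in> {u \<in> elts X. ev f u \<in> csub Y (Range (agraph f))}"
    using X _ u(1)
  proof (rule core_divisible)
    show "submodule {u \<in> elts X. ev f u \<in> csub Y (Range (agraph f))} V (core X)"
      by (rule submodule_preimage[OF ev_hom[OF f] module_core[OF X] module_core[OF Y] csub_submodule[OF Y amor_Range[OF f]]])
  next
    fix e u assume e: "e \<in> \<mm>" and u: "u \<in> elts X"
    then obtain x where x: "x \<in> mpart X" "u = cl X x" by (meson core_cases)
    obtain y where y: "(x, y) \<in> agraph f" "y \<in> mpart Y" "ev f (cl X x) = cl Y y" using ev_ex[OF f x(1)] .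
    have "ev f (e \<odot>\<^bsub>core X\<^esub> u) = cl Y (e \<odot>\<^bsub>Y\<^esub> y)"
      using mod_hom_smult[OF ev_hom[OF f] mm_carrier[OF e] u] x y cl_smult[OF Y mm_carrier[OF e] y(2)] by simp
    moreover have "y \<in> Range (agraph f)" using y(1) by auto
    ultimately show "e \<odot>\<^bsub>core X\<^esub> u \<in> {u \<in> elts X. ev f u \<in> csub Y (Range (agraph f))}"
      using csubI[OF amor_Range[OF f] Y e] module.smult_closed[OF module_core[OF X] mm_carrier[OF e] u] by simp
  qed
  then show "w \<in> csub Y (Range (agraph f))" using u by simp
qed

lemma ev_aincl_aimage:
  assumes f: "is_amor X Y f"
  shows "ev (aincl Y (aimage f)) ` elts (sub_mod Y (aimage f)) = ev f ` elts X"
  using ev_aincl_image[OF amorD(2)[OF f] aimage_submodule[OF f]] csub_msat[OF amorD(2)[OF f] amor_Range[OF f]]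
    csub_Range[OF f] amorD(4)[OF f] by (simp add: aimage_def)

lemma ev_aproj_aimage_zero_iff:
  assumes f: "is_amor X Y f" and u: "u \<in> elts Y"
  shows "ev (aproj Y (aimage f)) u = \<zero>\<^bsub>core (quot_mod Y (aimage f))\<^esub> \<longleftrightarrow>
    (\<forall>e\<in>\<mm>. e \<odot>\<^bsub>core Y\<^esub> u \<in> ev f ` elts X)"
  using ev_aproj_zero_iff[OF amorD(2)[OF f] amor_Range[OF f] u] csub_Range[OF f] amorD(4)[OF f] by (simp add: aimage_def)

subsection \<open>Factorizations\<close>

lemma adescend:
  assumes q: "is_amor X Y q" and f: "is_amor X Z f"
    and surj: "ev q ` elts X = elts Y"
    and ker: "\<And>u. u \<in> elts X \<Longrightarrow> ev q u = \<zero>\<^bsub>core Y\<^esub> \<Longrightarrow> ev f u = \<zero>\<^bsub>core Z\<^esub>"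
  shows is_amor_adescend: "is_amor Y Z (adescend q f)"
    and ev_adescend: "u \<in> elts X \<Longrightarrow> ev (adescend q f) (ev q u) = ev f u"
proof -
  note X = amorD(1)[OF q] and Y = amorD(2)[OF q] and Z = amorD(2)[OF f]
  obtain k where k: "k \<in> mod_hom V (core Y) (core Z)" "\<And>u. u \<in> elts X \<Longrightarrow> k (ev q u) = ev f u"
    using hom_factor[OF module_core[OF X] module_core[OF Y] module_core[OF Z] ev_hom[OF q] ev_hom[OF f] surj ker] by blast
  let ?S = "(agraph q)\<inverse> O agraph f"
  have S: "?S \<subseteq> carrier Y \<times> carrier Z" using amorD(6)[OF q] amorD(6)[OF f] by auto
  have c: "cl Z (e \<odot>\<^bsub>Z\<^esub> z) = k (cl Y (e \<odot>\<^bsub>Y\<^esub> y))" if "(y, z) \<in> ?S" "e \<in> \<mm>" for y z e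
  proof -
    obtain x where x: "(x, y) \<in> agraph q" "(x, z) \<in> agraph f" using \<open>(y, z) \<in> ?S\<close> by auto
    note x' = amorD(5)[OF q x(1)]
    have "cl Y (e \<odot>\<^bsub>Y\<^esub> y) = e \<odot>\<^bsub>core Y\<^esub> ev q (cl X x)" using agraph_iff[OF q] x(1) that by blast
    moreover have "cl Z (e \<odot>\<^bsub>Z\<^esub> z) = e \<odot>\<^bsub>core Z\<^esub> ev f (cl X x)" using agraph_iff[OF f] x(2) that by blast
    ultimately show ?thesis
      using mod_hom_smult[OF k(1) mm_carrier[OF that(2)] ev_closed[OF q cl_closed[OF x']]] k(2)[OF cl_closed[OF x']] by simp
  qed
  have "mpart Y \<subseteq> Domain ?S"
  proof
    fix y assume y: "y \<in> mpart Y"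
    then obtain u where "u \<in> elts X" "cl Y y = ev q u" using surj cl_closed by (metis imageE)
    then obtain x where x: "x \<in> mpart X" "cl Y y = ev q (cl X x)" by (metis core_cases)
    obtain z where z: "(x, z) \<in> agraph f" using amor_total[OF f x(1)] by blast
    have "(x, y) \<in> agraph q" unfolding agraph_iff[OF q]
      using x y mpart_carrier[OF Y y] by (simp add: x(2)[symmetric] cl_smult[OF Y] mm_carrier)
    then show "y \<in> Domain ?S" using z by auto
  qed
  then have d: "mpart Y \<subseteq> span_mod V Y (Domain ?S)" using span_mod_superset[of "Domain ?S" V Y] by (rule subset_trans)
  have ad: "adescend q f = gen_amor Y Z ?S" using amorD(4)[OF q] amorD(4)[OF f] by (simp add: adescend_def)
  show "is_amor Y Z (adescend q f)" unfolding ad by (rule is_amor_gen_amor[OF Y Z k(1) S c d])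
  assume "u \<in> elts X"
  then show "ev (adescend q f) (ev q u) = ev f u" unfolding ad
    using ev_gen_amor[OF Y Z k(1) S c d] k(2) ev_closed[OF q] by simp
qed

lemma alift:
  assumes i: "is_amor Z Y i" and f: "is_amor X Y f"
    and inj: "inj_on (ev i) (elts Z)"
    and im: "\<And>u. u \<in> elts X \<Longrightarrow> ev f u \<in> ev i ` elts Z"
  shows is_amor_alift: "is_amor X Z (alift i f)"
    and ev_alift: "u \<in> elts X \<Longrightarrow> ev i (ev (alift i f) u) = ev f u"
proof -
  note X = amorD(1)[OF f] and Y = amorD(2)[OF f] and Z = amorD(1)[OF i]
  obtain k where k: "k \<in> mod_hom V (core X) (core Z)" "\<And>u. u \<in> elts X \<Longrightarrow> ev i (k u) = ev f u"
    using hom_lift[OF module_core[OF X] module_core[OF Z] module_core[OF Y] ev_hom[OF i] ev_hom[OF f] inj im] by blast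
  let ?S = "agraph f O (agraph i)\<inverse>"
  have S: "?S \<subseteq> carrier X \<times> carrier Z"
    using amorD(5)[OF f] amorD(5)[OF i] mpart_carrier[OF X] mpart_carrier[OF Z] by auto
  have c: "cl Z (e \<odot>\<^bsub>Z\<^esub> z) = k (cl X (e \<odot>\<^bsub>X\<^esub> x))" if "(x, z) \<in> ?S" "e \<in> \<mm>" for x z e
  proof -
    obtain y where y: "(x, y) \<in> agraph f" "(z, y) \<in> agraph i" using \<open>(x, z) \<in> ?S\<close> by auto
    note x' = amorD(5)[OF f y(1)] and z' = amorD(5)[OF i y(2)]
    have "e \<odot>\<^bsub>core Y\<^esub> ev f (cl X x) = cl Y (e \<odot>\<^bsub>Y\<^esub> y)" using agraph_iff[OF f] y(1) that by metis
    also have "\<dots> = e \<odot>\<^bsub>core Y\<^esub> ev i (cl Z z)" using agraph_iff[OF i] y(2) that by metis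
    finally have "ev i (cl Z (e \<odot>\<^bsub>Z\<^esub> z)) = ev i (k (cl X (e \<odot>\<^bsub>X\<^esub> x)))"
      using mod_hom_smult[OF ev_hom[OF i] mm_carrier[OF that(2)]] mod_hom_smult[OF ev_hom[OF f] mm_carrier[OF that(2)]]
        cl_closed[OF x'] cl_closed[OF z'] k(2)[OF cl_closed[OF mpart_smult[OF X mm_carrier[OF that(2)] x']]]
      by (simp add: cl_smult[OF Z mm_carrier[OF that(2)] z', symmetric] cl_smult[OF X mm_carrier[OF that(2)] x', symmetric])
    then show ?thesis
      using inj_onD[OF inj] cl_closed[OF mpart_smult[OF Z mm_carrier[OF that(2)] z']]
        mod_hom_closed[OF k(1) cl_closed[OF mpart_smult[OF X mm_carrier[OF that(2)] x']]] by blast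
  qed
  have "mpart X \<subseteq> Domain ?S"
  proof
    fix x assume x: "x \<in> mpart X"
    obtain z where z: "z \<in> mpart Z" "ev f (cl X x) = ev i (cl Z z)"
    proof -
      obtain w where w: "w \<in> elts Z" "ev f (cl X x) = ev i w" using im[OF cl_closed[OF x]] by auto
      obtain z where "z \<in> mpart Z" "w = cl Z z" using w(1) by (rule core_cases)
      then show ?thesis using that w(2) by simp
    qed
    obtain y where y: "(x, y) \<in> agraph f" using amor_total[OF f x] by blast
    then have "(z, y) \<in> agraph i" using agraph_iff[OF f] agraph_iff[OF i] z by auto
    then show "x \<in> Domain ?S" using y by auto
  qed
  then have d: "mpart X \<subseteq> span_mod V X (Domain ?S)" using span_mod_superset[of "Domain ?S" V X] by (rule subset_trans)
  have ad: "alift i f = gen_amor X Z ?S" using amorD(3)[OF i] amorD(3)[OF f] by (simp add: alift_def)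
  show "is_amor X Z (alift i f)" unfolding ad by (rule is_amor_gen_amor[OF X Z k(1) S c d])
  assume "u \<in> elts X"
  then show "ev i (ev (alift i f) u) = ev f u" unfolding ad
    using ev_gen_amor[OF X Z k(1) S c d] k(2) by simp
qed

section \<open>Tensor products and bilinear maps of cores\<close>

lemma V_cring: "cring V" by (rule is_cring)

lemma pt_closed: "module V X \<Longrightarrow> module V Y \<Longrightarrow> x \<in> carrier X \<Longrightarrow> y \<in> carrier Y \<Longrightarrow> pure_tens V X Y x y \<in> carrier (X \<otimes>\<^sub>m Y)"
  by (rule tensor_product.pt_closed[OF tensor_productI])

lemmas pt_bilin = bilinD[OF tensor_product.pt_bilin[OF tensor_productI]]
lemmas module_tens = tensor_product.module_tens[OF tensor_productI]

lemma pt_double: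
  assumes "module V X" "module V Y" "x \<in> carrier X" "y \<in> carrier Y" "a \<in> carrier V" "b \<in> carrier V"
  shows "pure_tens V X Y (a \<odot>\<^bsub>X\<^esub> x) (b \<odot>\<^bsub>Y\<^esub> y) = (a \<otimes> b) \<odot>\<^bsub>X \<otimes>\<^sub>m Y\<^esub> pure_tens V X Y x y"
  using assms module.smult_closed[OF assms(2)] pt_closed[OF assms(1,2)]
  by (simp add: pt_bilin(4)[OF assms(1,2)] pt_bilin(5)[OF assms(1,2)] module.smult_assoc1[OF module_tens[OF assms(1,2)]])

text \<open>\<open>\<mm>(X \<otimes> Y)\<close> is spanned by \<open>\<mm>X \<otimes> \<mm>Y\<close>, since \<open>(a b)(x \<otimes> y) = a x \<otimes> b y\<close> and products \<open>a b\<close> span \<open>\<mm>\<close>.\<close>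

lemma tens_mpart_induct [consumes 3, case_names pure zero add]:
  assumes X: "module V X" and Y: "module V Y" and t: "t \<in> mpart (X \<otimes>\<^sub>m Y)"
    and pure: "\<And>x y. x \<in> mpart X \<Longrightarrow> y \<in> mpart Y \<Longrightarrow> P (pure_tens V X Y x y)"
    and zero: "P \<zero>\<^bsub>X \<otimes>\<^sub>m Y\<^esub>"
    and add: "\<And>s t. s \<in> mpart (X \<otimes>\<^sub>m Y) \<Longrightarrow> t \<in> mpart (X \<otimes>\<^sub>m Y) \<Longrightarrow> P s \<Longrightarrow> P t \<Longrightarrow> P (s \<oplus>\<^bsub>X \<otimes>\<^sub>m Y\<^esub> t)"
  shows "P t"
proof -
  interpret T: tensor_product V X Y by (rule tensor_productI[OF X Y])
  note TM = T.module_tens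
  interpret M: module V "X \<otimes>\<^sub>m Y" by (rule TM)
  have gens: "{pure_tens V X Y x y |x y. x \<in> carrier X \<and> y \<in> carrier Y} \<subseteq> carrier (X \<otimes>\<^sub>m Y)"
    using T.pt_closed by auto
  have *: "\<forall>e\<in>\<mm>. P (e \<odot>\<^bsub>X \<otimes>\<^sub>m Y\<^esub> t)" if t: "t \<in> carrier (X \<otimes>\<^sub>m Y)" for t
    using TM gens T.tens_span[OF t]
  proof (induct rule: span_mod_induct)
    case (base s)
    then obtain x y where s: "s = pure_tens V X Y x y" "x \<in> carrier X" "y \<in> carrier Y" by auto
    show ?case
    proof
      fix e assume "e \<in> \<mm>"
      then show "P (e \<odot>\<^bsub>X \<otimes>\<^sub>m Y\<^esub> s)"
      proof (induct rule: mm_induct)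
        case (mult a b)
        then show ?case unfolding s(1)
          using pure[OF mpart_base[OF mult(1) s(2)] mpart_base[OF mult(2) s(3)]] s
          by (simp add: pt_double[OF X Y] mm_carrier)
      next
        case (add a b)
        have sc: "s \<in> carrier (X \<otimes>\<^sub>m Y)" using s T.pt_closed by simp
        show ?case
          using assms(6)[OF mpart_base[OF add(1) sc] mpart_base[OF add(2) sc] add(3,4)] add(1,2) sc
          by (simp add: M.smult_l_distr mm_carrier)
      qed
    qed
  next
    case (add s t)
    then show ?case using assms(6)[OF mpart_base mpart_base] by (simp add: M.smult_r_distr mm_carrier)
  next
    case (smult v s)
    have "e \<odot>\<^bsub>X \<otimes>\<^sub>m Y\<^esub> (v \<odot>\<^bsub>X \<otimes>\<^sub>m Y\<^esub> s) = (v \<otimes> e) \<odot>\<^bsub>X \<otimes>\<^sub>m Y\<^esub> s" if "e \<in> \<mm>" for e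
      using smult that by (simp add: M.smult_assoc1[symmetric] mm_carrier m_comm)
    then show ?case using smult mm_mult[OF smult(1)] by simp
  qed (use zero in \<open>simp add: mm_carrier\<close>)
  show ?thesis using TM t
  proof (induct rule: mpart_induct)
    case (smult e x)
    then show ?case using * mpart_carrier[OF TM] by blast
  qed (rule add)
qed

lemma pt_mpart:
  assumes X: "module V X" and Y: "module V Y" and x: "x \<in> mpart X" and y: "y \<in> carrier Y"
  shows "pure_tens V X Y x y \<in> mpart (X \<otimes>\<^sub>m Y)"
proof -
  have "(\<lambda>x. pure_tens V X Y x y) \<in> mod_hom V X (X \<otimes>\<^sub>m Y)"
    using tensor_product.pt_bilin[OF tensor_productI[OF X Y]] y by (simp add: bilin_def)
  then show ?thesis by (rule hom_mpart[OF X module_tens[OF X Y] _ x])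
qed

text \<open>The class of \<open>x \<otimes> y\<close> as a function of the classes of \<open>x\<close> and \<open>y\<close>.\<close>

definition ptc :: "('v, 'x) module \<Rightarrow> ('v, 'y) module \<Rightarrow> 'x set \<Rightarrow> 'y set \<Rightarrow> ('v, 'x, 'y) tens set" where
  "ptc X Y C D = (\<Union>x\<in>C. \<Union>y\<in>D. cl (X \<otimes>\<^sub>m Y) (pure_tens V X Y x y))"

lemma ptc_cl:
  assumes X: "module V X" and Y: "module V Y" and x: "x \<in> mpart X" "y \<in> mpart Y"
  shows "ptc X Y (cl X x) (cl Y y) = cl (X \<otimes>\<^sub>m Y) (pure_tens V X Y x y)"
proof -
  have "cl (X \<otimes>\<^sub>m Y) (pure_tens V X Y a b) = cl (X \<otimes>\<^sub>m Y) (pure_tens V X Y x y)" if "a \<in> cl X x" "b \<in> cl Y y" for a b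
  proof (rule cl_eqI)
    fix e assume e: "e \<in> \<mm>"
    have ab: "a \<in> carrier X" "b \<in> carrier Y" "x \<in> carrier X" "y \<in> carrier Y"
      "e \<odot>\<^bsub>X\<^esub> a = e \<odot>\<^bsub>X\<^esub> x" "e \<odot>\<^bsub>Y\<^esub> b = e \<odot>\<^bsub>Y\<^esub> y"
      using that e x mpart_carrier[OF X] mpart_carrier[OF Y] by (auto simp: cl_def)
    then show "e \<odot>\<^bsub>X \<otimes>\<^sub>m Y\<^esub> pure_tens V X Y a b = e \<odot>\<^bsub>X \<otimes>\<^sub>m Y\<^esub> pure_tens V X Y x y"
      using pt_bilin(4)[OF X Y mm_carrier[OF e] ab(1,2)] pt_bilin(5)[OF X Y mm_carrier[OF e] ab(3,2)]
        pt_bilin(4)[OF X Y mm_carrier[OF e] ab(3,2)] pt_bilin(5)[OF X Y mm_carrier[OF e] ab(3,4)] by simp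
  qed
  moreover have "cl X x \<noteq> {}" "cl Y y \<noteq> {}" using cl_self[OF x(1)] cl_self[OF x(2)] by auto
  ultimately show ?thesis by (simp add: ptc_def cong: SUP_cong)
qed

lemma ptc_bilin:
  assumes X: "module V X" and Y: "module V Y"
  shows "bilin V (core X) (core Y) (core (X \<otimes>\<^sub>m Y)) (ptc X Y)"
proof (rule bilinI)
  note T = module_tens[OF X Y]
  show "ptc X Y x y \<in> elts (X \<otimes>\<^sub>m Y)" if "x \<in> elts X" "y \<in> elts Y" for x y
    using that by (auto elim!: core_cases simp: ptc_cl[OF X Y] cl_closed pt_mpart[OF X Y] mpart_carrier[OF Y])
  show "ptc X Y (x \<oplus>\<^bsub>core X\<^esub> x') y = ptc X Y x y \<oplus>\<^bsub>core (X \<otimes>\<^sub>m Y)\<^esub> ptc X Y x' y"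
    if xy: "x \<in> elts X" "x' \<in> elts X" "y \<in> elts Y" for x x' y
  proof -
    obtain a a' b where ab: "a \<in> mpart X" "a' \<in> mpart X" "b \<in> mpart Y" "x = cl X a" "x' = cl X a'" "y = cl Y b"
      using xy by (meson core_cases)
    note c = mpart_carrier[OF X ab(1)] mpart_carrier[OF X ab(2)] mpart_carrier[OF Y ab(3)]
    show ?thesis unfolding ab(4-6) cl_add[OF X ab(1,2)] ptc_cl[OF X Y mpart_add[OF X ab(1,2)] ab(3)]
        ptc_cl[OF X Y ab(1,3)] ptc_cl[OF X Y ab(2,3)] cl_add[OF T pt_mpart[OF X Y ab(1) c(3)] pt_mpart[OF X Y ab(2) c(3)]]
        pt_bilin(2)[OF X Y c] ..
  qed
  show "ptc X Y x (y \<oplus>\<^bsub>core Y\<^esub> y') = ptc X Y x y \<oplus>\<^bsub>core (X \<otimes>\<^sub>m Y)\<^esub> ptc X Y x y'"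
    if xy: "x \<in> elts X" "y \<in> elts Y" "y' \<in> elts Y" for x y y'
  proof -
    obtain a b b' where ab: "a \<in> mpart X" "b \<in> mpart Y" "b' \<in> mpart Y" "x = cl X a" "y = cl Y b" "y' = cl Y b'"
      using xy by (meson core_cases)
    note c = mpart_carrier[OF X ab(1)] mpart_carrier[OF Y ab(2)] mpart_carrier[OF Y ab(3)]
    show ?thesis unfolding ab(4-6) cl_add[OF Y ab(2,3)] ptc_cl[OF X Y ab(1) mpart_add[OF Y ab(2,3)]]
        ptc_cl[OF X Y ab(1,2)] ptc_cl[OF X Y ab(1,3)] cl_add[OF T pt_mpart[OF X Y ab(1) c(2)] pt_mpart[OF X Y ab(1) c(3)]]
        pt_bilin(3)[OF X Y c] ..
  qed
  show "ptc X Y (v \<odot>\<^bsub>core X\<^esub> x) y = v \<odot>\<^bsub>core (X \<otimes>\<^sub>m Y)\<^esub> ptc X Y x y"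
    and "ptc X Y x (v \<odot>\<^bsub>core Y\<^esub> y) = v \<odot>\<^bsub>core (X \<otimes>\<^sub>m Y)\<^esub> ptc X Y x y"
    if v: "v \<in> carrier V" and xy: "x \<in> elts X" "y \<in> elts Y" for v x y
  proof -
    obtain a b where ab: "a \<in> mpart X" "b \<in> mpart Y" "x = cl X a" "y = cl Y b" using xy by (meson core_cases)
    note c = mpart_carrier[OF X ab(1)] mpart_carrier[OF Y ab(2)]
    show "ptc X Y (v \<odot>\<^bsub>core X\<^esub> x) y = v \<odot>\<^bsub>core (X \<otimes>\<^sub>m Y)\<^esub> ptc X Y x y"
      unfolding ab(3-4) cl_smult[OF X v ab(1)] ptc_cl[OF X Y mpart_smult[OF X v ab(1)] ab(2)] ptc_cl[OF X Y ab(1,2)]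
        cl_smult[OF T v pt_mpart[OF X Y ab(1) c(2)]] pt_bilin(4)[OF X Y v c] ..
    show "ptc X Y x (v \<odot>\<^bsub>core Y\<^esub> y) = v \<odot>\<^bsub>core (X \<otimes>\<^sub>m Y)\<^esub> ptc X Y x y"
      unfolding ab(3-4) cl_smult[OF Y v ab(2)] ptc_cl[OF X Y ab(1) mpart_smult[OF Y v ab(2)]] ptc_cl[OF X Y ab(1,2)]
        cl_smult[OF T v pt_mpart[OF X Y ab(1) c(2)]] pt_bilin(5)[OF X Y v c] ..
  qed
qed

lemmas ptc_simps = bilinD[OF ptc_bilin]

lemma ptc_gens: "module V X \<Longrightarrow> module V Y \<Longrightarrow>
    {ptc X Y x y |x y. x \<in> elts X \<and> y \<in> elts Y} \<subseteq> elts (X \<otimes>\<^sub>m Y)"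
  by (auto intro: ptc_simps(1))

lemma ptc_span:
  assumes X: "module V X" and Y: "module V Y" and u: "u \<in> elts (X \<otimes>\<^sub>m Y)"
  shows "u \<in> span_mod V (core (X \<otimes>\<^sub>m Y)) {ptc X Y x y |x y. x \<in> elts X \<and> y \<in> elts Y}" (is "_ \<in> ?S")
proof -
  note T = module_tens[OF X Y]
  note S = submoduleD[OF module_core[OF T] span_mod_submodule[OF module_core[OF T] ptc_gens[OF X Y]]]
  obtain t where t: "t \<in> mpart (X \<otimes>\<^sub>m Y)" "u = cl (X \<otimes>\<^sub>m Y) t" using u by (rule core_cases)
  have "cl (X \<otimes>\<^sub>m Y) t \<in> ?S" using X Y t(1)
  proof (induct rule: tens_mpart_induct)
    case (pure x y)
    have "ptc X Y (cl X x) (cl Y y) \<in> ?S"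
      using cl_closed[OF pure(1)] cl_closed[OF pure(2)] by (intro span_mod_base) auto
    then show ?case using ptc_cl[OF X Y pure] by simp
  next
    case zero
    then show ?case using S(2) by (simp add: core_zero)
  next
    case (add s t)
    then show ?case using S(3)[OF add(3,4)] by (simp add: cl_add[OF T add(1,2)])
  qed
  then show ?thesis using t by simp
qed

lemma tens_hom_eqI:
  assumes X: "module V X" and Y: "module V Y" and Z: "module V Z"
    and h: "h \<in> mod_hom V (core (X \<otimes>\<^sub>m Y)) Z" "h' \<in> mod_hom V (core (X \<otimes>\<^sub>m Y)) Z"
    and eq: "\<And>x y. x \<in> elts X \<Longrightarrow> y \<in> elts Y \<Longrightarrow> h (ptc X Y x y) = h' (ptc X Y x y)"
    and u: "u \<in> elts (X \<otimes>\<^sub>m Y)"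
  shows "h u = h' u"
  by (rule mod_hom_eq_span[OF h module_core[OF module_tens[OF X Y]] Z ptc_gens[OF X Y] _ ptc_span[OF X Y u]])
     (use eq in auto)

lemma tens_image_sub:
  assumes X: "module V X" and Y: "module V Y" and Z: "module V Z"
    and h: "h \<in> mod_hom V (core (X \<otimes>\<^sub>m Y)) Z" and N: "submodule N V Z"
    and mem: "\<And>x y. x \<in> elts X \<Longrightarrow> y \<in> elts Y \<Longrightarrow> h (ptc X Y x y) \<in> N"
    and u: "u \<in> elts (X \<otimes>\<^sub>m Y)"
  shows "h u \<in> N"
  by (rule mod_hom_span[OF h module_core[OF module_tens[OF X Y]] Z ptc_gens[OF X Y] N _ ptc_span[OF X Y u]])
     (use mem in auto)

lemma core_eqI2:
  assumes X: "module V X" and u: "u \<in> elts X" "w \<in> elts X"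
    and eq: "\<And>a b. a \<in> \<mm> \<Longrightarrow> b \<in> \<mm> \<Longrightarrow> (a \<otimes> b) \<odot>\<^bsub>core X\<^esub> u = (a \<otimes> b) \<odot>\<^bsub>core X\<^esub> w"
  shows "u = w"
proof (rule core_eqI[OF X u])
  fix e assume "e \<in> \<mm>"
  then show "e \<odot>\<^bsub>core X\<^esub> u = e \<odot>\<^bsub>core X\<^esub> w"
  proof (rule mm_cancel[OF module_core[OF X] u])
    fix a b assume "a \<in> \<mm>" "b \<in> \<mm>"
    then show "a \<odot>\<^bsub>core X\<^esub> (b \<odot>\<^bsub>core X\<^esub> u) = a \<odot>\<^bsub>core X\<^esub> (b \<odot>\<^bsub>core X\<^esub> w)"
      using eq[of a b] u by (simp add: module.smult_assoc1[OF module_core[OF X]] mm_carrier)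
  qed
qed

text \<open>The tensor product represents bilinear maps of cores: \<open>x \<otimes> y \<mapsto> \<beta> (a x) (b y)\<close> makes sense on
  all of \<open>X \<otimes> Y\<close> for \<open>a\<close>, \<open>b\<close> in \<open>\<mm>\<close>, and these maps glue because the core of \<open>Z\<close> has no torsion.\<close>

lemma tens_core_universal:
  assumes X: "module V X" and Y: "module V Y" and Z: "module V Z"
    and \<beta>: "bilin V (core X) (core Y) (core Z) \<beta>"
  obtains h where "h \<in> mod_hom V (core (X \<otimes>\<^sub>m Y)) (core Z)"
    "\<And>x y. x \<in> elts X \<Longrightarrow> y \<in> elts Y \<Longrightarrow> h (ptc X Y x y) = \<beta> x y"
proof -
  interpret X: module V X by fact
  interpret Y: module V Y by fact
  note T = module_tens[OF X Y]
  note CZ = module_core[OF Z]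
  interpret CZ: module V "core Z" by (rule CZ)
  interpret CX: module V "core X" by (rule module_core[OF X])
  interpret CY: module V "core Y" by (rule module_core[OF Y])
  interpret T: module V "X \<otimes>\<^sub>m Y" by (rule T)
  \<comment> \<open>\<open>x \<otimes> y\<close> has a value only if \<open>x\<close> and \<open>y\<close> have classes, but \<open>a x\<close> and \<open>b y\<close> always do\<close>
  have "\<exists>k. k \<in> mod_hom V (X \<otimes>\<^sub>m Y) (core Z) \<and> (\<forall>x\<in>carrier X. \<forall>y\<in>carrier Y.
      k (pure_tens V X Y x y) = \<beta> (cl X (a \<odot>\<^bsub>X\<^esub> x)) (cl Y (b \<odot>\<^bsub>Y\<^esub> y)))" if ab: "a \<in> \<mm>" "b \<in> \<mm>" for a b
  proof -
    have f: "(\<lambda>x. cl X (a \<odot>\<^bsub>X\<^esub> x)) \<in> mod_hom V X (core X)"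
      by (rule mod_homI) (use ab in \<open>auto simp: cl_closed mpart_base cl_base_add[OF X] cl_base_smult[OF X]\<close>)
    have g: "(\<lambda>y. cl Y (b \<odot>\<^bsub>Y\<^esub> y)) \<in> mod_hom V Y (core Y)"
      by (rule mod_homI) (use ab in \<open>auto simp: cl_closed mpart_base cl_base_add[OF Y] cl_base_smult[OF Y]\<close>)
    have i: "(\<lambda>z. z) \<in> mod_hom V (core Z) (core Z)" by (rule mod_homI) auto
    show ?thesis
      by (rule tensor_product.tens_universal[OF tensor_productI[OF X Y] bilin_comp[OF \<beta> f g i] CZ]) blast
  qed
  then obtain k where k: "\<And>a b. a \<in> \<mm> \<Longrightarrow> b \<in> \<mm> \<Longrightarrow> k a b \<in> mod_hom V (X \<otimes>\<^sub>m Y) (core Z)"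
    and kp: "\<And>a b x y. a \<in> \<mm> \<Longrightarrow> b \<in> \<mm> \<Longrightarrow> x \<in> carrier X \<Longrightarrow> y \<in> carrier Y \<Longrightarrow>
      k a b (pure_tens V X Y x y) = \<beta> (cl X (a \<odot>\<^bsub>X\<^esub> x)) (cl Y (b \<odot>\<^bsub>Y\<^esub> y))" by metis
  \<comment> \<open>\<open>z\<close> is the value at \<open>t\<close>, expressed through its multiples by \<open>a b\<close>\<close>
  define good where "good t z \<longleftrightarrow> z \<in> elts Z \<and> (\<forall>a\<in>\<mm>. \<forall>b\<in>\<mm>. (a \<otimes> b) \<odot>\<^bsub>core Z\<^esub> z = k a b t)" for t z
  have good_pure: "good (pure_tens V X Y x y) (\<beta> (cl X x) (cl Y y))" if "x \<in> mpart X" "y \<in> mpart Y" for x y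
  proof -
    have "(a \<otimes> b) \<odot>\<^bsub>core Z\<^esub> \<beta> (cl X x) (cl Y y) = k a b (pure_tens V X Y x y)" if ab: "a \<in> \<mm>" "b \<in> \<mm>" for a b
      using ab \<open>x \<in> mpart X\<close> \<open>y \<in> mpart Y\<close> kp[OF ab, of x y]
      by (simp add: cl_smult[OF X, symmetric] cl_smult[OF Y, symmetric] mm_carrier mpart_carrier[OF X] mpart_carrier[OF Y]
          bilinD[OF \<beta>] cl_closed CZ.smult_assoc1[symmetric] m_comm)
    then show ?thesis using that by (simp add: good_def bilinD(1)[OF \<beta>] cl_closed)
  qed
  have good_add: "good (s \<oplus>\<^bsub>X \<otimes>\<^sub>m Y\<^esub> t) (z \<oplus>\<^bsub>core Z\<^esub> w)" if "good s z" "good t w" "s \<in> carrier (X \<otimes>\<^sub>m Y)" "t \<in> carrier (X \<otimes>\<^sub>m Y)" for s t z w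
    using that mod_hom_add[OF k] by (auto simp: good_def CZ.smult_r_distr mm_carrier)
  have good_smult: "good (v \<odot>\<^bsub>X \<otimes>\<^sub>m Y\<^esub> t) (v \<odot>\<^bsub>core Z\<^esub> z)" if "good t z" "v \<in> carrier V" "t \<in> carrier (X \<otimes>\<^sub>m Y)" for t z v
  proof -
    have "(a \<otimes> b) \<odot>\<^bsub>core Z\<^esub> (v \<odot>\<^bsub>core Z\<^esub> z) = v \<odot>\<^bsub>core Z\<^esub> ((a \<otimes> b) \<odot>\<^bsub>core Z\<^esub> z)" if "a \<in> \<mm>" "b \<in> \<mm>" for a b
      using that \<open>v \<in> carrier V\<close> \<open>good t z\<close> CZ.smult_assoc1[of "a \<otimes> b" v z] CZ.smult_assoc1[of v "a \<otimes> b" z]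
        m_comm[of "a \<otimes> b" v] by (simp add: good_def mm_carrier)
    then show ?thesis using that mod_hom_smult[OF k] by (auto simp: good_def)
  qed
  have unique: "z = w" if "good t z" "good t w" for t z w
    by (rule core_eqI2[OF Z]) (use that in \<open>auto simp: good_def\<close>)
  have ex: "\<exists>z. good t z" if "t \<in> mpart (X \<otimes>\<^sub>m Y)" for t
    using X Y that
  proof (induct rule: tens_mpart_induct)
    case zero
    have "good \<zero>\<^bsub>X \<otimes>\<^sub>m Y\<^esub> \<zero>\<^bsub>core Z\<^esub>" using mod_hom_zero[OF k T CZ] by (simp add: good_def mm_carrier)
    then show ?case by blast
  next
    case (add s t)
    then show ?case using good_add mpart_carrier[OF T] by blast
  qed (use good_pure in blast)
  define H where "H t = (THE z. good t z)" for t
  have H: "H t = z" if "good t z" for t z unfolding H_def by (rule the_equality, rule that, rule unique[OF _ that])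
  have goodH: "good t (H t)" if "t \<in> mpart (X \<otimes>\<^sub>m Y)" for t using ex[OF that] H by metis
  have A: "module V (sub_mod (X \<otimes>\<^sub>m Y) (mpart (X \<otimes>\<^sub>m Y)))" by (rule module_sub_mod[OF T mpart_submodule[OF T]])
  have q: "cl (X \<otimes>\<^sub>m Y) \<in> mod_hom V (sub_mod (X \<otimes>\<^sub>m Y) (mpart (X \<otimes>\<^sub>m Y))) (core (X \<otimes>\<^sub>m Y))"
    by (rule mod_homI) (auto simp: cl_closed cl_add[OF T] cl_smult[OF T])
  have f: "H \<in> mod_hom V (sub_mod (X \<otimes>\<^sub>m Y) (mpart (X \<otimes>\<^sub>m Y))) (core Z)"
  proof (rule mod_homI)
    show "H t \<in> elts Z" if "t \<in> carrier (sub_mod (X \<otimes>\<^sub>m Y) (mpart (X \<otimes>\<^sub>m Y)))" for t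
      using goodH[of t] that by (simp add: good_def)
  next
    fix s t assume "s \<in> carrier (sub_mod (X \<otimes>\<^sub>m Y) (mpart (X \<otimes>\<^sub>m Y)))" "t \<in> carrier (sub_mod (X \<otimes>\<^sub>m Y) (mpart (X \<otimes>\<^sub>m Y)))"
    then show "H (s \<oplus>\<^bsub>sub_mod (X \<otimes>\<^sub>m Y) (mpart (X \<otimes>\<^sub>m Y))\<^esub> t) = H s \<oplus>\<^bsub>core Z\<^esub> H t"
      using H[OF good_add[OF goodH goodH]] mpart_carrier[OF T] by simp
  next
    fix v t assume "v \<in> carrier V" "t \<in> carrier (sub_mod (X \<otimes>\<^sub>m Y) (mpart (X \<otimes>\<^sub>m Y)))"
    then show "H (v \<odot>\<^bsub>sub_mod (X \<otimes>\<^sub>m Y) (mpart (X \<otimes>\<^sub>m Y))\<^esub> t) = v \<odot>\<^bsub>core Z\<^esub> H t"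
      using H[OF good_smult[OF goodH]] mpart_carrier[OF T] by simp
  qed
  have ker: "H t = \<zero>\<^bsub>core Z\<^esub>" if t: "t \<in> carrier (sub_mod (X \<otimes>\<^sub>m Y) (mpart (X \<otimes>\<^sub>m Y)))" and z: "cl (X \<otimes>\<^sub>m Y) t = \<zero>\<^bsub>core (X \<otimes>\<^sub>m Y)\<^esub>" for t
  proof -
    have tm: "t \<in> mpart (X \<otimes>\<^sub>m Y)" using t by simp
    have "e \<odot>\<^bsub>core Z\<^esub> H t = e \<odot>\<^bsub>core Z\<^esub> \<zero>\<^bsub>core Z\<^esub>" if e: "e \<in> \<mm>" for e
    proof -
      have "e \<odot>\<^bsub>X \<otimes>\<^sub>m Y\<^esub> t = \<zero>\<^bsub>X \<otimes>\<^sub>m Y\<^esub>"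
        using cl_eq_iff[OF tm, of "\<zero>\<^bsub>X \<otimes>\<^sub>m Y\<^esub>"] z[unfolded core_zero] e by (simp add: mm_carrier)
      moreover have "good (e \<odot>\<^bsub>X \<otimes>\<^sub>m Y\<^esub> t) (e \<odot>\<^bsub>core Z\<^esub> H t)"
        by (rule good_smult[OF goodH[OF tm] mm_carrier[OF e] mpart_carrier[OF T tm]])
      moreover have "good \<zero>\<^bsub>X \<otimes>\<^sub>m Y\<^esub> \<zero>\<^bsub>core Z\<^esub>" using mod_hom_zero[OF k T CZ] by (simp add: good_def mm_carrier)
      ultimately show ?thesis using unique e by (simp add: mm_carrier)
    qed
    then show ?thesis using core_eqI[OF Z _ CZ.M.zero_closed] goodH[OF tm] by (simp add: good_def)
  qed
  have surj: "cl (X \<otimes>\<^sub>m Y) ` carrier (sub_mod (X \<otimes>\<^sub>m Y) (mpart (X \<otimes>\<^sub>m Y))) = elts (X \<otimes>\<^sub>m Y)"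
    by (simp add: core_carrier)
  obtain h where h: "h \<in> mod_hom V (core (X \<otimes>\<^sub>m Y)) (core Z)"
    "\<And>t. t \<in> carrier (sub_mod (X \<otimes>\<^sub>m Y) (mpart (X \<otimes>\<^sub>m Y))) \<Longrightarrow> h (cl (X \<otimes>\<^sub>m Y) t) = H t"
    by (rule hom_factor[OF A module_core[OF T] CZ q f surj ker]; (rule that)?)
  show ?thesis
  proof (rule that[OF h(1)])
    fix x y assume "x \<in> elts X" "y \<in> elts Y"
    then obtain x' y' where xy: "x' \<in> mpart X" "x = cl X x'" "y' \<in> mpart Y" "y = cl Y y'" by (meson core_cases)
    then show "h (ptc X Y x y) = \<beta> x y"
      using h(2)[of "pure_tens V X Y x' y'"] H[OF good_pure[of x' y']] pt_mpart[OF X Y xy(1) mpart_carrier[OF Y xy(3)]]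
      by (simp add: ptc_cl[OF X Y])
  qed
qed

lemma tens_amor_eqI:
  assumes f: "is_amor (X \<otimes>\<^sub>m Y) Z f" and g: "is_amor (X \<otimes>\<^sub>m Y) Z g" and X: "module V X" and Y: "module V Y"
    and eq: "\<And>x y. x \<in> elts X \<Longrightarrow> y \<in> elts Y \<Longrightarrow> ev f (ptc X Y x y) = ev g (ptc X Y x y)"
  shows "f = g"
  by (rule amor_eqI[OF f g], rule tens_hom_eqI[OF X Y module_core[OF amorD(2)[OF f]] ev_hom[OF f] ev_hom[OF g] eq])

lemma amap_tens:
  assumes f: "is_amor X X' f" and g: "is_amor Y Y' g"
  shows is_amor_amap_tens: "is_amor (X \<otimes>\<^sub>m Y) (X' \<otimes>\<^sub>m Y') (f \<otimes>\<^sub>a g)"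
    and ev_amap_tens: "x \<in> elts X \<Longrightarrow> y \<in> elts Y \<Longrightarrow>
      ev (f \<otimes>\<^sub>a g) (ptc X Y x y) = ptc X' Y' (ev f x) (ev g y)"
proof -
  note X = amorD(1)[OF f] and X' = amorD(2)[OF f] and Y = amorD(1)[OF g] and Y' = amorD(2)[OF g]
  note T = module_tens[OF X Y] and T' = module_tens[OF X' Y']
  note bil = bilin_comp[OF ptc_bilin[OF X' Y'] ev_hom[OF f] ev_hom[OF g]]
  have i: "(\<lambda>z. z) \<in> mod_hom V (core (X' \<otimes>\<^sub>m Y')) (core (X' \<otimes>\<^sub>m Y'))" by (rule mod_homI) auto
  obtain h where h: "h \<in> mod_hom V (core (X \<otimes>\<^sub>m Y)) (core (X' \<otimes>\<^sub>m Y'))"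
    and hp: "\<And>x y. x \<in> elts X \<Longrightarrow> y \<in> elts Y \<Longrightarrow> h (ptc X Y x y) = ptc X' Y' (ev f x) (ev g y)"
    using tens_core_universal[OF X Y T' bil[OF i]] by blast
  let ?S = "{(pure_tens V X Y x x', pure_tens V X' Y' y y') | x y x' y'. (x, y) \<in> agraph f \<and> (x', y') \<in> agraph g}"
  have S: "?S \<subseteq> carrier (X \<otimes>\<^sub>m Y) \<times> carrier (X' \<otimes>\<^sub>m Y')"
    by (auto intro!: pt_closed X Y X' Y' simp: mpart_carrier[OF X amorD(5)[OF f]] mpart_carrier[OF Y amorD(5)[OF g]]
      amorD(6)[OF f] amorD(6)[OF g])
  have c: "cl (X' \<otimes>\<^sub>m Y') (e \<odot>\<^bsub>X' \<otimes>\<^sub>m Y'\<^esub> t') = h (cl (X \<otimes>\<^sub>m Y) (e \<odot>\<^bsub>X \<otimes>\<^sub>m Y\<^esub> t))" if "(t, t') \<in> ?S" "e \<in> \<mm>" for t t' e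
  proof -
    note e = that(2)
    obtain x y x' y' where t: "t = pure_tens V X Y x x'" "t' = pure_tens V X' Y' y y'" "(x, y) \<in> agraph f" "(x', y') \<in> agraph g"
      using \<open>(t, t') \<in> ?S\<close> by auto
    have xm: "x \<in> mpart X" "x' \<in> mpart Y" using amorD(5)[OF f t(3)] amorD(5)[OF g t(4)] .
    have yc: "y \<in> carrier X'" "y' \<in> carrier Y'" using amorD(6)[OF f t(3)] amorD(6)[OF g t(4)] .
    have tm: "t \<in> mpart (X \<otimes>\<^sub>m Y)" unfolding t by (rule pt_mpart[OF X Y xm(1) mpart_carrier[OF Y xm(2)]])
    have t'c: "t' \<in> carrier (X' \<otimes>\<^sub>m Y')" unfolding t by (rule pt_closed[OF X' Y' yc])
    let ?F = "ev f (cl X x)" and ?G = "ev g (cl Y x')"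
    note FG = ev_closed[OF f cl_closed[OF xm(1)]] ev_closed[OF g cl_closed[OF xm(2)]]
    have ht: "h (cl (X \<otimes>\<^sub>m Y) t) = ptc X' Y' ?F ?G"
      unfolding t using hp[OF cl_closed[OF xm(1)] cl_closed[OF xm(2)]] ptc_cl[OF X Y xm] by simp
    have hte: "h (cl (X \<otimes>\<^sub>m Y) (e \<odot>\<^bsub>X \<otimes>\<^sub>m Y\<^esub> t)) = e \<odot>\<^bsub>core (X' \<otimes>\<^sub>m Y')\<^esub> ptc X' Y' ?F ?G"
      using mod_hom_smult[OF h mm_carrier[OF e] cl_closed[OF tm]] ht by (simp add: cl_smult[OF T mm_carrier[OF e] tm])
    show ?thesis unfolding hte
    proof (rule core_eqI[OF T' cl_closed[OF mpart_base[OF e t'c]]])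
      show "e \<odot>\<^bsub>core (X' \<otimes>\<^sub>m Y')\<^esub> ptc X' Y' ?F ?G \<in> elts (X' \<otimes>\<^sub>m Y')"
        using module.smult_closed[OF module_core[OF T'] mm_carrier[OF e]] ptc_simps(1)[OF X' Y' FG] by blast
    next
      fix a assume a: "a \<in> \<mm>"
      have "a \<odot>\<^bsub>core (X' \<otimes>\<^sub>m Y')\<^esub> cl (X' \<otimes>\<^sub>m Y') (e \<odot>\<^bsub>X' \<otimes>\<^sub>m Y'\<^esub> t') =
          cl (X' \<otimes>\<^sub>m Y') (pure_tens V X' Y' (a \<odot>\<^bsub>X'\<^esub> y) (e \<odot>\<^bsub>Y'\<^esub> y'))"
        unfolding cl_smult[OF T' mm_carrier[OF a] mpart_base[OF e t'c]] pt_double[OF X' Y' yc mm_carrier[OF a] mm_carrier[OF e]]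
        using t'c by (simp add: t(2) module.smult_assoc1[OF T'] mm_carrier a e)
      also have "\<dots> = ptc X' Y' (cl X' (a \<odot>\<^bsub>X'\<^esub> y)) (cl Y' (e \<odot>\<^bsub>Y'\<^esub> y'))"
        by (rule ptc_cl[OF X' Y' mpart_base[OF a yc(1)] mpart_base[OF e yc(2)], symmetric])
      also have "\<dots> = ptc X' Y' (a \<odot>\<^bsub>core X'\<^esub> ?F) (e \<odot>\<^bsub>core Y'\<^esub> ?G)"
        using agraph_iff[OF f] agraph_iff[OF g] t(3,4) a e by metis
      also have "\<dots> = a \<odot>\<^bsub>core (X' \<otimes>\<^sub>m Y')\<^esub> (e \<odot>\<^bsub>core (X' \<otimes>\<^sub>m Y')\<^esub> ptc X' Y' ?F ?G)"
        using FG a e module.smult_closed[OF module_core[OF Y'] mm_carrier[OF e]] by (simp add: ptc_simps(4,5)[OF X' Y'] mm_carrier)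
      finally show "a \<odot>\<^bsub>core (X' \<otimes>\<^sub>m Y')\<^esub> cl (X' \<otimes>\<^sub>m Y') (e \<odot>\<^bsub>X' \<otimes>\<^sub>m Y'\<^esub> t') =
          a \<odot>\<^bsub>core (X' \<otimes>\<^sub>m Y')\<^esub> (e \<odot>\<^bsub>core (X' \<otimes>\<^sub>m Y')\<^esub> ptc X' Y' ?F ?G)" .
    qed
  qed
  have d: "mpart (X \<otimes>\<^sub>m Y) \<subseteq> span_mod V (X \<otimes>\<^sub>m Y) (Domain ?S)"
  proof
    have Sc: "Domain ?S \<subseteq> carrier (X \<otimes>\<^sub>m Y)" using S by blast
    note sp = submoduleD[OF T span_mod_submodule[OF T Sc]]
    fix t assume "t \<in> mpart (X \<otimes>\<^sub>m Y)"
    with X Y show "t \<in> span_mod V (X \<otimes>\<^sub>m Y) (Domain ?S)"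
    proof (induct rule: tens_mpart_induct)
      case (pure x y)
      then obtain x' y' where "(x, x') \<in> agraph f" "(y, y') \<in> agraph g" using amor_total[OF f] amor_total[OF g] by blast
      then have "pure_tens V X Y x y \<in> Domain ?S" by blast
      then show ?case by (rule span_mod_base)
    qed (use sp in auto)
  qed
  have eq: "f \<otimes>\<^sub>a g = gen_amor (X \<otimes>\<^sub>m Y) (X' \<otimes>\<^sub>m Y') ?S"
    by (simp add: amap_tens_def amorD(3,4)[OF f] amorD(3,4)[OF g])
  show "is_amor (X \<otimes>\<^sub>m Y) (X' \<otimes>\<^sub>m Y') (f \<otimes>\<^sub>a g)" unfolding eq by (rule is_amor_gen_amor[OF T T' h S c d])
  show "x \<in> elts X \<Longrightarrow> y \<in> elts Y \<Longrightarrow> ev (f \<otimes>\<^sub>a g) (ptc X Y x y) = ptc X' Y' (ev f x) (ev g y)"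
    unfolding eq using ev_gen_amor[OF T T' h S c d ptc_simps(1)[OF X Y]] hp by simp
qed

lemma aswap:
  assumes X: "module V X" and Y: "module V Y"
  shows is_amor_aswap: "is_amor (X \<otimes>\<^sub>m Y) (Y \<otimes>\<^sub>m X) (aswap X Y)"
    and ev_aswap: "x \<in> elts X \<Longrightarrow> y \<in> elts Y \<Longrightarrow> ev (aswap X Y) (ptc X Y x y) = ptc Y X y x"
proof -
  note T = module_tens[OF X Y] and T' = module_tens[OF Y X]
  have "bilin V X Y (Y \<otimes>\<^sub>m X) (\<lambda>x y. pure_tens V Y X y x)"
    using tensor_product.pt_bilin[OF tensor_productI[OF Y X]] by (simp add: bilin_def)
  then obtain g where g: "g \<in> mod_hom V (X \<otimes>\<^sub>m Y) (Y \<otimes>\<^sub>m X)"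
    and gp: "\<And>x y. x \<in> carrier X \<Longrightarrow> y \<in> carrier Y \<Longrightarrow> g (pure_tens V X Y x y) = pure_tens V Y X y x"
    using tensor_product.tens_universal[OF tensor_productI[OF X Y] _ T'] by blast
  let ?S = "{(pure_tens V X Y x y, pure_tens V Y X y x) | x y. x \<in> carrier X \<and> y \<in> carrier Y}"
  have S: "x \<in> carrier (X \<otimes>\<^sub>m Y) \<and> y = g x" if "(x, y) \<in> ?S" for x y using that gp pt_closed[OF X Y] by auto
  have "Domain ?S = {pure_tens V X Y x y |x y. x \<in> carrier X \<and> y \<in> carrier Y}" by auto
  then have d: "mpart (X \<otimes>\<^sub>m Y) \<subseteq> span_mod V (X \<otimes>\<^sub>m Y) (Domain ?S)"
    using tensor_product.tens_span[OF tensor_productI[OF X Y]] mpart_carrier[OF T] by auto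
  show "is_amor (X \<otimes>\<^sub>m Y) (Y \<otimes>\<^sub>m X) (aswap X Y)"
    unfolding aswap_def by (rule is_amor_gen_amor_linear[OF T T' g S d])
  assume "x \<in> elts X" "y \<in> elts Y"
  then obtain x' y' where xy: "x' \<in> mpart X" "x = cl X x'" "y' \<in> mpart Y" "y = cl Y y'" by (meson core_cases)
  show "ev (aswap X Y) (ptc X Y x y) = ptc Y X y x"
    unfolding aswap_def xy(2,4) ptc_cl[OF X Y xy(1,3)] ptc_cl[OF Y X xy(3,1)]
    using ev_gen_amor_linear[OF T T' g S d pt_mpart[OF X Y xy(1) mpart_carrier[OF Y xy(3)]]]
      gp[OF mpart_carrier[OF X xy(1)] mpart_carrier[OF Y xy(3)]] by simp
qed

lemma mod_hom_sum:
  assumes Z: "module V Z" and f: "f \<in> mod_hom V X Z" "g \<in> mod_hom V X Z"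
  shows "(\<lambda>x. f x \<oplus>\<^bsub>Z\<^esub> g x) \<in> mod_hom V X Z"
proof -
  interpret Z: module V Z by fact
  show ?thesis
    by (rule mod_homI) (auto simp: mod_hom_closed[OF f(1)] mod_hom_closed[OF f(2)] mod_hom_add[OF f(1)] mod_hom_add[OF f(2)]
        mod_hom_smult[OF f(1)] mod_hom_smult[OF f(2)] Z.M.a_ac Z.smult_r_distr)
qed

lemma mod_hom_scale:
  assumes Z: "module V Z" and f: "f \<in> mod_hom V X Z" and v: "v \<in> carrier V"
  shows "(\<lambda>x. v \<odot>\<^bsub>Z\<^esub> f x) \<in> mod_hom V X Z"
proof -
  interpret Z: module V Z by fact
  show ?thesis
    by (rule mod_homI) (auto simp: mod_hom_closed[OF f] mod_hom_add[OF f] mod_hom_smult[OF f] v Z.smult_r_distr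
        Z.smult_assoc1[symmetric] m_comm)
qed

lemma aassoc:
  assumes X: "module V X" and Y: "module V Y" and Z: "module V Z"
  shows is_amor_aassoc: "is_amor ((X \<otimes>\<^sub>m Y) \<otimes>\<^sub>m Z) (X \<otimes>\<^sub>m (Y \<otimes>\<^sub>m Z)) (aassoc X Y Z)"
    and ev_aassoc: "x \<in> elts X \<Longrightarrow> y \<in> elts Y \<Longrightarrow> z \<in> elts Z \<Longrightarrow>
      ev (aassoc X Y Z) (ptc (X \<otimes>\<^sub>m Y) Z (ptc X Y x y) z) = ptc X (Y \<otimes>\<^sub>m Z) x (ptc Y Z y z)"
proof -
  note XY = module_tens[OF X Y] and YZ = module_tens[OF Y Z]
  note A = module_tens[OF XY Z] and B = module_tens[OF X YZ]
  note bXYZ = tensor_product.pt_bilin[OF tensor_productI[OF X YZ]]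
  note bYZ = tensor_product.pt_bilin[OF tensor_productI[OF Y Z]]
  note bXY = tensor_product.pt_bilin[OF tensor_productI[OF X Y]]
  have "\<exists>h. h \<in> mod_hom V (X \<otimes>\<^sub>m Y) (X \<otimes>\<^sub>m (Y \<otimes>\<^sub>m Z)) \<and> (\<forall>x\<in>carrier X. \<forall>y\<in>carrier Y.
      h (pure_tens V X Y x y) = pure_tens V X (Y \<otimes>\<^sub>m Z) x (pure_tens V Y Z y z))" if z: "z \<in> carrier Z" for z
  proof -
    have f: "(\<lambda>x. x) \<in> mod_hom V X X" and i: "(\<lambda>x. x) \<in> mod_hom V (X \<otimes>\<^sub>m (Y \<otimes>\<^sub>m Z)) (X \<otimes>\<^sub>m (Y \<otimes>\<^sub>m Z))"
      by (rule mod_homI; simp)+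
    have g: "(\<lambda>y. pure_tens V Y Z y z) \<in> mod_hom V Y (Y \<otimes>\<^sub>m Z)" using bYZ z by (simp add: bilin_def)
    show ?thesis
      by (rule tensor_product.tens_universal[OF tensor_productI[OF X Y] bilin_comp[OF bXYZ f g i] B]) blast
  qed
  then obtain h where h: "\<And>z. z \<in> carrier Z \<Longrightarrow> h z \<in> mod_hom V (X \<otimes>\<^sub>m Y) (X \<otimes>\<^sub>m (Y \<otimes>\<^sub>m Z))"
    and hp: "\<And>x y z. x \<in> carrier X \<Longrightarrow> y \<in> carrier Y \<Longrightarrow> z \<in> carrier Z \<Longrightarrow>
      h z (pure_tens V X Y x y) = pure_tens V X (Y \<otimes>\<^sub>m Z) x (pure_tens V Y Z y z)" by metis
  have eqI: "f t = g t" if "f \<in> mod_hom V (X \<otimes>\<^sub>m Y) (X \<otimes>\<^sub>m (Y \<otimes>\<^sub>m Z))" "g \<in> mod_hom V (X \<otimes>\<^sub>m Y) (X \<otimes>\<^sub>m (Y \<otimes>\<^sub>m Z))"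
      "\<And>x y. x \<in> carrier X \<Longrightarrow> y \<in> carrier Y \<Longrightarrow> f (pure_tens V X Y x y) = g (pure_tens V X Y x y)"
      "t \<in> carrier (X \<otimes>\<^sub>m Y)" for f g t
    by (rule mod_hom_eq_span[OF that(1,2) XY B _ _ tensor_product.tens_span[OF tensor_productI[OF X Y] that(4)]])
       (use that(3) pt_closed[OF X Y] in auto)
  interpret Z: module V Z by fact
  have bil: "bilin V (X \<otimes>\<^sub>m Y) Z (X \<otimes>\<^sub>m (Y \<otimes>\<^sub>m Z)) (\<lambda>t z. h z t)"
  proof (rule bilinI)
    fix t z z' assume t: "t \<in> carrier (X \<otimes>\<^sub>m Y)" and z: "z \<in> carrier Z" "z' \<in> carrier Z"
    show "h (z \<oplus>\<^bsub>Z\<^esub> z') t = h z t \<oplus>\<^bsub>X \<otimes>\<^sub>m (Y \<otimes>\<^sub>m Z)\<^esub> h z' t"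
      by (rule eqI[OF _ mod_hom_sum[OF B]])
         (use z t in \<open>simp_all add: h hp bilinD(3)[OF bXYZ] bilinD(3)[OF bYZ] bilinD(1)[OF bYZ]\<close>)
  next
    fix v t z assume v: "v \<in> carrier V" and t: "t \<in> carrier (X \<otimes>\<^sub>m Y)" and z: "z \<in> carrier Z"
    show "h (v \<odot>\<^bsub>Z\<^esub> z) t = v \<odot>\<^bsub>X \<otimes>\<^sub>m (Y \<otimes>\<^sub>m Z)\<^esub> h z t"
      by (rule eqI[OF _ mod_hom_scale[OF B]])
         (use v z t in \<open>simp_all add: h hp bilinD(5)[OF bXYZ] bilinD(5)[OF bYZ] bilinD(1)[OF bYZ]\<close>)
  qed (auto simp: mod_hom_closed[OF h] mod_hom_add[OF h] mod_hom_smult[OF h])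
  obtain g where g: "g \<in> mod_hom V ((X \<otimes>\<^sub>m Y) \<otimes>\<^sub>m Z) (X \<otimes>\<^sub>m (Y \<otimes>\<^sub>m Z))"
    and gp: "\<And>t z. t \<in> carrier (X \<otimes>\<^sub>m Y) \<Longrightarrow> z \<in> carrier Z \<Longrightarrow> g (pure_tens V (X \<otimes>\<^sub>m Y) Z t z) = h z t"
    using tensor_product.tens_universal[OF tensor_productI[OF XY Z] bil B] by blast
  let ?S = "{(pure_tens V (X \<otimes>\<^sub>m Y) Z (pure_tens V X Y x y) z,
       pure_tens V X (Y \<otimes>\<^sub>m Z) x (pure_tens V Y Z y z)) | x y z.
        x \<in> carrier X \<and> y \<in> carrier Y \<and> z \<in> carrier Z}"
  have S: "x \<in> carrier ((X \<otimes>\<^sub>m Y) \<otimes>\<^sub>m Z) \<and> y = g x" if "(x, y) \<in> ?S" for x y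
    using that gp hp pt_closed[OF X Y] pt_closed[OF XY Z] by auto
  have d: "mpart ((X \<otimes>\<^sub>m Y) \<otimes>\<^sub>m Z) \<subseteq> span_mod V ((X \<otimes>\<^sub>m Y) \<otimes>\<^sub>m Z) (Domain ?S)"
  proof
    have Sc: "Domain ?S \<subseteq> carrier ((X \<otimes>\<^sub>m Y) \<otimes>\<^sub>m Z)" using S by blast
    note sp = submoduleD[OF A span_mod_submodule[OF A Sc]]
    fix t assume t: "t \<in> mpart ((X \<otimes>\<^sub>m Y) \<otimes>\<^sub>m Z)"
    show "t \<in> span_mod V ((X \<otimes>\<^sub>m Y) \<otimes>\<^sub>m Z) (Domain ?S)"
      using XY Z t
    proof (induct rule: tens_mpart_induct)
      case (pure s z)
      have hz: "(\<lambda>s. pure_tens V (X \<otimes>\<^sub>m Y) Z s z) \<in> mod_hom V (X \<otimes>\<^sub>m Y) ((X \<otimes>\<^sub>m Y) \<otimes>\<^sub>m Z)"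
        using tensor_product.pt_bilin[OF tensor_productI[OF XY Z]] mpart_carrier[OF Z pure(2)] by (simp add: bilin_def)
      show ?case
      proof (rule mod_hom_span[OF hz XY A _ span_mod_submodule[OF A Sc] _ tensor_product.tens_span[OF tensor_productI[OF X Y] mpart_carrier[OF XY pure(1)]]])
        fix s assume "s \<in> {pure_tens V X Y x y |x y. x \<in> carrier X \<and> y \<in> carrier Y}"
        then have "pure_tens V (X \<otimes>\<^sub>m Y) Z s z \<in> Domain ?S" using mpart_carrier[OF Z pure(2)] by blast
        then show "pure_tens V (X \<otimes>\<^sub>m Y) Z s z \<in> span_mod V ((X \<otimes>\<^sub>m Y) \<otimes>\<^sub>m Z) (Domain ?S)" by (rule span_mod_base)
      qed (use pt_closed[OF X Y] in auto)
    qed (use sp in auto)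
  qed
  show "is_amor ((X \<otimes>\<^sub>m Y) \<otimes>\<^sub>m Z) (X \<otimes>\<^sub>m (Y \<otimes>\<^sub>m Z)) (aassoc X Y Z)"
    unfolding aassoc_def by (rule is_amor_gen_amor_linear[OF A B g S d])
  assume "x \<in> elts X" "y \<in> elts Y" "z \<in> elts Z"
  then obtain x' y' z' where xyz: "x' \<in> mpart X" "x = cl X x'" "y' \<in> mpart Y" "y = cl Y y'" "z' \<in> mpart Z" "z = cl Z z'"
    by (meson core_cases)
  note c = mpart_carrier[OF X xyz(1)] mpart_carrier[OF Y xyz(3)] mpart_carrier[OF Z xyz(5)]
  note m = pt_mpart[OF X Y xyz(1) c(2)] pt_mpart[OF Y Z xyz(3) c(3)]
  show "ev (aassoc X Y Z) (ptc (X \<otimes>\<^sub>m Y) Z (ptc X Y x y) z) = ptc X (Y \<otimes>\<^sub>m Z) x (ptc Y Z y z)"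
    unfolding aassoc_def xyz(2,4,6) ptc_cl[OF X Y xyz(1,3)] ptc_cl[OF Y Z xyz(3,5)] ptc_cl[OF XY Z m(1) xyz(5)] ptc_cl[OF X YZ xyz(1) m(2)]
    using ev_gen_amor_linear[OF A B g S d pt_mpart[OF XY Z m(1) c(3)]] gp[OF pt_closed[OF X Y c(1,2)] c(3)] hp[OF c] by simp
qed

section \<open>Inverse limits\<close>

lemma alim_simps [simp]:
  "carrier (alim T t) = {x. (\<forall>n. x n \<in> carrier (T n)) \<and> (\<forall>n. (x (Suc n), x n) \<in> agraph (t n))}"
  "\<zero>\<^bsub>alim T t\<^esub> = (\<lambda>n. \<zero>\<^bsub>T n\<^esub>)" "x \<oplus>\<^bsub>alim T t\<^esub> y = (\<lambda>n. x n \<oplus>\<^bsub>T n\<^esub> y n)" "v \<odot>\<^bsub>alim T t\<^esub> x = (\<lambda>n. v \<odot>\<^bsub>T n\<^esub> x n)"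
  by (simp_all add: alim_def)

context
  fixes T :: "nat \<Rightarrow> ('v, 'x) module" and t :: "nat \<Rightarrow> ('v, 'x, 'x) amor"
  assumes t: "\<And>n. is_amor (T (Suc n)) (T n) (t n)"
begin

lemma tower_module: "module V (T n)"
  using amorD(2)[OF t] .

lemma module_alim: "module V (alim T t)"
proof -
  interpret T: module V "T n" for n by (rule tower_module)
  note S = module_seq_mod[of V T, OF tower_module]
  show ?thesis unfolding alim_def
  proof (rule module_sub_mod[OF S])
    have z: "(\<zero>\<^bsub>T (Suc n)\<^esub>, \<zero>\<^bsub>T n\<^esub>) \<in> agraph (t n)" for n
      using submoduleD(2)[OF module_sum_mod[OF tower_module tower_module], of "agraph (t n)"] t[of n] by (simp add: is_amor_def)
    show "submodule {x \<in> carrier (seq_mod T). \<forall>n. (x (Suc n), x n) \<in> agraph (t n)} V (seq_mod T)"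
      unfolding submodule_iff[OF S] using z by (auto intro: amorD(7,8)[OF t])
  qed
qed

lemma alim_component_hom: "(\<lambda>x. x n) \<in> mod_hom V (alim T t) (T n)"
  by (rule mod_homI) auto

lemma alim_proj:
  shows is_amor_alim_proj: "is_amor (alim T t) (T n) (alim_proj T t n)"
    and ev_alim_proj: "x \<in> mpart (alim T t) \<Longrightarrow> ev (alim_proj T t n) (cl (alim T t) x) = cl (T n) (x n)"
proof -
  let ?S = "{(x, x n) | x. x \<in> carrier (alim T t)}"
  have "Domain ?S = carrier (alim T t)" by auto
  then have d: "mpart (alim T t) \<subseteq> span_mod V (alim T t) (Domain ?S)" using span_carrier[OF module_alim] by simp
  have S: "x \<in> carrier (alim T t) \<and> y = x n" if "(x, y) \<in> ?S" for x y using that by auto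
  show "is_amor (alim T t) (T n) (alim_proj T t n)" unfolding alim_proj_def
    by (rule is_amor_gen_amor_linear[OF module_alim tower_module alim_component_hom S d])
  show "x \<in> mpart (alim T t) \<Longrightarrow> ev (alim_proj T t n) (cl (alim T t) x) = cl (T n) (x n)" unfolding alim_proj_def
    by (rule ev_gen_amor_linear[OF module_alim tower_module alim_component_hom S d])
qed

lemma alim_component_mpart: "x \<in> mpart (alim T t) \<Longrightarrow> x n \<in> mpart (T n)"
  by (rule hom_mpart[OF module_alim tower_module alim_component_hom])

lemma alim_proj_compat:
  assumes "u \<in> elts (alim T t)"
  shows "ev (t n) (ev (alim_proj T t (Suc n)) u) = ev (alim_proj T t n) u"
proof -
  obtain x where x: "x \<in> mpart (alim T t)" "u = cl (alim T t) x" using assms by (rule core_cases)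
  have "(x (Suc n), x n) \<in> agraph (t n)" using mpart_carrier[OF module_alim x(1)] by simp
  from ev_cl[OF t this alim_component_mpart[OF x(1)]] show ?thesis using x by (simp add: ev_alim_proj)
qed

lemma alim_proj_eqI:
  assumes u: "u \<in> elts (alim T t)" "w \<in> elts (alim T t)"
    and eq: "\<And>n. ev (alim_proj T t n) u = ev (alim_proj T t n) w"
  shows "u = w"
proof -
  obtain x where x: "x \<in> mpart (alim T t)" "u = cl (alim T t) x" using u(1) by (rule core_cases)
  obtain y where y: "y \<in> mpart (alim T t)" "w = cl (alim T t) y" using u(2) by (rule core_cases)
  have "e \<odot>\<^bsub>T n\<^esub> x n = e \<odot>\<^bsub>T n\<^esub> y n" if "e \<in> \<mm>" for e n
    using eq[of n] x y cl_eq_iff[OF alim_component_mpart[OF x(1)], of n] that by (simp add: ev_alim_proj)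
  then show ?thesis unfolding x y by (intro cl_eqI) auto
qed

text \<open>Representatives of a compatible sequence of classes form an element of the limit, but this element need
  not be in \<open>\<mm>\<close> times the limit, so only its multiples have classes.\<close>

lemma alim_proj_ex:
  assumes z: "\<And>n. z n \<in> elts (T n)" "\<And>n. ev (t n) (z (Suc n)) = z n" and e: "e \<in> \<mm>"
  obtains u where "u \<in> elts (alim T t)" "\<And>n. ev (alim_proj T t n) u = e \<odot>\<^bsub>core (T n)\<^esub> z n"
proof -
  have "\<exists>x. x \<in> mpart (T n) \<and> z n = cl (T n) x" for n using core_cases[OF z(1)] by metis
  then obtain x where x: "\<And>n. x n \<in> mpart (T n)" "\<And>n. z n = cl (T n) (x n)" by metis
  have "(x (Suc n), x n) \<in> agraph (t n)" for n
    unfolding agraph_iff[OF t] using x z(2)[of n]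
    by (simp add: mpart_carrier[OF tower_module] cl_smult[OF tower_module] mm_carrier)
  then have xc: "x \<in> carrier (alim T t)" using x mpart_carrier[OF tower_module] by simp
  show ?thesis
  proof (rule that[OF cl_closed[OF mpart_base[OF e xc]]])
    fix n
    show "ev (alim_proj T t n) (cl (alim T t) (e \<odot>\<^bsub>alim T t\<^esub> x)) = e \<odot>\<^bsub>core (T n)\<^esub> z n"
      using ev_alim_proj[OF mpart_base[OF e xc], of n] x by (simp add: cl_smult[OF tower_module] mm_carrier e)
  qed
qed

lemma alim_lift:
  assumes W: "module V W" and f: "\<And>n. is_amor W (T n) (f n)"
    and compat: "\<And>n u. u \<in> elts W \<Longrightarrow> ev (t n) (ev (f (Suc n)) u) = ev (f n) u"
  shows is_amor_alim_lift: "is_amor W (alim T t) (alim_lift T t W f)"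
    and ev_alim_lift: "u \<in> elts W \<Longrightarrow> ev (alim_proj T t n) (ev (alim_lift T t W f) u) = ev (f n) u"
proof -
  let ?l = "alim_lift T t W f"
  have g: "(w, x) \<in> agraph ?l \<longleftrightarrow> x \<in> carrier (alim T t) \<and> (\<forall>n. (w, x n) \<in> agraph (f n))" for w x
    by (simp add: alim_lift_def)
  interpret T: module V "T n" for n by (rule tower_module)
  interpret L: module V "alim T t" by (rule module_alim)
  show am: "is_amor W (alim T t) ?l"
  proof (rule is_amorI[OF W module_alim])
    fix w x assume "(w, x) \<in> agraph ?l"
    then show "w \<in> mpart W \<and> x \<in> carrier (alim T t)" using amorD(5)[OF f] g by blast
  next
    fix w x w' x' assume "(w, x) \<in> agraph ?l" "(w', x') \<in> agraph ?l"
    then show "(w \<oplus>\<^bsub>W\<^esub> w', x \<oplus>\<^bsub>alim T t\<^esub> x') \<in> agraph ?l" using L.M.a_closed[of x x'] amorD(7)[OF f] by (simp add: g)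
  next
    fix v w x assume "v \<in> carrier V" "(w, x) \<in> agraph ?l"
    then show "(v \<odot>\<^bsub>W\<^esub> w, v \<odot>\<^bsub>alim T t\<^esub> x) \<in> agraph ?l" using L.smult_closed[of v x] amorD(8)[OF f] by (simp add: g)
  next
    fix w assume w: "w \<in> mpart W"
    have "\<exists>y. (w, y) \<in> agraph (f n) \<and> y \<in> mpart (T n) \<and> ev (f n) (cl W w) = cl (T n) y" for n
      using ev_ex[OF f w, of n] by blast
    then obtain x where x: "\<And>n. (w, x n) \<in> agraph (f n)" "\<And>n. x n \<in> mpart (T n)" "\<And>n. ev (f n) (cl W w) = cl (T n) (x n)"
      by metis
    have "(x (Suc n), x n) \<in> agraph (t n)" for n
      unfolding agraph_iff[OF t] using x compat[OF cl_closed[OF w], of n]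
      by (simp add: mpart_carrier[OF tower_module] cl_smult[OF tower_module] mm_carrier)
    then have "(w, x) \<in> agraph ?l" using x mpart_carrier[OF tower_module] by (simp add: g)
    then show "\<exists>x. (w, x) \<in> agraph ?l" by blast
  next
    fix x assume x: "x \<in> carrier (alim T t)"
    have "(\<zero>\<^bsub>W\<^esub>, x n) \<in> agraph (f n) \<longleftrightarrow> (\<forall>e\<in>\<mm>. e \<odot>\<^bsub>T n\<^esub> x n = \<zero>\<^bsub>T n\<^esub>)" for n
    proof -
      have "(\<zero>\<^bsub>W\<^esub>, x n) \<in> agraph (f n) \<longleftrightarrow> x n \<in> mtors (T n)" using f[of n] by (auto simp: is_amor_def)
      then show ?thesis using x by (simp add: mtors_def)
    qed
    then show "(\<zero>\<^bsub>W\<^esub>, x) \<in> agraph ?l \<longleftrightarrow> (\<forall>e\<in>\<mm>. e \<odot>\<^bsub>alim T t\<^esub> x = \<zero>\<^bsub>alim T t\<^esub>)"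
      using x by (auto simp: g fun_eq_iff)
  qed (simp_all add: alim_lift_def)
  assume "u \<in> elts W"
  then obtain w where w: "w \<in> mpart W" "u = cl W w" by (rule core_cases)
  obtain x where x: "(w, x) \<in> agraph ?l" "x \<in> mpart (alim T t)" "ev ?l (cl W w) = cl (alim T t) x" using ev_ex[OF am w(1)] .
  have "(w, x n) \<in> agraph (f n)" using x(1) g by blast
  from ev_cl[OF f this alim_component_mpart[OF x(2)]]
  show "ev (alim_proj T t n) (ev ?l u) = ev (f n) u" using x w by (simp add: ev_alim_proj)
qed

end

section \<open>Differences and images\<close>

lemma agraphI:
  assumes f: "is_amor X Y f" and x: "x \<in> mpart X" and y: "y \<in> mpart Y" and eq: "ev f (cl X x) = cl Y y"
  shows "(x, y) \<in> agraph f"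
  unfolding agraph_iff[OF f] using x y eq mpart_carrier[OF amorD(2)[OF f] y]
  by (simp add: cl_smult[OF amorD(2)[OF f]] mm_carrier)

lemma adiff:
  assumes f: "is_amor X Y f" and g: "is_amor X Y g"
  shows is_amor_adiff: "is_amor X Y (adiff f g)"
    and ev_adiff: "u \<in> elts X \<Longrightarrow> ev (adiff f g) u = ev f u \<ominus>\<^bsub>core Y\<^esub> ev g u"
proof -
  note X = amorD(1)[OF f] and Y = amorD(2)[OF f]
  interpret X: module V X by fact
  interpret Y: module V Y by fact
  interpret CY: module V "core Y" by (rule module_core[OF Y])
  have gr: "(x, w) \<in> agraph (adiff f g) \<longleftrightarrow> (\<exists>y z. w = y \<ominus>\<^bsub>Y\<^esub> z \<and> (x, y) \<in> agraph f \<and> (x, z) \<in> agraph g)" for x w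
    by (auto simp: adiff_def amorD(4)[OF f])
  have z: "(\<zero>\<^bsub>X\<^esub>, w) \<in> agraph h \<longleftrightarrow> w \<in> mtors Y" if "is_amor X Y h" for h w
    using that by (auto simp: is_amor_def)
  show am: "is_amor X Y (adiff f g)"
  proof (rule is_amorI[OF X Y])
    fix x w assume "(x, w) \<in> agraph (adiff f g)"
    then show "x \<in> mpart X \<and> w \<in> carrier Y" unfolding gr using amorD(5,6)[OF f] amorD(6)[OF g] by auto
  next
    fix x w x' w' assume "(x, w) \<in> agraph (adiff f g)" "(x', w') \<in> agraph (adiff f g)"
    then obtain y z y' z' where yz: "w = y \<ominus>\<^bsub>Y\<^esub> z" "(x, y) \<in> agraph f" "(x, z) \<in> agraph g"
      "w' = y' \<ominus>\<^bsub>Y\<^esub> z'" "(x', y') \<in> agraph f" "(x', z') \<in> agraph g" unfolding gr by blast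
    note c = amorD(6)[OF f yz(2)] amorD(6)[OF g yz(3)] amorD(6)[OF f yz(5)] amorD(6)[OF g yz(6)]
    have "w \<oplus>\<^bsub>Y\<^esub> w' = (y \<oplus>\<^bsub>Y\<^esub> y') \<ominus>\<^bsub>Y\<^esub> (z \<oplus>\<^bsub>Y\<^esub> z')"
      using c by (simp add: yz a_minus_def Y.M.minus_add Y.M.a_ac)
    then show "(x \<oplus>\<^bsub>X\<^esub> x', w \<oplus>\<^bsub>Y\<^esub> w') \<in> agraph (adiff f g)"
      unfolding gr using amorD(7)[OF f yz(2,5)] amorD(7)[OF g yz(3,6)] by blast
  next
    fix v x w assume v: "v \<in> carrier V" and "(x, w) \<in> agraph (adiff f g)"
    then obtain y z where yz: "w = y \<ominus>\<^bsub>Y\<^esub> z" "(x, y) \<in> agraph f" "(x, z) \<in> agraph g" unfolding gr by blast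
    have "v \<odot>\<^bsub>Y\<^esub> w = v \<odot>\<^bsub>Y\<^esub> y \<ominus>\<^bsub>Y\<^esub> v \<odot>\<^bsub>Y\<^esub> z"
      using amorD(6)[OF f yz(2)] amorD(6)[OF g yz(3)] v by (simp add: yz Y.smult_minus)
    then show "(v \<odot>\<^bsub>X\<^esub> x, v \<odot>\<^bsub>Y\<^esub> w) \<in> agraph (adiff f g)"
      unfolding gr using amorD(8)[OF f v yz(2)] amorD(8)[OF g v yz(3)] by blast
  next
    fix x assume "x \<in> mpart X"
    then show "\<exists>w. (x, w) \<in> agraph (adiff f g)" using amor_total[OF f] amor_total[OF g] gr by blast
  next
    fix w assume w: "w \<in> carrier Y"
    show "(\<zero>\<^bsub>X\<^esub>, w) \<in> agraph (adiff f g) \<longleftrightarrow> (\<forall>e\<in>\<mm>. e \<odot>\<^bsub>Y\<^esub> w = \<zero>\<^bsub>Y\<^esub>)"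
    proof
      assume "(\<zero>\<^bsub>X\<^esub>, w) \<in> agraph (adiff f g)"
      then obtain y z where "w = y \<ominus>\<^bsub>Y\<^esub> z" "y \<in> mtors Y" "z \<in> mtors Y" unfolding gr z[OF f] z[OF g] by blast
      then show "\<forall>e\<in>\<mm>. e \<odot>\<^bsub>Y\<^esub> w = \<zero>\<^bsub>Y\<^esub>" by (auto simp: mtors_def Y.smult_minus mm_carrier Y.minus_eq_zero_iff)
    next
      assume "\<forall>e\<in>\<mm>. e \<odot>\<^bsub>Y\<^esub> w = \<zero>\<^bsub>Y\<^esub>"
      then have "w \<in> mtors Y" "\<zero>\<^bsub>Y\<^esub> \<in> mtors Y" using w by (auto simp: mtors_def mm_carrier)
      moreover have "w = w \<ominus>\<^bsub>Y\<^esub> \<zero>\<^bsub>Y\<^esub>"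
        using w Y.M.minus_equality[of "\<zero>\<^bsub>Y\<^esub>" "\<zero>\<^bsub>Y\<^esub>"] by (simp add: a_minus_def)
      ultimately show "(\<zero>\<^bsub>X\<^esub>, w) \<in> agraph (adiff f g)" unfolding gr z[OF f] z[OF g] by blast
    qed
  qed (simp_all add: adiff_def amorD(3,4)[OF f])
  assume "u \<in> elts X"
  then obtain x where x: "x \<in> mpart X" "u = cl X x" by (rule core_cases)
  obtain y where y: "(x, y) \<in> agraph f" "y \<in> mpart Y" "ev f (cl X x) = cl Y y" using ev_ex[OF f x(1)] .
  obtain z where z: "(x, z) \<in> agraph g" "z \<in> mpart Y" "ev g (cl X x) = cl Y z" using ev_ex[OF g x(1)] .
  have m: "y \<ominus>\<^bsub>Y\<^esub> z \<in> mpart Y" by (rule submodule_minus[OF Y mpart_submodule[OF Y] y(2) z(2)])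
  have "ev (adiff f g) u = cl Y (y \<ominus>\<^bsub>Y\<^esub> z)"
    using ev_cl[OF am _ m, of x] gr y z x by blast
  moreover have "cl Y (y \<ominus>\<^bsub>Y\<^esub> z) \<oplus>\<^bsub>core Y\<^esub> cl Y z = cl Y y"
    using mpart_carrier[OF Y y(2)] mpart_carrier[OF Y z(2)]
    by (simp add: cl_add[OF Y m z(2)]) (simp add: a_minus_def Y.M.a_assoc Y.M.l_neg)
  ultimately show "ev (adiff f g) u = ev f u \<ominus>\<^bsub>core Y\<^esub> ev g u"
    using x y z cl_closed[OF y(2)] cl_closed[OF z(2)] cl_closed[OF m]
    by (metis CY.M.a_assoc CY.M.r_neg CY.M.r_zero CY.M.a_inv_closed a_minus_def)
qed

text \<open>A relation that need not be total or single-valued modulo torsion: such relations occur when a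
  construction is applied outside its natural domain, and they still have images.\<close>

definition linrel :: "('v, 'x) module \<Rightarrow> ('v, 'y) module \<Rightarrow> ('v, 'x, 'y) amor \<Rightarrow> bool" where
  "linrel X Y f \<longleftrightarrow> module V X \<and> module V Y \<and> asrc f = X \<and> atgt f = Y \<and> submodule (agraph f) V (sum_mod X Y)"

lemma amor_linrel: "is_amor X Y f \<Longrightarrow> linrel X Y f"
  by (simp add: is_amor_def linrel_def)

lemma linrelD:
  assumes "linrel X Y f"
  shows "module V X" "module V Y" "asrc f = X" "atgt f = Y" "submodule (agraph f) V (sum_mod X Y)"
    "(x, y) \<in> agraph f \<Longrightarrow> x \<in> carrier X" "(x, y) \<in> agraph f \<Longrightarrow> y \<in> carrier Y"
proof -
  show f: "module V X" "module V Y" "asrc f = X" "atgt f = Y" "submodule (agraph f) V (sum_mod X Y)"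
    using assms by (auto simp: linrel_def)
  show "(x, y) \<in> agraph f \<Longrightarrow> x \<in> carrier X" "(x, y) \<in> agraph f \<Longrightarrow> y \<in> carrier Y"
    using submoduleD(1)[OF module_sum_mod[OF f(1,2)] f(5), of "(x, y)"] by auto
qed

lemma linrel_gen_amor:
  assumes X: "module V X" and Y: "module V Y" and S: "S \<subseteq> carrier X \<times> carrier Y"
  shows "linrel X Y (gen_amor X Y S)"
proof -
  interpret X: module V X by fact
  interpret Y: module V Y by fact
  note XY = module_sum_mod[OF X Y]
  have "submodule (span_mod V (sum_mod X Y) (S \<union> {\<zero>\<^bsub>X\<^esub>} \<times> mtors Y)) V (sum_mod X Y)"
    by (rule span_mod_submodule[OF XY]) (use S in \<open>auto simp: mtors_def\<close>)
  moreover have "submodule (mpart X \<times> carrier Y) V (sum_mod X Y)"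
    using mpart_add[OF X] mpart_zero[OF X] mpart_smult[OF X] mpart_carrier[OF X] by (auto simp: submodule_iff[OF XY])
  ultimately have "submodule (span_mod V (sum_mod X Y) (S \<union> {\<zero>\<^bsub>X\<^esub>} \<times> mtors Y) \<inter> mpart X \<times> carrier Y) V (sum_mod X Y)"
    unfolding submodule_iff[OF XY] by blast
  then show ?thesis using X Y by (simp add: linrel_def gen_amor_def)
qed

lemma linrel_acomp:
  assumes f: "linrel X Y f" and g: "linrel Y Z g" shows "linrel X Z (f \<Zsemi> g)"
proof -
  note X = linrelD(1)[OF f] and Y = linrelD(2)[OF f] and Z = linrelD(2)[OF g]
  note F = submoduleD[OF module_sum_mod[OF X Y] linrelD(5)[OF f]] and G = submoduleD[OF module_sum_mod[OF Y Z] linrelD(5)[OF g]]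
  have "submodule (agraph f O agraph g) V (sum_mod X Z)"
    unfolding submodule_iff[OF module_sum_mod[OF X Z]]
  proof (intro conjI ballI)
    show "agraph f O agraph g \<subseteq> carrier (sum_mod X Z)" using linrelD(6)[OF f] linrelD(7)[OF g] by auto
    show "\<zero>\<^bsub>sum_mod X Z\<^esub> \<in> agraph f O agraph g" using F(2) G(2) by auto
  next
    fix p q assume "p \<in> agraph f O agraph g" "q \<in> agraph f O agraph g"
    then obtain x y z x' y' z' where "p = (x, z)" "q = (x', z')" "(x, y) \<in> agraph f" "(y, z) \<in> agraph g" "(x', y') \<in> agraph f" "(y', z') \<in> agraph g"
      by auto
    then show "p \<oplus>\<^bsub>sum_mod X Z\<^esub> q \<in> agraph f O agraph g" using F(3)[of "(x, y)" "(x', y')"] G(3)[of "(y, z)" "(y', z')"] by auto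
  next
    fix v p assume v: "v \<in> carrier V" and "p \<in> agraph f O agraph g"
    then obtain x y z where "p = (x, z)" "(x, y) \<in> agraph f" "(y, z) \<in> agraph g" by auto
    then show "v \<odot>\<^bsub>sum_mod X Z\<^esub> p \<in> agraph f O agraph g" using F(4)[OF v, of "(x, y)"] G(4)[OF v, of "(y, z)"] by auto
  qed
  then show ?thesis using X Z linrelD(3)[OF f] linrelD(4)[OF g] by (simp add: linrel_def acomp_def)
qed

lemma linrel_amap_tens:
  assumes f: "linrel X X' f" and g: "linrel Y Y' g" shows "linrel (X \<otimes>\<^sub>m Y) (X' \<otimes>\<^sub>m Y') (f \<otimes>\<^sub>a g)"
  unfolding amap_tens_def linrelD(3,4)[OF f] linrelD(3,4)[OF g]
  by (rule linrel_gen_amor[OF module_tens[OF linrelD(1)[OF f] linrelD(1)[OF g]] module_tens[OF linrelD(2)[OF f] linrelD(2)[OF g]]])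
     (auto intro!: pt_closed linrelD(1,2)[OF f] linrelD(1,2)[OF g] linrelD(6,7)[OF f] linrelD(6,7)[OF g])

lemma aimage_adiff_submodule:
  assumes f: "linrel X Y f" and g: "linrel X Y g" shows "submodule (aimage (adiff f g)) V Y"
proof -
  note X = linrelD(1)[OF f] and Y = linrelD(2)[OF f]
  interpret X: module V X by fact
  interpret Y: module V Y by fact
  note F = submoduleD[OF module_sum_mod[OF X Y] linrelD(5)[OF f]] and G = submoduleD[OF module_sum_mod[OF X Y] linrelD(5)[OF g]]
  have R: "Range (agraph (adiff f g)) = {y \<ominus>\<^bsub>Y\<^esub> z | x y z. (x, y) \<in> agraph f \<and> (x, z) \<in> agraph g}"
    by (auto simp: adiff_def linrelD(4)[OF f])
  have "submodule (Range (agraph (adiff f g))) V Y"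
    unfolding submodule_iff[OF Y] R
  proof (intro conjI ballI)
    show "{y \<ominus>\<^bsub>Y\<^esub> z | x y z. (x, y) \<in> agraph f \<and> (x, z) \<in> agraph g} \<subseteq> carrier Y"
      using linrelD(7)[OF f] linrelD(7)[OF g] by auto
    show "\<zero>\<^bsub>Y\<^esub> \<in> {y \<ominus>\<^bsub>Y\<^esub> z | x y z. (x, y) \<in> agraph f \<and> (x, z) \<in> agraph g}"
      using F(2) G(2) Y.minus_eq_zero_iff[of "\<zero>\<^bsub>Y\<^esub>" "\<zero>\<^bsub>Y\<^esub>"] by force
  next
    fix w w' assume "w \<in> {y \<ominus>\<^bsub>Y\<^esub> z | x y z. (x, y) \<in> agraph f \<and> (x, z) \<in> agraph g}" "w' \<in> {y \<ominus>\<^bsub>Y\<^esub> z | x y z. (x, y) \<in> agraph f \<and> (x, z) \<in> agraph g}"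
    then obtain x x' y z y' z' where yz: "w = y \<ominus>\<^bsub>Y\<^esub> z" "(x, y) \<in> agraph f" "(x, z) \<in> agraph g"
      "w' = y' \<ominus>\<^bsub>Y\<^esub> z'" "(x', y') \<in> agraph f" "(x', z') \<in> agraph g" by blast
    note c = linrelD(7)[OF f yz(2)] linrelD(7)[OF g yz(3)] linrelD(7)[OF f yz(5)] linrelD(7)[OF g yz(6)]
    have "w \<oplus>\<^bsub>Y\<^esub> w' = (y \<oplus>\<^bsub>Y\<^esub> y') \<ominus>\<^bsub>Y\<^esub> (z \<oplus>\<^bsub>Y\<^esub> z')"
      using c by (simp add: yz a_minus_def Y.M.minus_add Y.M.a_ac)
    then show "w \<oplus>\<^bsub>Y\<^esub> w' \<in> {y \<ominus>\<^bsub>Y\<^esub> z | x y z. (x, y) \<in> agraph f \<and> (x, z) \<in> agraph g}"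
      using F(3)[OF yz(2,5)] G(3)[OF yz(3,6)] by auto
  next
    fix v w assume v: "v \<in> carrier V" and "w \<in> {y \<ominus>\<^bsub>Y\<^esub> z | x y z. (x, y) \<in> agraph f \<and> (x, z) \<in> agraph g}"
    then obtain x y z where yz: "w = y \<ominus>\<^bsub>Y\<^esub> z" "(x, y) \<in> agraph f" "(x, z) \<in> agraph g" by blast
    have "v \<odot>\<^bsub>Y\<^esub> w = v \<odot>\<^bsub>Y\<^esub> y \<ominus>\<^bsub>Y\<^esub> v \<odot>\<^bsub>Y\<^esub> z"
      using linrelD(7)[OF f yz(2)] linrelD(7)[OF g yz(3)] v by (simp add: yz Y.smult_minus)
    then show "v \<odot>\<^bsub>Y\<^esub> w \<in> {y \<ominus>\<^bsub>Y\<^esub> z | x y z. (x, y) \<in> agraph f \<and> (x, z) \<in> agraph g}"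
      using F(4)[OF v yz(2)] G(4)[OF v yz(3)] by auto
  qed
  from msat_submodule[OF Y this] show ?thesis by (simp add: aimage_def adiff_def linrelD(4)[OF f])
qed

lemma msat_msat: "module V X \<Longrightarrow> submodule N V X \<Longrightarrow> msat X (msat X N) = msat X N"
proof (rule subset_antisym)
  assume X: "module V X" and N: "submodule N V X"
  show "msat X (msat X N) \<subseteq> msat X N"
  proof
    fix x assume "x \<in> msat X (msat X N)"
    then have "x \<in> carrier X" "\<And>e. e \<in> \<mm> \<Longrightarrow> e \<odot>\<^bsub>X\<^esub> x \<in> msat X N" by (auto simp: msat_def[of X "msat X N"])
    then show "x \<in> msat X N" by (rule msat_eqD[OF _ X N])
  qed
  show "msat X N \<subseteq> msat X (msat X N)" by (rule msat_superset[OF X msat_submodule[OF X N]])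
qed

text \<open>The image of a descended relation can be computed before descending, whether or not the
  descended relation is single-valued.\<close>

lemma aimage_adescend:
  assumes q: "is_amor X Y q" and f: "is_amor X W f" and c: "is_amor W Z c"
  shows "aimage (adescend q f \<Zsemi> c) = aimage (f \<Zsemi> c)"
proof -
  note X = amorD(1)[OF q] and Y = amorD(2)[OF q] and W = amorD(2)[OF f] and Z = amorD(2)[OF c]
  note fc = is_amor_acomp[OF f c]
  interpret W: module V W by fact
  let ?S = "(agraph q)\<inverse> O agraph f"
  have ad: "agraph (adescend q f) = span_mod V (sum_mod Y W) (?S \<union> {\<zero>\<^bsub>Y\<^esub>} \<times> mtors W) \<inter> mpart Y \<times> carrier W"
    by (simp add: adescend_def gen_amor_def amorD(4)[OF q] amorD(4)[OF f])
  have sub: "submodule (Range (agraph f)) V W" by (rule amor_Range[OF f])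
  have "submodule (carrier Y \<times> msat W (Range (agraph f))) V (sum_mod Y W)"
    using submoduleD[OF W msat_submodule[OF W sub]] submoduleD[OF Y submodule_carrier[OF Y]]
    by (auto simp: submodule_iff[OF module_sum_mod[OF Y W]])
  moreover have "?S \<union> {\<zero>\<^bsub>Y\<^esub>} \<times> mtors W \<subseteq> carrier Y \<times> msat W (Range (agraph f))"
    using msat_superset[OF W sub] amorD(6)[OF q] submoduleD(2)[OF W sub] submoduleD(2)[OF Y submodule_carrier[OF Y]]
    by (auto simp: msat_def mtors_def)
  ultimately have up: "w \<in> msat W (Range (agraph f))" if "(y, w) \<in> agraph (adescend q f)" for y w
    using span_mod_least that unfolding ad by blast
  have 1: "Range (agraph (adescend q f \<Zsemi> c)) \<subseteq> msat Z (Range (agraph (f \<Zsemi> c)))"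
  proof
    fix z assume "z \<in> Range (agraph (adescend q f \<Zsemi> c))"
    then obtain y w where yw: "(y, w) \<in> agraph (adescend q f)" "(w, z) \<in> agraph c" by (auto simp: acomp_def)
    have "e \<odot>\<^bsub>Z\<^esub> z \<in> Range (agraph (f \<Zsemi> c))" if e: "e \<in> \<mm>" for e
    proof -
      have "e \<odot>\<^bsub>W\<^esub> w \<in> Range (agraph f)" using up[OF yw(1)] e by (auto simp: msat_def)
      then show ?thesis using amorD(8)[OF c mm_carrier[OF e] yw(2)] by (auto simp: acomp_def)
    qed
    then show "z \<in> msat Z (Range (agraph (f \<Zsemi> c)))" using amorD(6)[OF c yw(2)] by (simp add: msat_def)
  qed
  have 2: "Range (agraph (f \<Zsemi> c)) \<subseteq> Range (agraph (adescend q f \<Zsemi> c))"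
  proof
    fix z assume "z \<in> Range (agraph (f \<Zsemi> c))"
    then obtain x w where xw: "(x, w) \<in> agraph f" "(w, z) \<in> agraph c" by (auto simp: acomp_def)
    obtain y where y: "y \<in> mpart Y" "(x, y) \<in> agraph q" using amor_total[OF q amorD(5)[OF f xw(1)]] by blast
    then have "(y, w) \<in> ?S" using xw by auto
    then have "(y, w) \<in> agraph (adescend q f)" unfolding ad
      using span_mod_base[of "(y, w)" "?S \<union> {\<zero>\<^bsub>Y\<^esub>} \<times> mtors W"] y amorD(6)[OF f xw(1)] by blast
    then show "z \<in> Range (agraph (adescend q f \<Zsemi> c))" using xw by (auto simp: acomp_def)
  qed
  have "msat Z (Range (agraph (adescend q f \<Zsemi> c))) = msat Z (Range (agraph (f \<Zsemi> c)))"
    using msat_mono[OF 1, of Z] msat_mono[OF 2, of Z] msat_msat[OF Z amor_Range[OF fc]] by blast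
  then show ?thesis by (simp add: aimage_def acomp_def amorD(4)[OF c])
qed

lemma csub_mono:
  assumes X: "module V X" and N: "submodule N V X" "submodule N' V X" and le: "N \<subseteq> N'"
  shows "csub X N \<subseteq> csub X N'"
proof
  fix u assume "u \<in> csub X N"
  with X N(1) show "u \<in> csub X N'"
  proof (induct rule: csub_induct)
    case (base e y)
    then show ?case using csubI[OF N(2) X] le by blast
  next
    case (add u w)
    then show ?case using submoduleD(3)[OF module_core[OF X] csub_submodule[OF X N(2)]] by blast
  qed
qed

lemma csub_span:
  assumes X: "module V X" and S: "S \<subseteq> carrier X"
  shows "csub X (span_mod V X S) = span_mod V (core X) {cl X (e \<odot>\<^bsub>X\<^esub> y) |e y. e \<in> \<mm> \<and> y \<in> S}" (is "_ = span_mod V (core X) ?G")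
proof (rule subset_antisym)
  interpret X: module V X by fact
  note C = module_core[OF X]
  note N = span_mod_submodule[OF X S]
  have G: "?G \<subseteq> elts X" using S by (auto intro!: cl_closed mpart_base)
  note D = submoduleD[OF C span_mod_submodule[OF C G]]
  show "span_mod V (core X) ?G \<subseteq> csub X (span_mod V X S)"
    by (rule span_mod_least[OF csub_submodule[OF X N]]) (use csubI[OF N X] span_mod_base[of _ S V X] in auto)
  have *: "\<forall>e\<in>\<mm>. cl X (e \<odot>\<^bsub>X\<^esub> y) \<in> span_mod V (core X) ?G" if "y \<in> span_mod V X S" for y
    using X S that
  proof (induct rule: span_mod_induct)
    case (base x)
    then show ?case by (auto intro!: span_mod_base)
  next
    case zero
    then show ?case using D(2) by (simp add: mm_carrier core_zero)
  next
    case (add x y)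
    then show ?case using D(3) by (simp add: cl_base_add[OF X])
  next
    case (smult v x)
    then show ?case using D(4) by (simp add: cl_base_smult[OF X])
  qed
  show "csub X (span_mod V X S) \<subseteq> span_mod V (core X) ?G"
  proof
    fix u assume "u \<in> csub X (span_mod V X S)"
    with X N show "u \<in> span_mod V (core X) ?G"
      by (induct rule: csub_induct) (use * D(3) in auto)
  qed
qed

end

section \<open>Smith ideals and modules on the level of cores\<close>

locale smith_setup = almost_setup V \<mm> for V :: "'v ring" (structure) and \<mm> +
  fixes A :: "('v, 'a) aalg" and J :: "('v, 'i, 'a) smith"
  assumes alg: "almost_algebra A" and smith: "smith_ideal A J"
begin

abbreviation "RR \<equiv> alg_obj A"
abbreviation "II \<equiv> asrc (s_arrow J)"
abbreviation "SM \<equiv> smith_module J"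

lemma alg_amors: "is_amor (RR \<otimes>\<^sub>m RR) RR (alg_mult A)" "is_amor (self_mod V) RR (alg_unit A)"
  using alg by (auto simp: almost_algebra_def Let_def)

lemma RR: "module V RR" using amorD(2)[OF alg_amors(1)] .

definition mulc :: "'a set \<Rightarrow> 'a set \<Rightarrow> 'a set" where
  "mulc a b = ev (alg_mult A) (ptc RR RR a b)"

definition actc :: "('v, 'a, 'x) amodule \<Rightarrow> 'a set \<Rightarrow> 'x set \<Rightarrow> 'x set" where
  "actc M a x = ev (act M) (ptc RR (obj M) a x)"

text \<open>An action of \<open>A\<close> suffices to form tensor products over \<open>A\<close> and to speak of linear maps; \<open>amod\<close> adds
  associativity.\<close>

definition premod :: "('v, 'a, 'x) amodule \<Rightarrow> bool" where
  "premod M \<longleftrightarrow> module V (obj M) \<and> is_amor (RR \<otimes>\<^sub>m obj M) (obj M) (act M)"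

definition amod :: "('v, 'a, 'x) amodule \<Rightarrow> bool" where
  "amod M \<longleftrightarrow> premod M \<and> (\<forall>a\<in>elts RR. \<forall>b\<in>elts RR. \<forall>x\<in>elts (obj M).
     actc M (mulc a b) x = actc M a (actc M b x))"

lemma premodD: "premod M \<Longrightarrow> module V (obj M)" "premod M \<Longrightarrow> is_amor (RR \<otimes>\<^sub>m obj M) (obj M) (act M)"
  by (auto simp: premod_def)

lemma amodD: "amod M \<Longrightarrow> premod M"
  "amod M \<Longrightarrow> a \<in> elts RR \<Longrightarrow> b \<in> elts RR \<Longrightarrow> x \<in> elts (obj M) \<Longrightarrow>
     actc M (mulc a b) x = actc M a (actc M b x)"
  by (auto simp: amod_def)

lemma amor_bilin:
  assumes X: "module V X" and Y: "module V Y" and f: "is_amor (X \<otimes>\<^sub>m Y) Z f"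
  shows "bilin V (core X) (core Y) (core Z) (\<lambda>x y. ev f (ptc X Y x y))"
proof -
  have i: "(\<lambda>z. z) \<in> mod_hom V X' X'" for X' :: "('v, 'z) module" by (rule mod_homI) auto
  show ?thesis by (rule bilin_comp[OF ptc_bilin[OF X Y] i i ev_hom[OF f]])
qed

lemma actc_bilin: "premod M \<Longrightarrow> bilin V (core RR) (core (obj M)) (core (obj M)) (actc M)"
  unfolding actc_def[abs_def] by (rule amor_bilin[OF RR premodD(1) premodD(2)])

lemma mulc_bilin: "bilin V (core RR) (core RR) (core RR) mulc"
  unfolding mulc_def[abs_def] by (rule amor_bilin[OF RR RR alg_amors(1)])

lemmas actc_simps = bilinD[OF actc_bilin]
lemmas mulc_simps = bilinD[OF mulc_bilin]

lemma mulc_comm: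
  assumes "a \<in> elts RR" "b \<in> elts RR" shows "mulc a b = mulc b a"
proof -
  have "aswap RR RR \<Zsemi> alg_mult A = alg_mult A" using alg by (simp add: almost_algebra_def Let_def)
  then have "mulc a b = ev (aswap RR RR \<Zsemi> alg_mult A) (ptc RR RR a b)" by (simp add: mulc_def)
  then show ?thesis
    using assms by (simp add: ev_acomp[OF is_amor_aswap[OF RR RR] alg_amors(1)] ptc_simps(1)[OF RR RR] ev_aswap[OF RR RR] mulc_def)
qed

lemma self_mod: "module V (self_mod V)" by (rule module_self_mod[OF V_cring])

text \<open>The unit of \<open>A\<close> is not an element of its core, but its multiples by elements of \<open>\<mm>\<close> are.\<close>

lemma unit_ex:
  assumes e: "e \<in> \<mm>"
  obtains w where "w \<in> elts RR" "\<And>a. a \<in> elts RR \<Longrightarrow> mulc w a = e \<odot>\<^bsub>core RR\<^esub> a"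
proof -
  have em: "e \<in> mpart (self_mod V)" using mpart_base[OF e, of \<one> "self_mod V"] e by (simp add: mm_carrier)
  \<comment> \<open>the image of \<open>e\<close> plays the role of \<open>e 1\<close>\<close>
  let ?w = "ev (alg_unit A) (cl (self_mod V) e)"
  have w: "?w \<in> elts RR" by (rule ev_closed[OF alg_amors(2) cl_closed[OF em]])
  have un: "(alg_unit A \<otimes>\<^sub>a aid RR) \<Zsemi> alg_mult A = alunit RR" using alg by (simp add: almost_algebra_def Let_def)
  note t = is_amor_amap_tens[OF alg_amors(2) is_amor_aid[OF RR]]
  have al: "is_amor (self_mod V \<otimes>\<^sub>m RR) RR (alunit RR)" using is_amor_acomp[OF t alg_amors(1)] un by simp
  show ?thesis
  proof (rule that[OF w])
    fix a assume a: "a \<in> elts RR"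
    then obtain x where x: "x \<in> mpart RR" "a = cl RR x" by (rule core_cases)
    note xc = mpart_carrier[OF RR x(1)]
    let ?p = "pure_tens V (self_mod V) RR e x"
    have pm: "?p \<in> mpart (self_mod V \<otimes>\<^sub>m RR)" by (rule pt_mpart[OF self_mod RR em xc])
    have "(?p, e \<odot>\<^bsub>RR\<^esub> x) \<in> agraph (alunit RR)"
    proof -
      have "(?p, e \<odot>\<^bsub>RR\<^esub> x) \<in> span_mod V (sum_mod (self_mod V \<otimes>\<^sub>m RR) RR)
        ({(pure_tens V (self_mod V) RR v x, v \<odot>\<^bsub>RR\<^esub> x) | v x. v \<in> carrier V \<and> x \<in> carrier RR} \<union> {\<zero>\<^bsub>self_mod V \<otimes>\<^sub>m RR\<^esub>} \<times> mtors RR)"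
        using xc mm_carrier[OF e] by (intro span_mod_base) blast
      then show ?thesis using pm mpart_carrier[OF RR mpart_base[OF e xc]] by (simp add: alunit_def gen_amor_def)
    qed
    then have "ev (alunit RR) (cl (self_mod V \<otimes>\<^sub>m RR) ?p) = cl RR (e \<odot>\<^bsub>RR\<^esub> x)"
      by (rule ev_cl[OF al _ mpart_base[OF e xc]])
    moreover have "ev (alunit RR) (ptc (self_mod V) RR (cl (self_mod V) e) a) = mulc ?w a"
      using a cl_closed[OF em]
      by (simp add: un[symmetric] ev_acomp[OF t alg_amors(1)] ptc_simps(1)[OF self_mod RR] ev_amap_tens[OF alg_amors(2) is_amor_aid[OF RR]] ev_aid[OF RR] mulc_def)
    ultimately show "mulc ?w a = e \<odot>\<^bsub>core RR\<^esub> a"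
      using x e by (simp add: ptc_cl[OF self_mod RR em x(1)] cl_smult[OF RR mm_carrier[OF e]])
  qed
qed

lemma almost_module_amod:
  assumes M: "almost_module A M" shows "amod M"
proof -
  have am: "is_amor (RR \<otimes>\<^sub>m obj M) (obj M) (act M)"
    and ass: "(alg_mult A \<otimes>\<^sub>a aid (obj M)) \<Zsemi> act M = aassoc RR RR (obj M) \<Zsemi> (aid RR \<otimes>\<^sub>a act M) \<Zsemi> act M"
    using M by (auto simp: almost_module_def Let_def)
  note X = amorD(2)[OF am] and t = is_amor_amap_tens[OF alg_amors(1) is_amor_aid[OF amorD(2)[OF am]]]
    and t' = is_amor_amap_tens[OF is_amor_aid[OF RR] am]
    and a = is_amor_aassoc[OF RR RR amorD(2)[OF am]]
  have "actc M (mulc x y) z = actc M x (actc M y z)"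
    if xyz: "x \<in> elts RR" "y \<in> elts RR" "z \<in> elts (obj M)" for x y z
  proof -
    let ?p = "ptc (RR \<otimes>\<^sub>m RR) (obj M) (ptc RR RR x y) z"
    note p = ptc_simps(1)[OF RR RR xyz(1,2)]
    note p' = ptc_simps(1)[OF module_tens[OF RR RR] X p xyz(3)]
    note q = ptc_simps(1)[OF RR X xyz(2,3)]
    note q' = ptc_simps(1)[OF RR module_tens[OF RR X] xyz(1) q]
    have "actc M (mulc x y) z = ev ((alg_mult A \<otimes>\<^sub>a aid (obj M)) \<Zsemi> act M) ?p"
      using p xyz(3) by (simp add: ev_acomp[OF t am p'] ev_amap_tens[OF alg_amors(1) is_amor_aid[OF X]] ev_aid[OF X] actc_def mulc_def)
    also have "\<dots> = ev (aassoc RR RR (obj M) \<Zsemi> (aid RR \<otimes>\<^sub>a act M) \<Zsemi> act M) ?p" by (simp only: ass)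
    also have "\<dots> = actc M x (actc M y z)"
      using xyz q by (simp add: ev_acomp[OF is_amor_acomp[OF a t'] am p'] ev_acomp[OF a t' p'] ev_aassoc[OF RR RR X]
          ev_amap_tens[OF is_amor_aid[OF RR] am] ev_aid[OF RR] actc_def)
    finally show ?thesis .
  qed
  then show ?thesis using am X by (simp add: amod_def premod_def)
qed

text \<open>Equality of two morphisms out of a tensor product can be tested on pairs of elements of the cores.\<close>

lemma alinear_iff:
  assumes M: "premod M" and N: "premod N"
  shows "alinear A M N f \<longleftrightarrow> is_amor (obj M) (obj N) f \<and>
    (\<forall>a\<in>elts RR. \<forall>x\<in>elts (obj M). ev f (actc M a x) = actc N a (ev f x))"
proof (cases "is_amor (obj M) (obj N) f")
  case f: True
  note t = is_amor_amap_tens[OF is_amor_aid[OF RR] f]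
  note 1 = is_amor_acomp[OF premodD(2)[OF M] f] and 2 = is_amor_acomp[OF t premodD(2)[OF N]]
  have e1: "ev (act M \<Zsemi> f) (ptc RR (obj M) a x) = ev f (actc M a x)"
    and e2: "ev ((aid RR \<otimes>\<^sub>a f) \<Zsemi> act N) (ptc RR (obj M) a x) = actc N a (ev f x)"
    if ax: "a \<in> elts RR" "x \<in> elts (obj M)" for a x
    using ax ptc_simps(1)[OF RR premodD(1)[OF M] ax]
    by (simp_all add: ev_acomp[OF premodD(2)[OF M] f] ev_acomp[OF t premodD(2)[OF N]] actc_def
        ev_amap_tens[OF is_amor_aid[OF RR] f] ev_aid[OF RR])
  show ?thesis
  proof
    assume "alinear A M N f"
    then have eq: "act M \<Zsemi> f = (aid RR \<otimes>\<^sub>a f) \<Zsemi> act N" by (simp add: alinear_def)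
    then show "is_amor (obj M) (obj N) f \<and> (\<forall>a\<in>elts RR. \<forall>x\<in>elts (obj M). ev f (actc M a x) = actc N a (ev f x))"
      using f e1 e2 by metis
  next
    assume r: "is_amor (obj M) (obj N) f \<and> (\<forall>a\<in>elts RR. \<forall>x\<in>elts (obj M). ev f (actc M a x) = actc N a (ev f x))"
    have "act M \<Zsemi> f = (aid RR \<otimes>\<^sub>a f) \<Zsemi> act N"
      by (rule tens_amor_eqI[OF 1 2 RR premodD(1)[OF M]]) (use r e1 e2 in simp)
    then show "alinear A M N f" using f by (simp add: alinear_def)
  qed
qed (simp add: alinear_def)

lemma amod_sub:
  assumes M: "amod M" and N: "submodule N V (obj M)"
    and stable: "\<And>a u. a \<in> elts RR \<Longrightarrow> u \<in> csub (obj M) N \<Longrightarrow> actc M a u \<in> csub (obj M) N"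
  shows amod_sub_amodule: "amod (sub_amodule A M N)"
    and actc_sub_amodule: "a \<in> elts RR \<Longrightarrow> u \<in> elts (sub_mod (obj M) N) \<Longrightarrow>
      ev (aincl (obj M) N) (actc (sub_amodule A M N) a u) = actc M a (ev (aincl (obj M) N) u)"
    and obj_sub_amodule: "obj (sub_amodule A M N) = sub_mod (obj M) N"
proof -
  note Mp = amodD(1)[OF M]
  note X = premodD(1)[OF Mp]
  note i = is_amor_aincl[OF X N] and inj = ev_aincl_inj[OF X N] and im = ev_aincl_image[OF X N]
  note S = module_sub_mod[OF X N]
  let ?i = "aincl (obj M) N"
  note t = is_amor_amap_tens[OF is_amor_aid[OF RR] i]
  note c = is_amor_acomp[OF t premodD(2)[OF Mp]]
  have evc: "ev ((aid RR \<otimes>\<^sub>a ?i) \<Zsemi> act M) (ptc RR (sub_mod (obj M) N) a u) = actc M a (ev ?i u)"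
    if "a \<in> elts RR" "u \<in> elts (sub_mod (obj M) N)" for a u
    using that by (simp add: ev_acomp[OF t premodD(2)[OF Mp]] ptc_simps(1)[OF RR S] ev_amap_tens[OF is_amor_aid[OF RR] i] ev_aid[OF RR] actc_def)
  have st: "ev ((aid RR \<otimes>\<^sub>a ?i) \<Zsemi> act M) (ptc RR (sub_mod (obj M) N) a u) \<in> csub (obj M) N"
    if "a \<in> elts RR" "u \<in> elts (sub_mod (obj M) N)" for a u
  proof -
    have "ev ?i u \<in> csub (obj M) N" using im that(2) by blast
    then show ?thesis using evc[OF that] stable[OF that(1)] by simp
  qed
  have im': "ev ((aid RR \<otimes>\<^sub>a ?i) \<Zsemi> act M) w \<in> ev ?i ` elts (sub_mod (obj M) N)"
    if w: "w \<in> elts (RR \<otimes>\<^sub>m sub_mod (obj M) N)" for w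
    unfolding im
    by (rule tens_image_sub[OF RR S module_core[OF X] ev_hom[OF c] csub_submodule[OF X N] _ w])
       (rule st)
  show o: "obj (sub_amodule A M N) = sub_mod (obj M) N" by (simp add: sub_amodule_def Let_def)
  have a: "act (sub_amodule A M N) = alift ?i ((aid RR \<otimes>\<^sub>a ?i) \<Zsemi> act M)" by (simp add: sub_amodule_def Let_def)
  have am: "is_amor (RR \<otimes>\<^sub>m sub_mod (obj M) N) (sub_mod (obj M) N) (act (sub_amodule A M N))"
    unfolding a by (rule is_amor_alift[OF i c inj im'])
  then have p: "premod (sub_amodule A M N)" using S o by (simp add: premod_def)
  show e: "ev ?i (actc (sub_amodule A M N) a u) = actc M a (ev ?i u)"
    if "a \<in> elts RR" "u \<in> elts (sub_mod (obj M) N)" for a u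
    using ev_alift[OF i c inj im' ptc_simps(1)[OF RR S that]] evc[OF that] by (simp add: actc_def a o)
  note cls = actc_simps(1)[OF p, unfolded o] actc_simps(1)[OF Mp] ev_closed[OF i] mulc_simps(1)
  have "actc (sub_amodule A M N) (mulc a b) u = actc (sub_amodule A M N) a (actc (sub_amodule A M N) b u)"
    if "a \<in> elts RR" "b \<in> elts RR" "u \<in> elts (sub_mod (obj M) N)" for a b u
    by (rule inj_onD[OF inj]) (use that in \<open>simp_all add: e cls amodD(2)[OF M]\<close>)
  then show "amod (sub_amodule A M N)" using p o by (simp add: amod_def)
qed

lemma amod_quot:
  assumes M: "amod M" and N: "submodule N V (obj M)"
    and stable: "\<And>a u. a \<in> elts RR \<Longrightarrow> u \<in> elts (obj M) \<Longrightarrow>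
      ev (aproj (obj M) N) u = \<zero>\<^bsub>core (quot_mod (obj M) N)\<^esub> \<Longrightarrow>
      ev (aproj (obj M) N) (actc M a u) = \<zero>\<^bsub>core (quot_mod (obj M) N)\<^esub>"
  shows amod_quot_amodule: "amod (quot_amodule A M N)"
    and actc_quot_amodule: "a \<in> elts RR \<Longrightarrow> u \<in> elts (obj M) \<Longrightarrow>
      actc (quot_amodule A M N) a (ev (aproj (obj M) N) u) = ev (aproj (obj M) N) (actc M a u)"
    and obj_quot_amodule: "obj (quot_amodule A M N) = quot_mod (obj M) N"
proof -
  note Mp = amodD(1)[OF M]
  note X = premodD(1)[OF Mp]
  note Y = module_quot_mod[OF X N] and q = is_amor_aproj[OF X N] and sur = ev_aproj_surj[OF X N]
  let ?q = "aproj (obj M) N" and ?Y = "quot_mod (obj M) N"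
  note CX = module_core[OF X] and CY = module_core[OF Y] and CR = module_core[OF RR]
  note t = is_amor_amap_tens[OF is_amor_aid[OF RR] q]
  note c = is_amor_acomp[OF premodD(2)[OF Mp] q]
  have evt: "ev (aid RR \<otimes>\<^sub>a ?q) (ptc RR (obj M) a u) = ptc RR ?Y a (ev ?q u)"
    and evc: "ev (act M \<Zsemi> ?q) (ptc RR (obj M) a u) = ev ?q (actc M a u)"
    if "a \<in> elts RR" "u \<in> elts (obj M)" for a u
    using that by (simp_all add: ev_amap_tens[OF is_amor_aid[OF RR] q] ev_aid[OF RR] ev_acomp[OF premodD(2)[OF Mp] q] ptc_simps(1)[OF RR X] actc_def)
  have "\<exists>k. k \<in> mod_hom V (core ?Y) (core ?Y) \<and> (\<forall>u\<in>elts (obj M). k (ev ?q u) = ev ?q (actc M a u))"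
    if a: "a \<in> elts RR" for a
  proof -
    have h: "(\<lambda>u. ev ?q (actc M a u)) \<in> mod_hom V (core (obj M)) (core ?Y)"
      by (rule mod_hom_comp[OF _ ev_hom[OF q]]) (use actc_bilin[OF Mp] a in \<open>simp add: bilin_def\<close>)
    show ?thesis by (rule hom_factor[OF CX CY CY ev_hom[OF q] h sur stable[OF a]]) blast+
  qed
  then obtain k where k: "\<And>a. a \<in> elts RR \<Longrightarrow> k a \<in> mod_hom V (core ?Y) (core ?Y)"
    and kq: "\<And>a u. a \<in> elts RR \<Longrightarrow> u \<in> elts (obj M) \<Longrightarrow> k a (ev ?q u) = ev ?q (actc M a u)" by metis
  have lift: "\<exists>u\<in>elts (obj M). y = ev ?q u" if "y \<in> elts ?Y" for y using sur that by (metis imageE)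
  have kb: "bilin V (core RR) (core ?Y) (core ?Y) k"
  proof (rule bilinI)
    fix a a' y assume a: "a \<in> elts RR" "a' \<in> elts RR" and "y \<in> elts ?Y"
    then obtain u where u: "u \<in> elts (obj M)" "y = ev ?q u" using lift by blast
    show "k (a \<oplus>\<^bsub>core RR\<^esub> a') y = k a y \<oplus>\<^bsub>core ?Y\<^esub> k a' y"
      using a u submoduleD(3)[OF CR submodule_carrier[OF CR]]
      by (simp add: kq actc_simps(2)[OF Mp] mod_hom_add[OF ev_hom[OF q]] actc_simps(1)[OF Mp])
  next
    fix v a y assume v: "v \<in> carrier V" and a: "a \<in> elts RR" and "y \<in> elts ?Y"
    then obtain u where u: "u \<in> elts (obj M)" "y = ev ?q u" using lift by blast
    show "k (v \<odot>\<^bsub>core RR\<^esub> a) y = v \<odot>\<^bsub>core ?Y\<^esub> k a y"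
      using v a u submoduleD(4)[OF CR submodule_carrier[OF CR]]
      by (simp add: kq actc_simps(4)[OF Mp] mod_hom_smult[OF ev_hom[OF q]] actc_simps(1)[OF Mp])
  qed (auto simp: mod_hom_closed[OF k] mod_hom_add[OF k] mod_hom_smult[OF k])
  obtain H where H: "H \<in> mod_hom V (core (RR \<otimes>\<^sub>m ?Y)) (core ?Y)"
    and Hp: "\<And>a y. a \<in> elts RR \<Longrightarrow> y \<in> elts ?Y \<Longrightarrow> H (ptc RR ?Y a y) = k a y"
    using tens_core_universal[OF RR Y Y kb] by blast
  have fact: "H (ev (aid RR \<otimes>\<^sub>a ?q) w) = ev (act M \<Zsemi> ?q) w" if w: "w \<in> elts (RR \<otimes>\<^sub>m obj M)" for w
    by (rule tens_hom_eqI[OF RR X CY mod_hom_comp[OF ev_hom[OF t] H] ev_hom[OF c] _ w])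
       (simp add: evt evc Hp ev_closed[OF q] kq)
  have tsur: "ev (aid RR \<otimes>\<^sub>a ?q) ` elts (RR \<otimes>\<^sub>m obj M) = elts (RR \<otimes>\<^sub>m ?Y)"
  proof (rule subset_antisym; rule subsetI)
    note T = module_tens[OF RR X] and T' = module_tens[OF RR Y]
    note img = submodule_image[OF ev_hom[OF t] module_core[OF T] module_core[OF T'] submodule_carrier[OF module_core[OF T]]]
    have i: "(\<lambda>z. z) \<in> mod_hom V (core (RR \<otimes>\<^sub>m ?Y)) (core (RR \<otimes>\<^sub>m ?Y))" by (rule mod_homI) auto
    fix w assume w: "w \<in> elts (RR \<otimes>\<^sub>m ?Y)"
    show "w \<in> ev (aid RR \<otimes>\<^sub>a ?q) ` elts (RR \<otimes>\<^sub>m obj M)"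
    proof (rule tens_image_sub[OF RR Y module_core[OF T'] i img _ w])
      fix a y assume a: "a \<in> elts RR" and "y \<in> elts ?Y"
      then obtain u where u: "u \<in> elts (obj M)" "y = ev ?q u" using lift by blast
      then show "ptc RR ?Y a y \<in> ev (aid RR \<otimes>\<^sub>a ?q) ` elts (RR \<otimes>\<^sub>m obj M)"
        using evt[OF a u(1)] ptc_simps(1)[OF RR X a u(1)] by (metis imageI)
    qed
  qed (use ev_closed[OF t] in auto)
  have ker: "ev (act M \<Zsemi> ?q) w = \<zero>\<^bsub>core ?Y\<^esub>" if "w \<in> elts (RR \<otimes>\<^sub>m obj M)" "ev (aid RR \<otimes>\<^sub>a ?q) w = \<zero>\<^bsub>core (RR \<otimes>\<^sub>m ?Y)\<^esub>" for w
    using fact[OF that(1)] that(2) mod_hom_zero[OF H module_core[OF module_tens[OF RR Y]] CY] by simp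
  show o: "obj (quot_amodule A M N) = ?Y" by (simp add: quot_amodule_def Let_def)
  have a: "act (quot_amodule A M N) = adescend (aid RR \<otimes>\<^sub>a ?q) (act M \<Zsemi> ?q)" by (simp add: quot_amodule_def Let_def)
  have am: "is_amor (RR \<otimes>\<^sub>m ?Y) ?Y (act (quot_amodule A M N))"
    unfolding a by (rule is_amor_adescend[OF t c tsur ker])
  then have p: "premod (quot_amodule A M N)" using Y o by (simp add: premod_def)
  show e: "actc (quot_amodule A M N) a (ev ?q u) = ev ?q (actc M a u)"
    if "a \<in> elts RR" "u \<in> elts (obj M)" for a u
    using ev_adescend[OF t c tsur ker ptc_simps(1)[OF RR X that]] evc[OF that] evt[OF that] by (simp add: actc_def o a)
  have "actc (quot_amodule A M N) (mulc a b) y = actc (quot_amodule A M N) a (actc (quot_amodule A M N) b y)"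
    if ab: "a \<in> elts RR" "b \<in> elts RR" and y: "y \<in> elts ?Y" for a b y
  proof -
    obtain u where u: "u \<in> elts (obj M)" "y = ev ?q u" using lift y by blast
    show ?thesis using ab u by (simp add: e mulc_simps(1) actc_simps(1)[OF Mp] amodD(2)[OF M])
  qed
  then show "amod (quot_amodule A M N)" using p o by (simp add: amod_def)
qed

lemma amod_alim:
  assumes T: "\<And>n. amod (T n)" and t: "\<And>n. is_amor (obj (T (Suc n))) (obj (T n)) (t n)"
    and lin: "\<And>n a x. a \<in> elts RR \<Longrightarrow> x \<in> elts (obj (T (Suc n))) \<Longrightarrow>
      ev (t n) (actc (T (Suc n)) a x) = actc (T n) a (ev (t n) x)"
  shows amod_alim_module: "amod (alim_module A T t)"
    and actc_alim_module: "a \<in> elts RR \<Longrightarrow> u \<in> elts (alim (obj \<circ> T) t) \<Longrightarrow>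
      ev (alim_proj (obj \<circ> T) t n) (actc (alim_module A T t) a u) = actc (T n) a (ev (alim_proj (obj \<circ> T) t n) u)"
    and obj_alim_module: "obj (alim_module A T t) = alim (obj \<circ> T) t"
proof -
  have t': "is_amor ((obj \<circ> T) (Suc n)) ((obj \<circ> T) n) (t n)" for n using t by simp
  let ?L = "alim (obj \<circ> T) t" and ?p = "alim_proj (obj \<circ> T) t"
  note L = module_alim[of "obj \<circ> T" t, OF t']
  have p: "is_amor ?L (obj (T n)) (?p n)" for n using is_amor_alim_proj[of "obj \<circ> T" t, OF t', of n] by simp
  have Tp: "premod (T n)" for n using amodD(1)[OF T] .
  note tp = is_amor_amap_tens[OF is_amor_aid[OF RR] p]
  have c: "is_amor (RR \<otimes>\<^sub>m ?L) (obj (T n)) ((aid RR \<otimes>\<^sub>a ?p n) \<Zsemi> act (T n))" for n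
    by (rule is_amor_acomp[OF tp premodD(2)[OF Tp]])
  have c': "is_amor (RR \<otimes>\<^sub>m ?L) ((obj \<circ> T) n) ((aid RR \<otimes>\<^sub>a ?p n) \<Zsemi> act (T n))" for n using c by simp
  have evc: "ev ((aid RR \<otimes>\<^sub>a ?p n) \<Zsemi> act (T n)) (ptc RR ?L a u) = actc (T n) a (ev (?p n) u)"
    if "a \<in> elts RR" "u \<in> elts ?L" for a u n
    using that by (simp add: ev_acomp[OF tp premodD(2)[OF Tp]] ptc_simps(1)[OF RR L] ev_amap_tens[OF is_amor_aid[OF RR] p] ev_aid[OF RR] actc_def)
  have compat: "ev (t n) (ev ((aid RR \<otimes>\<^sub>a ?p (Suc n)) \<Zsemi> act (T (Suc n))) w) = ev ((aid RR \<otimes>\<^sub>a ?p n) \<Zsemi> act (T n)) w"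
    if w: "w \<in> elts (RR \<otimes>\<^sub>m ?L)" for n w
    by (rule tens_hom_eqI[OF RR L module_core[OF premodD(1)[OF Tp]] mod_hom_comp[OF ev_hom[OF c] ev_hom[OF t]] ev_hom[OF c] _ w])
       (simp add: evc lin ev_closed[OF p] alim_proj_compat[of "obj \<circ> T" t, OF t'])
  show o: "obj (alim_module A T t) = ?L" by (simp add: alim_module_def Let_def)
  have a: "act (alim_module A T t) = alim_lift (obj \<circ> T) t (RR \<otimes>\<^sub>m ?L) (\<lambda>n. (aid RR \<otimes>\<^sub>a ?p n) \<Zsemi> act (T n))"
    by (simp add: alim_module_def Let_def)
  have am: "is_amor (RR \<otimes>\<^sub>m ?L) ?L (act (alim_module A T t))"
    unfolding a by (rule is_amor_alim_lift[of "obj \<circ> T" t, OF t' module_tens[OF RR L] c' compat])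
  then have pp: "premod (alim_module A T t)" using L o by (simp add: premod_def)
  show e: "ev (?p n) (actc (alim_module A T t) a u) = actc (T n) a (ev (?p n) u)"
    if "a \<in> elts RR" "u \<in> elts ?L" for a u n
    using ev_alim_lift[of "obj \<circ> T" t, OF t' module_tens[OF RR L] c' compat ptc_simps(1)[OF RR L that]] evc[OF that]
    by (simp only: actc_def a o)
  have "actc (alim_module A T t) (mulc a b) u = actc (alim_module A T t) a (actc (alim_module A T t) b u)"
    if ab: "a \<in> elts RR" "b \<in> elts RR" and u: "u \<in> elts ?L" for a b u
    by (rule alim_proj_eqI[of "obj \<circ> T" t, OF t'])
       (use ab u in \<open>simp_all add: e mulc_simps(1) actc_simps(1)[OF pp, unfolded o] amodD(2)[OF T] ev_closed[OF p]\<close>)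
  then show "amod (alim_module A T t)" using pp o by (simp add: amod_def)
qed

subsection \<open>The Smith ideal\<close>

lemma smith_amors:
  shows s_arrow_amor: "is_amor II RR (s_arrow J)"
    and s_mult_amor: "is_amor (box_obj (s_arrow J) (s_arrow J)) II (sq0 (s_mult J))"
    and s_mult_square: "sq0 (s_mult J) \<Zsemi> s_arrow J = (s_arrow J \<box> s_arrow J) \<Zsemi> alg_mult A"
    and s_mult_swap: "sq0 (box_swap (s_arrow J) (s_arrow J)) \<Zsemi> sq0 (s_mult J) = sq0 (s_mult J)"
proof -
  have m: "smith_monoid J" "atgt (s_arrow J) = RR" "sq1 (s_mult J) = alg_mult A" using smith by (auto simp: smith_ideal_def)
  show "is_amor II RR (s_arrow J)" using m by (simp add: smith_monoid_def Let_def)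
  have sq: "is_asq (s_arrow J \<box> s_arrow J) (s_arrow J) (s_mult J)"
    and sw: "box_swap (s_arrow J) (s_arrow J) \<Zsemi>\<^sub>s s_mult J = s_mult J" using m by (simp_all add: smith_monoid_def Let_def)
  have "asrc (s_arrow J \<box> s_arrow J) = box_obj (s_arrow J) (s_arrow J)" by (simp add: box_def gen_amor_def)
  then show "is_amor (box_obj (s_arrow J) (s_arrow J)) II (sq0 (s_mult J))"
    "sq0 (s_mult J) \<Zsemi> s_arrow J = (s_arrow J \<box> s_arrow J) \<Zsemi> alg_mult A" using sq m by (simp_all add: is_asq_def)
  show "sq0 (box_swap (s_arrow J) (s_arrow J)) \<Zsemi> sq0 (s_mult J) = sq0 (s_mult J)"
    using arg_cong[OF sw, of sq0] by (simp add: sq_comp_def)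
qed

lemma II: "module V II" using amorD(1)[OF s_arrow_amor] .
lemma s_tgt: "atgt (s_arrow J) = RR" using amorD(4)[OF s_arrow_amor] .

abbreviation "BS \<equiv> box_sum (s_arrow J) (s_arrow J)"
abbreviation "BK \<equiv> box_ker (s_arrow J) (s_arrow J)"
abbreviation "BO \<equiv> box_obj (s_arrow J) (s_arrow J)"

lemma BS: "BS = sum_mod (II \<otimes>\<^sub>m RR) (RR \<otimes>\<^sub>m II)"
  by (simp add: box_sum_def s_tgt)

lemmas IR = module_tens[OF II RR] and RI = module_tens[OF RR II] and ITI = module_tens[OF II II]

lemma module_BS: "module V BS"
  unfolding BS by (rule module_sum_mod[OF IR RI])

lemma box_amors:
  shows box_amor1: "is_amor (II \<otimes>\<^sub>m II) (II \<otimes>\<^sub>m RR) (aid II \<otimes>\<^sub>a s_arrow J)"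
    and box_amor2: "is_amor (II \<otimes>\<^sub>m II) (RR \<otimes>\<^sub>m II) (s_arrow J \<otimes>\<^sub>a aid II)"
  by (rule is_amor_amap_tens[OF is_amor_aid[OF II] s_arrow_amor] is_amor_amap_tens[OF s_arrow_amor is_amor_aid[OF II]])+

lemma BK_submodule:
  shows "submodule BK V BS"
    and "(c, p) \<in> agraph (aid II \<otimes>\<^sub>a s_arrow J) \<Longrightarrow> (c, q) \<in> agraph (s_arrow J \<otimes>\<^sub>a aid II) \<Longrightarrow>
      (p, \<ominus>\<^bsub>RR \<otimes>\<^sub>m II\<^esub> q) \<in> BK"
proof -
  interpret RI: module V "RR \<otimes>\<^sub>m II" by (rule RI)
  let ?f = "aid II \<otimes>\<^sub>a s_arrow J" and ?g = "s_arrow J \<otimes>\<^sub>a aid II"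
  let ?R = "{(p, \<ominus>\<^bsub>RR \<otimes>\<^sub>m II\<^esub> q) | c p q. (c, p) \<in> agraph ?f \<and> (c, q) \<in> agraph ?g}"
  have BK: "BK = msat BS ?R"
  proof -
    have "BK = msat BS (Range {(c, (p, \<ominus>\<^bsub>RR \<otimes>\<^sub>m II\<^esub> q)) | c p q. (c, p) \<in> agraph ?f \<and> (c, q) \<in> agraph ?g})"
      by (simp add: box_ker_def aimage_def s_tgt)
    also have "Range {(c, (p, \<ominus>\<^bsub>RR \<otimes>\<^sub>m II\<^esub> q)) | c p q. (c, p) \<in> agraph ?f \<and> (c, q) \<in> agraph ?g} = ?R" by blast
    finally show ?thesis .
  qed
  note f = box_amor1 and g = box_amor2
  have sub: "submodule ?R V BS"
    unfolding submodule_iff[OF module_BS]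
  proof (intro conjI ballI)
    show "?R \<subseteq> carrier BS" using amorD(6)[OF f] amorD(6)[OF g] by (auto simp: BS)
    have "(\<zero>\<^bsub>II \<otimes>\<^sub>m II\<^esub>, \<zero>\<^bsub>II \<otimes>\<^sub>m RR\<^esub>) \<in> agraph ?f"
      using submoduleD(2)[OF module_sum_mod[OF ITI IR] linrelD(5)[OF amor_linrel[OF f]]] by simp
    moreover have "(\<zero>\<^bsub>II \<otimes>\<^sub>m II\<^esub>, \<zero>\<^bsub>RR \<otimes>\<^sub>m II\<^esub>) \<in> agraph ?g"
      using submoduleD(2)[OF module_sum_mod[OF ITI RI] linrelD(5)[OF amor_linrel[OF g]]] by simp
    moreover have mz: "\<ominus>\<^bsub>RR \<otimes>\<^sub>m II\<^esub> \<zero>\<^bsub>RR \<otimes>\<^sub>m II\<^esub> = \<zero>\<^bsub>RR \<otimes>\<^sub>m II\<^esub>"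
      using RI.M.minus_equality[of "\<zero>\<^bsub>RR \<otimes>\<^sub>m II\<^esub>" "\<zero>\<^bsub>RR \<otimes>\<^sub>m II\<^esub>"] by simp
    moreover have "\<zero>\<^bsub>BS\<^esub> = (\<zero>\<^bsub>II \<otimes>\<^sub>m RR\<^esub>, \<ominus>\<^bsub>RR \<otimes>\<^sub>m II\<^esub> \<zero>\<^bsub>RR \<otimes>\<^sub>m II\<^esub>)"
      unfolding mz unfolding BS sum_mod_simps ..
    ultimately show "\<zero>\<^bsub>BS\<^esub> \<in> ?R" by blast
  next
    fix w w' assume "w \<in> ?R" "w' \<in> ?R"
    then obtain c p q c' p' q' where w: "w = (p, \<ominus>\<^bsub>RR \<otimes>\<^sub>m II\<^esub> q)" "(c, p) \<in> agraph ?f" "(c, q) \<in> agraph ?g"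
      "w' = (p', \<ominus>\<^bsub>RR \<otimes>\<^sub>m II\<^esub> q')" "(c', p') \<in> agraph ?f" "(c', q') \<in> agraph ?g" by blast
    have "\<ominus>\<^bsub>RR \<otimes>\<^sub>m II\<^esub> q \<oplus>\<^bsub>RR \<otimes>\<^sub>m II\<^esub> \<ominus>\<^bsub>RR \<otimes>\<^sub>m II\<^esub> q' = \<ominus>\<^bsub>RR \<otimes>\<^sub>m II\<^esub> (q \<oplus>\<^bsub>RR \<otimes>\<^sub>m II\<^esub> q')"
      using amorD(6)[OF g w(3)] amorD(6)[OF g w(6)] by (simp add: RI.M.minus_add)
    then show "w \<oplus>\<^bsub>BS\<^esub> w' \<in> ?R"
      using amorD(7)[OF f w(2,5)] amorD(7)[OF g w(3,6)] by (auto simp: BS w(1,4))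
  next
    fix v w assume v: "v \<in> carrier V" and "w \<in> ?R"
    then obtain c p q where w: "w = (p, \<ominus>\<^bsub>RR \<otimes>\<^sub>m II\<^esub> q)" "(c, p) \<in> agraph ?f" "(c, q) \<in> agraph ?g" by blast
    have "v \<odot>\<^bsub>RR \<otimes>\<^sub>m II\<^esub> (\<ominus>\<^bsub>RR \<otimes>\<^sub>m II\<^esub> q) = \<ominus>\<^bsub>RR \<otimes>\<^sub>m II\<^esub> (v \<odot>\<^bsub>RR \<otimes>\<^sub>m II\<^esub> q)"
      using amorD(6)[OF g w(3)] v by (simp add: RI.smult_r_minus)
    then show "v \<odot>\<^bsub>BS\<^esub> w \<in> ?R"
      using amorD(8)[OF f v w(2)] amorD(8)[OF g v w(3)] by (auto simp: BS w(1))
  qed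
  show "submodule BK V BS" unfolding BK by (rule msat_submodule[OF module_BS sub])
  show "(c, p) \<in> agraph ?f \<Longrightarrow> (c, q) \<in> agraph ?g \<Longrightarrow> (p, \<ominus>\<^bsub>RR \<otimes>\<^sub>m II\<^esub> q) \<in> BK"
    unfolding BK using msat_superset[OF module_BS sub] by blast
qed

lemma BO: "BO = quot_mod BS BK" by (simp add: box_obj_def)

lemma module_BO: "module V BO"
  unfolding BO by (rule module_quot_mod[OF module_BS BK_submodule(1)])

abbreviation "inlB p \<equiv> box_inl (s_arrow J) (s_arrow J) p"
abbreviation "inrB q \<equiv> box_inr (s_arrow J) (s_arrow J) q"

lemma inrB_hom: "(\<lambda>q. inrB q) \<in> mod_hom V (RR \<otimes>\<^sub>m II) BO"
proof -
  interpret Q: quotient V BS BK by (rule quotientI[OF module_BS BK_submodule(1)])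
  interpret IR: module V "II \<otimes>\<^sub>m RR" by (rule IR)
  have "(\<lambda>q. (\<zero>\<^bsub>II \<otimes>\<^sub>m RR\<^esub>, q)) \<in> mod_hom V (RR \<otimes>\<^sub>m II) BS" by (rule mod_homI) (auto simp: BS)
  from mod_hom_comp[OF this Q.coset_hom] show ?thesis by (simp add: box_inr_def s_tgt BO)
qed

lemma inlB_hom: "(\<lambda>p. inlB p) \<in> mod_hom V (II \<otimes>\<^sub>m RR) BO"
proof -
  interpret Q: quotient V BS BK by (rule quotientI[OF module_BS BK_submodule(1)])
  interpret RI: module V "RR \<otimes>\<^sub>m II" by (rule RI)
  have "(\<lambda>p. (p, \<zero>\<^bsub>RR \<otimes>\<^sub>m II\<^esub>)) \<in> mod_hom V (II \<otimes>\<^sub>m RR) BS" by (rule mod_homI) (auto simp: BS)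
  from mod_hom_comp[OF this Q.coset_hom] show ?thesis by (simp add: box_inl_def s_tgt BO)
qed

lemma inlB_eq_inrB:
  assumes "(c, p) \<in> agraph (aid II \<otimes>\<^sub>a s_arrow J)" "(c, q) \<in> agraph (s_arrow J \<otimes>\<^sub>a aid II)"
  shows "inlB p = inrB q"
proof -
  interpret Q: quotient V BS BK by (rule quotientI[OF module_BS BK_submodule(1)])
  interpret BO: module V BO by (rule module_BO)
  interpret IR: module V "II \<otimes>\<^sub>m RR" by (rule IR)
  interpret RI: module V "RR \<otimes>\<^sub>m II" by (rule RI)
  have p: "p \<in> carrier (II \<otimes>\<^sub>m RR)" and q: "q \<in> carrier (RR \<otimes>\<^sub>m II)"
    using amorD(6)[OF box_amor1 assms(1)] amorD(6)[OF box_amor2 assms(2)] .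
  have c: "(p, \<ominus>\<^bsub>RR \<otimes>\<^sub>m II\<^esub> q) \<in> carrier BS" "(\<zero>\<^bsub>II \<otimes>\<^sub>m RR\<^esub>, q) \<in> carrier BS" using p q by (auto simp: BS)
  have "inlB p = BK +>\<^bsub>BS\<^esub> ((p, \<ominus>\<^bsub>RR \<otimes>\<^sub>m II\<^esub> q) \<oplus>\<^bsub>BS\<^esub> (\<zero>\<^bsub>II \<otimes>\<^sub>m RR\<^esub>, q))"
    using p q by (simp add: box_inl_def s_tgt BS RI.M.l_neg)
  also have "\<dots> = (BK +>\<^bsub>BS\<^esub> (p, \<ominus>\<^bsub>RR \<otimes>\<^sub>m II\<^esub> q)) \<oplus>\<^bsub>BO\<^esub> inrB q"
    unfolding BO by (simp add: Q.coset_add[OF c] box_inr_def s_tgt)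
  also have "BK +>\<^bsub>BS\<^esub> (p, \<ominus>\<^bsub>RR \<otimes>\<^sub>m II\<^esub> q) = \<zero>\<^bsub>BO\<^esub>"
    using Q.coset_eq_zero_iff[OF c(1)] BK_submodule(2)[OF assms] by (simp add: BO)
  finally show ?thesis using mod_hom_closed[OF inrB_hom q] by simp
qed

lemma act_SM: "act SM = gen_amor (RR \<otimes>\<^sub>m II) BO {(q, inrB q) | q. q \<in> carrier (RR \<otimes>\<^sub>m II)} \<Zsemi> sq0 (s_mult J)"
  and obj_SM [simp]: "obj SM = II"
  by (simp_all add: smith_module_def Let_def s_tgt)

lemma inrB_amor:
  shows is_amor_inrB: "is_amor (RR \<otimes>\<^sub>m II) BO (gen_amor (RR \<otimes>\<^sub>m II) BO {(q, inrB q) | q. q \<in> carrier (RR \<otimes>\<^sub>m II)})"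
    and ev_inrB: "q \<in> mpart (RR \<otimes>\<^sub>m II) \<Longrightarrow>
      ev (gen_amor (RR \<otimes>\<^sub>m II) BO {(q, inrB q) | q. q \<in> carrier (RR \<otimes>\<^sub>m II)}) (cl (RR \<otimes>\<^sub>m II) q) = cl BO (inrB q)"
proof -
  let ?S = "{(q, inrB q) | q. q \<in> carrier (RR \<otimes>\<^sub>m II)}"
  have S: "x \<in> carrier (RR \<otimes>\<^sub>m II) \<and> y = inrB x" if "(x, y) \<in> ?S" for x y using that by auto
  have "Domain ?S = carrier (RR \<otimes>\<^sub>m II)" by auto
  then have d: "mpart (RR \<otimes>\<^sub>m II) \<subseteq> span_mod V (RR \<otimes>\<^sub>m II) (Domain ?S)" using span_carrier[OF RI] by simp
  show "is_amor (RR \<otimes>\<^sub>m II) BO (gen_amor (RR \<otimes>\<^sub>m II) BO ?S)" by (rule is_amor_gen_amor_linear[OF RI module_BO inrB_hom S d])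
  show "q \<in> mpart (RR \<otimes>\<^sub>m II) \<Longrightarrow> ev (gen_amor (RR \<otimes>\<^sub>m II) BO ?S) (cl (RR \<otimes>\<^sub>m II) q) = cl BO (inrB q)"
    by (rule ev_gen_amor_linear[OF RI module_BO inrB_hom S d])
qed

lemma premod_SM: "premod SM"
  using II is_amor_acomp[OF is_amor_inrB s_mult_amor] by (simp add: premod_def act_SM)

lemma actc_SM_cl:
  assumes "x \<in> mpart RR" "y \<in> mpart II"
  shows "actc SM (cl RR x) (cl II y) = ev (sq0 (s_mult J)) (cl BO (inrB (pure_tens V RR II x y)))"
  using pt_mpart[OF RR II assms(1) mpart_carrier[OF II assms(2)]]
  by (simp add: actc_def act_SM ptc_cl[OF RR II assms] ev_acomp[OF is_amor_inrB s_mult_amor] cl_closed ev_inrB)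

abbreviation "jc i \<equiv> ev (s_arrow J) i"

lemma jc_closed: "i \<in> elts II \<Longrightarrow> jc i \<in> elts RR"
  by (rule ev_closed[OF s_arrow_amor])

text \<open>The multiplication of the Smith ideal lies over the multiplication of \<open>A\<close>; on the summand \<open>A \<otimes> I\<close> of the
  pushout this says \<open>j(a i) = a j(i)\<close>.\<close>

lemma jc_linear:
  assumes a: "a \<in> elts RR" and i: "i \<in> elts II"
  shows "jc (actc SM a i) = mulc a (jc i)"
proof -
  obtain x where x: "x \<in> mpart RR" "a = cl RR x" using a by (rule core_cases)
  obtain y where y: "y \<in> mpart II" "i = cl II y" using i by (rule core_cases)
  let ?q = "pure_tens V RR II x y"
  have q: "?q \<in> mpart (RR \<otimes>\<^sub>m II)" by (rule pt_mpart[OF RR II x(1) mpart_carrier[OF II y(1)]])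
  note t = is_amor_amap_tens[OF is_amor_aid[OF RR] s_arrow_amor]
  obtain z where z: "(?q, z) \<in> agraph (aid RR \<otimes>\<^sub>a s_arrow J)" "z \<in> mpart (RR \<otimes>\<^sub>m RR)"
    "ev (aid RR \<otimes>\<^sub>a s_arrow J) (cl (RR \<otimes>\<^sub>m II) ?q) = cl (RR \<otimes>\<^sub>m RR) z" using ev_ex[OF t q] .
  obtain w where w: "(z, w) \<in> agraph (alg_mult A)" "w \<in> mpart RR" "ev (alg_mult A) (cl (RR \<otimes>\<^sub>m RR) z) = cl RR w"
    using ev_ex[OF alg_amors(1) z(2)] .
  note m = hom_mpart[OF RI module_BO inrB_hom q]
  let ?S = "{(inlB p, z) | p z. (p, z) \<in> agraph (s_arrow J \<otimes>\<^sub>a aid RR)} \<union> {(inrB q, z) | q z. (q, z) \<in> agraph (aid RR \<otimes>\<^sub>a s_arrow J)}"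
  have "(inrB ?q, z) \<in> ?S" using z(1) by blast
  then have "(inrB ?q, z) \<in> span_mod V (sum_mod BO (RR \<otimes>\<^sub>m RR)) (?S \<union> {\<zero>\<^bsub>BO\<^esub>} \<times> mtors (RR \<otimes>\<^sub>m RR))"
    by (intro span_mod_base) blast
  then have "(inrB ?q, z) \<in> agraph (s_arrow J \<box> s_arrow J)"
    using m mpart_carrier[OF module_tens[OF RR RR] z(2)] by (simp add: box_def gen_amor_def s_tgt)
  then have "(inrB ?q, w) \<in> agraph (sq0 (s_mult J) \<Zsemi> s_arrow J)"
    unfolding s_mult_square using w(1) by (auto simp: acomp_def)
  from ev_cl[OF is_amor_acomp[OF s_mult_amor s_arrow_amor] this w(2)]
  have "jc (actc SM a i) = cl RR w"
    using x y by (simp add: actc_SM_cl ev_acomp[OF s_mult_amor s_arrow_amor] cl_closed[OF m])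
  also have "\<dots> = mulc a (jc i)"
    using w(3) z(3) x y ptc_cl[OF RR II x(1) y(1)] ev_amap_tens[OF is_amor_aid[OF RR] s_arrow_amor a i] ev_aid[OF RR a]
    by (simp add: mulc_def)
  finally show ?thesis .
qed

text \<open>The symmetry of the multiplication identifies \<open>i \<otimes> a\<close> with \<open>a \<otimes> i\<close>, and the pushout identifies
  \<open>i \<otimes> j(i')\<close> with \<open>j(i) \<otimes> i'\<close>.\<close>

lemma jc_comm:
  assumes i: "i \<in> elts II" "i' \<in> elts II"
  shows "actc SM (jc i) i' = actc SM (jc i') i"
proof -
  obtain x where x: "x \<in> mpart II" "i = cl II x" using i(1) by (rule core_cases)
  obtain x' where x': "x' \<in> mpart II" "i' = cl II x'" using i(2) by (rule core_cases)
  obtain y where y: "y \<in> mpart RR" "jc i = cl RR y" using jc_closed[OF i(1)] by (rule core_cases)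
  obtain y' where y': "y' \<in> mpart RR" "jc i' = cl RR y'" using jc_closed[OF i(2)] by (rule core_cases)
  note xc = mpart_carrier[OF II x(1)] and x'c = mpart_carrier[OF II x'(1)]
    and yc = mpart_carrier[OF RR y(1)] and y'c = mpart_carrier[OF RR y'(1)]
  let ?c = "pure_tens V II II x x'" and ?p = "pure_tens V II RR x y'" and ?q = "pure_tens V RR II y x'" and ?r = "pure_tens V RR II y' x"
  have m: "?c \<in> mpart (II \<otimes>\<^sub>m II)" "?p \<in> mpart (II \<otimes>\<^sub>m RR)" "?q \<in> mpart (RR \<otimes>\<^sub>m II)" "?r \<in> mpart (RR \<otimes>\<^sub>m II)"
    by (rule pt_mpart[OF II II x(1) x'c] pt_mpart[OF II RR x(1) y'c] pt_mpart[OF RR II y(1) x'c] pt_mpart[OF RR II y'(1) xc])+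
  have cp: "(?c, ?p) \<in> agraph (aid II \<otimes>\<^sub>a s_arrow J)"
    using ev_amap_tens[OF is_amor_aid[OF II] s_arrow_amor i] ev_aid[OF II i(1)] x x' y'
    by (intro agraphI[OF box_amor1 m(1,2)]) (simp add: ptc_cl[OF II II] ptc_cl[OF II RR])
  have cq: "(?c, ?q) \<in> agraph (s_arrow J \<otimes>\<^sub>a aid II)"
    using ev_amap_tens[OF s_arrow_amor is_amor_aid[OF II] i] ev_aid[OF II i(2)] x x' y
    by (intro agraphI[OF box_amor2 m(1,3)]) (simp add: ptc_cl[OF II II] ptc_cl[OF RR II])
  note inlm = hom_mpart[OF IR module_BO inlB_hom m(2)] and inrm = hom_mpart[OF RI module_BO inrB_hom m(4)]
  obtain w where w: "(inrB ?r, w) \<in> agraph (sq0 (s_mult J))" "w \<in> mpart II"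
    "ev (sq0 (s_mult J)) (cl BO (inrB ?r)) = cl II w" using ev_ex[OF s_mult_amor inrm] .
  let ?S = "{(inlB (pure_tens V II RR x y), inrB (pure_tens V RR II y x)) | x y. x \<in> carrier II \<and> y \<in> carrier RR} \<union>
    {(inrB (pure_tens V RR II x y), inlB (pure_tens V II RR y x)) | x y. x \<in> carrier RR \<and> y \<in> carrier II}"
  have "(inlB ?p, inrB ?r) \<in> ?S" using xc y'c by blast
  then have "(inlB ?p, inrB ?r) \<in> span_mod V (sum_mod BO BO) (?S \<union> {\<zero>\<^bsub>BO\<^esub>} \<times> mtors BO)"
    by (intro span_mod_base) blast
  then have "(inlB ?p, inrB ?r) \<in> agraph (sq0 (box_swap (s_arrow J) (s_arrow J)))"
    using inlm mpart_carrier[OF module_BO inrm] by (simp add: box_swap_def gen_amor_def s_tgt)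
  then have "(inlB ?p, w) \<in> agraph (sq0 (box_swap (s_arrow J) (s_arrow J)) \<Zsemi> sq0 (s_mult J))"
    using w(1) by (auto simp: acomp_def)
  then have "(inlB ?p, w) \<in> agraph (sq0 (s_mult J))" unfolding s_mult_swap .
  then have "ev (sq0 (s_mult J)) (cl BO (inlB ?p)) = cl II w" by (rule ev_cl[OF s_mult_amor _ w(2)])
  then show ?thesis
    using w(3) inlB_eq_inrB[OF cp cq] x x' y y' by (simp add: actc_SM_cl)
qed

subsection \<open>Tensor products over the algebra\<close>

abbreviation "TA P M \<equiv> quot_mod (obj P \<otimes>\<^sub>m obj M) (tensA_ker A P M)"

text \<open>The class of \<open>i \<otimes> x\<close> in \<open>P \<otimes>\<^sub>A M\<close>.\<close>

definition ptA :: "('v, 'a, 'x) amodule \<Rightarrow> ('v, 'a, 'y) amodule \<Rightarrow> 'x set \<Rightarrow> 'y set \<Rightarrow> ('v, 'x, 'y) tens set set" where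
  "ptA P M i x = ev (tensA_proj A P M) (ptc (obj P) (obj M) i x)"

context
  fixes P :: "('v, 'a, 'p) amodule" and M :: "('v, 'a, 'x) amodule"
  assumes P: "premod P" and M: "premod M"
begin

abbreviation "\<phi>1 \<equiv> (aswap (obj P) RR \<Zsemi> act P) \<otimes>\<^sub>a aid (obj M)"
abbreviation "\<phi>2 \<equiv> aassoc (obj P) RR (obj M) \<Zsemi> (aid (obj P) \<otimes>\<^sub>a act M)"

lemmas PM_mods = premodD(1)[OF P] premodD(1)[OF M]
lemmas PM_tens = module_tens[OF PM_mods]

lemma \<phi>_amors: "is_amor ((obj P \<otimes>\<^sub>m RR) \<otimes>\<^sub>m obj M) (obj P \<otimes>\<^sub>m obj M) \<phi>1"
  "is_amor ((obj P \<otimes>\<^sub>m RR) \<otimes>\<^sub>m obj M) (obj P \<otimes>\<^sub>m obj M) \<phi>2"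
  by (rule is_amor_amap_tens[OF is_amor_acomp[OF is_amor_aswap[OF PM_mods(1) RR] premodD(2)[OF P]] is_amor_aid[OF PM_mods(2)]]
    is_amor_acomp[OF is_amor_aassoc[OF PM_mods(1) RR PM_mods(2)] is_amor_amap_tens[OF is_amor_aid[OF PM_mods(1)] premodD(2)[OF M]]])+

lemma ev_\<phi>:
  assumes "i \<in> elts (obj P)" "a \<in> elts RR" "x \<in> elts (obj M)"
  shows "ev \<phi>1 (ptc (obj P \<otimes>\<^sub>m RR) (obj M) (ptc (obj P) RR i a) x) = ptc (obj P) (obj M) (actc P a i) x"
    and "ev \<phi>2 (ptc (obj P \<otimes>\<^sub>m RR) (obj M) (ptc (obj P) RR i a) x) = ptc (obj P) (obj M) i (actc M a x)"
proof -
  note s = is_amor_acomp[OF is_amor_aswap[OF PM_mods(1) RR] premodD(2)[OF P]]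
  note u = is_amor_amap_tens[OF is_amor_aid[OF PM_mods(1)] premodD(2)[OF M]]
  note c = ptc_simps(1)[OF PM_mods(1) RR assms(1,2)]
  show "ev \<phi>1 (ptc (obj P \<otimes>\<^sub>m RR) (obj M) (ptc (obj P) RR i a) x) = ptc (obj P) (obj M) (actc P a i) x"
    using assms c by (simp add: ev_amap_tens[OF s is_amor_aid[OF PM_mods(2)]] ev_aid[OF PM_mods(2)]
        ev_acomp[OF is_amor_aswap[OF PM_mods(1) RR] premodD(2)[OF P]] ev_aswap[OF PM_mods(1) RR] actc_def)
  show "ev \<phi>2 (ptc (obj P \<otimes>\<^sub>m RR) (obj M) (ptc (obj P) RR i a) x) = ptc (obj P) (obj M) i (actc M a x)"
    using assms ptc_simps(1)[OF RR PM_mods(2) assms(2,3)] ptc_simps(1)[OF module_tens[OF PM_mods(1) RR] PM_mods(2) c assms(3)]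
    by (simp add: ev_acomp[OF is_amor_aassoc[OF PM_mods(1) RR PM_mods(2)] u] ev_aassoc[OF PM_mods(1) RR PM_mods(2)]
        ev_amap_tens[OF is_amor_aid[OF PM_mods(1)] premodD(2)[OF M]] ev_aid[OF PM_mods(1)] actc_def)
qed

lemma tensA_ker_eq: "tensA_ker A P M = aimage (adiff \<phi>1 \<phi>2)"
  by (simp add: tensA_ker_def Let_def)

lemma tensA_ker_submodule: "submodule (tensA_ker A P M) V (obj P \<otimes>\<^sub>m obj M)"
  unfolding tensA_ker_eq by (rule aimage_submodule[OF is_amor_adiff[OF \<phi>_amors]])

lemma module_TA: "module V (TA P M)"
  by (rule module_quot_mod[OF PM_tens tensA_ker_submodule])

lemma tensA_proj_amor: "is_amor (obj P \<otimes>\<^sub>m obj M) (TA P M) (tensA_proj A P M)"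
  and tensA_proj_surj: "ev (tensA_proj A P M) ` elts (obj P \<otimes>\<^sub>m obj M) = elts (TA P M)"
  unfolding tensA_proj_def
  by (rule is_amor_aproj[OF PM_tens tensA_ker_submodule] ev_aproj_surj[OF PM_tens tensA_ker_submodule])+

lemma tensA_proj_zero_iff:
  assumes "u \<in> elts (obj P \<otimes>\<^sub>m obj M)"
  shows "ev (tensA_proj A P M) u = \<zero>\<^bsub>core (TA P M)\<^esub> \<longleftrightarrow>
    (\<forall>e\<in>\<mm>. \<exists>w\<in>elts ((obj P \<otimes>\<^sub>m RR) \<otimes>\<^sub>m obj M). e \<odot>\<^bsub>core (obj P \<otimes>\<^sub>m obj M)\<^esub> u = ev \<phi>1 w \<ominus>\<^bsub>core (obj P \<otimes>\<^sub>m obj M)\<^esub> ev \<phi>2 w)"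
  unfolding tensA_proj_def tensA_ker_eq ev_aproj_aimage_zero_iff[OF is_amor_adiff[OF \<phi>_amors] assms]
  by (auto simp: ev_adiff[OF \<phi>_amors] image_iff)

text \<open>The kernel of \<open>P \<otimes> M \<rightarrow> P \<otimes>\<^sub>A M\<close> is the saturated image of the difference of the two actions, and cores have
  no torsion: a map that equalizes the actions kills the kernel.\<close>

lemma tensA_hom_zero:
  assumes Z: "module V Z" and h: "h \<in> mod_hom V (core (obj P \<otimes>\<^sub>m obj M)) (core Z)"
    and bal: "\<And>i a x. i \<in> elts (obj P) \<Longrightarrow> a \<in> elts RR \<Longrightarrow> x \<in> elts (obj M) \<Longrightarrow>
      h (ptc (obj P) (obj M) (actc P a i) x) = h (ptc (obj P) (obj M) i (actc M a x))"
    and u: "u \<in> elts (obj P \<otimes>\<^sub>m obj M)" "ev (tensA_proj A P M) u = \<zero>\<^bsub>core (TA P M)\<^esub>"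
  shows "h u = \<zero>\<^bsub>core Z\<^esub>"
proof (rule core_eqI[OF Z mod_hom_closed[OF h u(1)]])
  note CZ = module_core[OF Z] and CT = module_core[OF PM_tens]
  note CPR = module_core[OF module_tens[OF PM_mods(1) RR]]
  interpret CZ: module V "core Z" by (rule CZ)
  show "\<zero>\<^bsub>core Z\<^esub> \<in> elts Z" by simp
  note h1 = mod_hom_comp[OF ev_hom[OF \<phi>_amors(1)] h] and h2 = mod_hom_comp[OF ev_hom[OF \<phi>_amors(2)] h]
  have eq: "h (ev \<phi>1 w) = h (ev \<phi>2 w)" if w: "w \<in> elts ((obj P \<otimes>\<^sub>m RR) \<otimes>\<^sub>m obj M)" for w
  proof (rule tens_hom_eqI[OF module_tens[OF PM_mods(1) RR] PM_mods(2) CZ h1 h2 _ w])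
    fix t x assume t: "t \<in> elts (obj P \<otimes>\<^sub>m RR)" and x: "x \<in> elts (obj M)"
    have "(\<lambda>t. ptc (obj P \<otimes>\<^sub>m RR) (obj M) t x) \<in> mod_hom V (core (obj P \<otimes>\<^sub>m RR)) (core ((obj P \<otimes>\<^sub>m RR) \<otimes>\<^sub>m obj M))"
      using ptc_bilin[OF module_tens[OF PM_mods(1) RR] PM_mods(2)] x by (simp add: bilin_def)
    note k = mod_hom_comp[OF this h1] mod_hom_comp[OF this h2]
    show "h (ev \<phi>1 (ptc (obj P \<otimes>\<^sub>m RR) (obj M) t x)) = h (ev \<phi>2 (ptc (obj P \<otimes>\<^sub>m RR) (obj M) t x))"
      by (rule tens_hom_eqI[OF PM_mods(1) RR CZ k _ t]) (simp add: ev_\<phi> x bal)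
  qed
  fix e assume e: "e \<in> \<mm>"
  obtain w where w: "w \<in> elts ((obj P \<otimes>\<^sub>m RR) \<otimes>\<^sub>m obj M)"
    "e \<odot>\<^bsub>core (obj P \<otimes>\<^sub>m obj M)\<^esub> u = ev \<phi>1 w \<ominus>\<^bsub>core (obj P \<otimes>\<^sub>m obj M)\<^esub> ev \<phi>2 w"
    using u(2) e unfolding tensA_proj_zero_iff[OF u(1)] by blast
  note wc = ev_closed[OF \<phi>_amors(1) w(1)] ev_closed[OF \<phi>_amors(2) w(1)]
  have "e \<odot>\<^bsub>core Z\<^esub> h u = h (ev \<phi>1 w) \<ominus>\<^bsub>core Z\<^esub> h (ev \<phi>2 w)"
    using mod_hom_smult[OF h mm_carrier[OF e] u(1)] w(2) mod_hom_minus[OF h CT CZ wc] by simp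
  also have "\<dots> = \<zero>\<^bsub>core Z\<^esub>" using eq[OF w(1)] mod_hom_closed[OF h wc(2)] by (simp add: CZ.minus_eq_zero_iff)
  finally show "e \<odot>\<^bsub>core Z\<^esub> h u = e \<odot>\<^bsub>core Z\<^esub> \<zero>\<^bsub>core Z\<^esub>" using e by (simp add: mm_carrier)
qed

lemma ptA_bilin: "bilin V (core (obj P)) (core (obj M)) (core (TA P M)) (ptA P M)"
  unfolding ptA_def[abs_def] by (rule amor_bilin[OF PM_mods tensA_proj_amor])

lemma ptA_balanced:
  assumes "i \<in> elts (obj P)" "a \<in> elts RR" "x \<in> elts (obj M)"
  shows "ptA P M (actc P a i) x = ptA P M i (actc M a x)"
proof -
  note CT = module_core[OF PM_tens] and CA = module_core[OF module_TA]
  interpret CT: module V "core (obj P \<otimes>\<^sub>m obj M)" by (rule CT)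
  interpret CA: module V "core (TA P M)" by (rule CA)
  let ?w = "ptc (obj P \<otimes>\<^sub>m RR) (obj M) (ptc (obj P) RR i a) x"
  let ?d = "ev \<phi>1 ?w \<ominus>\<^bsub>core (obj P \<otimes>\<^sub>m obj M)\<^esub> ev \<phi>2 ?w"
  have w: "?w \<in> elts ((obj P \<otimes>\<^sub>m RR) \<otimes>\<^sub>m obj M)"
    by (rule ptc_simps(1)[OF module_tens[OF PM_mods(1) RR] PM_mods(2) ptc_simps(1)[OF PM_mods(1) RR assms(1,2)] assms(3)])
  note wc = ev_closed[OF \<phi>_amors(1) w] ev_closed[OF \<phi>_amors(2) w]
  have "ev (tensA_proj A P M) ?d = \<zero>\<^bsub>core (TA P M)\<^esub>"
  proof -
    have dc: "?d \<in> elts (obj P \<otimes>\<^sub>m obj M)" using wc by simp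
    have "\<exists>w'\<in>elts ((obj P \<otimes>\<^sub>m RR) \<otimes>\<^sub>m obj M). e \<odot>\<^bsub>core (obj P \<otimes>\<^sub>m obj M)\<^esub> ?d = ev \<phi>1 w' \<ominus>\<^bsub>core (obj P \<otimes>\<^sub>m obj M)\<^esub> ev \<phi>2 w'"
      if e: "e \<in> \<mm>" for e
    proof -
      have "e \<odot>\<^bsub>core (obj P \<otimes>\<^sub>m obj M)\<^esub> ?d = ev \<phi>1 (e \<odot>\<^bsub>core ((obj P \<otimes>\<^sub>m RR) \<otimes>\<^sub>m obj M)\<^esub> ?w) \<ominus>\<^bsub>core (obj P \<otimes>\<^sub>m obj M)\<^esub> ev \<phi>2 (e \<odot>\<^bsub>core ((obj P \<otimes>\<^sub>m RR) \<otimes>\<^sub>m obj M)\<^esub> ?w)"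
        using wc w e by (simp add: CT.smult_minus mm_carrier mod_hom_smult[OF ev_hom[OF \<phi>_amors(1)]] mod_hom_smult[OF ev_hom[OF \<phi>_amors(2)]])
      then show ?thesis
        using module.smult_closed[OF module_core[OF module_tens[OF module_tens[OF PM_mods(1) RR] PM_mods(2)]] mm_carrier[OF e] w] by blast
    qed
    then show ?thesis unfolding tensA_proj_zero_iff[OF dc] by blast
  qed
  then have "ev (tensA_proj A P M) (ev \<phi>1 ?w) \<ominus>\<^bsub>core (TA P M)\<^esub> ev (tensA_proj A P M) (ev \<phi>2 ?w) = \<zero>\<^bsub>core (TA P M)\<^esub>"
    using mod_hom_minus[OF ev_hom[OF tensA_proj_amor] CT CA wc] by simp
  then have "ev (tensA_proj A P M) (ev \<phi>1 ?w) = ev (tensA_proj A P M) (ev \<phi>2 ?w)"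
    using CA.minus_eq_zero_iff[OF ev_closed[OF tensA_proj_amor wc(1)] ev_closed[OF tensA_proj_amor wc(2)]] by simp
  then show ?thesis unfolding ptA_def ev_\<phi>[OF assms] .
qed

lemma tensA_universal:
  assumes Z: "module V Z" and \<beta>: "bilin V (core (obj P)) (core (obj M)) (core Z) \<beta>"
    and bal: "\<And>i a x. i \<in> elts (obj P) \<Longrightarrow> a \<in> elts RR \<Longrightarrow> x \<in> elts (obj M) \<Longrightarrow>
      \<beta> (actc P a i) x = \<beta> i (actc M a x)"
  obtains h where "h \<in> mod_hom V (core (TA P M)) (core Z)"
    "\<And>i x. i \<in> elts (obj P) \<Longrightarrow> x \<in> elts (obj M) \<Longrightarrow> h (ptA P M i x) = \<beta> i x"
proof -
  obtain k where k: "k \<in> mod_hom V (core (obj P \<otimes>\<^sub>m obj M)) (core Z)"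
    and kp: "\<And>i x. i \<in> elts (obj P) \<Longrightarrow> x \<in> elts (obj M) \<Longrightarrow> k (ptc (obj P) (obj M) i x) = \<beta> i x"
    using tens_core_universal[OF PM_mods Z \<beta>] by blast
  have ker: "k u = \<zero>\<^bsub>core Z\<^esub>" if "u \<in> elts (obj P \<otimes>\<^sub>m obj M)" "ev (tensA_proj A P M) u = \<zero>\<^bsub>core (TA P M)\<^esub>" for u
    by (rule tensA_hom_zero[OF Z k _ that]) (simp add: kp bal actc_simps(1)[OF P] actc_simps(1)[OF M])
  obtain h where "h \<in> mod_hom V (core (TA P M)) (core Z)"
    "\<And>u. u \<in> elts (obj P \<otimes>\<^sub>m obj M) \<Longrightarrow> h (ev (tensA_proj A P M) u) = k u"
    using hom_factor[OF module_core[OF PM_tens] module_core[OF module_TA] module_core[OF Z] ev_hom[OF tensA_proj_amor] k tensA_proj_surj ker] by blast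
  then show ?thesis using that kp ptc_simps(1)[OF PM_mods] by (simp add: ptA_def)
qed

lemma ptA_gens: "{ptA P M i x |i x. i \<in> elts (obj P) \<and> x \<in> elts (obj M)} \<subseteq> elts (TA P M)"
  using bilinD(1)[OF ptA_bilin] by auto

lemma ptA_span:
  assumes u: "u \<in> elts (TA P M)"
  shows "u \<in> span_mod V (core (TA P M)) {ptA P M i x |i x. i \<in> elts (obj P) \<and> x \<in> elts (obj M)}"
proof -
  obtain w where w: "w \<in> elts (obj P \<otimes>\<^sub>m obj M)" "u = ev (tensA_proj A P M) w" using tensA_proj_surj u by auto
  show ?thesis unfolding w(2)
    by (rule tens_image_sub[OF PM_mods module_core[OF module_TA] ev_hom[OF tensA_proj_amor]
          span_mod_submodule[OF module_core[OF module_TA] ptA_gens] _ w(1)])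
       (rule span_mod_base, auto simp: ptA_def)
qed

lemma tensA_hom_eqI:
  assumes Z: "module V Z" and h: "h \<in> mod_hom V (core (TA P M)) Z" "h' \<in> mod_hom V (core (TA P M)) Z"
    and eq: "\<And>i x. i \<in> elts (obj P) \<Longrightarrow> x \<in> elts (obj M) \<Longrightarrow> h (ptA P M i x) = h' (ptA P M i x)"
    and u: "u \<in> elts (TA P M)"
  shows "h u = h' u"
  by (rule mod_hom_eq_span[OF h module_core[OF module_TA] Z ptA_gens _ ptA_span[OF u]]) (use eq in auto)

lemma tensA_amor_bilin:
  assumes c: "is_amor (TA P M) Z c"
  shows "bilin V (core (obj P)) (core (obj M)) (core Z) (\<lambda>i x. ev c (ptA P M i x))"
proof -
  have i: "(\<lambda>z. z) \<in> mod_hom V X' X'" for X' :: "('v, 'z) module" by (rule mod_homI) auto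
  show ?thesis by (rule bilin_comp[OF ptA_bilin i i ev_hom[OF c]])
qed

end

lemma tensA_map:
  assumes P: "premod P" and P': "premod P'" and M: "premod M" and M': "premod M'"
    and f: "is_amor (obj P) (obj P') f" and g: "is_amor (obj M) (obj M') g"
    and flin: "\<And>a i. a \<in> elts RR \<Longrightarrow> i \<in> elts (obj P) \<Longrightarrow> ev f (actc P a i) = actc P' a (ev f i)"
    and glin: "\<And>a x. a \<in> elts RR \<Longrightarrow> x \<in> elts (obj M) \<Longrightarrow> ev g (actc M a x) = actc M' a (ev g x)"
  shows is_amor_tensA_map: "is_amor (TA P M) (TA P' M') (tensA_map A P P' f M M' g)"
    and ev_tensA_map: "i \<in> elts (obj P) \<Longrightarrow> x \<in> elts (obj M) \<Longrightarrow>
      ev (tensA_map A P P' f M M' g) (ptA P M i x) = ptA P' M' (ev f i) (ev g x)"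
proof -
  note t = is_amor_amap_tens[OF f g]
  note c = is_amor_acomp[OF t tensA_proj_amor[OF P' M']]
  note X = premodD(1)[OF P] premodD(1)[OF M]
  have e: "ev ((f \<otimes>\<^sub>a g) \<Zsemi> tensA_proj A P' M') (ptc (obj P) (obj M) i x) = ptA P' M' (ev f i) (ev g x)"
    if "i \<in> elts (obj P)" "x \<in> elts (obj M)" for i x
    using that by (simp add: ev_acomp[OF t tensA_proj_amor[OF P' M']] ptc_simps(1)[OF X] ev_amap_tens[OF f g] ptA_def)
  have ker: "ev ((f \<otimes>\<^sub>a g) \<Zsemi> tensA_proj A P' M') u = \<zero>\<^bsub>core (TA P' M')\<^esub>"
    if "u \<in> elts (obj P \<otimes>\<^sub>m obj M)" "ev (tensA_proj A P M) u = \<zero>\<^bsub>core (TA P M)\<^esub>" for u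
    by (rule tensA_hom_zero[OF P M module_TA[OF P' M'] ev_hom[OF c] _ that])
       (simp add: e actc_simps(1)[OF P] actc_simps(1)[OF M] flin glin ptA_balanced[OF P' M'] ev_closed[OF f] ev_closed[OF g])
  show "is_amor (TA P M) (TA P' M') (tensA_map A P P' f M M' g)"
    unfolding tensA_map_def by (rule is_amor_adescend[OF tensA_proj_amor[OF P M] c tensA_proj_surj[OF P M] ker])
  assume ix: "i \<in> elts (obj P)" "x \<in> elts (obj M)"
  show "ev (tensA_map A P P' f M M' g) (ptA P M i x) = ptA P' M' (ev f i) (ev g x)"
    unfolding tensA_map_def
    using ev_adescend[OF tensA_proj_amor[OF P M] c tensA_proj_surj[OF P M] ker ptc_simps(1)[OF X ix]] e[OF ix]
    by (simp add: ptA_def[of P M])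
qed

lemma jact:
  assumes M: "amod M"
  shows is_amor_jact: "is_amor (TA SM M) (obj M) (jact A J M)"
    and ev_jact: "i \<in> elts II \<Longrightarrow> x \<in> elts (obj M) \<Longrightarrow> ev (jact A J M) (ptA SM M i x) = actc M (jc i) x"
proof -
  note Mp = amodD(1)[OF M]
  note X = premodD(1)[OF Mp]
  note t = is_amor_amap_tens[OF s_arrow_amor is_amor_aid[OF X]]
  note c = is_amor_acomp[OF t premodD(2)[OF Mp]]
  have pr: "is_amor (II \<otimes>\<^sub>m obj M) (TA SM M) (tensA_proj A SM M)"
    and su: "ev (tensA_proj A SM M) ` elts (II \<otimes>\<^sub>m obj M) = elts (TA SM M)"
    using tensA_proj_amor[OF premod_SM Mp] tensA_proj_surj[OF premod_SM Mp] by simp_all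
  have e: "ev ((s_arrow J \<otimes>\<^sub>a aid (obj M)) \<Zsemi> act M) (ptc II (obj M) i x) = actc M (jc i) x"
    if "i \<in> elts II" "x \<in> elts (obj M)" for i x
    using that by (simp add: ev_acomp[OF t premodD(2)[OF Mp]] ptc_simps(1)[OF II X] ev_amap_tens[OF s_arrow_amor is_amor_aid[OF X]] ev_aid[OF X] actc_def)
  have bal: "actc M (jc (actc SM a i)) x = actc M (jc i) (actc M a x)"
    if "a \<in> elts RR" "i \<in> elts II" "x \<in> elts (obj M)" for a i x
    using that by (simp add: jc_linear mulc_comm[of a] jc_closed amodD(2)[OF M])
  have ker: "ev ((s_arrow J \<otimes>\<^sub>a aid (obj M)) \<Zsemi> act M) u = \<zero>\<^bsub>core (obj M)\<^esub>"
    if "u \<in> elts (II \<otimes>\<^sub>m obj M)" "ev (tensA_proj A SM M) u = \<zero>\<^bsub>core (TA SM M)\<^esub>" for u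
    using tensA_hom_zero[OF premod_SM Mp X, of "ev ((s_arrow J \<otimes>\<^sub>a aid (obj M)) \<Zsemi> act M)" u] that ev_hom[OF c]
      actc_simps(1)[OF premod_SM] by (simp add: e bal actc_simps(1)[OF Mp])
  show "is_amor (TA SM M) (obj M) (jact A J M)"
    unfolding jact_def by (rule is_amor_adescend[OF pr c su ker])
  assume ix: "i \<in> elts II" "x \<in> elts (obj M)"
  show "ev (jact A J M) (ptA SM M i x) = actc M (jc i) x"
    unfolding jact_def using ev_adescend[OF pr c su ker ptc_simps(1)[OF II X ix]] e[OF ix] by (simp add: ptA_def)
qed

section \<open>Powers of the Smith ideal\<close>

lemma smith_bin:
  shows is_amor_smith_bin: "is_amor (II \<otimes>\<^sub>m II) II (smith_bin J)"
    and ev_smith_bin: "i \<in> elts II \<Longrightarrow> i' \<in> elts II \<Longrightarrow>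
      ev (smith_bin J) (ptc II II i i') = actc SM (jc i) i'"
proof -
  note t = box_amor2
  have a: "is_amor (RR \<otimes>\<^sub>m II) II (act SM)" using premodD(2)[OF premod_SM] by simp
  show "is_amor (II \<otimes>\<^sub>m II) II (smith_bin J)" unfolding smith_bin_def by (rule is_amor_acomp[OF t a])
  show "i \<in> elts II \<Longrightarrow> i' \<in> elts II \<Longrightarrow> ev (smith_bin J) (ptc II II i i') = actc SM (jc i) i'"
    by (simp add: smith_bin_def ev_acomp[OF t a] ptc_simps(1)[OF II II] ev_amap_tens[OF s_arrow_amor is_amor_aid[OF II]] ev_aid[OF II] actc_def)
qed

definition pure_products :: "nat \<Rightarrow> 'i set" where
  "pure_products m = \<Union> {smith_prods J xs | xs. length xs = m \<and> set xs \<subseteq> carrier II}"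

lemma smith_prods_carrier: "smith_prods J xs \<subseteq> carrier II"
  by (cases "(J, xs)" rule: smith_prods.cases)
     (use amorD(6)[OF is_amor_aid[OF II]] amorD(6)[OF is_amor_smith_bin] in auto)

lemma pure_products_carrier: "pure_products m \<subseteq> carrier II"
  using smith_prods_carrier by (auto simp: pure_products_def)

lemma smith_prods_hd: "y \<in> smith_prods J xs \<Longrightarrow> xs \<noteq> [] \<and> hd xs \<in> mpart II"
  by (cases "(J, xs)" rule: smith_prods.cases) (use amorD(5)[OF is_amor_aid[OF II]] in auto)

context
  fixes m :: nat
begin

abbreviation "TPF \<equiv> tpow_free V II m"

lemma TPF: "module V TPF"
  unfolding tpow_free_def by (rule module_free_mod[OF V_cring])

lemma tpow_gen: "length xs = m \<Longrightarrow> set xs \<subseteq> carrier II \<Longrightarrow> free_gen V xs \<in> carrier TPF"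
  unfolding tpow_free_def by (rule free_gen_closed[OF V_cring]) auto

lemma tpow_gen_upd: "length xs = m \<Longrightarrow> set xs \<subseteq> carrier II \<Longrightarrow> x \<in> carrier II \<Longrightarrow> free_gen V (xs[i := x]) \<in> carrier TPF"
  using set_update_subset_insert[of xs i x] by (intro tpow_gen) auto

lemma tpow_rels_carrier: "tpow_rels V II m \<subseteq> carrier TPF"
proof -
  interpret F: module V TPF by (rule TPF)
  interpret II: module V II by (rule II)
  show ?thesis
  proof
    fix f assume "f \<in> tpow_rels V II m"
    then consider xs i x y where "f = free_gen V (xs[i := x \<oplus>\<^bsub>II\<^esub> y]) \<ominus>\<^bsub>TPF\<^esub> (free_gen V (xs[i := x]) \<oplus>\<^bsub>TPF\<^esub> free_gen V (xs[i := y]))"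
        "length xs = m" "set xs \<subseteq> carrier II" "x \<in> carrier II" "y \<in> carrier II"
      | xs i v x where "f = free_gen V (xs[i := v \<odot>\<^bsub>II\<^esub> x]) \<ominus>\<^bsub>TPF\<^esub> v \<odot>\<^bsub>TPF\<^esub> free_gen V (xs[i := x])"
        "length xs = m" "set xs \<subseteq> carrier II" "v \<in> carrier V" "x \<in> carrier II"
      unfolding tpow_rels_def Let_def by blast
    then show "f \<in> carrier TPF" by cases (simp_all add: tpow_gen_upd)
  qed
qed

lemma tpow_ker: "submodule (tpow_ker V II m) V TPF"
  unfolding tpow_ker_def by (rule span_mod_submodule[OF TPF tpow_rels_carrier])

lemma module_tpow: "module V (tpow V II m)"
  unfolding tpow_def by (rule module_quot_mod[OF TPF tpow_ker])

lemma pure_tpow_closed: "length xs = m \<Longrightarrow> set xs \<subseteq> carrier II \<Longrightarrow> pure_tpow V II m xs \<in> carrier (tpow V II m)"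
  unfolding tpow_def pure_tpow_def by (rule quotient.coset_closed[OF quotientI[OF TPF tpow_ker] tpow_gen])

lemma pure_tpow_mpart:
  assumes xs: "length xs = m" "set xs \<subseteq> carrier II" "xs \<noteq> []" "hd xs \<in> mpart II"
  shows "pure_tpow V II m xs \<in> mpart (tpow V II m)"
proof -
  interpret Q: quotient V TPF "tpow_ker V II m" by (rule quotientI[OF TPF tpow_ker])
  interpret F: module V TPF by (rule TPF)
  interpret II: module V II by (rule II)
  have m: "0 < m" using xs by auto
  have eqI: "tpow_ker V II m +>\<^bsub>TPF\<^esub> a = tpow_ker V II m +>\<^bsub>TPF\<^esub> b"
    if "a \<ominus>\<^bsub>TPF\<^esub> b \<in> tpow_rels V II m" "a \<in> carrier TPF" "b \<in> carrier TPF" for a b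
    unfolding Q.coset_eq_iff[OF that(2,3)] using that(1) unfolding tpow_ker_def by (rule span_mod_base)
  have "(\<lambda>x. pure_tpow V II m (xs[0 := x])) \<in> mod_hom V II (tpow V II m)"
  proof (rule mod_homI)
    show "pure_tpow V II m (xs[0 := x]) \<in> carrier (tpow V II m)" if "x \<in> carrier II" for x
      using xs set_update_subset_insert[of xs 0 x] that by (intro pure_tpow_closed) auto
  next
    fix x y assume xy: "x \<in> carrier II" "y \<in> carrier II"
    note c = tpow_gen_upd[OF xs(1,2) xy(1), of 0] tpow_gen_upd[OF xs(1,2) xy(2), of 0] tpow_gen_upd[OF xs(1,2) II.M.a_closed[OF xy], of 0]
    show "pure_tpow V II m (xs[0 := x \<oplus>\<^bsub>II\<^esub> y]) = pure_tpow V II m (xs[0 := x]) \<oplus>\<^bsub>tpow V II m\<^esub> pure_tpow V II m (xs[0 := y])"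
      unfolding pure_tpow_def tpow_def Q.coset_add[OF c(1,2)]
    proof (rule eqI)
      show "free_gen V (xs[0 := x \<oplus>\<^bsub>II\<^esub> y]) \<ominus>\<^bsub>TPF\<^esub> (free_gen V (xs[0 := x]) \<oplus>\<^bsub>TPF\<^esub> free_gen V (xs[0 := y])) \<in> tpow_rels V II m"
        unfolding tpow_rels_def Let_def using xs m xy by blast
    qed (use c in auto)
  next
    fix v x assume v: "v \<in> carrier V" and x: "x \<in> carrier II"
    note c = tpow_gen_upd[OF xs(1,2) x, of 0] tpow_gen_upd[OF xs(1,2) II.smult_closed[OF v x], of 0]
    show "pure_tpow V II m (xs[0 := v \<odot>\<^bsub>II\<^esub> x]) = v \<odot>\<^bsub>tpow V II m\<^esub> pure_tpow V II m (xs[0 := x])"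
      unfolding pure_tpow_def tpow_def Q.coset_smult[OF v c(1)]
    proof (rule eqI)
      show "free_gen V (xs[0 := v \<odot>\<^bsub>II\<^esub> x]) \<ominus>\<^bsub>TPF\<^esub> (v \<odot>\<^bsub>TPF\<^esub> free_gen V (xs[0 := x])) \<in> tpow_rels V II m"
        unfolding tpow_rels_def Let_def using xs m x v by blast
    qed (use c v in auto)
  qed
  from hom_mpart[OF II module_tpow this xs(4)] xs(3) show ?thesis by (simp add: hd_conv_nth[symmetric] list_update_id[of xs 0, unfolded hd_conv_nth[OF xs(3), symmetric]])
qed

end

text \<open>The image of the multiplication \<open>I\<^sup>\<otimes>\<^sup>m \<rightarrow> I\<close> is spanned, up to saturation, by the products.\<close>

definition ppow :: "nat \<Rightarrow> 'i set set" where
  "ppow m = csub II (span_mod V II (pure_products m))"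

lemma smith_pow:
  shows smith_pow_submodule: "submodule (smith_pow J m) V II"
    and csub_smith_pow: "csub II (smith_pow J m) = ppow m"
proof -
  let ?S = "{(pure_tpow V II m xs, y) | xs y. length xs = m \<and> set xs \<subseteq> carrier II \<and> y \<in> smith_prods J xs}"
  let ?G = "agraph (gen_amor (tpow V II m) II ?S)"
  have S: "?S \<subseteq> carrier (tpow V II m) \<times> carrier II"
    using pure_tpow_closed smith_prods_carrier by auto
  note lr = linrel_gen_amor[OF module_tpow II S]
  note R = Range_submodule[OF module_tpow II linrelD(5)[OF lr]]
  note Q = span_mod_submodule[OF II pure_products_carrier, of m]
  have sp: "smith_pow J m = msat II (Range ?G)"
    by (simp add: smith_pow_def smith_mult_def Let_def aimage_def) (simp add: gen_amor_def)
  show sub: "submodule (smith_pow J m) V II" unfolding sp by (rule msat_submodule[OF II R])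
  have 1: "span_mod V II (pure_products m) \<subseteq> Range ?G"
  proof (rule span_mod_least[OF R], rule subsetI)
    fix y assume "y \<in> pure_products m"
    then obtain xs where xs: "length xs = m" "set xs \<subseteq> carrier II" "y \<in> smith_prods J xs" by (auto simp: pure_products_def)
    then have "(pure_tpow V II m xs, y) \<in> ?S" by blast
    then have "(pure_tpow V II m xs, y) \<in> ?G"
      using pure_tpow_mpart[OF xs(1,2)] smith_prods_hd[OF xs(3)] smith_prods_carrier xs(3)
        span_mod_base[of "(pure_tpow V II m xs, y)" "?S \<union> {\<zero>\<^bsub>tpow V II m\<^esub>} \<times> mtors II"] by (simp add: gen_amor_def) blast
    then show "y \<in> Range ?G" by auto
  qed
  have 2: "Range ?G \<subseteq> msat II (span_mod V II (pure_products m))"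
  proof -
    have "submodule (carrier (tpow V II m) \<times> msat II (span_mod V II (pure_products m))) V (sum_mod (tpow V II m) II)"
      using submoduleD[OF II msat_submodule[OF II Q]] submoduleD[OF module_tpow submodule_carrier[OF module_tpow]]
      by (auto simp: submodule_iff[OF module_sum_mod[OF module_tpow II]])
    moreover have "?S \<union> {\<zero>\<^bsub>tpow V II m\<^esub>} \<times> mtors II \<subseteq> carrier (tpow V II m) \<times> msat II (span_mod V II (pure_products m))"
    proof -
      have "y \<in> msat II (span_mod V II (pure_products m))" if "y \<in> smith_prods J xs" "length xs = m" "set xs \<subseteq> carrier II" for y xs
      proof -
        have "y \<in> pure_products m" unfolding pure_products_def using that by blast
        then show ?thesis by (rule subsetD[OF msat_superset[OF II Q] span_mod_base])
      qed
      moreover have "mtors II \<subseteq> msat II (span_mod V II (pure_products m))"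
        using submoduleD(2)[OF II Q] by (auto simp: msat_def mtors_def)
      ultimately show ?thesis
        using pure_tpow_closed submoduleD(2)[OF module_tpow submodule_carrier[OF module_tpow]] by auto
    qed
    ultimately have "span_mod V (sum_mod (tpow V II m) II) (?S \<union> {\<zero>\<^bsub>tpow V II m\<^esub>} \<times> mtors II)
        \<subseteq> carrier (tpow V II m) \<times> msat II (span_mod V II (pure_products m))" by (rule span_mod_least)
    then show ?thesis by (auto simp: gen_amor_def)
  qed
  show "csub II (smith_pow J m) = ppow m"
    unfolding sp csub_msat[OF II R] ppow_def
    using csub_mono[OF II Q R 1] csub_mono[OF II R msat_submodule[OF II Q] 2] csub_msat[OF II Q] by auto
qed

lemma ppow_gens: "ppow m = span_mod V (core II) {cl II (e \<odot>\<^bsub>II\<^esub> y) |e y. e \<in> \<mm> \<and> y \<in> pure_products m}"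
  unfolding ppow_def by (rule csub_span[OF II pure_products_carrier])

lemma ppow_submodule: "submodule (ppow m) V (core II)"
  unfolding ppow_def by (rule csub_submodule[OF II span_mod_submodule[OF II pure_products_carrier]])

lemma ppow_carrier: "p \<in> ppow m \<Longrightarrow> p \<in> elts II"
  by (rule submoduleD(1)[OF module_core[OF II] ppow_submodule])

lemma ppow_1: "ppow (Suc 0) = elts II"
proof (rule subset_antisym; rule subsetI)
  show "u \<in> elts II" if "u \<in> ppow (Suc 0)" for u using that by (rule ppow_carrier)
  fix u assume u: "u \<in> elts II"
  show "u \<in> ppow (Suc 0)"
  proof (rule core_divisible[OF II ppow_submodule u])
    fix e u assume e: "e \<in> \<mm>" and "u \<in> elts II"
    then obtain x where x: "x \<in> mpart II" "u = cl II x" by (meson core_cases)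
    have "(x, x) \<in> agraph (aid II)" by (rule agraphI[OF is_amor_aid[OF II] x(1) x(1)]) (simp add: ev_aid[OF II] cl_closed x)
    then have "x \<in> smith_prods J [x]" by simp
    then have "x \<in> pure_products (Suc 0)" using mpart_carrier[OF II x(1)]
      unfolding pure_products_def by (intro UnionI[of "smith_prods J [x]"]) (auto intro!: exI[of _ "[x]"])
    then show "e \<odot>\<^bsub>core II\<^esub> u \<in> ppow (Suc 0)" unfolding ppow_gens using e x
      by (intro span_mod_base) (auto simp: cl_smult[OF II] mm_carrier)
  qed
qed

text \<open>\<open>I\<^sup>m\<^sup>+\<^sup>1 = j(I) I\<^sup>m\<close>, as a product of a list is formed from the right.\<close>

lemma ppow_Suc:
  "ppow (Suc (Suc m)) = span_mod V (core II) {actc SM (jc i) p |i p. i \<in> elts II \<and> p \<in> ppow (Suc m)}" (is "_ = span_mod V (core II) ?G")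
proof (rule subset_antisym)
  note C = module_core[OF II]
  interpret C: module V "core II" by (rule C)
  interpret II: module V II by (rule II)
  have cls: "actc SM (jc i) p \<in> elts II" if "i \<in> elts II" "p \<in> elts II" for i p
    using actc_simps(1)[OF premod_SM, of "jc i" p] jc_closed that by simp
  have G: "?G \<subseteq> elts II" using ppow_carrier cls by auto
  note S = span_mod_submodule[OF C G]
  note A = actc_bilin[OF premod_SM, unfolded obj_SM]
  \<comment> \<open>the value of a product, after multiplication by a scalar of \<open>\<mm>\<close> that is moved to the second factor\<close>
  have val: "cl II (e \<odot>\<^bsub>II\<^esub> y) = actc SM (jc (cl II x)) (cl II (e \<odot>\<^bsub>II\<^esub> z))"
    if e: "e \<in> \<mm>" and x: "x \<in> mpart II" and z: "z \<in> carrier II" and y: "(pure_tens V II II x z, y) \<in> agraph (smith_bin J)" for e x y z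
  proof -
    have "(e \<odot>\<^bsub>II \<otimes>\<^sub>m II\<^esub> pure_tens V II II x z, e \<odot>\<^bsub>II\<^esub> y) \<in> agraph (smith_bin J)"
      by (rule amorD(8)[OF is_amor_smith_bin mm_carrier[OF e] y])
    then have "(pure_tens V II II x (e \<odot>\<^bsub>II\<^esub> z), e \<odot>\<^bsub>II\<^esub> y) \<in> agraph (smith_bin J)"
      using pt_bilin(5)[OF II II mm_carrier[OF e] mpart_carrier[OF II x] z] by simp
    then have "ev (smith_bin J) (cl (II \<otimes>\<^sub>m II) (pure_tens V II II x (e \<odot>\<^bsub>II\<^esub> z))) = cl II (e \<odot>\<^bsub>II\<^esub> y)"
      by (rule ev_cl[OF is_amor_smith_bin]) (rule mpart_base[OF e amorD(6)[OF is_amor_smith_bin y]])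
    then show ?thesis
      using ptc_cl[OF II II x mpart_base[OF e z]] ev_smith_bin[OF cl_closed[OF x] cl_closed[OF mpart_base[OF e z]]] by simp
  qed
  show "ppow (Suc (Suc m)) \<subseteq> span_mod V (core II) ?G"
    unfolding ppow_gens[of "Suc (Suc m)"]
  proof (rule span_mod_least[OF S], rule subsetI)
    fix u assume "u \<in> {cl II (e \<odot>\<^bsub>II\<^esub> y) |e y. e \<in> \<mm> \<and> y \<in> pure_products (Suc (Suc m))}"
    then obtain e y xs where u: "u = cl II (e \<odot>\<^bsub>II\<^esub> y)" "e \<in> \<mm>" "length xs = Suc (Suc m)" "set xs \<subseteq> carrier II" "y \<in> smith_prods J xs"
      by (auto simp: pure_products_def)
    then obtain x w zs where xs: "xs = x # w # zs" by (metis length_Suc_conv)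
    then obtain z where z: "x \<in> mpart II" "z \<in> smith_prods J (w # zs)" "(pure_tens V II II x z, y) \<in> agraph (smith_bin J)"
      using u(5) by auto
    have zP: "z \<in> pure_products (Suc m)"
      unfolding pure_products_def using u(3,4) z(2) xs by (intro UnionI[of "smith_prods J (w # zs)"]) (auto intro!: exI[of _ "w # zs"])
    have zc: "z \<in> carrier II" using z(2) smith_prods_carrier by blast
    have "cl II (e \<odot>\<^bsub>II\<^esub> z) \<in> ppow (Suc m)" unfolding ppow_gens using u(2) zP by (intro span_mod_base) auto
    then show "u \<in> span_mod V (core II) ?G"
      unfolding u(1) val[OF u(2) z(1) zc z(3)] using cl_closed[OF z(1)] by (intro span_mod_base) auto
  qed
  show "span_mod V (core II) ?G \<subseteq> ppow (Suc (Suc m))"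
  proof (rule span_mod_least[OF ppow_submodule], rule subsetI)
    fix u assume "u \<in> ?G"
    then obtain i p where u: "u = actc SM (jc i) p" "i \<in> elts II" "p \<in> ppow (Suc m)" by blast
    have h: "actc SM (jc i) \<in> mod_hom V (core II) (core II)" using A jc_closed[OF u(2)] by (simp add: bilin_def)
    have gc: "{cl II (e \<odot>\<^bsub>II\<^esub> y) |e y. e \<in> \<mm> \<and> y \<in> pure_products (Suc m)} \<subseteq> elts II"
      using pure_products_carrier by (auto intro!: cl_closed mpart_base)
    show "u \<in> ppow (Suc (Suc m))" unfolding u(1)
    proof (rule mod_hom_span[OF h C C gc ppow_submodule _ u(3)[unfolded ppow_gens]])
      fix p assume "p \<in> {cl II (e \<odot>\<^bsub>II\<^esub> y) |e y. e \<in> \<mm> \<and> y \<in> pure_products (Suc m)}"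
      then obtain e z zs where z: "p = cl II (e \<odot>\<^bsub>II\<^esub> z)" "e \<in> \<mm>" "length zs = Suc m" "set zs \<subseteq> carrier II" "z \<in> smith_prods J zs"
        by (auto simp: pure_products_def)
      obtain x where x: "x \<in> mpart II" "i = cl II x" using u(2) by (rule core_cases)
      have zc: "z \<in> carrier II" using z(5) smith_prods_carrier by blast
      obtain y where y: "(pure_tens V II II x z, y) \<in> agraph (smith_bin J)"
        using amor_total[OF is_amor_smith_bin pt_mpart[OF II II x(1) zc]] by blast
      obtain w ws where ws: "zs = w # ws" using z(3) by (metis length_Suc_conv)
      have "y \<in> smith_prods J (x # zs)" unfolding ws using x(1) z(5)[unfolded ws] y by auto
      then have "y \<in> pure_products (Suc (Suc m))" unfolding pure_products_def using z(3,4) mpart_carrier[OF II x(1)] by (intro UnionI[of "smith_prods J (x # zs)"]) (auto intro!: exI[of _ "x # zs"])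
      then show "actc SM (jc i) p \<in> ppow (Suc (Suc m))"
        unfolding z(1) x(2) val[OF z(2) x(1) zc y, symmetric] ppow_gens[of "Suc (Suc m)"] using z(2)
        by (intro span_mod_base) auto
    qed
  qed
qed

text \<open>The part \<open>\<beta>(I\<^sup>m, M)\<close> of the target of a balanced pairing \<open>\<beta> : I \<times> M \<rightarrow> Z\<close>.\<close>

definition gpow :: "('v, 'z) module \<Rightarrow> ('i set \<Rightarrow> 'x set \<Rightarrow> 'z set) \<Rightarrow> ('v, 'a, 'x) amodule \<Rightarrow> nat \<Rightarrow> 'z set set" where
  "gpow Z \<beta> M m = span_mod V (core Z) {\<beta> p x |p x. p \<in> ppow m \<and> x \<in> elts (obj M)}"

definition pairing :: "('v, 'z) module \<Rightarrow> ('i set \<Rightarrow> 'x set \<Rightarrow> 'z set) \<Rightarrow> ('v, 'a, 'x) amodule \<Rightarrow> bool" where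
  "pairing Z \<beta> M \<longleftrightarrow> module V Z \<and> amod M \<and> bilin V (core II) (core (obj M)) (core Z) \<beta> \<and>
    (\<forall>a\<in>elts RR. \<forall>i\<in>elts II. \<forall>x\<in>elts (obj M). \<beta> (actc SM a i) x = \<beta> i (actc M a x))"

lemma pairingD:
  assumes "pairing Z \<beta> M"
  shows "module V Z" "amod M" "bilin V (core II) (core (obj M)) (core Z) \<beta>"
    "a \<in> elts RR \<Longrightarrow> i \<in> elts II \<Longrightarrow> x \<in> elts (obj M) \<Longrightarrow> \<beta> (actc SM a i) x = \<beta> i (actc M a x)"
  using assms by (auto simp: pairing_def)

lemma amod_pairing: assumes M: "amod M" shows "pairing (obj M) (\<lambda>i x. actc M (jc i) x) M"
proof -
  note X = premodD(1)[OF amodD(1)[OF M]]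
  have i: "(\<lambda>x. x) \<in> mod_hom V X' X'" for X' :: "('v, 'z) module" by (rule mod_homI) auto
  have "bilin V (core II) (core (obj M)) (core (obj M)) (\<lambda>i x. actc M (jc i) x)"
    by (rule bilin_comp[OF actc_bilin[OF amodD(1)[OF M]] ev_hom[OF s_arrow_amor] i i])
  moreover have "actc M (jc (actc SM a i)) x = actc M (jc i) (actc M a x)"
    if "a \<in> elts RR" "i \<in> elts II" "x \<in> elts (obj M)" for a i x
    using that by (simp add: jc_linear mulc_comm[of a] jc_closed amodD(2)[OF M])
  ultimately show ?thesis using M X by (simp add: pairing_def)
qed

text \<open>The submodule \<open>I\<^sup>n M\<close> of the core of \<open>M\<close>, built by multiplying with one factor from \<open>I\<close> at a time.\<close>

fun Fpow :: "('v, 'a, 'x) amodule \<Rightarrow> nat \<Rightarrow> 'x set set" where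
  "Fpow M 0 = elts (obj M)"
| "Fpow M (Suc n) = span_mod V (core (obj M)) {actc M (jc i) y |i y. i \<in> elts II \<and> y \<in> Fpow M n}"

lemma Fpow_submodule: assumes M: "amod M" shows "submodule (Fpow M n) V (core (obj M))"
proof (induct n)
  note X = module_core[OF premodD(1)[OF amodD(1)[OF M]]]
  case 0
  show ?case using submodule_carrier[OF X] by simp
next
  note X = module_core[OF premodD(1)[OF amodD(1)[OF M]]]
  case (Suc n)
  have "{actc M (jc i) y |i y. i \<in> elts II \<and> y \<in> Fpow M n} \<subseteq> elts (obj M)"
    using submoduleD(1)[OF X Suc] actc_simps(1)[OF amodD(1)[OF M] jc_closed] by auto
  then show ?case using span_mod_submodule[OF X] by simp
qed

lemma Fpow_carrier: "amod M \<Longrightarrow> y \<in> Fpow M n \<Longrightarrow> y \<in> elts (obj M)"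
  by (rule submoduleD(1)[OF module_core[OF premodD(1)[OF amodD(1)]] Fpow_submodule])

lemma gpow_gens:
  assumes \<beta>: "pairing Z \<beta> M"
  shows "{\<beta> p x |p x. p \<in> ppow m \<and> x \<in> elts (obj M)} \<subseteq> elts Z"
  using bilinD(1)[OF pairingD(3)[OF \<beta>]] ppow_carrier by auto

lemma gpow_submodule: "pairing Z \<beta> M \<Longrightarrow> submodule (gpow Z \<beta> M m) V (core Z)"
  unfolding gpow_def by (rule span_mod_submodule[OF module_core[OF pairingD(1)] gpow_gens])

text \<open>By \<open>j(i) p = j(p) i\<close> and balancedness, \<open>\<beta>(j(i) p, x) = \<beta>(i, j(p) x)\<close>: all but one factor of a product
  can be moved to \<open>M\<close>.\<close>

lemma gpow_step:
  assumes \<beta>: "pairing Z \<beta> M"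
  shows "gpow Z \<beta> M (Suc (Suc m)) = span_mod V (core Z)
    {\<beta> i y |i y. i \<in> elts II \<and> y \<in> gpow (obj M) (\<lambda>i x. actc M (jc i) x) M (Suc m)}" (is "_ = span_mod V (core Z) ?G")
proof (rule subset_antisym)
  note M = pairingD(2)[OF \<beta>] and Z = module_core[OF pairingD(1)[OF \<beta>]] and bil = pairingD(3)[OF \<beta>]
  note X = module_core[OF premodD(1)[OF amodD(1)[OF M]]] and C = module_core[OF II]
  note act = amod_pairing[OF M]
  let ?F = "gpow (obj M) (\<lambda>i x. actc M (jc i) x) M (Suc m)"
  note F = gpow_submodule[OF act, of "Suc m"]
  have G: "?G \<subseteq> elts Z" using bilinD(1)[OF bil] submoduleD(1)[OF X F] by auto
  note S = span_mod_submodule[OF Z G]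
  \<comment> \<open>first \<open>j(i) p = j(p) i\<close>, then balancedness\<close>
  have key: "\<beta> (actc SM (jc i) p) x = \<beta> i (actc M (jc p) x)"
    if "i \<in> elts II" "p \<in> elts II" "x \<in> elts (obj M)" for i p x
    using that by (simp add: jc_comm[of i p] pairingD(4)[OF \<beta>] jc_closed)
  show "gpow Z \<beta> M (Suc (Suc m)) \<subseteq> span_mod V (core Z) ?G"
    unfolding gpow_def[of Z]
  proof (rule span_mod_least[OF S], rule subsetI)
    fix u assume "u \<in> {\<beta> p x |p x. p \<in> ppow (Suc (Suc m)) \<and> x \<in> elts (obj M)}"
    then obtain p x where u: "u = \<beta> p x" "p \<in> ppow (Suc (Suc m))" "x \<in> elts (obj M)" by blast
    have h: "(\<lambda>p. \<beta> p x) \<in> mod_hom V (core II) (core Z)" using bil u(3) by (simp add: bilin_def)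
    have gc: "{actc SM (jc i) p |i p. i \<in> elts II \<and> p \<in> ppow (Suc m)} \<subseteq> elts II"
      using ppow_carrier actc_simps(1)[OF premod_SM, unfolded obj_SM, OF jc_closed] by auto
    show "u \<in> span_mod V (core Z) ?G" unfolding u(1)
    proof (rule mod_hom_span[OF h C Z gc S _ u(2)[unfolded ppow_Suc]])
      fix q assume "q \<in> {actc SM (jc i) p |i p. i \<in> elts II \<and> p \<in> ppow (Suc m)}"
      then obtain i p where q: "q = actc SM (jc i) p" "i \<in> elts II" "p \<in> ppow (Suc m)" by blast
      have "actc M (jc p) x \<in> ?F" unfolding gpow_def using q(3) u(3) by (intro span_mod_base) blast
      then show "\<beta> q x \<in> span_mod V (core Z) ?G"
        unfolding q(1) key[OF q(2) ppow_carrier[OF q(3)] u(3)] using q(2) by (intro span_mod_base) blast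
    qed
  qed
  show "span_mod V (core Z) ?G \<subseteq> gpow Z \<beta> M (Suc (Suc m))"
  proof (rule span_mod_least[OF gpow_submodule[OF \<beta>]], rule subsetI)
    fix u assume "u \<in> ?G"
    then obtain i y where u: "u = \<beta> i y" "i \<in> elts II" "y \<in> ?F" by blast
    have h: "\<beta> i \<in> mod_hom V (core (obj M)) (core Z)" using bil u(2) by (simp add: bilin_def)
    show "u \<in> gpow Z \<beta> M (Suc (Suc m))" unfolding u(1)
    proof (rule mod_hom_span[OF h X Z gpow_gens[OF act] gpow_submodule[OF \<beta>] _ u(3)[unfolded gpow_def]])
      fix z assume "z \<in> {actc M (jc p) x |p x. p \<in> ppow (Suc m) \<and> x \<in> elts (obj M)}"
      then obtain p x where z: "z = actc M (jc p) x" "p \<in> ppow (Suc m)" "x \<in> elts (obj M)" by blast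
      have "actc SM (jc i) p \<in> ppow (Suc (Suc m))" unfolding ppow_Suc using u(2) z(2) by (intro span_mod_base) blast
      then show "\<beta> i z \<in> gpow Z \<beta> M (Suc (Suc m))"
        unfolding z(1) key[OF u(2) ppow_carrier[OF z(2)] z(3), symmetric] gpow_def[of Z] using z(3) by (intro span_mod_base) blast
    qed
  qed
qed

lemma Fpow_gpow: "amod M \<Longrightarrow> Fpow M (Suc n) = gpow (obj M) (\<lambda>i x. actc M (jc i) x) M (Suc n)"
proof (induct n)
  case 0
  then show ?case by (simp add: gpow_def ppow_1)
next
  case (Suc n)
  then show ?case unfolding gpow_step[OF amod_pairing[OF Suc(2)]] by simp
qed

text \<open>Only the outermost factor from \<open>I\<close> needs the pairing. This is the form in which finitely many generators
  of \<open>I\<close> can be used.\<close>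

lemma gpow_Fpow:
  assumes \<beta>: "pairing Z \<beta> M"
  shows "gpow Z \<beta> M (Suc n) = span_mod V (core Z) {\<beta> i y |i y. i \<in> elts II \<and> y \<in> Fpow M n}"
proof (cases n)
  case 0
  then show ?thesis by (simp add: gpow_def ppow_1)
next
  case (Suc k)
  then show ?thesis using gpow_step[OF \<beta>] Fpow_gpow[OF pairingD(2)[OF \<beta>]] by simp
qed

lemma pow_tens_amors:
  assumes M: "amod M"
  shows "is_amor (sub_mod II (smith_pow J m) \<otimes>\<^sub>m obj M) (quot_mod (sub_mod II (smith_pow J m) \<otimes>\<^sub>m obj M) (tensA_ker A (pow_module A J m) M))
    (tensA_proj A (pow_module A J m) M)"
proof -
  note N = smith_pow_submodule[of m]
  let ?P = "pow_module A J m" and ?N = "sub_mod II (smith_pow J m)" and ?i = "aincl II (smith_pow J m)"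
  note Mp = amodD(1)[OF M] and X = premodD(1)[OF amodD(1)[OF M]]
  note NM = module_sub_mod[OF II N] and i = is_amor_aincl[OF II N]
  have o: "obj ?P = ?N" and a: "act ?P = alift ?i ((aid RR \<otimes>\<^sub>a ?i) \<Zsemi> act SM)"
    by (simp_all add: pow_module_def sub_amodule_def Let_def)
  have f: "is_amor (RR \<otimes>\<^sub>m ?N) II ((aid RR \<otimes>\<^sub>a ?i) \<Zsemi> act SM)"
    by (rule is_amor_acomp[OF is_amor_amap_tens[OF is_amor_aid[OF RR] i]]) (use premodD(2)[OF premod_SM] in simp)
  have "linrel (RR \<otimes>\<^sub>m ?N) ?N (act ?P)"
  proof -
    have S: "agraph ((aid RR \<otimes>\<^sub>a ?i) \<Zsemi> act SM) O (agraph ?i)\<inverse> \<subseteq> carrier (RR \<otimes>\<^sub>m ?N) \<times> carrier ?N"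
      using linrelD(6)[OF amor_linrel[OF f]] linrelD(6)[OF amor_linrel[OF i]] by blast
    show ?thesis unfolding a alift_def amorD(3)[OF f] amorD(3)[OF i]
      by (rule linrel_gen_amor[OF module_tens[OF RR NM] NM S])
  qed
  then have "linrel (?N \<otimes>\<^sub>m RR) ?N (aswap ?N RR \<Zsemi> act ?P)"
    by (rule linrel_acomp[OF amor_linrel[OF is_amor_aswap[OF NM RR]]])
  then have 1: "linrel ((?N \<otimes>\<^sub>m RR) \<otimes>\<^sub>m obj M) (?N \<otimes>\<^sub>m obj M) ((aswap ?N RR \<Zsemi> act ?P) \<otimes>\<^sub>a aid (obj M))"
    by (rule linrel_amap_tens[OF _ amor_linrel[OF is_amor_aid[OF X]]])
  have 2: "linrel ((?N \<otimes>\<^sub>m RR) \<otimes>\<^sub>m obj M) (?N \<otimes>\<^sub>m obj M) (aassoc ?N RR (obj M) \<Zsemi> (aid ?N \<otimes>\<^sub>a act M))"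
    by (rule amor_linrel[OF is_amor_acomp[OF is_amor_aassoc[OF NM RR X] is_amor_amap_tens[OF is_amor_aid[OF NM] premodD(2)[OF Mp]]]])
  have "submodule (tensA_ker A ?P M) V (?N \<otimes>\<^sub>m obj M)"
    using aimage_adiff_submodule[OF 1 2] by (simp add: tensA_ker_def Let_def o)
  then show ?thesis unfolding tensA_proj_def o by (rule is_amor_aproj[OF module_tens[OF NM X]])
qed

text \<open>The submodules divided out by the approximations are images of \<open>I\<^sup>m \<otimes>\<^sub>A M \<rightarrow> I \<otimes>\<^sub>A M \<rightarrow> Z\<close>. Up to
  saturation such an image is \<open>\<beta>(I\<^sup>m, M)\<close>, so that the tensor products over \<open>A\<close> disappear from here on.\<close>

lemma pow_image:
  assumes M: "amod M" and c: "is_amor (TA SM M) Z c"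
  defines "\<beta> \<equiv> \<lambda>i x. ev c (ptA SM M i x)"
  shows pow_image_submodule: "submodule (aimage (pow_tens A J m M \<Zsemi> c)) V Z"
    and ev_aproj_pow_image: "u \<in> elts Z \<Longrightarrow>
      ev (aproj Z (aimage (pow_tens A J m M \<Zsemi> c))) u = \<zero>\<^bsub>core (quot_mod Z (aimage (pow_tens A J m M \<Zsemi> c)))\<^esub>
      \<longleftrightarrow> (\<forall>e\<in>\<mm>. e \<odot>\<^bsub>core Z\<^esub> u \<in> gpow Z \<beta> M m)"
    and pairing_amor: "pairing Z \<beta> M"
proof -
  note N = smith_pow_submodule[of m]
  let ?N = "sub_mod II (smith_pow J m)" and ?i = "aincl II (smith_pow J m)"
  note Mp = amodD(1)[OF M] and X = premodD(1)[OF amodD(1)[OF M]] and Z = amorD(2)[OF c]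
  note NM = module_sub_mod[OF II N] and i = is_amor_aincl[OF II N]
  have o: "obj (pow_module A J m) = ?N" by (simp add: pow_module_def sub_amodule_def Let_def)
  have pr: "is_amor (II \<otimes>\<^sub>m obj M) (TA SM M) (tensA_proj A SM M)" using tensA_proj_amor[OF premod_SM Mp] by simp
  note t = is_amor_amap_tens[OF i is_amor_aid[OF X]]
  note f = is_amor_acomp[OF t pr] and fc = is_amor_acomp[OF is_amor_acomp[OF t pr] c]
  let ?f = "(?i \<otimes>\<^sub>a aid (obj M)) \<Zsemi> tensA_proj A SM M"
  have eq: "aimage (pow_tens A J m M \<Zsemi> c) = aimage (?f \<Zsemi> c)"
    unfolding pow_tens_def tensA_map_def by (rule aimage_adescend[OF pow_tens_amors[OF M] f c])
  have e: "ev (?f \<Zsemi> c) (ptc ?N (obj M) p x) = \<beta> (ev ?i p) x"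
    if "p \<in> elts ?N" "x \<in> elts (obj M)" for p x
    using that ptc_simps(1)[OF NM X that]
    by (simp add: ev_acomp[OF f c] ev_acomp[OF t pr] ev_amap_tens[OF i is_amor_aid[OF X]] ev_aid[OF X] ptA_def \<beta>_def)
  show pair: "pairing Z \<beta> M"
    using M Z tensA_amor_bilin[OF premod_SM Mp c] ptA_balanced[OF premod_SM Mp] by (simp add: pairing_def \<beta>_def)
  show "submodule (aimage (pow_tens A J m M \<Zsemi> c)) V Z" unfolding eq by (rule aimage_submodule[OF fc])
  have im: "ev ?i ` elts ?N = ppow m" using ev_aincl_image[OF II N] csub_smith_pow by simp
  have img: "ev (?f \<Zsemi> c) ` elts (?N \<otimes>\<^sub>m obj M) = gpow Z \<beta> M m"
  proof (rule subset_antisym; rule subsetI)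
    fix w assume "w \<in> ev (?f \<Zsemi> c) ` elts (?N \<otimes>\<^sub>m obj M)"
    then obtain u where u: "u \<in> elts (?N \<otimes>\<^sub>m obj M)" "w = ev (?f \<Zsemi> c) u" by auto
    show "w \<in> gpow Z \<beta> M m" unfolding u(2)
    proof (rule tens_image_sub[OF NM X module_core[OF Z] ev_hom[OF fc] gpow_submodule[OF pair] _ u(1)])
      fix p x assume px: "p \<in> elts ?N" "x \<in> elts (obj M)"
      then have "ev ?i p \<in> ppow m" using im by blast
      then show "ev (?f \<Zsemi> c) (ptc ?N (obj M) p x) \<in> gpow Z \<beta> M m"
        unfolding e[OF px] gpow_def using px(2) by (intro span_mod_base) blast
    qed
  next
    fix w assume w: "w \<in> gpow Z \<beta> M m"
    have sub: "submodule (ev (?f \<Zsemi> c) ` elts (?N \<otimes>\<^sub>m obj M)) V (core Z)"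
      by (rule submodule_image[OF ev_hom[OF fc] module_core[OF module_tens[OF NM X]] module_core[OF Z] submodule_carrier[OF module_core[OF module_tens[OF NM X]]]])
    have "{\<beta> p x |p x. p \<in> ppow m \<and> x \<in> elts (obj M)} \<subseteq> ev (?f \<Zsemi> c) ` elts (?N \<otimes>\<^sub>m obj M)"
    proof
      fix z assume "z \<in> {\<beta> p x |p x. p \<in> ppow m \<and> x \<in> elts (obj M)}"
      then obtain p x where z: "z = \<beta> p x" "p \<in> ppow m" "x \<in> elts (obj M)" by blast
      then obtain q where q: "q \<in> elts ?N" "p = ev ?i q" using im by blast
      show "z \<in> ev (?f \<Zsemi> c) ` elts (?N \<otimes>\<^sub>m obj M)"
        unfolding z(1) q(2) e[OF q(1) z(3), symmetric] using ptc_simps(1)[OF NM X q(1) z(3)] by (rule imageI)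
    qed
    then show "w \<in> ev (?f \<Zsemi> c) ` elts (?N \<otimes>\<^sub>m obj M)" using span_mod_least[OF sub] w unfolding gpow_def by blast
  qed
  show "ev (aproj Z (aimage (pow_tens A J m M \<Zsemi> c))) u = \<zero>\<^bsub>core (quot_mod Z (aimage (pow_tens A J m M \<Zsemi> c)))\<^esub>
      \<longleftrightarrow> (\<forall>e\<in>\<mm>. e \<odot>\<^bsub>core Z\<^esub> u \<in> gpow Z \<beta> M m)" if "u \<in> elts Z"
    unfolding eq ev_aproj_aimage_zero_iff[OF fc that] img ..
qed

section \<open>Arrows with a pairing, their approximations and completions\<close>

abbreviation "core0 X \<equiv> core (obj (jtop X))"
abbreviation "core1 X \<equiv> core (obj (jbot X))"
abbreviation "elts0 X \<equiv> carrier (core0 X)"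
abbreviation "elts1 X \<equiv> carrier (core1 X)"

lemma ppow_stable:
  "i \<in> elts II \<Longrightarrow> p \<in> ppow (Suc m) \<Longrightarrow> actc SM (jc i) p \<in> ppow (Suc m)"
proof (induct m arbitrary: i p)
  case 0
  then show ?case using actc_simps(1)[OF premod_SM, unfolded obj_SM, OF jc_closed] by (simp add: ppow_1)
next
  case (Suc m)
  note C = module_core[OF II]
  have h: "actc SM (jc i) \<in> mod_hom V (core II) (core II)"
    using actc_bilin[OF premod_SM, unfolded obj_SM] jc_closed[OF Suc(2)] by (simp add: bilin_def)
  have gc: "{actc SM (jc i) p |i p. i \<in> elts II \<and> p \<in> ppow (Suc m)} \<subseteq> elts II"
    using ppow_carrier actc_simps(1)[OF premod_SM, unfolded obj_SM, OF jc_closed] by auto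
  show ?case
  proof (rule mod_hom_span[OF h C C gc ppow_submodule _ Suc(3)[unfolded ppow_Suc]])
    fix q assume "q \<in> {actc SM (jc i) p |i p. i \<in> elts II \<and> p \<in> ppow (Suc m)}"
    then have "q \<in> ppow (Suc m)" using Suc(1) by blast
    then show "actc SM (jc i) q \<in> ppow (Suc (Suc m))" unfolding ppow_Suc using Suc(2) by (intro span_mod_base) blast
  qed
qed

lemma ppow_antimono: "ppow (Suc (Suc m)) \<subseteq> ppow (Suc m)"
  unfolding ppow_Suc by (rule span_mod_least[OF ppow_submodule]) (use ppow_stable in auto)

text \<open>An arrow \<open>X\<^sub>0 \<rightarrow> X\<^sub>1\<close> with \<open>I \<otimes>\<^sub>A X\<^sub>1 \<rightarrow> X\<^sub>0\<close> amounts to a pairing \<open>I \<times> X\<^sub>1 \<rightarrow> X\<^sub>0\<close>. The arrows considered are linear,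
  and the composite of the pairing with \<open>X\<^sub>0 \<rightarrow> X\<^sub>1\<close> is the action of \<open>I\<close> on \<open>X\<^sub>1\<close> through \<open>j\<close>; approximations and
  completions have these properties again.\<close>

definition jpair :: "('v, 'a, 'i, 'x, 'y) jarrow \<Rightarrow> 'i set \<Rightarrow> 'y set \<Rightarrow> 'x set" where
  "jpair X = (\<lambda>i x. ev (jcmp X) (ptA SM (jbot X) i x))"

definition A_arrow :: "('v, 'a, 'i, 'x, 'y) jarrow \<Rightarrow> bool" where
  "A_arrow X \<longleftrightarrow> amod (jtop X) \<and> amod (jbot X) \<and>
     is_amor (obj (jtop X)) (obj (jbot X)) (jmap X) \<and>
     is_amor (TA SM (jbot X)) (obj (jtop X)) (jcmp X) \<and>
     (\<forall>a\<in>elts RR. \<forall>u\<in>elts0 X. ev (jmap X) (actc (jtop X) a u) = actc (jbot X) a (ev (jmap X) u)) \<and>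
     (\<forall>a\<in>elts RR. \<forall>i\<in>elts II. \<forall>x\<in>elts1 X. actc (jtop X) a (jpair X i x) = jpair X i (actc (jbot X) a x)) \<and>
     (\<forall>i\<in>elts II. \<forall>x\<in>elts1 X. ev (jmap X) (jpair X i x) = actc (jbot X) (jc i) x)"

lemma A_arrowD:
  assumes "A_arrow X"
  shows "amod (jtop X)" "amod (jbot X)" "is_amor (obj (jtop X)) (obj (jbot X)) (jmap X)"
    "is_amor (TA SM (jbot X)) (obj (jtop X)) (jcmp X)"
    "a \<in> elts RR \<Longrightarrow> u \<in> elts0 X \<Longrightarrow> ev (jmap X) (actc (jtop X) a u) = actc (jbot X) a (ev (jmap X) u)"
    "a \<in> elts RR \<Longrightarrow> i \<in> elts II \<Longrightarrow> x \<in> elts1 X \<Longrightarrow> actc (jtop X) a (jpair X i x) = jpair X i (actc (jbot X) a x)"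
    "i \<in> elts II \<Longrightarrow> x \<in> elts1 X \<Longrightarrow> ev (jmap X) (jpair X i x) = actc (jbot X) (jc i) x"
  using assms unfolding A_arrow_def by blast+

lemma A_arrowI:
  assumes "amod (jtop X)" "amod (jbot X)" "is_amor (obj (jtop X)) (obj (jbot X)) (jmap X)"
    "is_amor (TA SM (jbot X)) (obj (jtop X)) (jcmp X)"
    "\<And>a u. a \<in> elts RR \<Longrightarrow> u \<in> elts0 X \<Longrightarrow> ev (jmap X) (actc (jtop X) a u) = actc (jbot X) a (ev (jmap X) u)"
    "\<And>a i x. a \<in> elts RR \<Longrightarrow> i \<in> elts II \<Longrightarrow> x \<in> elts1 X \<Longrightarrow> actc (jtop X) a (jpair X i x) = jpair X i (actc (jbot X) a x)"
    "\<And>i x. i \<in> elts II \<Longrightarrow> x \<in> elts1 X \<Longrightarrow> ev (jmap X) (jpair X i x) = actc (jbot X) (jc i) x"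
  shows "A_arrow X"
  using assms unfolding A_arrow_def by blast

text \<open>The bottom of an arrow is treated as the top of the identity arrow.\<close>

definition idarrow :: "('v, 'a, 'y) amodule \<Rightarrow> ('v, 'a, 'i, 'y, 'y) jarrow" where
  "idarrow M = \<lparr>jtop = M, jbot = M, jmap = aid (obj M), jcmp = jact A J M\<rparr>"

lemma idarrow_simps [simp]: "jtop (idarrow M) = M" "jbot (idarrow M) = M" "jmap (idarrow M) = aid (obj M)" "jcmp (idarrow M) = jact A J M"
  by (simp_all add: idarrow_def)

lemma jpair_idarrow: "amod M \<Longrightarrow> i \<in> elts II \<Longrightarrow> x \<in> elts (obj M) \<Longrightarrow> jpair (idarrow M) i x = actc M (jc i) x"
  by (simp add: jpair_def ev_jact)

lemma act_comm:
  assumes M: "amod M" and "a \<in> elts RR" "b \<in> elts RR" "x \<in> elts (obj M)"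
  shows "actc M a (actc M b x) = actc M b (actc M a x)"
  using assms amodD(2)[OF M, of a b x] amodD(2)[OF M, of b a x] mulc_comm[of a b] by simp

lemma A_arrow_idarrow: assumes M: "amod M" shows "A_arrow (idarrow M)"
proof -
  note X = premodD(1)[OF amodD(1)[OF M]] and cl = actc_simps(1)[OF amodD(1)[OF M]]
  show ?thesis
    by (rule A_arrowI) (use M X is_amor_jact[OF M] in \<open>simp_all add: is_amor_aid ev_aid[OF X] cl jpair_idarrow jc_closed act_comm[OF M]\<close>)
qed

lemma jker1_idarrow: "jker1 A J n X = jker0 A J n (idarrow (jbot X))"
  by (simp add: jker1_def jker0_def pow_mult_mod_def)

lemma jproj1_idarrow: "jproj1 A J n X = jproj0 A J n (idarrow (jbot X))"
  by (simp add: jproj1_def jproj0_def jker1_idarrow)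

lemma jtrans1_idarrow: "jtrans1 A J X n = jtrans0 A J (idarrow (jbot X)) n"
  by (simp add: jtrans1_def jtrans0_def jproj1_idarrow)

lemma jtop_jP: "jtop (jP A J n X) = quot_amodule A (jtop X) (jker0 A J n X)"
  and jbot_jP: "jbot (jP A J n X) = jtop (jP A J n (idarrow (jbot X)))"
  by (simp_all add: jP_def Let_def jker1_idarrow)

lemma jtop_jcompletion: "jtop (jcompletion A J X) = alim_module A (\<lambda>n. jtop (jP A J n X)) (jtrans0 A J X)"
  by (simp add: jcompletion_def Let_def)

lemma jbot_jcompletion: "jbot (jcompletion A J X) = jtop (jcompletion A J (idarrow (jbot X)))"
proof -
  have "jtrans1 A J X = jtrans0 A J (idarrow (jbot X))" by (rule ext) (rule jtrans1_idarrow)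
  then show ?thesis by (simp add: jcompletion_def Let_def jbot_jP)
qed

subsection \<open>The approximations\<close>

abbreviation idA :: "('v, 'a, 'i, 'x, 'y) jarrow \<Rightarrow> ('v, 'a, 'i, 'y, 'y) jarrow" where "idA X \<equiv> idarrow (jbot X)"
abbreviation "cA X \<equiv> jcompletion A J X"
abbreviation "pr0 X n \<equiv> alim_proj (obj \<circ> (\<lambda>n. jtop (jP A J n X))) (jtrans0 A J X) n"
abbreviation "pr1 X n \<equiv> pr0 (idA X) n"
abbreviation "Gpow X n \<equiv> gpow (obj (jtop X)) (jpair X) (jbot X) (Suc n)"

context
  fixes X :: "('v, 'a, 'i, 'x, 'y) jarrow"
  assumes X: "A_arrow X"
begin

lemmas top_amod = A_arrowD(1)[OF X] and bot_amod = A_arrowD(2)[OF X]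
lemmas top_mod = premodD(1)[OF amodD(1)[OF A_arrowD(1)[OF X]]] and bot_mod = premodD(1)[OF amodD(1)[OF A_arrowD(2)[OF X]]]

lemma jpair_pairing: "pairing (obj (jtop X)) (jpair X) (jbot X)"
  unfolding jpair_def by (rule pairing_amor[OF bot_amod A_arrowD(4)[OF X]])

lemmas jpair_bilin = pairingD(3)[OF jpair_pairing]
lemmas Gpow_submodule = gpow_submodule[OF jpair_pairing]

lemma Gpow_carrier: "u \<in> Gpow X n \<Longrightarrow> u \<in> elts0 X"
  by (rule submoduleD(1)[OF module_core[OF top_mod] Gpow_submodule])

lemma Gpow_antimono: "Gpow X (Suc n) \<subseteq> Gpow X n"
  unfolding gpow_def by (rule span_mod_mono) (use ppow_antimono in blast)

lemma Gpow_stable: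
  assumes a: "a \<in> elts RR" and u: "u \<in> Gpow X n" shows "actc (jtop X) a u \<in> Gpow X n"
proof -
  have h: "actc (jtop X) a \<in> mod_hom V (core0 X) (core0 X)"
    using actc_bilin[OF amodD(1)[OF top_amod]] a by (simp add: bilin_def)
  show ?thesis
  proof (rule mod_hom_span[OF h module_core[OF top_mod] module_core[OF top_mod] gpow_gens[OF jpair_pairing] Gpow_submodule _ u[unfolded gpow_def]])
    fix w assume "w \<in> {jpair X p x |p x. p \<in> ppow (Suc n) \<and> x \<in> elts1 X}"
    then obtain p x where w: "w = jpair X p x" "p \<in> ppow (Suc n)" "x \<in> elts1 X" by blast
    show "actc (jtop X) a w \<in> Gpow X n"
      unfolding w(1) A_arrowD(6)[OF X a ppow_carrier[OF w(2)] w(3)] gpow_def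
      using w(2) actc_simps(1)[OF amodD(1)[OF bot_amod] a w(3)] by (intro span_mod_base) blast
  qed
qed

lemma jker0_submodule: "submodule (jker0 A J n X) V (obj (jtop X))"
  unfolding jker0_def by (rule pow_image_submodule[OF bot_amod A_arrowD(4)[OF X]])

lemma jproj0_amor: "is_amor (obj (jtop X)) (quot_mod (obj (jtop X)) (jker0 A J n X)) (jproj0 A J n X)"
  and jproj0_surj: "ev (jproj0 A J n X) ` elts0 X = elts (quot_mod (obj (jtop X)) (jker0 A J n X))"
  unfolding jproj0_def by (rule is_amor_aproj[OF top_mod jker0_submodule] ev_aproj_surj[OF top_mod jker0_submodule])+

lemma jproj0_zero_iff:
  "u \<in> elts0 X \<Longrightarrow> ev (jproj0 A J n X) u = \<zero>\<^bsub>core (quot_mod (obj (jtop X)) (jker0 A J n X))\<^esub>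
    \<longleftrightarrow> (\<forall>e\<in>\<mm>. e \<odot>\<^bsub>core0 X\<^esub> u \<in> Gpow X n)"
  unfolding jproj0_def jker0_def jpair_def by (rule ev_aproj_pow_image[OF bot_amod A_arrowD(4)[OF X]])

lemma jproj0_stable:
  assumes a: "a \<in> elts RR" and u: "u \<in> elts0 X"
    and z: "ev (jproj0 A J n X) u = \<zero>\<^bsub>core (quot_mod (obj (jtop X)) (jker0 A J n X))\<^esub>"
  shows "ev (jproj0 A J n X) (actc (jtop X) a u) = \<zero>\<^bsub>core (quot_mod (obj (jtop X)) (jker0 A J n X))\<^esub>"
proof -
  note cl = actc_simps[OF amodD(1)[OF top_amod]]
  show ?thesis unfolding jproj0_zero_iff[OF cl(1)[OF a u]]
    using z[unfolded jproj0_zero_iff[OF u]] Gpow_stable[OF a] a u by (simp add: cl(5)[symmetric] mm_carrier)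
qed

lemma jP_top:
  shows amod_jP_top: "amod (jtop (jP A J n X))"
    and actc_jP_top: "a \<in> elts RR \<Longrightarrow> u \<in> elts0 X \<Longrightarrow>
      actc (jtop (jP A J n X)) a (ev (jproj0 A J n X) u) = ev (jproj0 A J n X) (actc (jtop X) a u)"
    and obj_jP_top: "obj (jtop (jP A J n X)) = quot_mod (obj (jtop X)) (jker0 A J n X)"
  unfolding jtop_jP jproj0_def
  by (rule amod_quot_amodule[OF top_amod jker0_submodule jproj0_stable[unfolded jproj0_def]]
      actc_quot_amodule[OF top_amod jker0_submodule jproj0_stable[unfolded jproj0_def]]
      obj_quot_amodule[OF top_amod jker0_submodule jproj0_stable[unfolded jproj0_def]]; assumption)+

lemmas jproj0_amor' = jproj0_amor[folded obj_jP_top]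
lemmas jproj0_surj' = jproj0_surj[folded obj_jP_top]
lemmas jproj0_zero_iff' = jproj0_zero_iff[folded obj_jP_top]

lemma jproj0_ex: "w \<in> elts0 (jP A J n X) \<Longrightarrow> \<exists>u\<in>elts0 X. w = ev (jproj0 A J n X) u"
  using jproj0_surj'[of n] by (metis imageE)

lemma jproj0_closed: "u \<in> elts0 X \<Longrightarrow> ev (jproj0 A J n X) u \<in> elts0 (jP A J n X)"
  by (rule ev_closed[OF jproj0_amor'])

lemma jtrans0:
  shows jtrans0_amor: "is_amor (obj (jtop (jP A J (Suc n) X))) (obj (jtop (jP A J n X))) (jtrans0 A J X n)"
    and ev_jtrans0: "u \<in> elts0 X \<Longrightarrow>
      ev (jtrans0 A J X n) (ev (jproj0 A J (Suc n) X) u) = ev (jproj0 A J n X) u"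
proof -
  have ker: "ev (jproj0 A J n X) u = \<zero>\<^bsub>core0 (jP A J n X)\<^esub>"
    if "u \<in> elts0 X" "ev (jproj0 A J (Suc n) X) u = \<zero>\<^bsub>core0 (jP A J (Suc n) X)\<^esub>" for u
    using that(2) Gpow_antimono unfolding jproj0_zero_iff'[OF that(1)] by blast
  show "is_amor (obj (jtop (jP A J (Suc n) X))) (obj (jtop (jP A J n X))) (jtrans0 A J X n)"
    unfolding jtrans0_def by (rule is_amor_adescend[OF jproj0_amor' jproj0_amor' jproj0_surj' ker])
  show "u \<in> elts0 X \<Longrightarrow>
      ev (jtrans0 A J X n) (ev (jproj0 A J (Suc n) X) u) = ev (jproj0 A J n X) u"
    unfolding jtrans0_def by (rule ev_adescend[OF jproj0_amor' jproj0_amor' jproj0_surj' ker])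
qed

lemma jtrans0_linear:
  assumes a: "a \<in> elts RR" and x: "x \<in> elts0 (jP A J (Suc n) X)"
  shows "ev (jtrans0 A J X n) (actc (jtop (jP A J (Suc n) X)) a x) = actc (jtop (jP A J n X)) a (ev (jtrans0 A J X n) x)"
proof -
  obtain u where u: "u \<in> elts0 X" "x = ev (jproj0 A J (Suc n) X) u" using jproj0_ex[OF x] by blast
  show ?thesis using a u by (simp add: actc_jP_top ev_jtrans0 actc_simps(1)[OF amodD(1)[OF top_amod]])
qed

subsection \<open>The completion of the top\<close>

lemma jtrans0_amor': "is_amor ((obj \<circ> (\<lambda>n. jtop (jP A J n X))) (Suc n)) ((obj \<circ> (\<lambda>n. jtop (jP A J n X))) n) (jtrans0 A J X n)"
  using jtrans0_amor by simp

lemma jcompletion_top: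
  shows amod_jcompletion_top: "amod (jtop (cA X))"
    and obj_jcompletion_top: "obj (jtop (cA X)) = alim (obj \<circ> (\<lambda>n. jtop (jP A J n X))) (jtrans0 A J X)"
    and actc_jcompletion_top: "a \<in> elts RR \<Longrightarrow> u \<in> elts0 (cA X) \<Longrightarrow>
      ev (pr0 X n) (actc (jtop (cA X)) a u) = actc (jtop (jP A J n X)) a (ev (pr0 X n) u)"
proof -
  show "amod (jtop (cA X))" unfolding jtop_jcompletion
    by (rule amod_alim_module[of "\<lambda>n. jtop (jP A J n X)" "jtrans0 A J X", OF amod_jP_top jtrans0_amor jtrans0_linear])
  show o: "obj (jtop (cA X)) = alim (obj \<circ> (\<lambda>n. jtop (jP A J n X))) (jtrans0 A J X)" unfolding jtop_jcompletion
    by (rule obj_alim_module[of "\<lambda>n. jtop (jP A J n X)" "jtrans0 A J X", OF amod_jP_top jtrans0_amor jtrans0_linear])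
  show "a \<in> elts RR \<Longrightarrow> u \<in> elts0 (cA X) \<Longrightarrow>
      ev (pr0 X n) (actc (jtop (cA X)) a u) = actc (jtop (jP A J n X)) a (ev (pr0 X n) u)"
    unfolding o unfolding jtop_jcompletion
    by (rule actc_alim_module[of "\<lambda>n. jtop (jP A J n X)" "jtrans0 A J X", OF amod_jP_top jtrans0_amor jtrans0_linear])
qed

lemma prj_amor: "is_amor (obj (jtop (cA X))) (obj (jtop (jP A J n X))) (pr0 X n)"
  using is_amor_alim_proj[of "obj \<circ> (\<lambda>n. jtop (jP A J n X))" "jtrans0 A J X", OF jtrans0_amor', of n]
  by (simp add: obj_jcompletion_top)

lemma prj_compat: "u \<in> elts0 (cA X) \<Longrightarrow> ev (jtrans0 A J X n) (ev (pr0 X (Suc n)) u) = ev (pr0 X n) u"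
  unfolding obj_jcompletion_top by (rule alim_proj_compat[of "obj \<circ> (\<lambda>n. jtop (jP A J n X))" "jtrans0 A J X", OF jtrans0_amor'])

lemma prj_eqI: "u \<in> elts0 (cA X) \<Longrightarrow> w \<in> elts0 (cA X) \<Longrightarrow>
    (\<And>n. ev (pr0 X n) u = ev (pr0 X n) w) \<Longrightarrow> u = w"
  unfolding obj_jcompletion_top by (rule alim_proj_eqI[of "obj \<circ> (\<lambda>n. jtop (jP A J n X))" "jtrans0 A J X", OF jtrans0_amor'])

lemma prj_ex:
  assumes z: "\<And>n. z n \<in> elts0 (jP A J n X)" "\<And>n. ev (jtrans0 A J X n) (z (Suc n)) = z n" and e: "e \<in> \<mm>"
  obtains u where "u \<in> elts0 (cA X)" "\<And>n. ev (pr0 X n) u = e \<odot>\<^bsub>core0 (jP A J n X)\<^esub> z n"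
proof -
  have z': "z n \<in> elts ((obj \<circ> (\<lambda>n. jtop (jP A J n X))) n)" for n using z(1) by simp
  show ?thesis
    by (rule alim_proj_ex[of "obj \<circ> (\<lambda>n. jtop (jP A J n X))" "jtrans0 A J X" z e, OF jtrans0_amor' z' z(2) e])
       (rule that; simp add: obj_jcompletion_top)
qed

lemma prj_lift:
  assumes W: "module V W" and f: "\<And>n. is_amor W (obj (jtop (jP A J n X))) (f n)"
    and compat: "\<And>n u. u \<in> elts W \<Longrightarrow> ev (jtrans0 A J X n) (ev (f (Suc n)) u) = ev (f n) u"
  shows prj_lift_amor: "is_amor W (obj (jtop (cA X))) (alim_lift (obj \<circ> (\<lambda>n. jtop (jP A J n X))) (jtrans0 A J X) W f)"
    and ev_prj_lift: "u \<in> elts W \<Longrightarrow> ev (pr0 X n) (ev (alim_lift (obj \<circ> (\<lambda>n. jtop (jP A J n X))) (jtrans0 A J X) W f) u) = ev (f n) u"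
proof -
  have f': "is_amor W ((obj \<circ> (\<lambda>n. jtop (jP A J n X))) n) (f n)" for n using f by simp
  show "is_amor W (obj (jtop (cA X))) (alim_lift (obj \<circ> (\<lambda>n. jtop (jP A J n X))) (jtrans0 A J X) W f)"
    unfolding obj_jcompletion_top by (rule is_amor_alim_lift[of "obj \<circ> (\<lambda>n. jtop (jP A J n X))" "jtrans0 A J X", OF jtrans0_amor' W f' compat])
  show "u \<in> elts W \<Longrightarrow> ev (pr0 X n) (ev (alim_lift (obj \<circ> (\<lambda>n. jtop (jP A J n X))) (jtrans0 A J X) W f) u) = ev (f n) u"
    by (rule ev_alim_lift[of "obj \<circ> (\<lambda>n. jtop (jP A J n X))" "jtrans0 A J X", OF jtrans0_amor' W f' compat])
qed

end

context
  fixes X :: "('v, 'a, 'i, 'x, 'y) jarrow"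
  assumes X: "A_arrow X"
begin

lemmas A_arrow_idA = A_arrow_idarrow[OF A_arrowD(2)[OF X]]
lemmas arrow_mods = top_mod[OF X] bot_mod[OF X]
lemmas top_proj_amor = jproj0_amor'[OF X] and bot_proj_amor = jproj0_amor'[OF A_arrow_idA, simplified]

lemma obj_jP_bot: "obj (jbot (jP A J n X)) = obj (jtop (jP A J n (idA X)))" by (simp add: jbot_jP)

lemma jmap_Gpow:
  assumes u: "u \<in> Gpow X n" shows "ev (jmap X) u \<in> Gpow (idA X) n"
  unfolding idarrow_simps
proof (rule mod_hom_span[OF ev_hom[OF A_arrowD(3)[OF X]] module_core[OF arrow_mods(1)] module_core[OF arrow_mods(2)] gpow_gens[OF jpair_pairing[OF X]]
      Gpow_submodule[OF A_arrow_idA, simplified] _ u[unfolded gpow_def]])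
  fix w assume "w \<in> {jpair X p x |p x. p \<in> ppow (Suc n) \<and> x \<in> elts1 X}"
  then obtain p x where w: "w = jpair X p x" "p \<in> ppow (Suc n)" "x \<in> elts1 X" by blast
  then show "ev (jmap X) w \<in> gpow (obj (jbot X)) (jpair (idA X)) (jbot X) (Suc n)"
    unfolding w(1) A_arrowD(7)[OF X ppow_carrier[OF w(2)] w(3)] gpow_def
    using jpair_idarrow[OF A_arrowD(2)[OF X] ppow_carrier[OF w(2)] w(3)] by (intro span_mod_base) auto
qed

lemma jP_map_part:
  shows jP_jmap_amor: "is_amor (obj (jtop (jP A J n X))) (obj (jbot (jP A J n X))) (jmap (jP A J n X))"
    and ev_jP_jmap: "u \<in> elts0 X \<Longrightarrow>
      ev (jmap (jP A J n X)) (ev (jproj0 A J n X) u) = ev (jproj0 A J n (idA X)) (ev (jmap X) u)"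
proof -
  have m: "jmap (jP A J n X) = adescend (jproj0 A J n X) (jmap X \<Zsemi> jproj0 A J n (idA X))"
    by (simp add: jP_def Let_def jproj1_idarrow)
  note c = is_amor_acomp[OF A_arrowD(3)[OF X] bot_proj_amor]
  have ker: "ev (jmap X \<Zsemi> jproj0 A J n (idA X)) u = \<zero>\<^bsub>core0 (jP A J n (idA X))\<^esub>"
    if u: "u \<in> elts0 X" and z: "ev (jproj0 A J n X) u = \<zero>\<^bsub>core0 (jP A J n X)\<^esub>" for u
  proof -
    have "e \<odot>\<^bsub>core1 X\<^esub> ev (jmap X) u \<in> Gpow (idA X) n" if e: "e \<in> \<mm>" for e
      using z[unfolded jproj0_zero_iff'[OF X u]] e jmap_Gpow mod_hom_smult[OF ev_hom[OF A_arrowD(3)[OF X]] mm_carrier[OF e] u] by metis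
    then show ?thesis
      using jproj0_zero_iff'[OF A_arrow_idA, of "ev (jmap X) u" n] ev_closed[OF A_arrowD(3)[OF X] u]
      by (simp add: ev_acomp[OF A_arrowD(3)[OF X] bot_proj_amor u])
  qed
  show "is_amor (obj (jtop (jP A J n X))) (obj (jbot (jP A J n X))) (jmap (jP A J n X))"
    unfolding m obj_jP_bot by (rule is_amor_adescend[OF top_proj_amor c jproj0_surj'[OF X] ker])
  show "u \<in> elts0 X \<Longrightarrow>
      ev (jmap (jP A J n X)) (ev (jproj0 A J n X) u) = ev (jproj0 A J n (idA X)) (ev (jmap X) u)"
    unfolding m using ev_adescend[OF top_proj_amor c jproj0_surj'[OF X] ker] ev_acomp[OF A_arrowD(3)[OF X] bot_proj_amor] by simp
qed

lemma jpair_Gpow: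
  assumes i: "i \<in> elts II" and y: "y \<in> Gpow (idA X) n" shows "jpair X i y \<in> Gpow X n"
proof -
  note bil = jpair_bilin[OF X]
  have h: "jpair X i \<in> mod_hom V (core1 X) (core0 X)" using bil i by (simp add: bilin_def)
  have y': "y \<in> span_mod V (core1 X) {jpair (idA X) p x |p x. p \<in> ppow (Suc n) \<and> x \<in> elts1 X}"
    using y by (simp add: gpow_def)
  have g: "{jpair (idA X) p x |p x. p \<in> ppow (Suc n) \<and> x \<in> elts1 X} \<subseteq> elts1 X"
    using gpow_gens[OF jpair_pairing[OF A_arrow_idA]] by simp
  show ?thesis
  proof (rule mod_hom_span[OF h module_core[OF arrow_mods(2)] module_core[OF arrow_mods(1)] g Gpow_submodule[OF X] _ y'])
    fix w assume "w \<in> {jpair (idA X) p x |p x. p \<in> ppow (Suc n) \<and> x \<in> elts1 X}"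
    then obtain p x where w: "w = jpair (idA X) p x" "p \<in> ppow (Suc n)" "x \<in> elts1 X" by blast
    note p = ppow_carrier[OF w(2)]
    have "jpair X i w = jpair X (actc SM (jc p) i) x"
      unfolding w(1) jpair_idarrow[OF A_arrowD(2)[OF X] p w(3)]
      using pairingD(4)[OF jpair_pairing[OF X] jc_closed[OF p] i w(3)] by simp
    also have "actc SM (jc p) i = actc SM (jc i) p" by (rule jc_comm[OF p i])
    finally show "jpair X i w \<in> Gpow X n" unfolding gpow_def using ppow_stable[OF i w(2)] w(3) by (intro span_mod_base) auto
  qed
qed

lemma bot_proj_linear: "a \<in> elts RR \<Longrightarrow> x \<in> elts1 X \<Longrightarrow>
    ev (jproj0 A J n (idA X)) (actc (jbot X) a x) = actc (jtop (jP A J n (idA X))) a (ev (jproj0 A J n (idA X)) x)"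
  using actc_jP_top[OF A_arrow_idA, of a x n] by simp

lemma bot_proj_ex: "y \<in> elts0 (jP A J n (idA X)) \<Longrightarrow> \<exists>x\<in>elts1 X. y = ev (jproj0 A J n (idA X)) x"
  using jproj0_ex[OF A_arrow_idA, of y n] by simp

text \<open>The structure map descends along \<open>I \<otimes>\<^sub>A X\<^sub>1 \<rightarrow> I \<otimes>\<^sub>A (X\<^sub>1/I\<^sup>n\<^sup>+\<^sup>1 X\<^sub>1)\<close>. The kernel of this surjection need not be
  computed: the universal property of the target gives the descended map from the pairing on the
  quotients, and its existence shows that the kernel is killed.\<close>

lemma jP_cmp_part:
  shows jP_jcmp_amor: "is_amor (TA SM (jbot (jP A J n X))) (obj (jtop (jP A J n X))) (jcmp (jP A J n X))"
    and jpair_jP: "i \<in> elts II \<Longrightarrow> x \<in> elts1 X \<Longrightarrow>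
      jpair (jP A J n X) i (ev (jproj0 A J n (idA X)) x) = ev (jproj0 A J n X) (jpair X i x)"
proof -
  let ?B = "jtop (jP A J n (idA X))" and ?q0 = "jproj0 A J n X" and ?q1 = "jproj0 A J n (idA X)"
  let ?tm = "tensA_map A SM SM (aid II) (jbot X) ?B ?q1"
  have B: "jbot (jP A J n X) = ?B" by (rule jbot_jP)
  have Bp: "premod ?B" by (rule amodD(1)[OF amod_jP_top[OF A_arrow_idA]])
  note Mp = amodD(1)[OF A_arrowD(2)[OF X]] and Tp = amodD(1)[OF amod_jP_top[OF X]]
  have m: "jcmp (jP A J n X) = adescend ?tm (jcmp X \<Zsemi> ?q0)"
    by (simp add: jP_def Let_def jproj1_idarrow jker1_idarrow jtop_jP)
  have aI: "is_amor (obj SM) (obj SM) (aid II)" by (simp add: is_amor_aid[OF II])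
  have al: "ev (aid II) (actc SM a i) = actc SM a (ev (aid II) i)" if "a \<in> elts RR" "i \<in> elts (obj SM)" for a i
    using that actc_simps(1)[OF premod_SM] by (simp add: ev_aid[OF II])
  have tm: "is_amor (TA SM (jbot X)) (TA SM ?B) ?tm"
    and etm: "\<And>i x. i \<in> elts II \<Longrightarrow> x \<in> elts1 X \<Longrightarrow> ev ?tm (ptA SM (jbot X) i x) = ptA SM ?B i (ev ?q1 x)"
    using is_amor_tensA_map[OF premod_SM premod_SM Mp Bp aI bot_proj_amor al bot_proj_linear]
      ev_tensA_map[OF premod_SM premod_SM Mp Bp aI bot_proj_amor al bot_proj_linear] by (simp_all add: ev_aid[OF II])
  note c = is_amor_acomp[OF A_arrowD(4)[OF X] top_proj_amor]
  have ec: "ev (jcmp X \<Zsemi> ?q0) (ptA SM (jbot X) i x) = ev ?q0 (jpair X i x)"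
    if "i \<in> elts II" "x \<in> elts1 X" for i x
    using bilinD(1)[OF ptA_bilin[OF premod_SM Mp]] that by (simp add: ev_acomp[OF A_arrowD(4)[OF X] top_proj_amor] jpair_def)
  note CB = module_core[OF premodD(1)[OF Bp]] and CT = module_core[OF premodD(1)[OF Tp]]
  have "\<exists>k. k \<in> mod_hom V (core (obj ?B)) (core0 (jP A J n X)) \<and> (\<forall>x\<in>elts1 X. k (ev ?q1 x) = ev ?q0 (jpair X i x))"
    if i: "i \<in> elts II" for i
  proof -
    have h: "(\<lambda>x. ev ?q0 (jpair X i x)) \<in> mod_hom V (core1 X) (core0 (jP A J n X))"
      by (rule mod_hom_comp[OF _ ev_hom[OF top_proj_amor]]) (use jpair_bilin[OF X] i in \<open>simp add: bilin_def\<close>)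
    have ker: "ev ?q0 (jpair X i x) = \<zero>\<^bsub>core0 (jP A J n X)\<^esub>"
      if x: "x \<in> elts1 X" and z: "ev ?q1 x = \<zero>\<^bsub>core (obj ?B)\<^esub>" for x
    proof -
      have "e \<odot>\<^bsub>core1 X\<^esub> x \<in> Gpow (idA X) n" if "e \<in> \<mm>" for e
        using jproj0_zero_iff'[OF A_arrow_idA, of x n] x z that by simp
      then have "e \<odot>\<^bsub>core0 X\<^esub> jpair X i x \<in> Gpow X n" if "e \<in> \<mm>" for e
        using jpair_Gpow[OF i] bilinD(5)[OF jpair_bilin[OF X] mm_carrier[OF that] i x] that by metis
      then show ?thesis using jproj0_zero_iff'[OF X bilinD(1)[OF jpair_bilin[OF X] i x]] by blast
    qed
    have su: "ev ?q1 ` elts1 X = elts (obj ?B)" using jproj0_surj'[OF A_arrow_idA] by simp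
    show ?thesis by (rule hom_factor[OF module_core[OF arrow_mods(2)] CB CT ev_hom[OF bot_proj_amor] h su ker]) blast+
  qed
  then obtain k where k: "\<And>i. i \<in> elts II \<Longrightarrow> k i \<in> mod_hom V (core (obj ?B)) (core0 (jP A J n X))"
    and kq: "\<And>i x. i \<in> elts II \<Longrightarrow> x \<in> elts1 X \<Longrightarrow> k i (ev ?q1 x) = ev ?q0 (jpair X i x)" by metis
  interpret CI: module V "core II" by (rule module_core[OF II])
  have kb: "bilin V (core (obj SM)) (core (obj ?B)) (core0 (jP A J n X)) k"
  proof (rule bilinI)
    fix i i' y assume i: "i \<in> elts (obj SM)" "i' \<in> elts (obj SM)" and "y \<in> elts (obj ?B)"
    then obtain x where x: "x \<in> elts1 X" "y = ev ?q1 x" using bot_proj_ex by blast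
    show "k (i \<oplus>\<^bsub>core (obj SM)\<^esub> i') y = k i y \<oplus>\<^bsub>core0 (jP A J n X)\<^esub> k i' y"
      using i x by (simp add: kq bilinD(2)[OF jpair_bilin[OF X]] mod_hom_add[OF ev_hom[OF top_proj_amor]] bilinD(1)[OF jpair_bilin[OF X]])
  next
    fix v i y assume v: "v \<in> carrier V" and i: "i \<in> elts (obj SM)" and "y \<in> elts (obj ?B)"
    then obtain x where x: "x \<in> elts1 X" "y = ev ?q1 x" using bot_proj_ex by blast
    show "k (v \<odot>\<^bsub>core (obj SM)\<^esub> i) y = v \<odot>\<^bsub>core0 (jP A J n X)\<^esub> k i y"
      using v i x by (simp add: kq bilinD(4)[OF jpair_bilin[OF X]] mod_hom_smult[OF ev_hom[OF top_proj_amor]] bilinD(1)[OF jpair_bilin[OF X]])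
  qed (simp_all add: mod_hom_closed[OF k] mod_hom_add[OF k] mod_hom_smult[OF k])
  have bal: "k (actc SM a i) y = k i (actc ?B a y)"
    if ia: "i \<in> elts (obj SM)" "a \<in> elts RR" and "y \<in> elts (obj ?B)" for i a y
  proof -
    obtain x where x: "x \<in> elts1 X" "y = ev ?q1 x" using bot_proj_ex \<open>y \<in> elts (obj ?B)\<close> by blast
    show ?thesis using ia x actc_simps(1)[OF premod_SM, of a i] actc_simps(1)[OF Mp, of a x]
      by (simp add: kq bot_proj_linear[symmetric] pairingD(4)[OF jpair_pairing[OF X]])
  qed
  obtain H where H: "H \<in> mod_hom V (core (TA SM ?B)) (core0 (jP A J n X))"
    and Hp: "\<And>i y. i \<in> elts (obj SM) \<Longrightarrow> y \<in> elts (obj ?B) \<Longrightarrow> H (ptA SM ?B i y) = k i y"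
    using tensA_universal[OF premod_SM Bp premodD(1)[OF Tp] kb bal] by blast
  note TX = module_TA[OF premod_SM Mp] and TB = module_TA[OF premod_SM Bp]
  have fact: "H (ev ?tm w) = ev (jcmp X \<Zsemi> ?q0) w" if w: "w \<in> elts (TA SM (jbot X))" for w
    by (rule tensA_hom_eqI[OF premod_SM Mp CT mod_hom_comp[OF ev_hom[OF tm] H] ev_hom[OF c] _ w])
       (simp add: etm ec Hp kq ev_closed[OF bot_proj_amor])
  have su: "ev ?tm ` elts (TA SM (jbot X)) = elts (TA SM ?B)"
  proof (rule subset_antisym; rule subsetI)
    fix w assume w: "w \<in> elts (TA SM ?B)"
    have img: "submodule (ev ?tm ` elts (TA SM (jbot X))) V (core (TA SM ?B))"
      by (rule submodule_image[OF ev_hom[OF tm] module_core[OF TX] module_core[OF TB] submodule_carrier[OF module_core[OF TX]]])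
    have "{ptA SM ?B i x |i x. i \<in> elts (obj SM) \<and> x \<in> elts (obj ?B)} \<subseteq> ev ?tm ` elts (TA SM (jbot X))"
    proof
      fix z assume "z \<in> {ptA SM ?B i x |i x. i \<in> elts (obj SM) \<and> x \<in> elts (obj ?B)}"
      then obtain i y where z: "z = ptA SM ?B i y" "i \<in> elts II" "y \<in> elts (obj ?B)" by auto
      then obtain x where x: "x \<in> elts1 X" "y = ev ?q1 x" using bot_proj_ex by blast
      have "ptA SM (jbot X) i x \<in> elts (TA SM (jbot X))" using bilinD(1)[OF ptA_bilin[OF premod_SM Mp]] z(2) x(1) by simp
      then show "z \<in> ev ?tm ` elts (TA SM (jbot X))" unfolding z(1) x(2) etm[OF z(2) x(1), symmetric] by (rule imageI)
    qed
    then show "w \<in> ev ?tm ` elts (TA SM (jbot X))" using span_mod_least[OF img] ptA_span[OF premod_SM Bp w] by blast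
  qed (use ev_closed[OF tm] in auto)
  have ker: "ev (jcmp X \<Zsemi> ?q0) w = \<zero>\<^bsub>core0 (jP A J n X)\<^esub>"
    if "w \<in> elts (TA SM (jbot X))" "ev ?tm w = \<zero>\<^bsub>core (TA SM ?B)\<^esub>" for w
    using fact[OF that(1)] that(2) mod_hom_zero[OF H module_core[OF TB] CT] by simp
  show "is_amor (TA SM (jbot (jP A J n X))) (obj (jtop (jP A J n X))) (jcmp (jP A J n X))"
    unfolding B m by (rule is_amor_adescend[OF tm c su ker])
  assume ix: "i \<in> elts II" "x \<in> elts1 X"
  have p: "ptA SM (jbot X) i x \<in> elts (TA SM (jbot X))" using bilinD(1)[OF ptA_bilin[OF premod_SM Mp]] ix by simp
  show "jpair (jP A J n X) i (ev ?q1 x) = ev ?q0 (jpair X i x)"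
    unfolding jpair_def[of "jP A J n X"] B m etm[OF ix, symmetric]
    using ev_adescend[OF tm c su ker p] ec[OF ix] by simp
qed

lemma A_arrow_jP: "A_arrow (jP A J n X)"
proof (rule A_arrowI)
  note Tp = amodD(1)[OF A_arrowD(1)[OF X]] and Bp = amodD(1)[OF A_arrowD(2)[OF X]]
  show "amod (jtop (jP A J n X))" by (rule amod_jP_top[OF X])
  show "amod (jbot (jP A J n X))" unfolding jbot_jP by (rule amod_jP_top[OF A_arrow_idA])
  show "is_amor (obj (jtop (jP A J n X))) (obj (jbot (jP A J n X))) (jmap (jP A J n X))" by (rule jP_jmap_amor)
  show "is_amor (TA SM (jbot (jP A J n X))) (obj (jtop (jP A J n X))) (jcmp (jP A J n X))" by (rule jP_jcmp_amor)
  note cls = actc_simps(1)[OF Tp] actc_simps(1)[OF Bp] ev_closed[OF A_arrowD(3)[OF X]] bilinD(1)[OF jpair_bilin[OF X]]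
  fix a assume a: "a \<in> elts RR"
  show "ev (jmap (jP A J n X)) (actc (jtop (jP A J n X)) a u) = actc (jbot (jP A J n X)) a (ev (jmap (jP A J n X)) u)"
    if "u \<in> elts0 (jP A J n X)" for u
  proof -
    obtain w where w: "w \<in> elts0 X" "u = ev (jproj0 A J n X) w" using jproj0_ex[OF X] \<open>u \<in> _\<close> by blast
    show ?thesis using a w by (simp add: actc_jP_top[OF X] cls ev_jP_jmap A_arrowD(5)[OF X] bot_proj_linear jbot_jP)
  qed
  show "actc (jtop (jP A J n X)) a (jpair (jP A J n X) i x) = jpair (jP A J n X) i (actc (jbot (jP A J n X)) a x)"
    if i: "i \<in> elts II" and x: "x \<in> elts1 (jP A J n X)" for i x
  proof -
    obtain y where y: "y \<in> elts1 X" "x = ev (jproj0 A J n (idA X)) y" using bot_proj_ex x by (metis jbot_jP)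
    show ?thesis using a i y by (simp add: jpair_jP actc_jP_top[OF X] cls A_arrowD(6)[OF X] bot_proj_linear[symmetric] jbot_jP)
  qed
next
  note Tp = amodD(1)[OF A_arrowD(1)[OF X]] and Bp = amodD(1)[OF A_arrowD(2)[OF X]]
  note cls = actc_simps(1)[OF Tp] actc_simps(1)[OF Bp] ev_closed[OF A_arrowD(3)[OF X]] bilinD(1)[OF jpair_bilin[OF X]]
  fix i x assume i: "i \<in> elts II" and x: "x \<in> elts1 (jP A J n X)"
  obtain y where y: "y \<in> elts1 X" "x = ev (jproj0 A J n (idA X)) y" using bot_proj_ex x by (metis jbot_jP)
  show "ev (jmap (jP A J n X)) (jpair (jP A J n X) i x) = actc (jbot (jP A J n X)) (jc i) x"
    using i y by (simp add: jpair_jP ev_jP_jmap cls A_arrowD(7)[OF X] bot_proj_linear[symmetric] jbot_jP jc_closed)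
qed

subsection \<open>The completion of an arrow\<close>

lemma bot_completion: "jbot (cA X) = jtop (cA (idA X))" by (rule jbot_jcompletion)

lemmas pr0_amor = prj_amor[OF X] and pr1_amor = prj_amor[OF A_arrow_idA, folded bot_completion]

lemma jcompletion_map:
  shows jcompletion_jmap_amor: "is_amor (obj (jtop (cA X))) (obj (jbot (cA X))) (jmap (cA X))"
    and prj_jcompletion_jmap: "u \<in> elts0 (cA X) \<Longrightarrow> ev (pr1 X n) (ev (jmap (cA X)) u) = ev (jmap (jP A J n X)) (ev (pr0 X n) u)"
proof -
  have tr: "jtrans1 A J X = jtrans0 A J (idA X)" by (rule ext) (rule jtrans1_idarrow)
  have m: "jmap (cA X) = alim_lift (obj \<circ> (\<lambda>n. jtop (jP A J n (idA X)))) (jtrans0 A J (idA X)) (obj (jtop (cA X))) (\<lambda>n. pr0 X n \<Zsemi> jmap (jP A J n X))"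
    unfolding jtop_jcompletion by (simp add: jcompletion_def Let_def jbot_jP tr)
  have jm: "is_amor (obj (jtop (jP A J n X))) (obj (jtop (jP A J n (idA X)))) (jmap (jP A J n X))" for n
    using jP_jmap_amor[of n] by (simp add: jbot_jP)
  have f: "is_amor (obj (jtop (cA X))) (obj (jtop (jP A J n (idA X)))) (pr0 X n \<Zsemi> jmap (jP A J n X))" for n
    by (rule is_amor_acomp[OF pr0_amor jm])
  have sq: "ev (jtrans0 A J (idA X) n) (ev (jmap (jP A J (Suc n) X)) w) = ev (jmap (jP A J n X)) (ev (jtrans0 A J X n) w)"
    if w: "w \<in> elts0 (jP A J (Suc n) X)" for w n
  proof -
    obtain u where u: "u \<in> elts0 X" "w = ev (jproj0 A J (Suc n) X) u" using jproj0_ex[OF X w] by blast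
    then show ?thesis
      using ev_jtrans0[OF A_arrow_idA, of "ev (jmap X) u" n] ev_closed[OF A_arrowD(3)[OF X] u(1)]
      by (simp add: ev_jP_jmap ev_jtrans0[OF X])
  qed
  have c: "ev (jtrans0 A J (idA X) n) (ev (pr0 X (Suc n) \<Zsemi> jmap (jP A J (Suc n) X)) u) = ev (pr0 X n \<Zsemi> jmap (jP A J n X)) u"
    if u: "u \<in> elts0 (cA X)" for u n
    using u by (simp add: ev_acomp[OF pr0_amor jm] sq ev_closed[OF pr0_amor] prj_compat[OF X])
  note W = premodD(1)[OF amodD(1)[OF amod_jcompletion_top[OF X]]]
  show "is_amor (obj (jtop (cA X))) (obj (jbot (cA X))) (jmap (cA X))"
    unfolding m bot_completion by (rule prj_lift_amor[OF A_arrow_idA W f c])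
  show "ev (pr1 X n) (ev (jmap (cA X)) u) = ev (jmap (jP A J n X)) (ev (pr0 X n) u)" if u: "u \<in> elts0 (cA X)"
  proof -
    have "ev (pr1 X n) (ev (alim_lift (obj \<circ> (\<lambda>n. jtop (jP A J n (idA X)))) (jtrans0 A J (idA X)) (obj (jtop (cA X))) (\<lambda>n. pr0 X n \<Zsemi> jmap (jP A J n X))) u)
        = ev (pr0 X n \<Zsemi> jmap (jP A J n X)) u" by (rule ev_prj_lift[OF A_arrow_idA W f c u])
    then show ?thesis by (simp only: m ev_acomp[OF pr0_amor jm u])
  qed
qed

lemma jcompletion_bot: "amod (jbot (cA X))"
  unfolding bot_completion by (rule amod_jcompletion_top[OF A_arrow_idA])

lemma prj1_linear: "a \<in> elts RR \<Longrightarrow> u \<in> elts1 (cA X) \<Longrightarrow>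
    ev (pr1 X n) (actc (jbot (cA X)) a u) = actc (jtop (jP A J n (idA X))) a (ev (pr1 X n) u)"
  unfolding bot_completion by (rule actc_jcompletion_top[OF A_arrow_idA])

lemma jpair_trans:
  assumes i: "i \<in> elts II" and w: "w \<in> elts0 (jP A J (Suc n) (idA X))"
  shows "ev (jtrans0 A J X n) (jpair (jP A J (Suc n) X) i w) = jpair (jP A J n X) i (ev (jtrans0 A J (idA X) n) w)"
proof -
  obtain x where x: "x \<in> elts1 X" "w = ev (jproj0 A J (Suc n) (idA X)) x" using bot_proj_ex[OF w] by blast
  then show ?thesis
    using i ev_jtrans0[OF A_arrow_idA, of x n]
    by (simp add: jpair_jP ev_jtrans0[OF X] bilinD(1)[OF jpair_bilin[OF X]])
qed

lemma jcompletion_cmp: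
  shows jcompletion_jcmp_amor: "is_amor (TA SM (jbot (cA X))) (obj (jtop (cA X))) (jcmp (cA X))"
    and prj_jpair: "i \<in> elts II \<Longrightarrow> x \<in> elts1 (cA X) \<Longrightarrow>
      ev (pr0 X n) (jpair (cA X) i x) = jpair (jP A J n X) i (ev (pr1 X n) x)"
proof -
  have tr: "jtrans1 A J X = jtrans0 A J (idA X)" by (rule ext) (rule jtrans1_idarrow)
  let ?tm = "\<lambda>n. tensA_map A SM SM (aid II) (jbot (cA X)) (jtop (jP A J n (idA X))) (pr1 X n)"
  have src: "atgt (tensA_proj A SM L) = quot_mod (II \<otimes>\<^sub>m obj L) (tensA_ker A SM L)" for L :: "('v, 'a, 'z) amodule" by (simp add: tensA_proj_def aproj_def gen_amor_def)
  have m: "jcmp (cA X) = alim_lift (obj \<circ> (\<lambda>n. jtop (jP A J n X))) (jtrans0 A J X) (TA SM (jbot (cA X))) (\<lambda>n. ?tm n \<Zsemi> jcmp (jP A J n X))"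
    unfolding bot_completion jtop_jcompletion[of "idA X"] by (simp add: jcompletion_def Let_def jbot_jP tr src)
  note Bp = amodD(1)[OF jcompletion_bot] and Tp = amodD(1)[OF amod_jP_top[OF A_arrow_idA]]
  have aI: "is_amor (obj SM) (obj SM) (aid II)" by (simp add: is_amor_aid[OF II])
  have al: "ev (aid II) (actc SM a i) = actc SM a (ev (aid II) i)" if "a \<in> elts RR" "i \<in> elts (obj SM)" for a i
    using that actc_simps(1)[OF premod_SM] by (simp add: ev_aid[OF II])
  have tm: "is_amor (TA SM (jbot (cA X))) (TA SM (jtop (jP A J n (idA X)))) (?tm n)" for n
    by (rule is_amor_tensA_map[OF premod_SM premod_SM Bp Tp aI pr1_amor al prj1_linear])
  have etm: "ev (?tm n) (ptA SM (jbot (cA X)) i x) = ptA SM (jtop (jP A J n (idA X))) i (ev (pr1 X n) x)"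
    if "i \<in> elts II" "x \<in> elts1 (cA X)" for i x n
    using ev_tensA_map[OF premod_SM premod_SM Bp Tp aI pr1_amor al prj1_linear] that by (simp add: ev_aid[OF II])
  have cmp: "is_amor (TA SM (jtop (jP A J n (idA X)))) (obj (jtop (jP A J n X))) (jcmp (jP A J n X))" for n
    using jP_jcmp_amor[of n] by (simp add: jbot_jP)
  have f: "is_amor (TA SM (jbot (cA X))) (obj (jtop (jP A J n X))) (?tm n \<Zsemi> jcmp (jP A J n X))" for n
    by (rule is_amor_acomp[OF tm cmp])
  have ef: "ev (?tm n \<Zsemi> jcmp (jP A J n X)) (ptA SM (jbot (cA X)) i x) = jpair (jP A J n X) i (ev (pr1 X n) x)"
    if "i \<in> elts II" "x \<in> elts1 (cA X)" for i x n
    using bilinD(1)[OF ptA_bilin[OF premod_SM Bp]] that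
    by (simp add: ev_acomp[OF tm cmp] etm jpair_def[of "jP A J n X"] jbot_jP)
  have p1': "ev (pr1 X n) x \<in> elts0 (jP A J n (idA X))" if "x \<in> elts1 (cA X)" for n x
    by (rule ev_closed[OF pr1_amor that])
  have c: "ev (jtrans0 A J X n) (ev (?tm (Suc n) \<Zsemi> jcmp (jP A J (Suc n) X)) u) = ev (?tm n \<Zsemi> jcmp (jP A J n X)) u"
    if u: "u \<in> elts (TA SM (jbot (cA X)))" for u n
  proof (rule tensA_hom_eqI[OF premod_SM Bp module_core[OF top_mod[OF A_arrow_jP]] mod_hom_comp[OF ev_hom[OF f] ev_hom[OF jtrans0_amor[OF X]]] ev_hom[OF f] _ u])
    fix i x assume "i \<in> elts (obj SM)" and x: "x \<in> elts1 (cA X)"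
    then have i: "i \<in> elts II" by simp
    have "ev (jtrans0 A J (idA X) n) (ev (pr1 X (Suc n)) x) = ev (pr1 X n) x"
      using prj_compat[OF A_arrow_idA, folded bot_completion, OF x] .
    then show "ev (jtrans0 A J X n) (ev (?tm (Suc n) \<Zsemi> jcmp (jP A J (Suc n) X)) (ptA SM (jbot (cA X)) i x)) = ev (?tm n \<Zsemi> jcmp (jP A J n X)) (ptA SM (jbot (cA X)) i x)"
      unfolding ef[OF i x] jpair_trans[OF i p1'[OF x]] by simp
  qed
  note W = module_TA[OF premod_SM Bp]
  show "is_amor (TA SM (jbot (cA X))) (obj (jtop (cA X))) (jcmp (cA X))"
    unfolding m by (rule prj_lift_amor[OF X W f c])
  assume ix: "i \<in> elts II" "x \<in> elts1 (cA X)"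
  have p: "ptA SM (jbot (cA X)) i x \<in> elts (TA SM (jbot (cA X)))" using bilinD(1)[OF ptA_bilin[OF premod_SM Bp]] ix by simp
  show "ev (pr0 X n) (jpair (cA X) i x) = jpair (jP A J n X) i (ev (pr1 X n) x)"
  proof -
    have "ev (pr0 X n) (ev (alim_lift (obj \<circ> (\<lambda>n. jtop (jP A J n X))) (jtrans0 A J X) (TA SM (jbot (cA X))) (\<lambda>n. ?tm n \<Zsemi> jcmp (jP A J n X))) (ptA SM (jbot (cA X)) i x))
        = ev (?tm n \<Zsemi> jcmp (jP A J n X)) (ptA SM (jbot (cA X)) i x)" by (rule ev_prj_lift[OF X W f c p])
    then show ?thesis by (simp only: jpair_def[of "cA X"] m ef[OF ix])
  qed
qed

lemma jpair_completion_closed: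
  "i \<in> elts II \<Longrightarrow> x \<in> elts1 (cA X) \<Longrightarrow> jpair (cA X) i x \<in> elts0 (cA X)"
  using bilinD(1)[OF pairingD(3)[OF pairing_amor[OF jcompletion_bot jcompletion_jcmp_amor]]] by (simp add: jpair_def)

lemma A_arrow_jcompletion: "A_arrow (cA X)"
proof (rule A_arrowI)
  note Tp = amodD(1)[OF amod_jcompletion_top[OF X]] and Bp = amodD(1)[OF jcompletion_bot]
  show "amod (jtop (cA X))" by (rule amod_jcompletion_top[OF X])
  show "amod (jbot (cA X))" by (rule jcompletion_bot)
  show "is_amor (obj (jtop (cA X))) (obj (jbot (cA X))) (jmap (cA X))" by (rule jcompletion_jmap_amor)
  show "is_amor (TA SM (jbot (cA X))) (obj (jtop (cA X))) (jcmp (cA X))" by (rule jcompletion_jcmp_amor)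
  note cls = actc_simps(1)[OF Tp] actc_simps(1)[OF Bp] ev_closed[OF jcompletion_jmap_amor] jpair_completion_closed
    ev_closed[OF pr0_amor] ev_closed[OF pr1_amor]
  have gn: "A_arrow (jP A J n X)" for n by (rule A_arrow_jP)
  note gD = A_arrowD(5)[OF gn] A_arrowD(6,7)[OF gn, unfolded jbot_jP]
  show "ev (jmap (cA X)) (actc (jtop (cA X)) a u) = actc (jbot (cA X)) a (ev (jmap (cA X)) u)"
    if a: "a \<in> elts RR" and u: "u \<in> elts0 (cA X)" for a u
    by (rule prj_eqI[OF A_arrow_idA, folded bot_completion])
       (use a u gD(1) in \<open>simp_all add: cls prj_jcompletion_jmap prj1_linear actc_jcompletion_top[OF X] jbot_jP\<close>)
  show "actc (jtop (cA X)) a (jpair (cA X) i x) = jpair (cA X) i (actc (jbot (cA X)) a x)"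
    if a: "a \<in> elts RR" and i: "i \<in> elts II" and x: "x \<in> elts1 (cA X)" for a i x
    by (rule prj_eqI[OF X]) (use a i x in \<open>simp_all add: cls prj_jpair prj1_linear actc_jcompletion_top[OF X] gD(2)\<close>)
  show "ev (jmap (cA X)) (jpair (cA X) i x) = actc (jbot (cA X)) (jc i) x"
    if i: "i \<in> elts II" and x: "x \<in> elts1 (cA X)" for i x
    by (rule prj_eqI[OF A_arrow_idA, folded bot_completion])
       (use i x in \<open>simp_all add: cls jc_closed prj_jcompletion_jmap prj_jpair prj1_linear gD(3)\<close>)
qed

end

lemma A_arrow_module_arrow:
  assumes M: "amod M" shows "A_arrow (module_arrow A J M)"
proof -
  let ?c = "jact A J M" and ?N = "aimage (jact A J M)"
  note Mp = amodD(1)[OF M] and Z = premodD(1)[OF amodD(1)[OF M]]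
  note c = is_amor_jact[OF M]
  note N = aimage_submodule[OF c]
  note i = is_amor_aincl[OF Z N] and inj = ev_aincl_inj[OF Z N]
  have im: "ev (aincl (obj M) ?N) ` elts (sub_mod (obj M) ?N) = ev ?c ` elts (TA SM M)"
    by (rule ev_aincl_aimage[OF c])
  have cs: "csub (obj M) ?N = ev ?c ` elts (TA SM M)" using im ev_aincl_image[OF Z N] by simp
  have st: "actc M a u \<in> csub (obj M) ?N" if a: "a \<in> elts RR" and u: "u \<in> csub (obj M) ?N" for a u
  proof -
    obtain w where w: "w \<in> elts (TA SM M)" "u = ev ?c w" using u cs by auto
    have h: "(\<lambda>w. actc M a (ev ?c w)) \<in> mod_hom V (core (TA SM M)) (core (obj M))"
      by (rule mod_hom_comp[OF ev_hom[OF c]]) (use actc_bilin[OF Mp] a in \<open>simp add: bilin_def\<close>)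
    show ?thesis unfolding w(2)
    proof (rule mod_hom_span[OF h module_core[OF module_TA[OF premod_SM Mp]] module_core[OF Z] ptA_gens[OF premod_SM Mp] csub_submodule[OF Z N] _ ptA_span[OF premod_SM Mp w(1)]])
      fix z assume "z \<in> {ptA SM M i x |i x. i \<in> elts (obj SM) \<and> x \<in> elts (obj M)}"
      then obtain i x where z: "z = ptA SM M i x" "i \<in> elts II" "x \<in> elts (obj M)" by auto
      have "actc M a (ev ?c z) = ev ?c (ptA SM M i (actc M a x))"
        using z a by (simp add: ev_jact[OF M] actc_simps(1)[OF Mp] act_comm[OF M] jc_closed)
      moreover have "ptA SM M i (actc M a x) \<in> elts (TA SM M)"
        using bilinD(1)[OF ptA_bilin[OF premod_SM Mp]] z(2) actc_simps(1)[OF Mp a z(3)] by simp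
      ultimately show "actc M a (ev ?c z) \<in> csub (obj M) ?N" unfolding cs by simp
    qed
  qed
  have sub1: "amod (sub_amodule A M ?N)" by (rule amod_sub_amodule[OF M N st])
  have sub2: "ev (aincl (obj M) ?N) (actc (sub_amodule A M ?N) a u) = actc M a (ev (aincl (obj M) ?N) u)"
    if "a \<in> elts RR" "u \<in> elts (sub_mod (obj M) ?N)" for a u
    by (rule actc_sub_amodule[OF M N st that])
  have sub3: "obj (sub_amodule A M ?N) = sub_mod (obj M) ?N" by (rule obj_sub_amodule[OF M N st])
  have s: "jtop (module_arrow A J M) = sub_amodule A M ?N" "jbot (module_arrow A J M) = M"
    "jmap (module_arrow A J M) = aincl (obj M) ?N" "jcmp (module_arrow A J M) = alift (aincl (obj M) ?N) ?c"
    by (simp_all add: module_arrow_def Let_def)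
  have im': "ev ?c u \<in> ev (aincl (obj M) ?N) ` elts (sub_mod (obj M) ?N)" if "u \<in> elts (TA SM M)" for u
    using that im by blast
  have l: "is_amor (TA SM M) (sub_mod (obj M) ?N) (alift (aincl (obj M) ?N) ?c)" by (rule is_amor_alift[OF i c inj im'])
  have el: "ev (aincl (obj M) ?N) (ev (alift (aincl (obj M) ?N) ?c) u) = ev ?c u" if "u \<in> elts (TA SM M)" for u
    by (rule ev_alift[OF i c inj im' that])
  have ptc: "ptA SM M i x \<in> elts (TA SM M)" if "i \<in> elts II" "x \<in> elts (obj M)" for i x
    using bilinD(1)[OF ptA_bilin[OF premod_SM Mp]] that by simp
  have jp: "ev (aincl (obj M) ?N) (jpair (module_arrow A J M) i x) = actc M (jc i) x"
    if "i \<in> elts II" "x \<in> elts (obj M)" for i x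
    unfolding jpair_def s el[OF ptc[OF that]] by (rule ev_jact[OF M that])
  have jpc: "jpair (module_arrow A J M) i x \<in> elts (sub_mod (obj M) ?N)"
    if "i \<in> elts II" "x \<in> elts (obj M)" for i x
    unfolding jpair_def s by (rule ev_closed[OF l ptc[OF that]])
  show ?thesis
  proof (rule A_arrowI)
    show "amod (jtop (module_arrow A J M))" "amod (jbot (module_arrow A J M))" using sub1 M by (simp_all add: s)
    show "is_amor (obj (jtop (module_arrow A J M))) (obj (jbot (module_arrow A J M))) (jmap (module_arrow A J M))"
      using i by (simp add: s sub3)
    show "is_amor (TA SM (jbot (module_arrow A J M))) (obj (jtop (module_arrow A J M))) (jcmp (module_arrow A J M))"
      using l by (simp add: s sub3)
    show "ev (jmap (module_arrow A J M)) (actc (jtop (module_arrow A J M)) a u) = actc (jbot (module_arrow A J M)) a (ev (jmap (module_arrow A J M)) u)"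
      if "a \<in> elts RR" "u \<in> elts0 (module_arrow A J M)" for a u
      using that sub2 by (simp add: s sub3)
    show "actc (jtop (module_arrow A J M)) a (jpair (module_arrow A J M) i x) = jpair (module_arrow A J M) i (actc (jbot (module_arrow A J M)) a x)"
      if a: "a \<in> elts RR" and i: "i \<in> elts II" and x: "x \<in> elts1 (module_arrow A J M)" for a i x
    proof (rule inj_onD[OF inj])
      have x': "x \<in> elts (obj M)" using x by (simp add: s)
      note ax = actc_simps(1)[OF Mp a x']
      show "ev (aincl (obj M) ?N) (actc (jtop (module_arrow A J M)) a (jpair (module_arrow A J M) i x)) =
          ev (aincl (obj M) ?N) (jpair (module_arrow A J M) i (actc (jbot (module_arrow A J M)) a x))"
        using sub2[OF a jpc[OF i x']] jp[OF i x'] jp[OF i ax] act_comm[OF M a jc_closed[OF i] x'] by (simp add: s)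
      show "actc (jtop (module_arrow A J M)) a (jpair (module_arrow A J M) i x) \<in> elts (sub_mod (obj M) ?N)"
        using actc_simps(1)[OF amodD(1)[OF sub1] a] jpc[OF i x'] by (simp add: s sub3)
      show "jpair (module_arrow A J M) i (actc (jbot (module_arrow A J M)) a x) \<in> elts (sub_mod (obj M) ?N)"
        using jpc[OF i ax] by (simp add: s)
    qed
    show "ev (jmap (module_arrow A J M)) (jpair (module_arrow A J M) i x) = actc (jbot (module_arrow A J M)) (jc i) x"
      if "i \<in> elts II" "x \<in> elts1 (module_arrow A J M)" for i x
      using that jp by (simp add: s)
  qed
qed

subsection \<open>Morphisms of arrows\<close>

definition A_arrow_mor :: "('v, 'a, 'i, 'x, 'y) jarrow \<Rightarrow> ('v, 'a, 'i, 'x1, 'y1) jarrow \<Rightarrow> ('v, 'x, 'y, 'x1, 'y1) asq \<Rightarrow> bool" where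
  "A_arrow_mor X Y s \<longleftrightarrow> sq_src s = jmap X \<and> sq_tgt s = jmap Y \<and>
     is_amor (obj (jtop X)) (obj (jtop Y)) (sq0 s) \<and> is_amor (obj (jbot X)) (obj (jbot Y)) (sq1 s) \<and>
     (\<forall>u\<in>elts0 X. ev (jmap Y) (ev (sq0 s) u) = ev (sq1 s) (ev (jmap X) u)) \<and>
     (\<forall>a\<in>elts RR. \<forall>u\<in>elts0 X. ev (sq0 s) (actc (jtop X) a u) = actc (jtop Y) a (ev (sq0 s) u)) \<and>
     (\<forall>a\<in>elts RR. \<forall>x\<in>elts1 X. ev (sq1 s) (actc (jbot X) a x) = actc (jbot Y) a (ev (sq1 s) x)) \<and>
     (\<forall>i\<in>elts II. \<forall>x\<in>elts1 X. ev (sq0 s) (jpair X i x) = jpair Y i (ev (sq1 s) x))"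

lemma A_arrow_morD:
  assumes "A_arrow_mor X Y s"
  shows "sq_src s = jmap X" "sq_tgt s = jmap Y"
    "is_amor (obj (jtop X)) (obj (jtop Y)) (sq0 s)" "is_amor (obj (jbot X)) (obj (jbot Y)) (sq1 s)"
    "u \<in> elts0 X \<Longrightarrow> ev (jmap Y) (ev (sq0 s) u) = ev (sq1 s) (ev (jmap X) u)"
    "a \<in> elts RR \<Longrightarrow> u \<in> elts0 X \<Longrightarrow> ev (sq0 s) (actc (jtop X) a u) = actc (jtop Y) a (ev (sq0 s) u)"
    "a \<in> elts RR \<Longrightarrow> x \<in> elts1 X \<Longrightarrow> ev (sq1 s) (actc (jbot X) a x) = actc (jbot Y) a (ev (sq1 s) x)"
    "i \<in> elts II \<Longrightarrow> x \<in> elts1 X \<Longrightarrow> ev (sq0 s) (jpair X i x) = jpair Y i (ev (sq1 s) x)"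
  using assms unfolding A_arrow_mor_def by blast+

lemma A_arrow_mor_is_asq_A:
  assumes X: "A_arrow X" and Y: "A_arrow Y" and s: "A_arrow_mor X Y s" shows "is_asq_A A X Y s"
proof -
  note sD = A_arrow_morD[OF s]
  note mX = A_arrowD(3)[OF X] and mY = A_arrowD(3)[OF Y]
  have "sq0 s \<Zsemi> jmap Y = jmap X \<Zsemi> sq1 s"
    by (rule amor_eqI[OF is_amor_acomp[OF sD(3) mY] is_amor_acomp[OF mX sD(4)]])
       (simp add: ev_acomp[OF sD(3) mY] ev_acomp[OF mX sD(4)] sD(5))
  moreover have "alinear A (jtop X) (jtop Y) (sq0 s)"
    using sD(3,6) by (simp add: alinear_iff[OF amodD(1)[OF A_arrowD(1)[OF X]] amodD(1)[OF A_arrowD(1)[OF Y]]])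
  moreover have "alinear A (jbot X) (jbot Y) (sq1 s)"
    using sD(4,7) by (simp add: alinear_iff[OF amodD(1)[OF A_arrowD(2)[OF X]] amodD(1)[OF A_arrowD(2)[OF Y]]])
  ultimately show ?thesis
    using sD by (simp add: is_asq_A_def is_asq_def amorD(3,4)[OF mX] amorD(3,4)[OF mY])
qed

lemma A_arrow_mor_iso:
  assumes X: "A_arrow X" and Y: "A_arrow Y" and s: "A_arrow_mor X Y s"
    and b0: "bij_betw (ev (sq0 s)) (elts0 X) (elts0 Y)"
    and b1: "bij_betw (ev (sq1 s)) (elts1 X) (elts1 Y)"
  shows "is_iso_A A X Y s"
proof -
  note sD = A_arrow_morD[OF s]
  note mX = A_arrowD(3)[OF X] and mY = A_arrowD(3)[OF Y]
  obtain g0 where g0: "is_amor (obj (jtop Y)) (obj (jtop X)) g0" "sq0 s \<Zsemi> g0 = aid (obj (jtop X))" "g0 \<Zsemi> sq0 s = aid (obj (jtop Y))"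
    using amor_inverse[OF sD(3) b0] .
  obtain g1 where g1: "is_amor (obj (jbot Y)) (obj (jbot X)) g1" "sq1 s \<Zsemi> g1 = aid (obj (jbot X))" "g1 \<Zsemi> sq1 s = aid (obj (jbot Y))"
    using amor_inverse[OF sD(4) b1] .
  note tX = top_mod[OF X] and bX = bot_mod[OF X] and tY = top_mod[OF Y] and bY = bot_mod[OF Y]
  have e0: "ev g0 (ev (sq0 s) u) = u" if "u \<in> elts0 X" for u
    using ev_acomp[OF sD(3) g0(1) that] ev_aid[OF tX that] g0(2) by simp
  have e1: "ev g1 (ev (sq1 s) u) = u" if "u \<in> elts1 X" for u
    using ev_acomp[OF sD(4) g1(1) that] ev_aid[OF bX that] g1(2) by simp
  have s0: "\<exists>u\<in>elts0 X. y = ev (sq0 s) u" if "y \<in> elts0 Y" for y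
    using b0 that unfolding bij_betw_def by (metis imageE)
  have s1: "\<exists>u\<in>elts1 X. y = ev (sq1 s) u" if "y \<in> elts1 Y" for y
    using b1 that unfolding bij_betw_def by (metis imageE)
  let ?g = "\<lparr>sq_src = jmap Y, sq_tgt = jmap X, sq0 = g0, sq1 = g1\<rparr>"
  note aX = amodD(1)[OF A_arrowD(1)[OF X]] amodD(1)[OF A_arrowD(2)[OF X]] and aY = amodD(1)[OF A_arrowD(1)[OF Y]] amodD(1)[OF A_arrowD(2)[OF Y]]
  have "g0 \<Zsemi> jmap X = jmap Y \<Zsemi> g1"
  proof (rule amor_eqI[OF is_amor_acomp[OF g0(1) mX] is_amor_acomp[OF mY g1(1)]])
    fix y assume "y \<in> elts0 Y"
    then obtain u where u: "u \<in> elts0 X" "y = ev (sq0 s) u" using s0 by blast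
    then show "ev (g0 \<Zsemi> jmap X) y = ev (jmap Y \<Zsemi> g1) y"
      by (simp add: ev_acomp[OF g0(1) mX] ev_acomp[OF mY g1(1)] ev_closed[OF sD(3)] e0 sD(5) e1 ev_closed[OF mX])
  qed
  moreover have "alinear A (jtop Y) (jtop X) g0"
    unfolding alinear_iff[OF aY(1) aX(1)]
  proof (intro conjI ballI g0(1))
    fix a y assume a: "a \<in> elts RR" and "y \<in> elts0 Y"
    then obtain u where u: "u \<in> elts0 X" "y = ev (sq0 s) u" using s0 by blast
    show "ev g0 (actc (jtop Y) a y) = actc (jtop X) a (ev g0 y)"
      using a u by (simp add: sD(6)[symmetric] e0 actc_simps(1)[OF aX(1)])
  qed
  moreover have "alinear A (jbot Y) (jbot X) g1"
    unfolding alinear_iff[OF aY(2) aX(2)]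
  proof (intro conjI ballI g1(1))
    fix a y assume a: "a \<in> elts RR" and "y \<in> elts1 Y"
    then obtain u where u: "u \<in> elts1 X" "y = ev (sq1 s) u" using s1 by blast
    show "ev g1 (actc (jbot Y) a y) = actc (jbot X) a (ev g1 y)"
      using a u by (simp add: sD(7)[symmetric] e1 actc_simps(1)[OF aX(2)])
  qed
  ultimately have "is_asq_A A Y X ?g"
    using g0(1) g1(1) by (simp add: is_asq_A_def is_asq_def amorD(3,4)[OF mX] amorD(3,4)[OF mY])
  moreover have "s \<Zsemi>\<^sub>s ?g = sq_id (jmap X)" "?g \<Zsemi>\<^sub>s s = sq_id (jmap Y)"
    using g0 g1 sD(1,2) by (simp_all add: sq_comp_def sq_id_def amorD(3,4)[OF mX] amorD(3,4)[OF mY])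
  ultimately show ?thesis using A_arrow_mor_is_asq_A[OF X Y s] unfolding is_iso_A_def by blast
qed

lemma A_arrow_mor_idarrow:
  assumes X: "A_arrow X" and Y: "A_arrow Y" and s: "A_arrow_mor X Y s"
  shows "A_arrow_mor (idarrow (jbot X)) (idarrow (jbot Y)) \<lparr>sq_src = aid (obj (jbot X)), sq_tgt = aid (obj (jbot Y)), sq0 = sq1 s, sq1 = sq1 s\<rparr>"
  using A_arrow_morD[OF s] ev_closed[OF A_arrow_morD(4)[OF s]]
  by (simp add: A_arrow_mor_def ev_aid[OF bot_mod[OF X]] ev_aid[OF bot_mod[OF Y]] jpair_idarrow[OF A_arrowD(2)[OF X]] jpair_idarrow[OF A_arrowD(2)[OF Y]] jc_closed)

lemma A_arrow_mor_Gpow: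
  assumes X: "A_arrow X" and Y: "A_arrow Y" and s: "A_arrow_mor X Y s" and u: "u \<in> Gpow X n"
  shows "ev (sq0 s) u \<in> Gpow Y n"
proof (rule mod_hom_span[OF ev_hom[OF A_arrow_morD(3)[OF s]] module_core[OF top_mod[OF X]] module_core[OF top_mod[OF Y]] gpow_gens[OF jpair_pairing[OF X]]
      Gpow_submodule[OF Y] _ u[unfolded gpow_def]])
  fix w assume "w \<in> {jpair X p x |p x. p \<in> ppow (Suc n) \<and> x \<in> elts1 X}"
  then obtain p x where w: "w = jpair X p x" "p \<in> ppow (Suc n)" "x \<in> elts1 X" by blast
  show "ev (sq0 s) w \<in> Gpow Y n"
    unfolding w(1) A_arrow_morD(8)[OF s ppow_carrier[OF w(2)] w(3)] gpow_def
    using w(2) ev_closed[OF A_arrow_morD(4)[OF s] w(3)] by (intro span_mod_base) auto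
qed

text \<open>If \<open>X\<^sub>1 \<rightarrow> Y\<^sub>1\<close> is onto, then \<open>I\<^sup>n\<^sup>+\<^sup>1 Y\<^sub>1\<close> in \<open>Y\<^sub>0\<close> is the image of \<open>I\<^sup>n\<^sup>+\<^sup>1 X\<^sub>1\<close> in \<open>X\<^sub>0\<close>.\<close>

lemma A_arrow_mor_Gpow_reflect:
  assumes X: "A_arrow X" and Y: "A_arrow Y" and s: "A_arrow_mor X Y s"
    and inj: "inj_on (ev (sq0 s)) (elts0 X)"
    and sur: "ev (sq1 s) ` elts1 X = elts1 Y"
    and u: "u \<in> elts0 X" "ev (sq0 s) u \<in> Gpow Y n"
  shows "u \<in> Gpow X n"
proof -
  have sub: "submodule (ev (sq0 s) ` Gpow X n) V (core0 Y)"
    by (rule submodule_image[OF ev_hom[OF A_arrow_morD(3)[OF s]] module_core[OF top_mod[OF X]] module_core[OF top_mod[OF Y]] Gpow_submodule[OF X]])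
  have "{jpair Y p x |p x. p \<in> ppow (Suc n) \<and> x \<in> elts1 Y} \<subseteq> ev (sq0 s) ` Gpow X n"
  proof
    fix w assume "w \<in> {jpair Y p x |p x. p \<in> ppow (Suc n) \<and> x \<in> elts1 Y}"
    then obtain p y where w: "w = jpair Y p y" "p \<in> ppow (Suc n)" "y \<in> elts1 Y" by blast
    then obtain x where x: "x \<in> elts1 X" "y = ev (sq1 s) x" using sur by blast
    have "jpair X p x \<in> Gpow X n" unfolding gpow_def using w(2) x(1) by (intro span_mod_base) auto
    then show "w \<in> ev (sq0 s) ` Gpow X n"
      unfolding w(1) x(2) A_arrow_morD(8)[OF s ppow_carrier[OF w(2)] x(1), symmetric] by (rule imageI)
  qed
  then have "ev (sq0 s) u \<in> ev (sq0 s) ` Gpow X n" using span_mod_least[OF sub] u(2) unfolding gpow_def by blast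
  then obtain w where w: "w \<in> Gpow X n" "ev (sq0 s) u = ev (sq0 s) w" by blast
  then show ?thesis using inj_onD[OF inj w(2) u(1) Gpow_carrier[OF X w(1)]] by simp
qed

lemma jP_map_top:
  fixes n :: nat
  assumes X: "A_arrow X" and Y: "A_arrow Y" and s: "A_arrow_mor X Y s"
  defines "f \<equiv> adescend (jproj0 A J n X) (sq0 s \<Zsemi> jproj0 A J n Y)"
  shows jP_map_top_amor: "is_amor (obj (jtop (jP A J n X))) (obj (jtop (jP A J n Y))) f"
    and ev_jP_map_top: "u \<in> elts0 X \<Longrightarrow> ev f (ev (jproj0 A J n X) u) = ev (jproj0 A J n Y) (ev (sq0 s) u)"
    and jP_map_top_bij: "bij_betw (ev (sq0 s)) (elts0 X) (elts0 Y) \<Longrightarrow>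
      ev (sq1 s) ` elts1 X = elts1 Y \<Longrightarrow>
      bij_betw (ev f) (elts0 (jP A J n X)) (elts0 (jP A J n Y))"
proof -
  note q0 = jproj0_amor'[OF X, of n] and q1 = jproj0_amor'[OF Y, of n]
  note s0 = A_arrow_morD(3)[OF s]
  note c = is_amor_acomp[OF s0 q1]
  have ker: "ev (sq0 s \<Zsemi> jproj0 A J n Y) u = \<zero>\<^bsub>core0 (jP A J n Y)\<^esub>"
    if u: "u \<in> elts0 X" and z: "ev (jproj0 A J n X) u = \<zero>\<^bsub>core0 (jP A J n X)\<^esub>" for u
  proof -
    have "e \<odot>\<^bsub>core0 Y\<^esub> ev (sq0 s) u \<in> Gpow Y n" if e: "e \<in> \<mm>" for e
      using z[unfolded jproj0_zero_iff'[OF X u]] e A_arrow_mor_Gpow[OF X Y s] mod_hom_smult[OF ev_hom[OF s0] mm_carrier[OF e] u] by metis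
    then show ?thesis
      using jproj0_zero_iff'[OF Y, of "ev (sq0 s) u" n] ev_closed[OF s0 u] by (simp add: ev_acomp[OF s0 q1 u])
  qed
  show am: "is_amor (obj (jtop (jP A J n X))) (obj (jtop (jP A J n Y))) f"
    unfolding f_def by (rule is_amor_adescend[OF q0 c jproj0_surj'[OF X] ker])
  show e: "ev f (ev (jproj0 A J n X) u) = ev (jproj0 A J n Y) (ev (sq0 s) u)" if "u \<in> elts0 X" for u
    unfolding f_def using ev_adescend[OF q0 c jproj0_surj'[OF X] ker that] ev_acomp[OF s0 q1 that] by simp
  assume b0: "bij_betw (ev (sq0 s)) (elts0 X) (elts0 Y)"
    and b1: "ev (sq1 s) ` elts1 X = elts1 Y"
  note PX = module_core[OF top_mod[OF A_arrow_jP[OF X, of n]]] and PY = module_core[OF top_mod[OF A_arrow_jP[OF Y, of n]]]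
  show "bij_betw (ev f) (elts0 (jP A J n X)) (elts0 (jP A J n Y))"
    unfolding bij_betw_def
  proof
    show "inj_on (ev f) (elts0 (jP A J n X))"
    proof (rule hom_inj_on[OF PX PY ev_hom[OF am]])
      fix w assume w: "w \<in> elts0 (jP A J n X)" and z: "ev f w = \<zero>\<^bsub>core0 (jP A J n Y)\<^esub>"
      obtain u where u: "u \<in> elts0 X" "w = ev (jproj0 A J n X) u" using jproj0_ex[OF X w] by blast
      have "\<forall>e\<in>\<mm>. e \<odot>\<^bsub>core0 Y\<^esub> ev (sq0 s) u \<in> Gpow Y n"
        using z u e[OF u(1)] jproj0_zero_iff'[OF Y ev_closed[OF s0 u(1)], of n] by simp
      then have "\<forall>e\<in>\<mm>. e \<odot>\<^bsub>core0 X\<^esub> u \<in> Gpow X n"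
        using A_arrow_mor_Gpow_reflect[OF X Y s _ b1] b0 mod_hom_smult[OF ev_hom[OF s0] mm_carrier u(1)]
          module.smult_closed[OF module_core[OF top_mod[OF X]] mm_carrier u(1)] unfolding bij_betw_def by metis
      then show "w = \<zero>\<^bsub>core0 (jP A J n X)\<^esub>" using jproj0_zero_iff'[OF X u(1)] u(2) by simp
    qed
    show "ev f ` elts0 (jP A J n X) = elts0 (jP A J n Y)"
    proof (rule subset_antisym; rule subsetI)
      fix y assume "y \<in> elts0 (jP A J n Y)"
      then obtain v where v: "v \<in> elts0 Y" "y = ev (jproj0 A J n Y) v" using jproj0_ex[OF Y] by blast
      then obtain u where u: "u \<in> elts0 X" "v = ev (sq0 s) u" using b0 unfolding bij_betw_def by blast
      then show "y \<in> ev f ` elts0 (jP A J n X)" using e[OF u(1)] v jproj0_closed[OF X u(1)] by (metis imageI)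
    qed (use ev_closed[OF am] in auto)
  qed
qed

lemma jP_map_iso:
  assumes X: "A_arrow X" and Y: "A_arrow Y" and s: "A_arrow_mor X Y s"
    and b0: "bij_betw (ev (sq0 s)) (elts0 X) (elts0 Y)"
    and b1: "bij_betw (ev (sq1 s)) (elts1 X) (elts1 Y)"
  shows "is_iso_A A (jP A J n X) (jP A J n Y) (jP_map A J n X Y s)"
proof -
  let ?iX = "idarrow (jbot X)" and ?iY = "idarrow (jbot Y)"
  let ?t = "\<lparr>sq_src = aid (obj (jbot X)), sq_tgt = aid (obj (jbot Y)), sq0 = sq1 s, sq1 = sq1 s\<rparr>"
  note iX = A_arrow_idarrow[OF A_arrowD(2)[OF X]] and iY = A_arrow_idarrow[OF A_arrowD(2)[OF Y]]
  note t = A_arrow_mor_idarrow[OF X Y s]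
  let ?f0 = "sq0 (jP_map A J n X Y s)" and ?f1 = "sq1 (jP_map A J n X Y s)"
  have f0: "?f0 = adescend (jproj0 A J n X) (sq0 s \<Zsemi> jproj0 A J n Y)"
    and f1: "?f1 = adescend (jproj0 A J n ?iX) (sq0 ?t \<Zsemi> jproj0 A J n ?iY)" by (simp_all add: jP_map_def jproj1_idarrow)
  note a0 = jP_map_top_amor[OF X Y s, of n, folded f0] and e0 = ev_jP_map_top[OF X Y s, of _ n, folded f0]
  note a1 = jP_map_top_amor[OF iX iY t, of n, folded f1] and e1 = ev_jP_map_top[OF iX iY t, of _ n, folded f1]
  have s1: "ev (sq1 s) ` elts1 X = elts1 Y" using b1 by (simp add: bij_betw_def)
  have B0: "bij_betw (ev ?f0) (elts0 (jP A J n X)) (elts0 (jP A J n Y))"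
    using jP_map_top_bij[OF X Y s b0 s1, of n, folded f0] .
  have B1: "bij_betw (ev ?f1) (elts0 (jP A J n ?iX)) (elts0 (jP A J n ?iY))"
    using jP_map_top_bij[OF iX iY t, of n, folded f1] b1 s1 by simp
  note clX = actc_simps(1)[OF amodD(1)[OF A_arrowD(1)[OF X]]] actc_simps(1)[OF amodD(1)[OF A_arrowD(2)[OF X]]] ev_closed[OF A_arrowD(3)[OF X]] bilinD(1)[OF jpair_bilin[OF X]]
  have g: "A_arrow_mor (jP A J n X) (jP A J n Y) (jP_map A J n X Y s)"
    unfolding A_arrow_mor_def
  proof (intro conjI ballI)
    show "sq_src (jP_map A J n X Y s) = jmap (jP A J n X)" "sq_tgt (jP_map A J n X Y s) = jmap (jP A J n Y)" by (simp_all add: jP_map_def)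
    show "is_amor (obj (jtop (jP A J n X))) (obj (jtop (jP A J n Y))) ?f0" by (rule a0)
    show "is_amor (obj (jbot (jP A J n X))) (obj (jbot (jP A J n Y))) ?f1" unfolding jbot_jP by (rule a1)
  next
    fix w assume "w \<in> elts0 (jP A J n X)"
    then obtain u where u: "u \<in> elts0 X" "w = ev (jproj0 A J n X) u" using jproj0_ex[OF X] by blast
    then show "ev (jmap (jP A J n Y)) (ev ?f0 w) = ev ?f1 (ev (jmap (jP A J n X)) w)"
      using e1[of "ev (jmap X) u"] by (simp add: e0 ev_jP_jmap[OF X] ev_jP_jmap[OF Y] ev_closed[OF A_arrow_morD(3)[OF s]] clX A_arrow_morD(5)[OF s])
  next
    fix a w assume a: "a \<in> elts RR" and "w \<in> elts0 (jP A J n X)"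
    then obtain u where u: "u \<in> elts0 X" "w = ev (jproj0 A J n X) u" using jproj0_ex[OF X] by blast
    then show "ev ?f0 (actc (jtop (jP A J n X)) a w) = actc (jtop (jP A J n Y)) a (ev ?f0 w)"
      using a by (simp add: e0 actc_jP_top[OF X] actc_jP_top[OF Y] clX ev_closed[OF A_arrow_morD(3)[OF s]] A_arrow_morD(6)[OF s])
  next
    fix a w assume a: "a \<in> elts RR" and "w \<in> elts1 (jP A J n X)"
    then obtain x where x: "x \<in> elts1 X" "w = ev (jproj0 A J n ?iX) x" using bot_proj_ex[OF X] by (metis jbot_jP)
    then show "ev ?f1 (actc (jbot (jP A J n X)) a w) = actc (jbot (jP A J n Y)) a (ev ?f1 w)"
      using a e1[of x] e1[of "actc (jbot X) a x"]
      by (simp add: jbot_jP bot_proj_linear[OF X, symmetric] bot_proj_linear[OF Y, symmetric] clX ev_closed[OF A_arrow_morD(4)[OF s]] A_arrow_morD(7)[OF s])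
  next
    fix i w assume i: "i \<in> elts II" and "w \<in> elts1 (jP A J n X)"
    then obtain x where x: "x \<in> elts1 X" "w = ev (jproj0 A J n ?iX) x" using bot_proj_ex[OF X] by (metis jbot_jP)
    then show "ev ?f0 (jpair (jP A J n X) i w) = jpair (jP A J n Y) i (ev ?f1 w)"
      using i e1[of x] by (simp add: jpair_jP[OF X] jpair_jP[OF Y] e0 clX ev_closed[OF A_arrow_morD(4)[OF s]] A_arrow_morD(8)[OF s])
  qed
  show ?thesis by (rule A_arrow_mor_iso[OF A_arrow_jP[OF X] A_arrow_jP[OF Y] g B0]) (use B1 in \<open>simp add: jbot_jP\<close>)
qed

lemma jcanonical:
  assumes X: "A_arrow X"
  shows jcanonical_gmor: "A_arrow_mor X (cA X) (jcanonical A J X)"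
    and prj_jcanonical: "u \<in> elts0 X \<Longrightarrow>
      ev (pr0 X n) (ev (sq0 (jcanonical A J X)) u) = ev (jproj0 A J n X) u"
    and sq1_jcanonical: "sq1 (jcanonical A J X) = sq0 (jcanonical A J (idarrow (jbot X)))"
proof -
  have s0: "sq0 (jcanonical A J X) = alim_lift (obj \<circ> (\<lambda>n. jtop (jP A J n X))) (jtrans0 A J X) (obj (jtop X)) (\<lambda>n. jproj0 A J n X)"
    if "A_arrow X" for X :: "('v, 'a, 'i, 'z, 'w) jarrow" by (simp add: jcanonical_def comp_def)
  have am: "is_amor (obj (jtop X)) (obj (jtop (cA X))) (sq0 (jcanonical A J X))"
    and ev: "\<And>n u. u \<in> elts0 X \<Longrightarrow>
      ev (pr0 X n) (ev (sq0 (jcanonical A J X)) u) = ev (jproj0 A J n X) u"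
    if X: "A_arrow X" for X :: "('v, 'a, 'i, 'z, 'w) jarrow"
    unfolding s0[OF X]
    by (rule prj_lift_amor[OF X top_mod[OF X] jproj0_amor'[OF X] ev_jtrans0[OF X]] ev_prj_lift[OF X top_mod[OF X] jproj0_amor'[OF X] ev_jtrans0[OF X]]; assumption)+
  have tr: "jtrans1 A J X = jtrans0 A J (idarrow (jbot X))" by (rule ext) (rule jtrans1_idarrow)
  show s1: "sq1 (jcanonical A J X) = sq0 (jcanonical A J (idarrow (jbot X)))"
    by (simp add: jcanonical_def tr jbot_jP jproj1_idarrow)
  note iX = A_arrow_idarrow[OF A_arrowD(2)[OF X]]
  note a0 = am[OF X] and e0 = ev[OF X]
  have a1: "is_amor (obj (jbot X)) (obj (jbot (cA X))) (sq1 (jcanonical A J X))"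
    unfolding s1 jbot_jcompletion using am[OF iX] by simp
  have e1: "ev (pr0 (idarrow (jbot X)) n) (ev (sq1 (jcanonical A J X)) x)
      = ev (jproj0 A J n (idarrow (jbot X))) x" if "x \<in> elts1 X" for x n
    unfolding s1 using ev[OF iX, of x n] that by simp
  show "u \<in> elts0 X \<Longrightarrow>
      ev (pr0 X n) (ev (sq0 (jcanonical A J X)) u) = ev (jproj0 A J n X) u"
    by (rule e0)
  note clX = actc_simps(1)[OF amodD(1)[OF A_arrowD(1)[OF X]]] actc_simps(1)[OF amodD(1)[OF A_arrowD(2)[OF X]]] ev_closed[OF A_arrowD(3)[OF X]] bilinD(1)[OF jpair_bilin[OF X]]
  note gc = A_arrow_jcompletion[OF X]
  note clY = actc_simps(1)[OF amodD(1)[OF A_arrowD(1)[OF gc]]] actc_simps(1)[OF amodD(1)[OF A_arrowD(2)[OF gc]]] ev_closed[OF A_arrowD(3)[OF gc]] bilinD(1)[OF jpair_bilin[OF gc]]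
  note c0 = ev_closed[OF a0] and c1 = ev_closed[OF a1]
  show "A_arrow_mor X (cA X) (jcanonical A J X)"
    unfolding A_arrow_mor_def
  proof (intro conjI ballI a0 a1)
    show "sq_src (jcanonical A J X) = jmap X" "sq_tgt (jcanonical A J X) = jmap (cA X)" by (simp_all add: jcanonical_def)
  next
    fix u assume u: "u \<in> elts0 X"
    show "ev (jmap (cA X)) (ev (sq0 (jcanonical A J X)) u) = ev (sq1 (jcanonical A J X)) (ev (jmap X) u)"
      by (rule prj_eqI[OF iX, folded jbot_jcompletion])
         (use u in \<open>simp_all add: c0 c1 clX clY prj_jcompletion_jmap[OF X] e0 e1 ev_jP_jmap[OF X]\<close>)
  next
    fix a u assume a: "a \<in> elts RR" and u: "u \<in> elts0 X"
    show "ev (sq0 (jcanonical A J X)) (actc (jtop X) a u) = actc (jtop (cA X)) a (ev (sq0 (jcanonical A J X)) u)"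
      by (rule prj_eqI[OF X]) (use a u in \<open>simp_all add: c0 clX clY e0 actc_jcompletion_top[OF X] actc_jP_top[OF X]\<close>)
  next
    fix a x assume a: "a \<in> elts RR" and x: "x \<in> elts1 X"
    show "ev (sq1 (jcanonical A J X)) (actc (jbot X) a x) = actc (jbot (cA X)) a (ev (sq1 (jcanonical A J X)) x)"
      by (rule prj_eqI[OF iX, folded jbot_jcompletion])
         (use a x in \<open>simp_all add: c1 clX clY e1 prj1_linear[OF X] bot_proj_linear[OF X]\<close>)
  next
    fix i x assume i: "i \<in> elts II" and x: "x \<in> elts1 X"
    show "ev (sq0 (jcanonical A J X)) (jpair X i x) = jpair (cA X) i (ev (sq1 (jcanonical A J X)) x)"
      by (rule prj_eqI[OF X]) (use i x in \<open>simp_all add: c0 c1 clX clY e0 e1 prj_jpair[OF X] jpair_jP[OF X]\<close>)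
  qed
qed

section \<open>Completions are complete\<close>

lemma gpow_cong:
  assumes "\<And>i x. i \<in> elts II \<Longrightarrow> x \<in> elts (obj M) \<Longrightarrow> \<beta> i x = \<gamma> i x"
  shows "gpow Z \<beta> M n = gpow Z \<gamma> M n"
proof -
  have "{\<beta> p x |p x. p \<in> ppow n \<and> x \<in> elts (obj M)} = {\<gamma> p x |p x. p \<in> ppow n \<and> x \<in> elts (obj M)}"
    using assms ppow_carrier by (intro Collect_cong) metis
  then show ?thesis by (simp add: gpow_def)
qed

lemma Gpow_idarrow: assumes M: "amod M" shows "Gpow (idarrow M) n = Fpow M (Suc n)"
  unfolding Fpow_gpow[OF M] idarrow_simps by (rule gpow_cong) (rule jpair_idarrow[OF M])

lemma Gpow_Fpow: "A_arrow X \<Longrightarrow> Gpow X n = span_mod V (core0 X) {jpair X i y |i y. i \<in> elts II \<and> y \<in> Fpow (jbot X) n}"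
  by (rule gpow_Fpow[OF jpair_pairing])

lemma Fpow_stable:
  assumes M: "amod M" and a: "a \<in> elts RR" and y: "y \<in> Fpow M n" shows "actc M a y \<in> Fpow M n"
proof (cases n)
  case 0
  then show ?thesis using y actc_simps(1)[OF amodD(1)[OF M] a] by simp
next
  case (Suc k)
  then show ?thesis using y Gpow_stable[OF A_arrow_idarrow[OF M] a, of y k] unfolding Suc Gpow_idarrow[OF M, symmetric] by simp
qed

text \<open>The completion of an identity is an identity. Hence the bottom of a completion is itself the top of the
  completion of an identity, and results on tops apply to it.\<close>

lemma jcompletion_idarrow:
  assumes M: "amod M"
  shows "cA (idarrow M) = idarrow (jtop (cA (idarrow M)))"
proof -
  note X = A_arrow_idarrow[OF M]
  let ?C = "cA (idarrow M)"
  note C = A_arrow_jcompletion[OF X]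
  have bot: "jbot ?C = jtop ?C" using jbot_jcompletion[of "idarrow M"] by simp
  note L = top_mod[OF C]
  have jm: "ev (jmap ?C) u = u" if u: "u \<in> elts0 ?C" for u
  proof (rule prj_eqI[OF X])
    show "ev (jmap ?C) u \<in> elts0 ?C" using ev_closed[OF A_arrowD(3)[OF C] u] by (simp add: bot)
    fix n
    obtain w where w: "w \<in> elts (obj M)" "ev (pr0 (idarrow M) n) u = ev (jproj0 A J n (idarrow M)) w"
      using jproj0_ex[OF X ev_closed[OF prj_amor[OF X] u]] by auto
    show "ev (pr0 (idarrow M) n) (ev (jmap ?C) u) =
        ev (pr0 (idarrow M) n) u"
      using prj_jcompletion_jmap[OF X u, of n] ev_jP_jmap[OF X, of w n] w ev_aid[OF premodD(1)[OF amodD(1)[OF M]] w(1)] by simp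
  qed (rule u)
  have 1: "jmap ?C = aid (obj (jtop ?C))"
    by (rule amor_eqI[OF _ is_amor_aid[OF L]]) (use A_arrowD(3)[OF C] jm in \<open>simp_all add: bot ev_aid[OF L]\<close>)
  note Cc = A_arrowD(4)[OF C, unfolded bot]
  have 2: "jcmp ?C = jact A J (jtop ?C)"
  proof (rule amor_eqI[OF Cc is_amor_jact[OF A_arrowD(1)[OF C]]])
    fix u assume u: "u \<in> elts (TA SM (jtop ?C))"
    show "ev (jcmp ?C) u = ev (jact A J (jtop ?C)) u"
    proof (rule tensA_hom_eqI[OF premod_SM amodD(1)[OF A_arrowD(1)[OF C]] module_core[OF L] ev_hom[OF Cc] ev_hom[OF is_amor_jact[OF A_arrowD(1)[OF C]]] _ u])
      fix i x assume i: "i \<in> elts (obj SM)" and x: "x \<in> elts0 ?C"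
      have "jpair ?C i x \<in> elts0 ?C" using bilinD(1)[OF jpair_bilin[OF C]] i x by (simp add: bot)
      then have "jpair ?C i x = actc (jtop ?C) (jc i) x" using A_arrowD(7)[OF C, of i x] jm i x by (simp add: bot)
      then show "ev (jcmp ?C) (ptA SM (jtop ?C) i x) = ev (jact A J (jtop ?C)) (ptA SM (jtop ?C) i x)"
        using i x by (simp add: jpair_def bot ev_jact[OF A_arrowD(1)[OF C]])
    qed
  qed
  show ?thesis using 1 2 bot by (simp add: idarrow_def)
qed

subsection \<open>Finitely many generators up to a scalar\<close>

lemma self_premod: "premod (self_amodule A)"
  using RR alg_amors(1) by (simp add: premod_def self_amodule_def)

lemma actc_self: "actc (self_amodule A) a b = mulc a b"
  by (simp add: actc_def self_amodule_def mulc_def)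

text \<open>A linear map \<open>\<phi> : A \<rightarrow> I\<close> is given by an element of \<open>I\<close> up to a scalar: for \<open>e\<close> in \<open>\<mm>\<close>, the map \<open>e \<phi>\<close> is
  multiplication with \<open>\<phi>(e 1)\<close>. Each of the four scalars has its own task: \<open>e0\<close> moves \<open>I\<close> into a
  finitely generated subobject, \<open>e1\<close> removes the saturation in the definition of that subobject, \<open>e2\<close>
  leads from \<open>I\<close> to its core, and \<open>e3\<close> replaces the maps \<open>\<phi>\<close> by the elements \<open>\<phi>(e3 1)\<close>.\<close>

lemma almost_generators:
  assumes fg: "almost_fin_gen A SM" and e: "e0 \<in> \<mm>" "e1 \<in> \<mm>" "e2 \<in> \<mm>" "e3 \<in> \<mm>"
  obtains \<Gamma> where "finite \<Gamma>" "\<Gamma> \<subseteq> elts II"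
    "\<And>i. i \<in> elts II \<Longrightarrow> e3 \<odot>\<^bsub>core II\<^esub> (e2 \<odot>\<^bsub>core II\<^esub> (e1 \<odot>\<^bsub>core II\<^esub> (e0 \<odot>\<^bsub>core II\<^esub> i))) \<in>
      span_mod V (core II) {actc SM a g |a g. a \<in> elts RR \<and> g \<in> \<Gamma>}"
proof -
  note C = module_core[OF II]
  interpret II: module V II by (rule II)
  interpret C: module V "core II" by (rule C)
  have gi: "genideal V {e0} \<subseteq> \<mm>" using genideal_minimal[OF ideal_mm, of "{e0}"] e(1) by simp
  have e0g: "e0 \<in> genideal V {e0}" using genideal_self[of "{e0}"] mm_carrier[OF e(1)] by simp
  obtain N0 where N0: "fin_gen_sub A SM N0"
    "span_mod V II {e \<odot>\<^bsub>II\<^esub> x | e x. e \<in> genideal V {e0} \<and> x \<in> carrier II} \<subseteq> N0"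
    using fg[unfolded almost_fin_gen_def, rule_format, of "{e0}"] gi mm_carrier[OF e(1)] by auto
  then obtain \<Phi> where \<Phi>: "finite \<Phi>" "\<And>\<phi>. \<phi> \<in> \<Phi> \<Longrightarrow> alinear A (self_amodule A) SM \<phi>"
    "N0 = msat II (span_mod V II (\<Union>\<phi> \<in> \<Phi>. Range (agraph \<phi>)))" by (auto simp: fin_gen_sub_def)
  have \<phi>: "is_amor RR II \<phi>" "\<And>a b. a \<in> elts RR \<Longrightarrow> b \<in> elts RR \<Longrightarrow> ev \<phi> (mulc a b) = actc SM a (ev \<phi> b)"
    if "\<phi> \<in> \<Phi>" for \<phi>
    using \<Phi>(2)[OF that] unfolding alinear_iff[OF self_premod premod_SM] actc_self by (auto simp: self_amodule_def)
  let ?R = "\<Union>\<phi> \<in> \<Phi>. Range (agraph \<phi>)"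
  have Rc: "?R \<subseteq> carrier II" using amorD(6)[OF \<phi>(1)] by auto
  obtain w where w: "w \<in> elts RR" "\<And>a. a \<in> elts RR \<Longrightarrow> mulc w a = e3 \<odot>\<^bsub>core RR\<^esub> a" using unit_ex[OF e(4)] by blast
  define \<Gamma> where "\<Gamma> = (\<lambda>\<phi>. ev \<phi> w) ` \<Phi>"
  let ?G = "{actc SM a g |a g. a \<in> elts RR \<and> g \<in> \<Gamma>}"
  have \<Gamma>c: "\<Gamma> \<subseteq> elts II" using ev_closed[OF \<phi>(1) w(1)] by (auto simp: \<Gamma>_def)
  have Gc: "?G \<subseteq> elts II" using actc_simps(1)[OF premod_SM, unfolded obj_SM] \<Gamma>c by auto
  have gen: "e3 \<odot>\<^bsub>core II\<^esub> ev \<phi> a \<in> ?G" if \<phi>': "\<phi> \<in> \<Phi>" and a: "a \<in> elts RR" for \<phi> a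
  proof -
    have "e3 \<odot>\<^bsub>core II\<^esub> ev \<phi> a = ev \<phi> (mulc w a)" using mod_hom_smult[OF ev_hom[OF \<phi>(1)[OF \<phi>']] mm_carrier[OF e(4)] a] w(2)[OF a] by simp
    also have "\<dots> = actc SM a (ev \<phi> w)" using mulc_comm[OF w(1) a] \<phi>(2)[OF \<phi>' a w(1)] by simp
    finally show ?thesis using a \<phi>' by (auto simp: \<Gamma>_def)
  qed
  have Q: "submodule (span_mod V II ?R) V II" by (rule span_mod_submodule[OF II Rc])
  have cQ: "e3 \<odot>\<^bsub>core II\<^esub> q \<in> span_mod V (core II) ?G" if q: "q \<in> csub II (span_mod V II ?R)" for q
  proof -
    have h: "(\<lambda>q. e3 \<odot>\<^bsub>core II\<^esub> q) \<in> mod_hom V (core II) (core II)"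
      by (rule mod_hom_scale[OF C _ mm_carrier[OF e(4)]]) (rule mod_homI; simp)
    have g: "{cl II (e \<odot>\<^bsub>II\<^esub> y) |e y. e \<in> \<mm> \<and> y \<in> ?R} \<subseteq> elts II" using Rc by (auto intro!: cl_closed mpart_base)
    show ?thesis
    proof (rule mod_hom_span[OF h C C g span_mod_submodule[OF C Gc] _ q[unfolded csub_span[OF II Rc]]])
      fix z assume "z \<in> {cl II (e \<odot>\<^bsub>II\<^esub> y) |e y. e \<in> \<mm> \<and> y \<in> ?R}"
      then obtain e y \<phi> x where z: "z = cl II (e \<odot>\<^bsub>II\<^esub> y)" "e \<in> \<mm>" "\<phi> \<in> \<Phi>" "(x, y) \<in> agraph \<phi>" by blast
      have zx: "z = ev \<phi> (cl RR (e \<odot>\<^bsub>RR\<^esub> x))"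
        unfolding z(1) by (rule ev_cl[symmetric, OF \<phi>(1)[OF z(3)] amorD(8)[OF \<phi>(1)[OF z(3)] mm_carrier[OF z(2)] z(4)] mpart_base[OF z(2) amorD(6)[OF \<phi>(1)[OF z(3)] z(4)]]])
      have "cl RR (e \<odot>\<^bsub>RR\<^esub> x) \<in> elts RR"
        by (rule cl_closed[OF mpart_smult[OF RR mm_carrier[OF z(2)] amorD(5)[OF \<phi>(1)[OF z(3)] z(4)]]])
      then have "e3 \<odot>\<^bsub>core II\<^esub> z \<in> ?G" unfolding zx by (rule gen[OF z(3)])
      then show "e3 \<odot>\<^bsub>core II\<^esub> z \<in> span_mod V (core II) ?G" by (rule span_mod_base)
    qed
  qed
  show ?thesis
  proof (rule that[of \<Gamma>])
    show "finite \<Gamma>" using \<Phi>(1) by (simp add: \<Gamma>_def)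
    show "\<Gamma> \<subseteq> elts II" by (rule \<Gamma>c)
    fix i assume "i \<in> elts II"
    then obtain x where x: "x \<in> mpart II" "i = cl II x" by (rule core_cases)
    note xc = mpart_carrier[OF II x(1)]
    have "e0 \<odot>\<^bsub>II\<^esub> x \<in> N0" using N0(2) span_mod_base[of "e0 \<odot>\<^bsub>II\<^esub> x" "{e \<odot>\<^bsub>II\<^esub> x | e x. e \<in> genideal V {e0} \<and> x \<in> carrier II}"] e0g xc by blast
    then have "e1 \<odot>\<^bsub>II\<^esub> (e0 \<odot>\<^bsub>II\<^esub> x) \<in> span_mod V II ?R" using e(2) unfolding \<Phi>(3) msat_def by blast
    then have "cl II (e2 \<odot>\<^bsub>II\<^esub> (e1 \<odot>\<^bsub>II\<^esub> (e0 \<odot>\<^bsub>II\<^esub> x))) \<in> csub II (span_mod V II ?R)" by (rule csubI[OF Q II e(3)])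
    from cQ[OF this] show "e3 \<odot>\<^bsub>core II\<^esub> (e2 \<odot>\<^bsub>core II\<^esub> (e1 \<odot>\<^bsub>core II\<^esub> (e0 \<odot>\<^bsub>core II\<^esub> i))) \<in> span_mod V (core II) ?G"
      using x e by (simp add: cl_smult[OF II] mm_carrier mpart_smult[OF II])
  qed
qed

subsection \<open>The kernel of the completion\<close>

lemma span_split:
  assumes Z: "module V Z" and h: "h \<in> mod_hom V X Z" and X: "module V X" and F: "submodule F V X" and B: "B \<subseteq> carrier Z"
    and u: "u \<in> span_mod V Z (h ` F \<union> B)"
  shows "\<exists>y\<in>F. \<exists>d\<in>span_mod V Z B. u = h y \<oplus>\<^bsub>Z\<^esub> d"
proof -
  interpret Z: module V Z by fact
  note HF = submoduleD[OF Z submodule_image[OF h X Z F]]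
  note SB = submoduleD[OF Z span_mod_submodule[OF Z B]] and FD = submoduleD[OF X F]
  let ?N = "{h y \<oplus>\<^bsub>Z\<^esub> d | y d. y \<in> F \<and> d \<in> span_mod V Z B}"
  have hc: "h y \<in> carrier Z" if "y \<in> F" for y using mod_hom_closed[OF h FD(1)[OF that]] .
  have "submodule ?N V Z"
    unfolding submodule_iff[OF Z]
  proof (intro conjI ballI)
    show "?N \<subseteq> carrier Z" using hc SB(1) by auto
    have "\<zero>\<^bsub>Z\<^esub> = h \<zero>\<^bsub>X\<^esub> \<oplus>\<^bsub>Z\<^esub> \<zero>\<^bsub>Z\<^esub>" using mod_hom_zero[OF h X Z] by simp
    then show "\<zero>\<^bsub>Z\<^esub> \<in> ?N" using FD(2) SB(2) by blast
  next
    fix p q assume "p \<in> ?N" "q \<in> ?N"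
    then obtain y d y' d' where p: "p = h y \<oplus>\<^bsub>Z\<^esub> d" "y \<in> F" "d \<in> span_mod V Z B" "q = h y' \<oplus>\<^bsub>Z\<^esub> d'" "y' \<in> F" "d' \<in> span_mod V Z B" by blast
    have "p \<oplus>\<^bsub>Z\<^esub> q = h (y \<oplus>\<^bsub>X\<^esub> y') \<oplus>\<^bsub>Z\<^esub> (d \<oplus>\<^bsub>Z\<^esub> d')"
      using hc[OF p(2)] hc[OF p(5)] SB(1)[OF p(3)] SB(1)[OF p(6)] mod_hom_add[OF h FD(1)[OF p(2)] FD(1)[OF p(5)]] by (simp add: p(1,4) Z.M.a_ac)
    then show "p \<oplus>\<^bsub>Z\<^esub> q \<in> ?N" using FD(3)[OF p(2,5)] SB(3)[OF p(3,6)] by blast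
  next
    fix v p assume v: "v \<in> carrier V" and "p \<in> ?N"
    then obtain y d where p: "p = h y \<oplus>\<^bsub>Z\<^esub> d" "y \<in> F" "d \<in> span_mod V Z B" by blast
    have "v \<odot>\<^bsub>Z\<^esub> p = h (v \<odot>\<^bsub>X\<^esub> y) \<oplus>\<^bsub>Z\<^esub> (v \<odot>\<^bsub>Z\<^esub> d)"
      using hc[OF p(2)] SB(1)[OF p(3)] mod_hom_smult[OF h v FD(1)[OF p(2)]] v by (simp add: p(1) Z.smult_r_distr)
    then show "v \<odot>\<^bsub>Z\<^esub> p \<in> ?N" using FD(4)[OF v p(2)] SB(4)[OF v p(3)] by blast
  qed
  moreover have "h ` F \<union> B \<subseteq> ?N"
  proof
    fix z assume "z \<in> h ` F \<union> B"
    then show "z \<in> ?N"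
    proof
      assume "z \<in> h ` F"
      then obtain y where y: "y \<in> F" "z = h y" by auto
      then have "z = h y \<oplus>\<^bsub>Z\<^esub> \<zero>\<^bsub>Z\<^esub>" using hc by simp
      then show ?thesis using y SB(2) by blast
    next
      assume z: "z \<in> B"
      then have "z = h \<zero>\<^bsub>X\<^esub> \<oplus>\<^bsub>Z\<^esub> z" using mod_hom_zero[OF h X Z] B by auto
      then show ?thesis using FD(2) span_mod_base[OF z] by blast
    qed
  qed
  ultimately have "u \<in> ?N" using span_mod_least u by blast
  then show ?thesis by blast
qed

context
  fixes X :: "('v, 'a, 'i, 'x, 'y) jarrow"
  assumes X: "A_arrow X"
begin

lemma jproj_Fpow_zero:
  assumes y: "y \<in> Fpow (jbot X) (Suc k)"
  shows "ev (jproj0 A J k (idA X)) y = \<zero>\<^bsub>core0 (jP A J k (idA X))\<^esub>"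
proof -
  note M = A_arrowD(2)[OF X]
  have yc: "y \<in> elts1 X" by (rule Fpow_carrier[OF M y])
  have "e \<odot>\<^bsub>core1 X\<^esub> y \<in> Fpow (jbot X) (Suc k)" if "e \<in> \<mm>" for e
    by (rule submoduleD(4)[OF module_core[OF bot_mod[OF X]] Fpow_submodule[OF M] mm_carrier[OF that] y])
  then show ?thesis using jproj0_zero_iff'[OF A_arrow_idA[OF X], of y k] yc by (simp add: Gpow_idarrow[OF M, simplified])
qed

text \<open>Let \<open>w k\<close> be the partial sums of a series whose \<open>k\<close>-th term is a sum of values \<open>\<beta>(g, y)\<close> with \<open>g \<in> \<Gamma>\<close> and
  \<open>y \<in> I\<^sup>k X\<^sub>1\<close>. As \<open>\<Gamma>\<close> is finite and does not depend on \<open>k\<close>, the series can be summed separately for each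
  \<open>g\<close>: its limit is \<open>\<Sum>\<^sub>g \<beta>(g, Y\<^sub>g)\<close>, where \<open>Y\<^sub>g\<close> is the limit of a series in \<open>X\<^sub>1\<close>. The first \<open>n\<close> terms vanish, so
  \<open>Y\<^sub>g\<close> vanishes in \<open>X\<^sub>1/I\<^sup>n X\<^sub>1\<close>, and the assumption \<open>H\<close> places \<open>e Y\<^sub>g\<close> in \<open>I\<^sup>n\<close> times the completion. The
  scalar \<open>e'\<close> is the price for the existence of limits of cores.\<close>

lemma series_limit:
  assumes fin: "finite \<Gamma>" and \<Gamma>: "\<Gamma> \<subseteq> elts II" and e: "e \<in> \<mm>" "e' \<in> \<mm>"
    and H: "\<And>Y e. Y \<in> elts1 (cA X) \<Longrightarrow> (\<And>m. n = Suc m \<Longrightarrow> ev (pr1 X m) Y = \<zero>\<^bsub>core0 (jP A J m (idA X))\<^esub>) \<Longrightarrow>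
      e \<in> \<mm> \<Longrightarrow> e \<odot>\<^bsub>core1 (cA X)\<^esub> Y \<in> Fpow (jbot (cA X)) n"
    and w: "\<And>k. w k \<in> elts0 X" "\<And>k. k \<le> n \<Longrightarrow> w k = \<zero>\<^bsub>core0 X\<^esub>"
      "\<And>k. w (Suc k) \<ominus>\<^bsub>core0 X\<^esub> w k \<in> span_mod V (core0 X) {jpair X g y |g y. g \<in> \<Gamma> \<and> y \<in> Fpow (jbot X) k}"
  shows "\<exists>v\<in>Gpow (cA X) n. \<forall>k. ev (pr0 X k) v = e \<odot>\<^bsub>core0 (jP A J k X)\<^esub> (e' \<odot>\<^bsub>core0 (jP A J k X)\<^esub> ev (jproj0 A J k X) (w (Suc k)))"
  using fin \<Gamma> w
proof (induct \<Gamma> arbitrary: w)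
  case empty
  note C = A_arrow_jcompletion[OF X]
  interpret W: module V "core0 X" by (rule module_core[OF top_mod[OF X]])
  interpret T: module V "core0 (jP A J k X)" for k by (rule module_core[OF top_mod[OF A_arrow_jP[OF X]]])
  have "span_mod V (core0 X) {} = {\<zero>\<^bsub>core0 X\<^esub>}"
    using span_mod_least[OF submodule_zero[OF W.module_axioms], of "{}"] submoduleD(2)[OF W.module_axioms span_mod_submodule[OF W.module_axioms, of "{}"]] by auto
  then have "w (Suc k) = w k" for k using empty(4)[of k] W.minus_eq_zero_iff[OF empty(2,2)] by auto
  then have w0: "w k = w 0" for k by (induct k) auto
  have wz: "w k = \<zero>\<^bsub>core0 X\<^esub>" for k using empty(3)[of 0] w0[of k] by simp
  have pz: "ev (pr0 X k) \<zero>\<^bsub>core0 (cA X)\<^esub> = \<zero>\<^bsub>core0 (jP A J k X)\<^esub>" for k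
    by (rule mod_hom_zero[OF ev_hom[OF prj_amor[OF X]] module_core[OF top_mod[OF C]] T.module_axioms])
  have qz: "ev (jproj0 A J k X) \<zero>\<^bsub>core0 X\<^esub> = \<zero>\<^bsub>core0 (jP A J k X)\<^esub>" for k
    by (rule mod_hom_zero[OF ev_hom[OF jproj0_amor'[OF X]] W.module_axioms T.module_axioms])
  show ?case
  proof (rule bexI; (rule allI)?)
    fix k
    show "ev (pr0 X k) \<zero>\<^bsub>core0 (cA X)\<^esub> = e \<odot>\<^bsub>core0 (jP A J k X)\<^esub> (e' \<odot>\<^bsub>core0 (jP A J k X)\<^esub> ev (jproj0 A J k X) (w (Suc k)))"
      unfolding pz wz qz using e by (simp add: mm_carrier)
  qed (rule submoduleD(2)[OF module_core[OF top_mod[OF C]] Gpow_submodule[OF C]])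
next
  case (insert g \<Gamma>)
  note C = A_arrow_jcompletion[OF X]
  note M = A_arrowD(2)[OF X] and bil = jpair_bilin[OF X]
  note CW = module_core[OF top_mod[OF X]] and CB = module_core[OF bot_mod[OF X]]
  interpret W: module V "core0 X" by (rule CW)
  interpret B: module V "core1 X" by (rule CB)
  interpret T: module V "core0 (jP A J k X)" for k by (rule module_core[OF top_mod[OF A_arrow_jP[OF X]]])
  interpret S: module V "core0 (jP A J k (idA X))" for k by (rule module_core[OF top_mod[OF A_arrow_jP[OF A_arrow_idA[OF X]]]])
  interpret LB: module V "core1 (cA X)" by (rule module_core[OF bot_mod[OF C]])
  have g: "g \<in> elts II" and \<Gamma>: "\<Gamma> \<subseteq> elts II" using insert(4) by auto
  have h: "jpair X g \<in> mod_hom V (core1 X) (core0 X)" using bil g by (simp add: bilin_def)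
  have hc: "jpair X g y \<in> elts0 X" if "y \<in> elts1 X" for y by (rule mod_hom_closed[OF h that])
  note Fz = submoduleD(2)[OF CB Fpow_submodule[OF M]]
  define P where "P k y d \<longleftrightarrow> y \<in> Fpow (jbot X) k \<and> d \<in> span_mod V (core0 X) {jpair X g y |g y. g \<in> \<Gamma> \<and> y \<in> Fpow (jbot X) k} \<and>
      w (Suc k) \<ominus>\<^bsub>core0 X\<^esub> w k = jpair X g y \<oplus>\<^bsub>core0 X\<^esub> d \<and> (k < n \<longrightarrow> y = \<zero>\<^bsub>core1 X\<^esub>)" for k y d
  have "\<exists>y d. P k y d" for k
  proof -
    let ?B = "{jpair X g y |g y. g \<in> \<Gamma> \<and> y \<in> Fpow (jbot X) k}"
    have Bc: "?B \<subseteq> elts0 X" using \<Gamma> bilinD(1)[OF bil] Fpow_carrier[OF M] by auto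
    show ?thesis
    proof (cases "k < n")
      case True
      then have "w (Suc k) = \<zero>\<^bsub>core0 X\<^esub>" "w k = \<zero>\<^bsub>core0 X\<^esub>" using insert(6) by auto
      then have "w (Suc k) \<ominus>\<^bsub>core0 X\<^esub> w k = jpair X g \<zero>\<^bsub>core1 X\<^esub> \<oplus>\<^bsub>core0 X\<^esub> \<zero>\<^bsub>core0 X\<^esub>"
        using mod_hom_zero[OF h CB CW] W.minus_eq_zero_iff[OF W.M.zero_closed W.M.zero_closed] by simp
      then show ?thesis using Fz[of k] submoduleD(2)[OF CW span_mod_submodule[OF CW Bc]] unfolding P_def by blast
    next
      case False
      have eq: "{jpair X g' y |g' y. g' \<in> insert g \<Gamma> \<and> y \<in> Fpow (jbot X) k} = jpair X g ` Fpow (jbot X) k \<union> ?B" by auto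
      show ?thesis using span_split[OF CW h CB Fpow_submodule[OF M] Bc insert(7)[of k, unfolded eq]] False unfolding P_def by blast
    qed
  qed
  then obtain y d where Pyd: "\<And>k. P k (y k) (d k)" by metis
  have y: "\<And>k. y k \<in> Fpow (jbot X) k" and y0: "\<And>k. k < n \<Longrightarrow> y k = \<zero>\<^bsub>core1 X\<^esub>"
    and d: "\<And>k. d k \<in> span_mod V (core0 X) {jpair X g y |g y. g \<in> \<Gamma> \<and> y \<in> Fpow (jbot X) k}"
    and yd: "\<And>k. w (Suc k) \<ominus>\<^bsub>core0 X\<^esub> w k = jpair X g (y k) \<oplus>\<^bsub>core0 X\<^esub> d k"
    using Pyd unfolding P_def by blast+
  \<comment> \<open>partial sums of the series in \<open>X\<^sub>1\<close> that is paired with \<open>g\<close>\<close>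
  define s where "s = rec_nat \<zero>\<^bsub>core1 X\<^esub> (\<lambda>k t. t \<oplus>\<^bsub>core1 X\<^esub> y k)"
  have s0: "s 0 = \<zero>\<^bsub>core1 X\<^esub>" and sS: "\<And>k. s (Suc k) = s k \<oplus>\<^bsub>core1 X\<^esub> y k" by (simp_all add: s_def)
  have yc: "y k \<in> elts1 X" for k by (rule Fpow_carrier[OF M y])
  have sc: "s k \<in> elts1 X" for k by (induct k) (simp_all add: s0 sS yc)
  have sz: "s k = \<zero>\<^bsub>core1 X\<^esub>" if "k \<le> n" for k using that by (induct k) (simp_all add: s0 sS y0)
  \<comment> \<open>the part of the series that belongs to the other generators\<close>
  define w' where "w' k = w k \<ominus>\<^bsub>core0 X\<^esub> jpair X g (s k)" for k
  have w'c: "w' k \<in> elts0 X" for k using insert(5) hc[OF sc] by (simp add: w'_def)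
  have w'z: "w' k = \<zero>\<^bsub>core0 X\<^esub>" if "k \<le> n" for k
    using insert(6)[OF that] sz[OF that] mod_hom_zero[OF h CB CW] W.minus_eq_zero_iff[OF W.M.zero_closed W.M.zero_closed] by (simp add: w'_def)
  have dc: "d k \<in> elts0 X" for k
  proof -
    have "{jpair X g y |g y. g \<in> \<Gamma> \<and> y \<in> Fpow (jbot X) k} \<subseteq> elts0 X" using \<Gamma> bilinD(1)[OF bil] Fpow_carrier[OF M] by auto
    then show ?thesis using submoduleD(1)[OF CW span_mod_submodule[OF CW] d] by blast
  qed
  have w'd: "w' (Suc k) \<ominus>\<^bsub>core0 X\<^esub> w' k = d k" for k
  proof -
    have a: "w (Suc k) = w k \<oplus>\<^bsub>core0 X\<^esub> (jpair X g (y k) \<oplus>\<^bsub>core0 X\<^esub> d k)"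
      using insert(5)[of k] insert(5)[of "Suc k"] unfolding yd[of k, symmetric] by (simp add: a_minus_def W.M.a_lcomm[of "w k"] W.M.r_neg)
    have b: "jpair X g (s (Suc k)) = jpair X g (s k) \<oplus>\<^bsub>core0 X\<^esub> jpair X g (y k)" using mod_hom_add[OF h sc yc] by (simp add: sS)
    have "w' (Suc k) = w' k \<oplus>\<^bsub>core0 X\<^esub> d k"
    proof -
      define p q r t where "p = w k" "q = jpair X g (s k)" "r = jpair X g (y k)" "t = d k"
      have c: "p \<in> elts0 X" "q \<in> elts0 X" "r \<in> elts0 X" "t \<in> elts0 X"
        unfolding p_q_r_t_def using insert(5) hc sc yc dc by auto
      have "(p \<oplus>\<^bsub>core0 X\<^esub> (r \<oplus>\<^bsub>core0 X\<^esub> t)) \<ominus>\<^bsub>core0 X\<^esub> (q \<oplus>\<^bsub>core0 X\<^esub> r) = (p \<ominus>\<^bsub>core0 X\<^esub> q) \<oplus>\<^bsub>core0 X\<^esub> t"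
      proof -
        have "(p \<oplus>\<^bsub>core0 X\<^esub> (r \<oplus>\<^bsub>core0 X\<^esub> t)) \<ominus>\<^bsub>core0 X\<^esub> (q \<oplus>\<^bsub>core0 X\<^esub> r) =
          (r \<oplus>\<^bsub>core0 X\<^esub> \<ominus>\<^bsub>core0 X\<^esub> r) \<oplus>\<^bsub>core0 X\<^esub> ((p \<ominus>\<^bsub>core0 X\<^esub> q) \<oplus>\<^bsub>core0 X\<^esub> t)"
          using c by (simp add: a_minus_def W.M.minus_add W.M.a_ac)
        then show ?thesis using c by (simp add: W.M.r_neg)
      qed
      then show ?thesis by (simp add: w'_def a b p_q_r_t_def)
    qed
    then show ?thesis using w'c[of k] dc[of k] by (simp add: a_minus_def W.M.a_ac) (simp add: W.M.a_assoc[symmetric] W.M.l_neg W.M.a_comm[of "w' k"])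
  qed
  have "\<exists>v\<in>Gpow (cA X) n. \<forall>k. ev (pr0 X k) v = e \<odot>\<^bsub>core0 (jP A J k X)\<^esub> (e' \<odot>\<^bsub>core0 (jP A J k X)\<^esub> ev (jproj0 A J k X) (w' (Suc k)))"
  proof (rule insert(3)[OF \<Gamma> w'c w'z])
    fix k show "w' (Suc k) \<ominus>\<^bsub>core0 X\<^esub> w' k \<in> span_mod V (core0 X) {jpair X g y |g y. g \<in> \<Gamma> \<and> y \<in> Fpow (jbot X) k}"
      unfolding w'd by (rule d)
  qed
  then obtain v' where v': "v' \<in> Gpow (cA X) n"
    "\<And>k. ev (pr0 X k) v' = e \<odot>\<^bsub>core0 (jP A J k X)\<^esub> (e' \<odot>\<^bsub>core0 (jP A J k X)\<^esub> ev (jproj0 A J k X) (w' (Suc k)))" by blast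
  \<comment> \<open>the part that belongs to \<open>g\<close>\<close>
  let ?q1 = "\<lambda>k. jproj0 A J k (idA X)"
  have q1c: "ev (?q1 k) x \<in> elts0 (jP A J k (idA X))" if "x \<in> elts1 X" for k x
    using jproj0_closed[OF A_arrow_idA[OF X], of x k] that by simp
  note q1h = ev_hom[OF jproj0_amor'[OF A_arrow_idA[OF X]], simplified]
  have zc: "ev (jtrans0 A J (idA X) k) (ev (?q1 (Suc k)) (s (Suc (Suc k)))) = ev (?q1 k) (s (Suc k))" for k
  proof -
    have "ev (jtrans0 A J (idA X) k) (ev (?q1 (Suc k)) (s (Suc (Suc k)))) = ev (?q1 k) (s (Suc (Suc k)))"
      using ev_jtrans0[OF A_arrow_idA[OF X], of "s (Suc (Suc k))" k] sc by simp
    also have "\<dots> = ev (?q1 k) (s (Suc k)) \<oplus>\<^bsub>core0 (jP A J k (idA X))\<^esub> ev (?q1 k) (y (Suc k))"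
      unfolding sS[of "Suc k"] by (rule mod_hom_add[OF q1h sc yc])
    also have "ev (?q1 k) (y (Suc k)) = \<zero>\<^bsub>core0 (jP A J k (idA X))\<^esub>" by (rule jproj_Fpow_zero[OF y])
    finally show ?thesis using q1c[OF sc] by simp
  qed
  obtain Y where Y: "Y \<in> elts1 (cA X)"
    "\<And>k. ev (pr1 X k) Y = e' \<odot>\<^bsub>core0 (jP A J k (idA X))\<^esub> ev (?q1 k) (s (Suc k))"
    using prj_ex[OF A_arrow_idA[OF X], where z = "\<lambda>k. ev (?q1 k) (s (Suc k))" and e = e', OF q1c[OF sc] zc e(2)]
    unfolding bot_completion[OF X] by blast
  have eY: "e \<odot>\<^bsub>core1 (cA X)\<^esub> Y \<in> Fpow (jbot (cA X)) n"
  proof (rule H[OF Y(1) _ e(1)])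
    fix m assume m: "n = Suc m"
    have "ev (?q1 m) \<zero>\<^bsub>core1 X\<^esub> = \<zero>\<^bsub>core0 (jP A J m (idA X))\<^esub>" by (rule mod_hom_zero[OF q1h CB S.module_axioms])
    then show "ev (pr1 X m) Y = \<zero>\<^bsub>core0 (jP A J m (idA X))\<^esub>"
      unfolding Y(2) using sz[of "Suc m"] m e(2) by (simp add: mm_carrier)
  qed
  let ?v = "jpair (cA X) g (e \<odot>\<^bsub>core1 (cA X)\<^esub> Y)"
  have vG: "?v \<in> Gpow (cA X) n" unfolding Gpow_Fpow[OF C] using g eY by (intro span_mod_base) blast
  have pv: "ev (pr0 X k) ?v = e \<odot>\<^bsub>core0 (jP A J k X)\<^esub> (e' \<odot>\<^bsub>core0 (jP A J k X)\<^esub> ev (jproj0 A J k X) (jpair X g (s (Suc k))))" for k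
  proof -
    have eYc: "e \<odot>\<^bsub>core1 (cA X)\<^esub> Y \<in> elts1 (cA X)" using Y(1) e(1) by (simp add: mm_carrier)
    note pb = jpair_bilin[OF A_arrow_jP[OF X, of k], unfolded jbot_jP]
    have "ev (pr0 X k) ?v = jpair (jP A J k X) g (e \<odot>\<^bsub>core0 (jP A J k (idA X))\<^esub> (e' \<odot>\<^bsub>core0 (jP A J k (idA X))\<^esub> ev (?q1 k) (s (Suc k))))"
      unfolding prj_jpair[OF X g eYc] Y(2)[symmetric] using mod_hom_smult[OF ev_hom[OF pr1_amor[OF X]] mm_carrier[OF e(1)] Y(1)] by simp
    also have "\<dots> = e \<odot>\<^bsub>core0 (jP A J k X)\<^esub> (e' \<odot>\<^bsub>core0 (jP A J k X)\<^esub> jpair (jP A J k X) g (ev (?q1 k) (s (Suc k))))"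
      using g q1c[OF sc] e by (simp add: bilinD(5)[OF pb] mm_carrier)
    finally show ?thesis unfolding jpair_jP[OF X g sc] .
  qed
  show ?case
  proof (intro bexI allI)
    show "?v \<oplus>\<^bsub>core0 (cA X)\<^esub> v' \<in> Gpow (cA X) n" by (rule submoduleD(3)[OF module_core[OF top_mod[OF C]] Gpow_submodule[OF C] vG v'(1)])
    fix k
    have wk: "w (Suc k) = jpair X g (s (Suc k)) \<oplus>\<^bsub>core0 X\<^esub> w' (Suc k)"
      using insert(5)[of "Suc k"] hc[OF sc, of "Suc k"] by (simp add: w'_def a_minus_def W.M.a_lcomm[of "jpair X g (s (Suc k))"] W.M.r_neg)
    note qc = jproj0_closed[OF X hc[OF sc], of k "Suc k"] jproj0_closed[OF X w'c, of k "Suc k"]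
    show "ev (pr0 X k) (?v \<oplus>\<^bsub>core0 (cA X)\<^esub> v') =
        e \<odot>\<^bsub>core0 (jP A J k X)\<^esub> (e' \<odot>\<^bsub>core0 (jP A J k X)\<^esub> ev (jproj0 A J k X) (w (Suc k)))"
      unfolding mod_hom_add[OF ev_hom[OF prj_amor[OF X]] Gpow_carrier[OF C vG] Gpow_carrier[OF C v'(1)]] pv v'(2) wk
        mod_hom_add[OF ev_hom[OF jproj0_amor'[OF X]] hc[OF sc] w'c]
      using qc e by (simp add: T.smult_r_distr mm_carrier)
  qed
qed

text \<open>The hypothesis \<open>H\<close> is the same assertion for the bottom and for \<open>I\<^sup>n\<close> in place of \<open>I\<^sup>n\<^sup>+\<^sup>1\<close>; it is vacuous beyond
  \<open>e Y\<close> being an element for \<open>n = 0\<close>. Approximate \<open>u\<close> by \<open>x k \<in> X\<^sub>0\<close>, starting with zeros up to \<open>k = n\<close>. The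
  difference of consecutive \<open>x k\<close> lies in \<open>I\<^sup>k\<^sup>+\<^sup>1 X\<^sub>1\<close>, so \<open>u\<close> is a series to which \<open>series_limit\<close> applies once
  \<open>I\<close> is replaced by finitely many generators. Of the seven scalars below, \<open>a0\<close> moves the differences into
  \<open>I\<^sup>k\<^sup>+\<^sup>1 X\<^sub>1\<close> itself, \<open>a1\<close> to \<open>a4\<close> provide the generators, and \<open>a5\<close>, \<open>a6\<close> the limit. They are chosen before the
  generators and kept for all \<open>k\<close>; as products of seven elements span \<open>\<mm>\<close>, they can be merged into one
  scalar \<open>e\<close> at the end.\<close>

lemma kernel_completion_step:
  assumes fg: "almost_fin_gen A SM"
    and H: "\<And>Y e. Y \<in> elts1 (cA X) \<Longrightarrow> (\<And>m. n = Suc m \<Longrightarrow> ev (pr1 X m) Y = \<zero>\<^bsub>core0 (jP A J m (idA X))\<^esub>) \<Longrightarrow>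
      e \<in> \<mm> \<Longrightarrow> e \<odot>\<^bsub>core1 (cA X)\<^esub> Y \<in> Fpow (jbot (cA X)) n"
    and u: "u \<in> elts0 (cA X)" "ev (pr0 X n) u = \<zero>\<^bsub>core0 (jP A J n X)\<^esub>" and e: "e \<in> \<mm>"
  shows "e \<odot>\<^bsub>core0 (cA X)\<^esub> u \<in> Gpow (cA X) n"
proof -
  note C = A_arrow_jcompletion[OF X]
  note M = A_arrowD(2)[OF X] and bil = jpair_bilin[OF X]
  note CW = module_core[OF top_mod[OF X]] and CL = module_core[OF top_mod[OF C]]
  interpret W: module V "core0 X" by (rule CW)
  interpret L: module V "core0 (cA X)" by (rule CL)
  interpret T: module V "core0 (jP A J k X)" for k by (rule module_core[OF top_mod[OF A_arrow_jP[OF X]]])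
  interpret CI: module V "core II" by (rule module_core[OF II])
  note q0 = ev_hom[OF jproj0_amor'[OF X]]
  have pz: "ev (pr0 X k) u = \<zero>\<^bsub>core0 (jP A J k X)\<^esub>" if "k \<le> n" for k
    using that
  proof (induct rule: inc_induct)
    case base
    show ?case by (rule u(2))
  next
    case (step m)
    have "ev (pr0 X m) u = ev (jtrans0 A J X m) (ev (pr0 X (Suc m)) u)" using prj_compat[OF X u(1)] by simp
    also have "\<dots> = \<zero>\<^bsub>core0 (jP A J m X)\<^esub>" unfolding step(3) by (rule mod_hom_zero[OF ev_hom[OF jtrans0_amor[OF X]] T.module_axioms T.module_axioms])
    finally show ?case .
  qed
  define P where "P k x \<longleftrightarrow> x \<in> elts0 X \<and> ev (jproj0 A J k X) x = ev (pr0 X k) u \<and> (k \<le> n \<longrightarrow> x = \<zero>\<^bsub>core0 X\<^esub>)" for k x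
  have "\<exists>x. P k x" for k
  proof (cases "k \<le> n")
    case True
    then show ?thesis unfolding P_def using mod_hom_zero[OF q0[of k] CW T.module_axioms] pz[OF True] by (intro exI[of _ "\<zero>\<^bsub>core0 X\<^esub>"] conjI impI) simp_all
  next
    case False
    then show ?thesis using jproj0_ex[OF X ev_closed[OF prj_amor[OF X] u(1)], of k] False unfolding P_def by metis
  qed
  then obtain x where Px: "\<And>k. P k (x k)" by metis
  have x: "\<And>k. x k \<in> elts0 X" "\<And>k. ev (jproj0 A J k X) (x k) = ev (pr0 X k) u"
    "\<And>k. k \<le> n \<Longrightarrow> x k = \<zero>\<^bsub>core0 X\<^esub>" using Px unfolding P_def by blast+
  \<comment> \<open>the shift by one: the \<open>k\<close>-th projection sees \<open>x (Suc k)\<close> and \<open>x k\<close> alike, so their difference is in \<open>I\<^sup>k\<^sup>+\<^sup>1 X\<^sub>1\<close>\<close>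
  have xq: "ev (jproj0 A J k X) (x (Suc k)) = ev (pr0 X k) u" for k
    using ev_jtrans0[OF X x(1), of k "Suc k"] x(2)[of "Suc k"] prj_compat[OF X u(1), of k] by simp
  have diff: "a \<odot>\<^bsub>core0 X\<^esub> (x (Suc k) \<ominus>\<^bsub>core0 X\<^esub> x k) \<in> Gpow X k" if a: "a \<in> \<mm>" for a k
  proof -
    have "ev (jproj0 A J k X) (x (Suc k) \<ominus>\<^bsub>core0 X\<^esub> x k) = \<zero>\<^bsub>core0 (jP A J k X)\<^esub>"
      using mod_hom_minus[OF q0 CW T.module_axioms x(1) x(1), of k "Suc k" k] xq[of k] x(2)[of k] ev_closed[OF prj_amor[OF X] u(1), of k]
        T.minus_eq_zero_iff by simp
    then show ?thesis using jproj0_zero_iff'[OF X, of "x (Suc k) \<ominus>\<^bsub>core0 X\<^esub> x k" k] x(1) a by simp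
  qed
  have main: "a6 \<odot>\<^bsub>core0 (cA X)\<^esub> (a5 \<odot>\<^bsub>core0 (cA X)\<^esub> (a4 \<odot>\<^bsub>core0 (cA X)\<^esub> (a3 \<odot>\<^bsub>core0 (cA X)\<^esub>
      (a2 \<odot>\<^bsub>core0 (cA X)\<^esub> (a1 \<odot>\<^bsub>core0 (cA X)\<^esub> (a0 \<odot>\<^bsub>core0 (cA X)\<^esub> u)))))) \<in> Gpow (cA X) n"
    if a: "a0 \<in> \<mm>" "a1 \<in> \<mm>" "a2 \<in> \<mm>" "a3 \<in> \<mm>" "a4 \<in> \<mm>" "a5 \<in> \<mm>" "a6 \<in> \<mm>" for a0 a1 a2 a3 a4 a5 a6
  proof -
    note ac = a[THEN mm_carrier]
    obtain \<Gamma> where \<Gamma>: "finite \<Gamma>" "\<Gamma> \<subseteq> elts II"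
      "\<And>i. i \<in> elts II \<Longrightarrow> a4 \<odot>\<^bsub>core II\<^esub> (a3 \<odot>\<^bsub>core II\<^esub> (a2 \<odot>\<^bsub>core II\<^esub> (a1 \<odot>\<^bsub>core II\<^esub> i))) \<in> span_mod V (core II) {actc SM b g |b g. b \<in> elts RR \<and> g \<in> \<Gamma>}"
      using almost_generators[OF fg a(2-5)] by blast
    \<comment> \<open>multiplication with the scalars that belong to the generators\<close>
    define sc where "sc z = a4 \<odot>\<^bsub>core0 X\<^esub> (a3 \<odot>\<^bsub>core0 X\<^esub> (a2 \<odot>\<^bsub>core0 X\<^esub> (a1 \<odot>\<^bsub>core0 X\<^esub> z)))" for z
    have idh: "(\<lambda>z. z) \<in> mod_hom V (core0 X) (core0 X)" by (rule mod_homI) auto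
    have sch: "sc \<in> mod_hom V (core0 X) (core0 X)"
      unfolding sc_def[abs_def] using ac(2-5) by (intro mod_hom_scale[OF CW] idh)
    have scG: "sc z \<in> span_mod V (core0 X) {jpair X g y |g y. g \<in> \<Gamma> \<and> y \<in> Fpow (jbot X) k}" (is "_ \<in> ?S k") if z: "z \<in> Gpow X k" for z k
    proof -
      have gS: "{jpair X g y |g y. g \<in> \<Gamma> \<and> y \<in> Fpow (jbot X) k} \<subseteq> elts0 X"
        using \<Gamma>(2) bilinD(1)[OF bil] Fpow_carrier[OF M] by auto
      note S = span_mod_submodule[OF CW gS]
      have gc: "{jpair X i y |i y. i \<in> elts II \<and> y \<in> Fpow (jbot X) k} \<subseteq> elts0 X"
        using bilinD(1)[OF bil] Fpow_carrier[OF M] by auto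
      show ?thesis
      proof (rule mod_hom_span[OF sch CW CW gc S _ z[unfolded Gpow_Fpow[OF X]]])
        fix t assume "t \<in> {jpair X i y |i y. i \<in> elts II \<and> y \<in> Fpow (jbot X) k}"
        then obtain i y where t: "t = jpair X i y" "i \<in> elts II" "y \<in> Fpow (jbot X) k" by blast
        note yc = Fpow_carrier[OF M t(3)]
        have h: "(\<lambda>i. jpair X i y) \<in> mod_hom V (core II) (core0 X)" using bil yc by (simp add: bilin_def)
        have ci: "{actc SM b g |b g. b \<in> elts RR \<and> g \<in> \<Gamma>} \<subseteq> elts II"
          using actc_simps(1)[OF premod_SM, unfolded obj_SM] \<Gamma>(2) by auto
        have "sc t = jpair X (a4 \<odot>\<^bsub>core II\<^esub> (a3 \<odot>\<^bsub>core II\<^esub> (a2 \<odot>\<^bsub>core II\<^esub> (a1 \<odot>\<^bsub>core II\<^esub> i)))) y"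
          using t(2) yc ac by (simp add: sc_def t(1) bilinD(4)[OF bil])
        also have "\<dots> \<in> ?S k"
        proof (rule mod_hom_span[OF h module_core[OF II] CW ci S _ \<Gamma>(3)[OF t(2)]])
          fix q assume "q \<in> {actc SM b g |b g. b \<in> elts RR \<and> g \<in> \<Gamma>}"
          then obtain b g where q: "q = actc SM b g" "b \<in> elts RR" "g \<in> \<Gamma>" by blast
          have "jpair X q y = jpair X g (actc (jbot X) b y)"
            unfolding q(1) using pairingD(4)[OF jpair_pairing[OF X] q(2) _ yc] q(3) \<Gamma>(2) by blast
          then show "jpair X q y \<in> ?S k" using q(3) Fpow_stable[OF M q(2) t(3)] by (intro span_mod_base) auto
        qed
        finally show "sc t \<in> ?S k" .
      qed
    qed
    define w where "w k = sc (a0 \<odot>\<^bsub>core0 X\<^esub> x k)" for k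
    have a0h: "(\<lambda>z. sc (a0 \<odot>\<^bsub>core0 X\<^esub> z)) \<in> mod_hom V (core0 X) (core0 X)"
      by (rule mod_hom_comp[OF mod_hom_scale[OF CW idh ac(1)] sch])
    have w1: "w k \<in> elts0 X" for k unfolding w_def by (rule mod_hom_closed[OF a0h x(1)])
    have w2: "w k = \<zero>\<^bsub>core0 X\<^esub>" if "k \<le> n" for k
      unfolding w_def x(3)[OF that] by (rule mod_hom_zero[OF a0h CW CW])
    have w3: "w (Suc k) \<ominus>\<^bsub>core0 X\<^esub> w k \<in> ?S k" for k
      unfolding w_def mod_hom_minus[OF a0h CW CW x(1) x(1), symmetric] by (rule scG[OF diff[OF a(1)]])
    obtain v where v: "v \<in> Gpow (cA X) n"
      "\<And>k. ev (pr0 X k) v = a6 \<odot>\<^bsub>core0 (jP A J k X)\<^esub> (a5 \<odot>\<^bsub>core0 (jP A J k X)\<^esub> ev (jproj0 A J k X) (w (Suc k)))"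
      using series_limit[OF \<Gamma>(1,2) a(7,6) H w1 w2 w3] by blast
    have "a6 \<odot>\<^bsub>core0 (cA X)\<^esub> (a5 \<odot>\<^bsub>core0 (cA X)\<^esub> (a4 \<odot>\<^bsub>core0 (cA X)\<^esub> (a3 \<odot>\<^bsub>core0 (cA X)\<^esub>
      (a2 \<odot>\<^bsub>core0 (cA X)\<^esub> (a1 \<odot>\<^bsub>core0 (cA X)\<^esub> (a0 \<odot>\<^bsub>core0 (cA X)\<^esub> u)))))) = v"
    proof (rule prj_eqI[OF X])
      fix k
      show "ev (pr0 X k) (a6 \<odot>\<^bsub>core0 (cA X)\<^esub> (a5 \<odot>\<^bsub>core0 (cA X)\<^esub> (a4 \<odot>\<^bsub>core0 (cA X)\<^esub> (a3 \<odot>\<^bsub>core0 (cA X)\<^esub>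
          (a2 \<odot>\<^bsub>core0 (cA X)\<^esub> (a1 \<odot>\<^bsub>core0 (cA X)\<^esub> (a0 \<odot>\<^bsub>core0 (cA X)\<^esub> u))))))) = ev (pr0 X k) v"
        using ac u(1) x(1)[of "Suc k"] xq[of k]
        by (simp add: v(2) w_def sc_def mod_hom_smult[OF ev_hom[OF prj_amor[OF X]]] mod_hom_smult[OF q0])
    qed (use ac u(1) Gpow_carrier[OF C v(1)] in auto)
    then show ?thesis using v(1) by simp
  qed
  note dbl = mm_double[OF CL Gpow_submodule[OF C]]
  \<comment> \<open>two neighbouring scalars are merged into one at a time\<close>
  have m5: "b \<odot>\<^bsub>core0 (cA X)\<^esub> (a4 \<odot>\<^bsub>core0 (cA X)\<^esub> (a3 \<odot>\<^bsub>core0 (cA X)\<^esub> (a2 \<odot>\<^bsub>core0 (cA X)\<^esub> (a1 \<odot>\<^bsub>core0 (cA X)\<^esub> (a0 \<odot>\<^bsub>core0 (cA X)\<^esub> u))))) \<in> Gpow (cA X) n"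
    if "b \<in> \<mm>" "a0 \<in> \<mm>" "a1 \<in> \<mm>" "a2 \<in> \<mm>" "a3 \<in> \<mm>" "a4 \<in> \<mm>" for b a0 a1 a2 a3 a4
    by (rule dbl[OF _ that(1)]) (use that main u(1) in \<open>auto simp: mm_carrier\<close>)
  have m4: "b \<odot>\<^bsub>core0 (cA X)\<^esub> (a3 \<odot>\<^bsub>core0 (cA X)\<^esub> (a2 \<odot>\<^bsub>core0 (cA X)\<^esub> (a1 \<odot>\<^bsub>core0 (cA X)\<^esub> (a0 \<odot>\<^bsub>core0 (cA X)\<^esub> u)))) \<in> Gpow (cA X) n"
    if "b \<in> \<mm>" "a0 \<in> \<mm>" "a1 \<in> \<mm>" "a2 \<in> \<mm>" "a3 \<in> \<mm>" for b a0 a1 a2 a3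
    by (rule dbl[OF _ that(1)]) (use that m5 u(1) in \<open>auto simp: mm_carrier\<close>)
  have m3: "b \<odot>\<^bsub>core0 (cA X)\<^esub> (a2 \<odot>\<^bsub>core0 (cA X)\<^esub> (a1 \<odot>\<^bsub>core0 (cA X)\<^esub> (a0 \<odot>\<^bsub>core0 (cA X)\<^esub> u))) \<in> Gpow (cA X) n"
    if "b \<in> \<mm>" "a0 \<in> \<mm>" "a1 \<in> \<mm>" "a2 \<in> \<mm>" for b a0 a1 a2
    by (rule dbl[OF _ that(1)]) (use that m4 u(1) in \<open>auto simp: mm_carrier\<close>)
  have m2: "b \<odot>\<^bsub>core0 (cA X)\<^esub> (a1 \<odot>\<^bsub>core0 (cA X)\<^esub> (a0 \<odot>\<^bsub>core0 (cA X)\<^esub> u)) \<in> Gpow (cA X) n"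
    if "b \<in> \<mm>" "a0 \<in> \<mm>" "a1 \<in> \<mm>" for b a0 a1
    by (rule dbl[OF _ that(1)]) (use that m3 u(1) in \<open>auto simp: mm_carrier\<close>)
  have m1: "b \<odot>\<^bsub>core0 (cA X)\<^esub> (a0 \<odot>\<^bsub>core0 (cA X)\<^esub> u) \<in> Gpow (cA X) n"
    if "b \<in> \<mm>" "a0 \<in> \<mm>" for b a0
    by (rule dbl[OF _ that(1)]) (use that m2 u(1) in \<open>auto simp: mm_carrier\<close>)
  show ?thesis by (rule dbl[OF u(1) e]) (rule m1)
qed

end

text \<open>For an identity the pairing is the action, so the conclusion of the step for \<open>n\<close> is its hypothesis for
  \<open>n + 1\<close>.\<close>

lemma kernel_completion_bot:
  assumes fg: "almost_fin_gen A SM" and M: "amod M"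
    and u: "u \<in> elts0 (cA (idarrow M))" "ev (pr0 (idarrow M) n) u = \<zero>\<^bsub>core0 (jP A J n (idarrow M))\<^esub>"
    and e: "e \<in> \<mm>"
  shows "e \<odot>\<^bsub>core0 (cA (idarrow M))\<^esub> u \<in> Fpow (jtop (cA (idarrow M))) (Suc n)"
  using u e
proof (induct n arbitrary: u e)
  note X = A_arrow_idarrow[OF M] and L = A_arrowD(1)[OF A_arrow_jcompletion[OF A_arrow_idarrow[OF M]]]
  note id = jcompletion_idarrow[OF M]
  have G: "Gpow (cA (idarrow M)) n = Fpow (jtop (cA (idarrow M))) (Suc n)" for n
    using Gpow_idarrow[OF L] id by metis
  have bot: "jbot (cA (idarrow M)) = jtop (cA (idarrow M))" using id by (metis idarrow_simps(1,2))
  note CLm = module_core[OF premodD(1)[OF amodD(1)[OF L]]]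
  {
    case 0
    show ?case unfolding G[symmetric]
    proof (rule kernel_completion_step[OF X fg _ 0])
      fix Y e assume "Y \<in> elts1 (cA (idarrow M))" "e \<in> \<mm>"
      then show "e \<odot>\<^bsub>core1 (cA (idarrow M))\<^esub> Y \<in> Fpow (jbot (cA (idarrow M))) 0"
        unfolding bot using module.smult_closed[OF CLm mm_carrier] by simp
    qed
  next
    case (Suc n)
    show ?case unfolding G[symmetric]
    proof (rule kernel_completion_step[OF X fg _ Suc(2-)])
      fix Y e assume Y: "Y \<in> elts1 (cA (idarrow M))"
        and z: "\<And>m. Suc n = Suc m \<Longrightarrow> ev (pr1 (idarrow M) m) Y = \<zero>\<^bsub>core0 (jP A J m (idA (idarrow M)))\<^esub>" and e: "e \<in> \<mm>"
      show "e \<odot>\<^bsub>core1 (cA (idarrow M))\<^esub> Y \<in> Fpow (jbot (cA (idarrow M))) (Suc n)"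
        unfolding bot by (rule Suc(1)[OF Y[unfolded bot] z[OF refl, unfolded idarrow_simps] e])
    qed
  }
qed

lemma kernel_completion:
  assumes fg: "almost_fin_gen A SM" and X: "A_arrow X"
    and u: "u \<in> elts0 (cA X)" "ev (pr0 X n) u = \<zero>\<^bsub>core0 (jP A J n X)\<^esub>" and e: "e \<in> \<mm>"
  shows "e \<odot>\<^bsub>core0 (cA X)\<^esub> u \<in> Gpow (cA X) n"
proof (rule kernel_completion_step[OF X fg _ u e])
  note M = A_arrowD(2)[OF X] and L = bot_mod[OF A_arrow_jcompletion[OF X]]
  fix Y e assume Y: "Y \<in> elts1 (cA X)" and z: "\<And>m. n = Suc m \<Longrightarrow> ev (pr1 X m) Y = \<zero>\<^bsub>core0 (jP A J m (idA X))\<^esub>" and e: "e \<in> \<mm>"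
  show "e \<odot>\<^bsub>core1 (cA X)\<^esub> Y \<in> Fpow (jbot (cA X)) n"
  proof (cases n)
    case 0
    then show ?thesis using module.smult_closed[OF module_core[OF L] mm_carrier[OF e] Y] by simp
  next
    case (Suc m)
    then show ?thesis using kernel_completion_bot[OF fg M Y[unfolded bot_completion[OF X]] z[OF Suc] e] by (simp add: bot_completion[OF X])
  qed
qed

text \<open>The kernel of \<open>\<Lambda>\<^sub>0 \<rightarrow> X\<^sub>0/I\<^sup>n\<^sup>+\<^sup>1 X\<^sub>1\<close> is the saturation of \<open>I\<^sup>n\<^sup>+\<^sup>1 \<Lambda>\<^sub>1\<close>, i.e. the kernel of the projection to the
  \<open>n\<close>-th approximation of the completion \<open>\<Lambda>\<close>. One inclusion is \<open>kernel_completion\<close>; the other holds because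
  the projection carries \<open>I\<^sup>n\<^sup>+\<^sup>1 \<Lambda>\<^sub>1\<close> into \<open>I\<^sup>n\<^sup>+\<^sup>1 X\<^sub>1\<close>.\<close>

lemma kernel_completion_iff:
  assumes fg: "almost_fin_gen A SM" and X: "A_arrow X" and u: "u \<in> elts0 (cA X)"
  shows "ev (jproj0 A J n (cA X)) u = \<zero>\<^bsub>core0 (jP A J n (cA X))\<^esub> \<longleftrightarrow> ev (pr0 X n) u = \<zero>\<^bsub>core0 (jP A J n X)\<^esub>"
proof
  note C = A_arrow_jcompletion[OF X]
  assume "ev (pr0 X n) u = \<zero>\<^bsub>core0 (jP A J n X)\<^esub>"
  then show "ev (jproj0 A J n (cA X)) u = \<zero>\<^bsub>core0 (jP A J n (cA X))\<^esub>"
    using kernel_completion[OF fg X u] jproj0_zero_iff'[OF C u] by blast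
next
  note C = A_arrow_jcompletion[OF X]
  note CL = module_core[OF top_mod[OF C]] and CT = module_core[OF top_mod[OF A_arrow_jP[OF X, of n]]]
  note ph = ev_hom[OF prj_amor[OF X, of n]]
  interpret T: module V "core0 (jP A J n X)" by (rule CT)
  assume z: "ev (jproj0 A J n (cA X)) u = \<zero>\<^bsub>core0 (jP A J n (cA X))\<^esub>"
  have G: "ev (pr0 X n) v \<in> {\<zero>\<^bsub>core0 (jP A J n X)\<^esub>}" if v: "v \<in> Gpow (cA X) n" for v
  proof (rule mod_hom_span[OF ph CL CT gpow_gens[OF jpair_pairing[OF C]] submodule_zero[OF CT] _ v[unfolded gpow_def]])
    fix z assume "z \<in> {jpair (cA X) p x |p x. p \<in> ppow (Suc n) \<and> x \<in> elts1 (cA X)}"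
    then obtain p Y where z: "z = jpair (cA X) p Y" "p \<in> ppow (Suc n)" "Y \<in> elts1 (cA X)" by blast
    note p = ppow_carrier[OF z(2)]
    obtain x where x: "x \<in> elts1 X" "ev (pr1 X n) Y = ev (jproj0 A J n (idA X)) x"
      using bot_proj_ex[OF X ev_closed[OF pr1_amor[OF X] z(3)]] by blast
    note jc = bilinD(1)[OF jpair_bilin[OF X] p x(1)]
    have "jpair X p x \<in> Gpow X n" unfolding gpow_def using z(2) x(1) by (intro span_mod_base) blast
    then have "e \<odot>\<^bsub>core0 X\<^esub> jpair X p x \<in> Gpow X n" if "e \<in> \<mm>" for e
      by (rule submoduleD(4)[OF module_core[OF top_mod[OF X]] Gpow_submodule[OF X] mm_carrier[OF that]])
    then show "ev (pr0 X n) z \<in> {\<zero>\<^bsub>core0 (jP A J n X)\<^esub>}"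
      using jproj0_zero_iff'[OF X jc, of n] unfolding z(1) prj_jpair[OF X p z(3)] x(2) jpair_jP[OF X p x(1)] by simp
  qed
  show "ev (pr0 X n) u = \<zero>\<^bsub>core0 (jP A J n X)\<^esub>"
  proof (rule core_eqI[OF top_mod[OF A_arrow_jP[OF X]] ev_closed[OF prj_amor[OF X] u] T.M.zero_closed])
    fix e assume e: "e \<in> \<mm>"
    then show "e \<odot>\<^bsub>core0 (jP A J n X)\<^esub> ev (pr0 X n) u = e \<odot>\<^bsub>core0 (jP A J n X)\<^esub> \<zero>\<^bsub>core0 (jP A J n X)\<^esub>"
      using z[unfolded jproj0_zero_iff'[OF C u]] G[of "e \<odot>\<^bsub>core0 (cA X)\<^esub> u"] mod_hom_smult[OF ph mm_carrier[OF e] u] by (simp add: mm_carrier)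
  qed
qed

text \<open>Two elements of \<open>\<Lambda>\<^sub>0\<close> agree in the \<open>n\<close>-th approximation of \<open>\<Lambda>\<close> iff they agree in that of \<open>X\<close>. So a compatible
  sequence in the approximations of \<open>\<Lambda>\<close>, lifted to \<open>\<Lambda>\<^sub>0\<close> term by term, gives a compatible sequence in those of
  \<open>X\<close>, whose limit is the required preimage, up to a scalar; surjectivity of a map of cores may be tested on
  multiples.\<close>

lemma jcanonical_bij:
  assumes fg: "almost_fin_gen A SM" and X: "A_arrow X"
  shows "bij_betw (ev (sq0 (jcanonical A J (cA X)))) (elts0 (cA X)) (elts0 (cA (cA X)))"
proof -
  note C = A_arrow_jcompletion[OF X]
  note CC = A_arrow_jcompletion[OF C]
  let ?s = "sq0 (jcanonical A J (cA X))"
  note sa = A_arrow_morD(3)[OF jcanonical_gmor[OF C]]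
  note CL = module_core[OF top_mod[OF C]] and CCL = module_core[OF top_mod[OF CC]]
  interpret L: module V "core0 (cA X)" by (rule CL)
  interpret LL: module V "core0 (cA (cA X))" by (rule CCL)
  interpret T: module V "core0 (jP A J n X)" for n by (rule module_core[OF top_mod[OF A_arrow_jP[OF X]]])
  interpret TT: module V "core0 (jP A J n (cA X))" for n by (rule module_core[OF top_mod[OF A_arrow_jP[OF C]]])
  note qh = ev_hom[OF jproj0_amor'[OF C]] and ph = ev_hom[OF prj_amor[OF X]] and pph = ev_hom[OF prj_amor[OF C]]
  have eq: "ev (jproj0 A J n (cA X)) u = ev (jproj0 A J n (cA X)) v \<longleftrightarrow> ev (pr0 X n) u = ev (pr0 X n) v"
    if uv: "u \<in> elts0 (cA X)" "v \<in> elts0 (cA X)" for u v n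
  proof -
    have "ev (jproj0 A J n (cA X)) u = ev (jproj0 A J n (cA X)) v \<longleftrightarrow> ev (jproj0 A J n (cA X)) (u \<ominus>\<^bsub>core0 (cA X)\<^esub> v) = \<zero>\<^bsub>core0 (jP A J n (cA X))\<^esub>"
      unfolding mod_hom_minus[OF qh CL TT.module_axioms uv] TT.minus_eq_zero_iff[OF mod_hom_closed[OF qh uv(1)] mod_hom_closed[OF qh uv(2)]] ..
    also have "\<dots> \<longleftrightarrow> ev (pr0 X n) (u \<ominus>\<^bsub>core0 (cA X)\<^esub> v) = \<zero>\<^bsub>core0 (jP A J n X)\<^esub>"
      by (rule kernel_completion_iff[OF fg X]) (use uv in simp)
    also have "\<dots> \<longleftrightarrow> ev (pr0 X n) u = ev (pr0 X n) v"
      unfolding mod_hom_minus[OF ph CL T.module_axioms uv] T.minus_eq_zero_iff[OF mod_hom_closed[OF ph uv(1)] mod_hom_closed[OF ph uv(2)]] ..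
    finally show ?thesis .
  qed
  have inj: "inj_on (ev ?s) (elts0 (cA X))"
  proof (rule inj_onI)
    fix u v assume uv: "u \<in> elts0 (cA X)" "v \<in> elts0 (cA X)" and "ev ?s u = ev ?s v"
    then have "ev (jproj0 A J n (cA X)) u = ev (jproj0 A J n (cA X)) v" for n
      using prj_jcanonical[OF C uv(1), of n] prj_jcanonical[OF C uv(2), of n] by simp
    then show "u = v" using eq[OF uv] by (intro prj_eqI[OF X uv]) blast
  qed
  have "y \<in> ev ?s ` elts0 (cA X)" if y: "y \<in> elts0 (cA (cA X))" for y
  proof (rule core_divisible[OF top_mod[OF CC] submodule_image[OF ev_hom[OF sa] CL CCL submodule_carrier[OF CL]] y])
    fix e y assume e: "e \<in> \<mm>" and y: "y \<in> elts0 (cA (cA X))"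
    have "\<exists>z. z \<in> elts0 (cA X) \<and> ev (pr0 (cA X) n) y = ev (jproj0 A J n (cA X)) z" for n
      using jproj0_ex[OF C ev_closed[OF prj_amor[OF C] y], of n] by blast
    then obtain z where z: "\<And>n. z n \<in> elts0 (cA X)" "\<And>n. ev (pr0 (cA X) n) y = ev (jproj0 A J n (cA X)) (z n)" by metis
    have "ev (jtrans0 A J X n) (ev (pr0 X (Suc n)) (z (Suc n))) = ev (pr0 X n) (z n)" for n
    proof -
      have "ev (jproj0 A J n (cA X)) (z (Suc n)) = ev (jproj0 A J n (cA X)) (z n)"
        using ev_jtrans0[OF C z(1), of n "Suc n"] prj_compat[OF C y, of n] z(2)[of n] z(2)[of "Suc n"] by simp
      then have "ev (pr0 X n) (z (Suc n)) = ev (pr0 X n) (z n)" using eq[OF z(1) z(1)] by blast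
      then show ?thesis using prj_compat[OF X z(1), of n "Suc n"] by simp
    qed
    from prj_ex[OF X ev_closed[OF prj_amor[OF X] z(1)] this e] obtain u where u: "u \<in> elts0 (cA X)"
      "\<And>n. ev (pr0 X n) u = e \<odot>\<^bsub>core0 (jP A J n X)\<^esub> ev (pr0 X n) (z n)" by blast
    have "ev ?s u = e \<odot>\<^bsub>core0 (cA (cA X))\<^esub> y"
    proof (rule prj_eqI[OF C ev_closed[OF sa u(1)]])
      show "e \<odot>\<^bsub>core0 (cA (cA X))\<^esub> y \<in> elts0 (cA (cA X))" using y e by (simp add: mm_carrier)
      fix n
      have ez: "e \<odot>\<^bsub>core0 (cA X)\<^esub> z n \<in> elts0 (cA X)" using z(1) e by (simp add: mm_carrier)
      have "ev (pr0 X n) u = ev (pr0 X n) (e \<odot>\<^bsub>core0 (cA X)\<^esub> z n)" using u(2) mod_hom_smult[OF ph mm_carrier[OF e] z(1)] by simp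
      then have "ev (jproj0 A J n (cA X)) u = ev (jproj0 A J n (cA X)) (e \<odot>\<^bsub>core0 (cA X)\<^esub> z n)" using eq[OF u(1) ez] by blast
      then show "ev (pr0 (cA X) n) (ev ?s u) = ev (pr0 (cA X) n) (e \<odot>\<^bsub>core0 (cA (cA X))\<^esub> y)"
        using prj_jcanonical[OF C u(1), of n] mod_hom_smult[OF qh mm_carrier[OF e] z(1)] mod_hom_smult[OF pph mm_carrier[OF e] y] z(2) by simp
    qed
    then show "e \<odot>\<^bsub>core0 (cA (cA X))\<^esub> y \<in> ev ?s ` elts0 (cA X)" using u(1) by (metis imageI)
  qed
  then have "ev ?s ` elts0 (cA X) = elts0 (cA (cA X))" using ev_closed[OF sa] by auto
  then show ?thesis using inj by (simp add: bij_betw_def)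
qed

lemma almost_complete_jcompletion:
  assumes fg: "almost_fin_gen A SM" and X: "A_arrow X" shows "almost_complete A J (cA X)"
proof -
  note C = A_arrow_jcompletion[OF X]
  have b1: "bij_betw (ev (sq1 (jcanonical A J (cA X)))) (elts1 (cA X)) (elts1 (cA (cA X)))"
  proof -
    have "idarrow (jbot (cA X)) = cA (idA X)" using jcompletion_idarrow[OF A_arrowD(2)[OF X]] by (simp add: bot_completion[OF X])
    then show ?thesis
      using jcanonical_bij[OF fg A_arrow_idA[OF X]] by (simp add: sq1_jcanonical[OF C] bot_completion[OF X] bot_completion[OF C])
  qed
  show ?thesis unfolding almost_complete_def Let_def
    using jP_map_iso[OF C A_arrow_jcompletion[OF C] jcanonical_gmor[OF C] jcanonical_bij[OF fg X] b1] by blast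
qed

end

theorem proposition3p13:
  fixes V :: "'v ring" and \<mm> :: "'v set"
    and A :: "('v, 'a) aalg" and J :: "('v, 'i, 'a) smith" and M :: "('v, 'a, 'x) amodule"
  assumes "almost_setup V \<mm>"
    and "almost_setup.almost_algebra V \<mm> A"
    and "almost_setup.smith_ideal V \<mm> A J"
    and "almost_setup.almost_fin_gen V \<mm> A (almost_setup.smith_module V \<mm> J)"
    and "almost_setup.almost_module V \<mm> A M"
  shows "almost_setup.almost_complete V \<mm> A J (almost_setup.nilpotent_approx V \<mm> A J M)"
proof -
  interpret almost_setup V \<mm> by fact
  interpret smith_setup V \<mm> A J
    by (rule smith_setup.intro[OF assms(1)], unfold_locales) (fact assms)+
  show ?thesis unfolding nilpotent_approx_def
    by (rule almost_complete_jcompletion[OF assms(4) A_arrow_module_arrow[OF almost_module_amod[OF assms(5)]]])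
qed

end
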